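(* Let $(V_G,G)$ be a classical graph. The category $\mathrm{QIso}((V_G,G),(V_G,G))$ of quantum isomorphisms $(V_G,G)\to(V_G,G)$ and intertwiners is (equivalent to) the category of finite-dimensional representations of Banica's quantum automorphism group algebra $A_{aut}(G)$ of the graph $G$.
   Context: All Hilbert spaces are finite-dimensional and complex; coherence isomorphisms of $\otimes$ are suppressed. A classical graph is a finite undirected graph $G$ with vertex set $V_G$; write $V=V_G$. The set $V$ is identified with the special commutative dagger Frobenius algebra $\mathbb{C}^{V}$ with orthonormal basis $\{|v\rangle\}_{v\in V}$, $m(|v\rangle\otimes|w\rangle)=\delta_{v,w}|v\rangle$, $u(1)=\sum_v|v\rangle$, $\Delta=m^\dagger$, $\epsilon=u^\dagger$. Also write $G:\mathbb{C}^V\to\mathbb{C}^V$ for the adjacency matrix, $G_{v,w}=1$ if $v$ and $w$ are connected and $0$ otherwise. A quantum isomorphism $(H,P):(V,G)\to(V,G)$ is a Hilbert space $H$ and a linear map $P:H\otimes V\to V\otimes H$ such that (i) $(\Delta\otimes\mathrm{id}_H)P=(\mathrm{id}\otimes P)(P\otimes \mathrm{id})(\mathrm{id}_H\otimes\Delta)$; (ii) $(\epsilon\otimes\mathrm{id}_H)P=\mathrm{id}_H\otimes\epsilon$; (iii) $P^\dagger=(\epsilon m\otimes\mathrm{id}_H\otimes\mathrm{id}_V)(\mathrm{id}_V\otimes P\otimes\mathrm{id}_V)(\mathrm{id}_V\otimes\mathrm{id}_H\otimes\Delta u)$; (iv) $P(\mathrm{id}_H\otimes m)=(m\otimes\mathrm{id}_H)(\mathrm{id}\otimes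 P)(P\otimes\mathrm{id})$; (v) $P(\mathrm{id}_H\otimes u)=u\otimes\mathrm{id}_H$; (vi) $P(\mathrm{id}_H\otimes G)=(G\otimes\mathrm{id}_H)P$. Morphisms (intertwiners) $(H,P)\to(H',P')$ are linear maps $f:H\to H'$ with $(\mathrm{id}_V\otimes f)P=P'(f\otimes\mathrm{id}_V)$. With $n=|V|$ and $\{G_{i,j}\}_{1\le i,j\le n}$ the adjacency matrix, $A_{aut}(G)$ is the universal unital $C^*$-algebra with generators $a_{i,j}$ ($i,j=1,\dots,n$) and relations $a_{i,j}^2=a_{i,j}=a_{i,j}^*$, $\sum_{i=1}^na_{i,j}=1$ for all $j$, $\sum_{j=1}^na_{i,j}=1$ for all $i$, and $\sum_{k=1}^nG_{i,k}a_{k,j}=\sum_{k=1}^na_{i,k}G_{k,j}$ for all $i,j$. A finite-dimensional representation is a unital $*$-homomorphism to $\mathrm{End}(H)$ with $H$ a finite-dimensional Hilbert space; morphisms are linear maps commuting with the actions. *)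

theory Defs
  imports
    "HOL-Library.Poly_Mapping"
    "HOL-Algebra.QuotRing"
    "Jordan_Normal_Form.VS_Connect"
    "Graph_Theory.Pair_Digraph"
begin

hide_const (open) Multiset.mult Modules.module_hom

section \<open>Categories and equivalence of categories\<close>

text \<open>
  Hom-sets need not be disjoint: an arrow does not determine its source and target object.
  The arrow part of a functor therefore takes the two objects as arguments.
\<close>

record ('o, 'm) cat =
  Obj :: "'o set"
  Hom :: "'o \<Rightarrow> 'o \<Rightarrow> 'm set"
  Ide :: "'o \<Rightarrow> 'm"
  Cmp :: "'m \<Rightarrow> 'm \<Rightarrow> 'm"  \<comment> \<open>\<open>Cmp C g f\<close> is \<open>g\<close> after \<open>f\<close>\<close>

locale category =
  fixes C :: "('o, 'm) cat"
  assumes Ide_in_Hom: "x \<in> Obj C \<Longrightarrow> Ide C x \<in> Hom C x x"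
    and Cmp_in_Hom:
      "\<lbrakk>x \<in> Obj C; y \<in> Obj C; z \<in> Obj C; f \<in> Hom C x y; g \<in> Hom C y z\<rbrakk>
        \<Longrightarrow> Cmp C g f \<in> Hom C x z"
    and Cmp_Ide: "\<lbrakk>x \<in> Obj C; y \<in> Obj C; f \<in> Hom C x y\<rbrakk> \<Longrightarrow> Cmp C f (Ide C x) = f"
    and Ide_Cmp: "\<lbrakk>x \<in> Obj C; y \<in> Obj C; f \<in> Hom C x y\<rbrakk> \<Longrightarrow> Cmp C (Ide C y) f = f"
    and Cmp_assoc:
      "\<lbrakk>w \<in> Obj C; x \<in> Obj C; y \<in> Obj C; z \<in> Obj C;
        f \<in> Hom C w x; g \<in> Hom C x y; h \<in> Hom C y z\<rbrakk>
        \<Longrightarrow> Cmp C h (Cmp C g f) = Cmp C (Cmp C h g) f"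

locale cat_functor =
  fixes C :: "('o, 'm) cat" and D :: "('p, 'n) cat"
    and Fo :: "'o \<Rightarrow> 'p" and Fm :: "'o \<Rightarrow> 'o \<Rightarrow> 'm \<Rightarrow> 'n"
  assumes Fo_Obj: "x \<in> Obj C \<Longrightarrow> Fo x \<in> Obj D"
    and Fm_Hom: "\<lbrakk>x \<in> Obj C; y \<in> Obj C; f \<in> Hom C x y\<rbrakk> \<Longrightarrow> Fm x y f \<in> Hom D (Fo x) (Fo y)"
    and Fm_Ide: "x \<in> Obj C \<Longrightarrow> Fm x x (Ide C x) = Ide D (Fo x)"
    and Fm_Cmp:
      "\<lbrakk>x \<in> Obj C; y \<in> Obj C; z \<in> Obj C; f \<in> Hom C x y; g \<in> Hom C y z\<rbrakk>
        \<Longrightarrow> Fm x z (Cmp C g f) = Cmp D (Fm y z g) (Fm x y f)"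

definition cat_iso :: "('o, 'm) cat \<Rightarrow> 'o \<Rightarrow> 'o \<Rightarrow> 'm \<Rightarrow> bool" where
  "cat_iso C x y f \<longleftrightarrow>
    f \<in> Hom C x y \<and> (\<exists>g \<in> Hom C y x. Cmp C g f = Ide C x \<and> Cmp C f g = Ide C y)"

definition nat_iso ::
    "('o, 'm) cat \<Rightarrow> ('p, 'n) cat \<Rightarrow> ('o \<Rightarrow> 'p) \<Rightarrow> ('o \<Rightarrow> 'o \<Rightarrow> 'm \<Rightarrow> 'n)
      \<Rightarrow> ('o \<Rightarrow> 'p) \<Rightarrow> ('o \<Rightarrow> 'o \<Rightarrow> 'm \<Rightarrow> 'n) \<Rightarrow> ('o \<Rightarrow> 'n) \<Rightarrow> bool" where
  "nat_iso C D Fo Fm Go Gm \<eta> \<longleftrightarrow>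
    (\<forall>x \<in> Obj C. cat_iso D (Fo x) (Go x) (\<eta> x)) \<and>
    (\<forall>x \<in> Obj C. \<forall>y \<in> Obj C. \<forall>f \<in> Hom C x y.
      Cmp D (\<eta> y) (Fm x y f) = Cmp D (Gm x y f) (\<eta> x))"

definition equivalent_categories :: "('o, 'm) cat \<Rightarrow> ('p, 'n) cat \<Rightarrow> bool" where
  "equivalent_categories C D \<longleftrightarrow>
    category C \<and> category D \<and>
    (\<exists>Fo Fm Go Gm \<eta> \<epsilon>.
      cat_functor C D Fo Fm \<and> cat_functor D C Go Gm \<and>
      nat_iso C C (\<lambda>x. x) (\<lambda>x y f. f) (\<lambda>x. Go (Fo x)) (\<lambda>x y f. Gm (Fo x) (Fo y) (Fm x y f)) \<eta> \<and>
      nat_iso D D (\<lambda>x. Fo (Go x)) (\<lambda>x y f. Fm (Go x) (Go y) (Gm x y f)) (\<lambda>x. x) (\<lambda>x y f. f) \<epsilon>)"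


section \<open>Finite-dimensional Hilbert spaces\<close>

text \<open>
  The ring multiplication and unit inherited from the library's module record play no role
  for vector spaces.  Inner products are antilinear in the first argument.
\<close>

record 'a hilb = "(complex, 'a) module" +
  inner :: "'a \<Rightarrow> 'a \<Rightarrow> complex"

abbreviation complex_ring :: "complex ring" where
  "complex_ring \<equiv> class_ring"

locale fd_hilbert = vectorspace complex_ring H for H :: "'a hilb" +
  assumes finite_dimensional: "fin_dim"
    and inner_add:
      "\<lbrakk>x \<in> carrier H; y \<in> carrier H; z \<in> carrier H\<rbrakk>
        \<Longrightarrow> inner H x (y \<oplus>\<^bsub>H\<^esub> z) = inner H x y + inner H x z"
    and inner_smult:
      "\<lbrakk>x \<in> carrier H; y \<in> carrier H\<rbrakk> \<Longrightarrow> inner H x (c \<odot>\<^bsub>H\<^esub> y) = c * inner H x y"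
    and inner_cnj: "\<lbrakk>x \<in> carrier H; y \<in> carrier H\<rbrakk> \<Longrightarrow> inner H y x = cnj (inner H x y)"
    and inner_pos: "\<lbrakk>x \<in> carrier H; x \<noteq> \<zero>\<^bsub>H\<^esub>\<rbrakk> \<Longrightarrow> 0 < Re (inner H x x)"

definition onb :: "'a hilb \<Rightarrow> 'a set \<Rightarrow> bool" where
  "onb H B \<longleftrightarrow>
    finite B \<and> B \<subseteq> carrier H \<and>
    LinearCombinations.module.span complex_ring H B = carrier H \<and>
    (\<forall>x \<in> B. \<forall>y \<in> B. inner H x y = of_bool (x = y))"

definition unit_space :: "complex hilb" where
  "unit_space =
    \<lparr>carrier = UNIV, mult = undefined, one = undefined, zero = 0, add = (+), smult = (*),
     inner = (\<lambda>x y. cnj x * y)\<rparr>"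

text \<open>\<open>\<complex>\<^sup>V\<close>, realised as the functions vanishing outside \<open>V\<close>.\<close>

definition fun_space :: "'v set \<Rightarrow> ('v \<Rightarrow> complex) hilb" where
  "fun_space V =
    \<lparr>carrier = {x. \<forall>v. v \<notin> V \<longrightarrow> x v = 0}, mult = undefined, one = undefined,
     zero = (\<lambda>_. 0), add = (\<lambda>x y v. x v + y v), smult = (\<lambda>c x v. c * x v),
     inner = (\<lambda>x y. \<Sum>v\<in>V. cnj (x v) * y v)\<rparr>"

definition ket :: "'v \<Rightarrow> 'v \<Rightarrow> complex" where
  "ket v = (\<lambda>w. of_bool (w = v))"

text \<open>
  The tensor product of finite-dimensional Hilbert spaces \<open>H\<close> and \<open>K\<close> is modelled by the forms
  on \<open>H \<times> K\<close> that are antilinear in both arguments (and vanish outside the carriers), with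
  \<open>h \<otimes> k\<close> the form \<open>(a, b) \<mapsto> \<langle>a, h\<rangle> \<langle>b, k\<rangle>\<close>.  The inner product
  \<open>\<Sum>\<^sub>e \<Sum>\<^sub>f cnj (\<phi> (e, f)) \<psi> (e, f)\<close> over orthonormal bases does not depend on
  the bases and satisfies \<open>\<langle>h \<otimes> k, h' \<otimes> k'\<rangle> = \<langle>h, h'\<rangle> \<langle>k, k'\<rangle>\<close>.
\<close>

definition tensor_space :: "'a hilb \<Rightarrow> 'b hilb \<Rightarrow> ('a \<times> 'b \<Rightarrow> complex) hilb"
    (infixr \<open>\<otimes>\<^sub>H\<close> 70) where
  "H \<otimes>\<^sub>H K =
    \<lparr>carrier = {\<phi>.
       (\<forall>a a' b. a \<in> carrier H \<and> a' \<in> carrier H \<and> b \<in> carrier K \<longrightarrow>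
          \<phi> (a \<oplus>\<^bsub>H\<^esub> a', b) = \<phi> (a, b) + \<phi> (a', b)) \<and>
       (\<forall>a b b'. a \<in> carrier H \<and> b \<in> carrier K \<and> b' \<in> carrier K \<longrightarrow>
          \<phi> (a, b \<oplus>\<^bsub>K\<^esub> b') = \<phi> (a, b) + \<phi> (a, b')) \<and>
       (\<forall>c a b. a \<in> carrier H \<and> b \<in> carrier K \<longrightarrow>
          \<phi> (c \<odot>\<^bsub>H\<^esub> a, b) = cnj c * \<phi> (a, b) \<and>
          \<phi> (a, c \<odot>\<^bsub>K\<^esub> b) = cnj c * \<phi> (a, b)) \<and>
       (\<forall>p. p \<notin> carrier H \<times> carrier K \<longrightarrow> \<phi> p = 0)},
     mult = undefined, one = undefined,
     zero = (\<lambda>_. 0), add = (\<lambda>\<phi> \<psi> p. \<phi> p + \<psi> p), smult = (\<lambda>c \<phi> p. c * \<phi> p),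
     inner = (\<lambda>\<phi> \<psi>. \<Sum>p \<in> (SOME B. onb H B) \<times> (SOME B. onb K B). cnj (\<phi> p) * \<psi> p)\<rparr>"

definition pure :: "'a hilb \<Rightarrow> 'b hilb \<Rightarrow> 'a \<Rightarrow> 'b \<Rightarrow> 'a \<times> 'b \<Rightarrow> complex" where
  "pure H K h k =
    (\<lambda>(a, b). if a \<in> carrier H \<and> b \<in> carrier K then inner H a h * inner K b k else 0)"


section \<open>Linear maps\<close>

record ('a, 'b) arr =
  src :: "'a hilb"
  tgt :: "'b hilb"
  app :: "'a \<Rightarrow> 'b"

text \<open>
  The underlying function is normalised to be zero outside the carrier of the source, so that a
  linear map is determined by its values on that carrier.
\<close>

definition lin :: "'a hilb \<Rightarrow> 'b hilb \<Rightarrow> ('a, 'b) arr set" where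
  "lin H K =
    {f. src f = H \<and> tgt f = K \<and> app f \<in> module_hom complex_ring H K \<and>
        (\<forall>x. x \<notin> carrier H \<longrightarrow> app f x = \<zero>\<^bsub>K\<^esub>)}"

definition idm :: "'a hilb \<Rightarrow> ('a, 'a) arr" where
  "idm H = \<lparr>src = H, tgt = H, app = (\<lambda>x. if x \<in> carrier H then x else \<zero>\<^bsub>H\<^esub>)\<rparr>"

definition comp_map :: "('b, 'c) arr \<Rightarrow> ('a, 'b) arr \<Rightarrow> ('a, 'c) arr" (infixr \<open>\<circ>\<^sub>M\<close> 55) where
  "g \<circ>\<^sub>M f = \<lparr>src = src f, tgt = tgt g, app = app g \<circ> app f\<rparr>"

definition adj :: "('a, 'b) arr \<Rightarrow> ('b, 'a) arr" where
  "adj f = (THE g. g \<in> lin (tgt f) (src f) \<and>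
    (\<forall>x \<in> carrier (src f). \<forall>y \<in> carrier (tgt f).
      inner (tgt f) (app f x) y = inner (src f) x (app g y)))"

definition tensor_map ::
    "('a, 'c) arr \<Rightarrow> ('b, 'd) arr \<Rightarrow> ('a \<times> 'b \<Rightarrow> complex, 'c \<times> 'd \<Rightarrow> complex) arr"
    (infixr \<open>\<otimes>\<^sub>M\<close> 70) where
  "f \<otimes>\<^sub>M g = (THE T. T \<in> lin (src f \<otimes>\<^sub>H src g) (tgt f \<otimes>\<^sub>H tgt g) \<and>
    (\<forall>h \<in> carrier (src f). \<forall>k \<in> carrier (src g).
      app T (pure (src f) (src g) h k) = pure (tgt f) (tgt g) (app f h) (app g k)))"

subsection \<open>Coherence isomorphisms\<close>

definition assoc where
  "assoc H K L = (THE T. T \<in> lin ((H \<otimes>\<^sub>H K) \<otimes>\<^sub>H L) (H \<otimes>\<^sub>H (K \<otimes>\<^sub>H L)) \<and>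
    (\<forall>h \<in> carrier H. \<forall>k \<in> carrier K. \<forall>l \<in> carrier L.
      app T (pure (H \<otimes>\<^sub>H K) L (pure H K h k) l) = pure H (K \<otimes>\<^sub>H L) h (pure K L k l)))"

definition assoc_inv where
  "assoc_inv H K L = (THE T. T \<in> lin (H \<otimes>\<^sub>H (K \<otimes>\<^sub>H L)) ((H \<otimes>\<^sub>H K) \<otimes>\<^sub>H L) \<and>
    (\<forall>h \<in> carrier H. \<forall>k \<in> carrier K. \<forall>l \<in> carrier L.
      app T (pure H (K \<otimes>\<^sub>H L) h (pure K L k l)) = pure (H \<otimes>\<^sub>H K) L (pure H K h k) l))"

definition lunit where
  "lunit H = (THE T. T \<in> lin (unit_space \<otimes>\<^sub>H H) H \<and>
    (\<forall>z. \<forall>h \<in> carrier H. app T (pure unit_space H z h) = z \<odot>\<^bsub>H\<^esub> h))"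

definition lunit_inv where
  "lunit_inv H = (THE T. T \<in> lin H (unit_space \<otimes>\<^sub>H H) \<and>
    (\<forall>h \<in> carrier H. app T h = pure unit_space H 1 h))"

definition runit where
  "runit H = (THE T. T \<in> lin (H \<otimes>\<^sub>H unit_space) H \<and>
    (\<forall>h \<in> carrier H. \<forall>z. app T (pure H unit_space h z) = z \<odot>\<^bsub>H\<^esub> h))"

definition runit_inv where
  "runit_inv H = (THE T. T \<in> lin H (H \<otimes>\<^sub>H unit_space) \<and>
    (\<forall>h \<in> carrier H. app T h = pure H unit_space h 1))"


section \<open>The Frobenius algebra \<open>\<complex>\<^sup>V\<close> and the adjacency matrix\<close>

definition frob_mult ::
    "'v set \<Rightarrow> (('v \<Rightarrow> complex) \<times> ('v \<Rightarrow> complex) \<Rightarrow> complex, 'v \<Rightarrow> complex) arr" where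
  "frob_mult V = (THE T. T \<in> lin (fun_space V \<otimes>\<^sub>H fun_space V) (fun_space V) \<and>
    (\<forall>v \<in> V. \<forall>w \<in> V. app T (pure (fun_space V) (fun_space V) (ket v) (ket w)) =
      (if v = w then ket v else \<zero>\<^bsub>fun_space V\<^esub>)))"

definition frob_unit :: "'v set \<Rightarrow> (complex, 'v \<Rightarrow> complex) arr" where
  "frob_unit V = (THE T. T \<in> lin unit_space (fun_space V) \<and>
    app T 1 = (\<lambda>w. \<Sum>v\<in>V. ket v w))"

definition frob_comult ::
    "'v set \<Rightarrow> ('v \<Rightarrow> complex, ('v \<Rightarrow> complex) \<times> ('v \<Rightarrow> complex) \<Rightarrow> complex) arr" where
  "frob_comult V = adj (frob_mult V)"

definition frob_counit :: "'v set \<Rightarrow> ('v \<Rightarrow> complex, complex) arr" where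
  "frob_counit V = adj (frob_unit V)"

definition adjacency :: "'v pair_pre_digraph \<Rightarrow> 'v \<Rightarrow> 'v \<Rightarrow> complex" where
  "adjacency G v w = of_bool ((v, w) \<in> parcs G)"

definition adjacency_map :: "'v pair_pre_digraph \<Rightarrow> ('v \<Rightarrow> complex, 'v \<Rightarrow> complex) arr" where
  "adjacency_map G = (THE T. T \<in> lin (fun_space (pverts G)) (fun_space (pverts G)) \<and>
    (\<forall>w \<in> pverts G. app T (ket w) = (\<lambda>u. \<Sum>v\<in>pverts G. adjacency G v w * ket v u)))"


section \<open>The category of quantum isomorphisms from a graph to itself\<close>

type_synonym ('v, 'h) qmap =
  "('h \<times> ('v \<Rightarrow> complex) \<Rightarrow> complex, ('v \<Rightarrow> complex) \<times> 'h \<Rightarrow> complex) arr"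

definition quantum_iso :: "'v pair_pre_digraph \<Rightarrow> 'h hilb \<Rightarrow> ('v, 'h) qmap \<Rightarrow> bool" where
  "quantum_iso G H P \<longleftrightarrow>
    (let X = fun_space (pverts G);
         m = frob_mult (pverts G); u = frob_unit (pverts G);
         \<Delta> = frob_comult (pverts G); \<epsilon> = frob_counit (pverts G);
         A = adjacency_map G
     in fd_hilbert H \<and> P \<in> lin (H \<otimes>\<^sub>H X) (X \<otimes>\<^sub>H H) \<and>
       assoc X X H \<circ>\<^sub>M (\<Delta> \<otimes>\<^sub>M idm H) \<circ>\<^sub>M P =
         (idm X \<otimes>\<^sub>M P) \<circ>\<^sub>M assoc X H X \<circ>\<^sub>M (P \<otimes>\<^sub>M idm X) \<circ>\<^sub>M assoc_inv H X X \<circ>\<^sub>M (idm H \<otimes>\<^sub>M \<Delta>) \<and>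
       lunit H \<circ>\<^sub>M (\<epsilon> \<otimes>\<^sub>M idm H) \<circ>\<^sub>M P = runit H \<circ>\<^sub>M (idm H \<otimes>\<^sub>M \<epsilon>) \<and>
       adj P =
         lunit (H \<otimes>\<^sub>H X) \<circ>\<^sub>M ((\<epsilon> \<circ>\<^sub>M m) \<otimes>\<^sub>M (idm H \<otimes>\<^sub>M idm X)) \<circ>\<^sub>M
         assoc_inv X X (H \<otimes>\<^sub>H X) \<circ>\<^sub>M (idm X \<otimes>\<^sub>M assoc X H X) \<circ>\<^sub>M
         (idm X \<otimes>\<^sub>M (P \<otimes>\<^sub>M idm X)) \<circ>\<^sub>M
         (idm X \<otimes>\<^sub>M assoc_inv H X X) \<circ>\<^sub>M assoc X H (X \<otimes>\<^sub>H X) \<circ>\<^sub>M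
         ((idm X \<otimes>\<^sub>M idm H) \<otimes>\<^sub>M (\<Delta> \<circ>\<^sub>M u)) \<circ>\<^sub>M runit_inv (X \<otimes>\<^sub>H H) \<and>
       P \<circ>\<^sub>M (idm H \<otimes>\<^sub>M m) =
         (m \<otimes>\<^sub>M idm H) \<circ>\<^sub>M assoc_inv X X H \<circ>\<^sub>M (idm X \<otimes>\<^sub>M P) \<circ>\<^sub>M assoc X H X \<circ>\<^sub>M
         (P \<otimes>\<^sub>M idm X) \<circ>\<^sub>M assoc_inv H X X \<and>
       P \<circ>\<^sub>M (idm H \<otimes>\<^sub>M u) \<circ>\<^sub>M runit_inv H = (u \<otimes>\<^sub>M idm H) \<circ>\<^sub>M lunit_inv H \<and>
       P \<circ>\<^sub>M (idm H \<otimes>\<^sub>M A) = (A \<otimes>\<^sub>M idm H) \<circ>\<^sub>M P)"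

text \<open>
  The carriers of the Hilbert spaces \<open>H\<close> range over the subsets of the type \<open>'h\<close>, which plays
  the role of a universe.
\<close>

definition QIso :: "'v pair_pre_digraph \<Rightarrow> ('h hilb \<times> ('v, 'h) qmap, ('h, 'h) arr) cat" where
  "QIso G =
    \<lparr>Obj = {(H, P). quantum_iso G H P},
     Hom = (\<lambda>(H, P) (H', P'). {f \<in> lin H H'.
       (idm (fun_space (pverts G)) \<otimes>\<^sub>M f) \<circ>\<^sub>M P = P' \<circ>\<^sub>M (f \<otimes>\<^sub>M idm (fun_space (pverts G)))}),
     Ide = (\<lambda>(H, P). idm H),
     Cmp = (\<circ>\<^sub>M)\<rparr>"


section \<open>Star algebras and their finite-dimensional representations\<close>

record 'a star_alg = "(complex, 'a) module" +
  star :: "'a \<Rightarrow> 'a"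

definition End :: "'h hilb \<Rightarrow> ('h, 'h) arr star_alg" where
  "End H =
    \<lparr>carrier = lin H H, mult = (\<circ>\<^sub>M), one = idm H,
     zero = \<lparr>src = H, tgt = H, app = (\<lambda>x. \<zero>\<^bsub>H\<^esub>)\<rparr>,
     add = (\<lambda>f g. \<lparr>src = H, tgt = H, app = (\<lambda>x. app f x \<oplus>\<^bsub>H\<^esub> app g x)\<rparr>),
     smult = (\<lambda>c f. \<lparr>src = H, tgt = H, app = (\<lambda>x. c \<odot>\<^bsub>H\<^esub> app f x)\<rparr>),
     star = adj\<rparr>"

definition unital_star_hom :: "'a star_alg \<Rightarrow> 'b star_alg \<Rightarrow> ('a \<Rightarrow> 'b) set" where
  "unital_star_hom A B =
    {\<rho> \<in> Ring.ring_hom A B.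
      \<rho> \<in> extensional (carrier A) \<and>
      (\<forall>c. \<forall>x \<in> carrier A. \<rho> (c \<odot>\<^bsub>A\<^esub> x) = c \<odot>\<^bsub>B\<^esub> \<rho> x) \<and>
      (\<forall>x \<in> carrier A. \<rho> (star A x) = star B (\<rho> x))}"

definition fd_Rep :: "'a star_alg \<Rightarrow> ('h hilb \<times> ('a \<Rightarrow> ('h, 'h) arr), ('h, 'h) arr) cat" where
  "fd_Rep A =
    \<lparr>Obj = {(H, \<rho>). fd_hilbert H \<and> \<rho> \<in> unital_star_hom A (End H)},
     Hom = (\<lambda>(H, \<rho>) (H', \<rho>'). {f \<in> lin H H'. \<forall>x \<in> carrier A. f \<circ>\<^sub>M \<rho> x = \<rho>' x \<circ>\<^sub>M f}),
     Ide = (\<lambda>(H, \<rho>). idm H),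
     Cmp = (\<circ>\<^sub>M)\<rparr>"


section \<open>The free unital star algebra on a set of generators\<close>

text \<open>
  Words in the letters \<open>g\<close>, encoded as \<open>(g, False)\<close>, and \<open>g\<^sup>*\<close>, encoded as \<open>(g, True)\<close>.
  They form a monoid under concatenation, here written additively so that the library's
  polynomial mappings with keys in this monoid carry the multiplication of the monoid algebra.
\<close>

datatype 'g star_word = Word (letters: "('g \<times> bool) list")

instantiation star_word :: (type) monoid_add
begin

definition zero_star_word :: "'a star_word" where
  "0 = Word []"

definition plus_star_word :: "'a star_word \<Rightarrow> 'a star_word \<Rightarrow> 'a star_word" where
  "v + w = Word (letters v @ letters w)"

instance
  by standard (auto simp: zero_star_word_def plus_star_word_def)

end

type_synonym 'g free_elem = "'g star_word \<Rightarrow>\<^sub>0 complex"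

definition word_star :: "'g star_word \<Rightarrow> 'g star_word" where
  "word_star w = Word (rev (map (\<lambda>(g, b). (g, \<not> b)) (letters w)))"

definition free_star :: "'g free_elem \<Rightarrow> 'g free_elem" where
  "free_star x =
    (\<Sum>w\<in>Poly_Mapping.keys x. Poly_Mapping.single (word_star w) (cnj (Poly_Mapping.lookup x w)))"

definition free_scale :: "complex \<Rightarrow> 'g free_elem \<Rightarrow> 'g free_elem" where
  "free_scale c x = Poly_Mapping.single 0 c * x"

definition gen :: "'g \<Rightarrow> 'g free_elem" where
  "gen g = Poly_Mapping.single (Word [(g, False)]) 1"

definition free_star_alg :: "'g set \<Rightarrow> 'g free_elem star_alg" where
  "free_star_alg X =
    \<lparr>carrier = {x. \<forall>w \<in> Poly_Mapping.keys x. fst ` set (letters w) \<subseteq> X},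
     mult = (*), one = 1, zero = 0, add = (+), smult = free_scale, star = free_star\<rparr>"


section \<open>Universal unital \<open>C\<^sup>*\<close>-algebras given by generators and relations\<close>

text \<open>
  For a set \<open>R\<close> of elements of the free star algebra on \<open>X\<close>, the universal unital
  \<open>C\<^sup>*\<close>-algebra generated by \<open>X\<close> subject to the relations \<open>r = 0\<close> for \<open>r \<in> R\<close> is the Hausdorff
  completion of the free star algebra with respect to the supremum of all \<open>C\<^sup>*\<close>-seminorms that
  vanish on \<open>R\<close>.  It exists if that supremum is finite on all elements, which holds as soon as
  the relations bound the seminorms of the generators (e.g. if they force the generators to be
  projections).  The completion is the ring of Cauchy sequences modulo the ideal of null sequences.
\<close>

definition cstar_seminorm :: "'a star_alg \<Rightarrow> ('a \<Rightarrow> real) \<Rightarrow> bool" where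
  "cstar_seminorm A p \<longleftrightarrow>
    (\<forall>x \<in> carrier A. 0 \<le> p x) \<and>
    (\<forall>x \<in> carrier A. \<forall>y \<in> carrier A. p (x \<oplus>\<^bsub>A\<^esub> y) \<le> p x + p y) \<and>
    (\<forall>c. \<forall>x \<in> carrier A. p (c \<odot>\<^bsub>A\<^esub> x) = cmod c * p x) \<and>
    (\<forall>x \<in> carrier A. \<forall>y \<in> carrier A. p (x \<otimes>\<^bsub>A\<^esub> y) \<le> p x * p y) \<and>
    (\<forall>x \<in> carrier A. p (star A x \<otimes>\<^bsub>A\<^esub> x) = (p x)\<^sup>2)"

definition univ_seminorm :: "'g set \<Rightarrow> 'g free_elem set \<Rightarrow> 'g free_elem \<Rightarrow> real" where
  "univ_seminorm X R x =
    Sup {p x | p. cstar_seminorm (free_star_alg X) p \<and> (\<forall>r \<in> R. p r = 0)}"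

definition cauchy_ring :: "'g set \<Rightarrow> 'g free_elem set \<Rightarrow> (nat \<Rightarrow> 'g free_elem) ring" where
  "cauchy_ring X R =
    \<lparr>carrier = {s. (\<forall>n. s n \<in> carrier (free_star_alg X)) \<and>
       (\<forall>e>0. \<exists>N. \<forall>m\<ge>N. \<forall>n\<ge>N. univ_seminorm X R (s m - s n) < e)},
     mult = (\<lambda>s t n. s n * t n), one = (\<lambda>n. 1), zero = (\<lambda>n. 0), add = (\<lambda>s t n. s n + t n)\<rparr>"

definition null_seqs :: "'g set \<Rightarrow> 'g free_elem set \<Rightarrow> (nat \<Rightarrow> 'g free_elem) set" where
  "null_seqs X R =
    {s \<in> carrier (cauchy_ring X R). (\<lambda>n. univ_seminorm X R (s n)) \<longlonglongrightarrow> 0}"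

text \<open>
  In the scalar multiplication, the null sequences are added back since for \<open>c = 0\<close> the set of
  multiples of representatives is not a whole coset.
\<close>

definition universal_cstar ::
    "'g set \<Rightarrow> 'g free_elem set \<Rightarrow> (nat \<Rightarrow> 'g free_elem) set star_alg" where
  "universal_cstar X R =
    (let C = cauchy_ring X R; N = null_seqs X R in
      \<lparr>carrier = carrier (C Quot N), mult = mult (C Quot N), one = one (C Quot N),
       zero = zero (C Quot N), add = add (C Quot N),
       smult = (\<lambda>c S. N <+>\<^bsub>C\<^esub> (\<lambda>s n. free_scale c (s n)) ` S),
       star = (\<lambda>S. (\<lambda>s n. free_star (s n)) ` S)\<rparr>)"


section \<open>Banica's quantum automorphism group algebra\<close>

text \<open>The generators are indexed by pairs of vertices.\<close>

definition aut_relations :: "'v pair_pre_digraph \<Rightarrow> ('v \<times> 'v) free_elem set" where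
  "aut_relations G = (let V = pverts G; a = (\<lambda>i j. gen (i, j)) in
    {a i j * a i j - a i j | i j. i \<in> V \<and> j \<in> V} \<union>
    {a i j - free_star (a i j) | i j. i \<in> V \<and> j \<in> V} \<union>
    {(\<Sum>i\<in>V. a i j) - 1 | j. j \<in> V} \<union>
    {(\<Sum>j\<in>V. a i j) - 1 | i. i \<in> V} \<union>
    {(\<Sum>k\<in>V. free_scale (adjacency G i k) (a k j)) -
     (\<Sum>k\<in>V. free_scale (adjacency G k j) (a i k)) | i j. i \<in> V \<and> j \<in> V})"

definition A_aut ::
    "'v pair_pre_digraph \<Rightarrow> (nat \<Rightarrow> ('v \<times> 'v) free_elem) set star_alg" where
  "A_aut G = universal_cstar (pverts G \<times> pverts G) (aut_relations G)"

end

theory Submission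
  imports Defs
begin

text \<open>
  Slicing \<open>P : H \<otimes> \<complex>\<^sup>V \<rightarrow> \<complex>\<^sup>V \<otimes> H\<close> along the basis of \<open>\<complex>\<^sup>V\<close> gives operators
  \<open>P\<^sub>v\<^sub>w\<close> on \<open>H\<close>, and conditions (i) to (vi) become the relations of \<open>A_aut G\<close> for them: (i) and (iv)
  say that they are idempotent and orthogonal along columns and rows, (ii) and (v) that columns and
  rows sum to one, (iii) that they are selfadjoint, (vi) that they commute with the adjacency matrix.
  The orthogonality is not a relation of \<open>A_aut G\<close>, but projections that sum to one are orthogonal.

  Such operators define a representation of the free star algebra whose operator norm is a
  C*-seminorm killing the relations; it is bounded by the universal seminorm, so the representation
  extends to the completion by weak limits. Conversely, a unital star homomorphism on \<open>A_aut G\<close> is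
  determined by the generators because it is automatically continuous: if \<open>y\<close> is small then
  \<open>1 - y\<^sup>* y = z\<^sup>2\<close> with \<open>z\<close> selfadjoint, hence \<open>\<parallel>\<rho> y h\<parallel> \<le> \<parallel>h\<parallel>\<close>. The correspondence is bijective on
  objects, and a linear map intertwines \<open>P\<close> and \<open>P'\<close> iff it intertwines all the operators
  \<open>P\<^sub>v\<^sub>w\<close> and \<open>P'\<^sub>v\<^sub>w\<close>, so it is the identity on morphisms.
\<close>

section \<open>Finite-dimensional Hilbert spaces and linear maps\<close>

text \<open>Tensor products of maps and the coherence isomorphisms are specified by
  \<open>THE\<close> on pure tensors, and values on pure tensors alone do not define a linear map.
  Tensors realised as biantilinear forms remove this obstacle: the value of a form at
  \<open>(h, k)\<close> is its inner product with \<open>h \<otimes> k\<close>, so a map whose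
  adjoint is known on pure tensors has an explicit formula, precomposition with that adjoint. On the
  algebraic side the obstacle is that the Hilbert spaces carry no topology and the completion is a
  bare ring of cosets without a norm. Limits are therefore taken only of the complex numbers
  \<open>inner H k (app T h)\<close>, and the operator is recovered from its sesquilinear form; the
  square root behind automatic continuity is built termwise on Cauchy sequences in the free algebra.
  Extensionality of the homomorphisms makes the correspondence injective on the nose and not only up
  to isomorphism.\<close>

context fd_hilbert
begin

lemma add_closed [simp, intro]: "x \<in> carrier H \<Longrightarrow> y \<in> carrier H \<Longrightarrow> x \<oplus>\<^bsub>H\<^esub> y \<in> carrier H"
  by simp

lemma scale_closed [simp, intro]: "x \<in> carrier H \<Longrightarrow> c \<odot>\<^bsub>H\<^esub> x \<in> carrier H"
  by simp

lemma zero_in_carrier [simp, intro]: "\<zero>\<^bsub>H\<^esub> \<in> carrier H"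
  by simp

lemma fsum_closed [simp, intro]:
  "(\<And>a. a \<in> A \<Longrightarrow> F a \<in> carrier H) \<Longrightarrow> finsum H F A \<in> carrier H"
  by (rule finsum_closed) auto

lemma scale_zero_left [simp]: "x \<in> carrier H \<Longrightarrow> 0 \<odot>\<^bsub>H\<^esub> x = \<zero>\<^bsub>H\<^esub>"
  using lmult_0[of x] by simp

lemma scale_one [simp]: "x \<in> carrier H \<Longrightarrow> 1 \<odot>\<^bsub>H\<^esub> x = x"
  using smult_one[of x] by simp

lemma scale_scale: "x \<in> carrier H \<Longrightarrow> c \<odot>\<^bsub>H\<^esub> (d \<odot>\<^bsub>H\<^esub> x) = (c * d) \<odot>\<^bsub>H\<^esub> x"
  using smult_assoc1[of c d x] by simp

lemma inner_zero_right [simp]: "x \<in> carrier H \<Longrightarrow> inner H x \<zero>\<^bsub>H\<^esub> = 0"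
  using inner_smult[of x "\<zero>\<^bsub>H\<^esub>" 0] by simp

lemma inner_add_left:
  "\<lbrakk>x \<in> carrier H; y \<in> carrier H; z \<in> carrier H\<rbrakk>
    \<Longrightarrow> inner H (x \<oplus>\<^bsub>H\<^esub> y) z = inner H x z + inner H y z"
  by (metis add_closed complex_cnj_add inner_add inner_cnj)

lemma inner_smult_left:
  "\<lbrakk>x \<in> carrier H; y \<in> carrier H\<rbrakk> \<Longrightarrow> inner H (c \<odot>\<^bsub>H\<^esub> x) y = cnj c * inner H x y"
  by (metis scale_closed complex_cnj_mult inner_smult inner_cnj)

lemma inner_zero_left [simp]: "x \<in> carrier H \<Longrightarrow> inner H \<zero>\<^bsub>H\<^esub> x = 0"
  by (metis inner_cnj inner_zero_right complex_cnj_zero zero_in_carrier)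

lemma inner_finsum_right:
  assumes "y \<in> carrier H" "\<And>a. a \<in> A \<Longrightarrow> F a \<in> carrier H"
  shows "inner H y (finsum H F A) = (\<Sum>a\<in>A. inner H y (F a))"
  using assms(2)
proof (induction A rule: infinite_finite_induct)
  case (insert a A)
  then have "finsum H F (insert a A) = F a \<oplus>\<^bsub>H\<^esub> finsum H F A"
    by (intro finsum_insert) auto
  with insert assms(1) show ?case by (simp add: inner_add)
qed (use assms in auto)

lemma inner_finsum_left:
  assumes "y \<in> carrier H" "\<And>a. a \<in> A \<Longrightarrow> F a \<in> carrier H"
  shows "inner H (finsum H F A) y = (\<Sum>a\<in>A. inner H (F a) y)"
proof -
  have "inner H (finsum H F A) y = cnj (inner H y (finsum H F A))"
    using assms by (intro inner_cnj) auto
  also have "\<dots> = (\<Sum>a\<in>A. cnj (inner H y (F a)))"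
    using assms by (subst inner_finsum_right) auto
  also have "\<dots> = (\<Sum>a\<in>A. inner H (F a) y)"
    using assms by (intro sum.cong refl inner_cnj[symmetric]) auto
  finally show ?thesis .
qed

lemma inner_self: "x \<in> carrier H \<Longrightarrow> inner H x x = complex_of_real (Re (inner H x x))"
  using inner_cnj[of x x] by (metis complex_cnj_cancel_iff of_real_Re Reals_cnj_iff)

lemma inner_self_nonneg: "x \<in> carrier H \<Longrightarrow> 0 \<le> Re (inner H x x)"
  using inner_pos[of x] by (cases "x = \<zero>\<^bsub>H\<^esub>") auto

text \<open>Positivity, with the difference of the two vectors tested against itself. Many later
  vector identities are reduced by this lemma to identities of complex numbers, away from the
  carrier-based module operations.\<close>

lemma eq_of_inner_eq:
  assumes "x \<in> carrier H" "y \<in> carrier H" "\<And>z. z \<in> carrier H \<Longrightarrow> inner H z x = inner H z y"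
  shows "x = y"
proof -
  define d where "d = x \<oplus>\<^bsub>H\<^esub> (-1) \<odot>\<^bsub>H\<^esub> y"
  have d: "d \<in> carrier H" using assms unfolding d_def by auto
  have "inner H d d = 0"
    by (subst (2) d_def) (use assms d in \<open>simp add: inner_add inner_smult\<close>)
  then have "d = \<zero>\<^bsub>H\<^esub>" using inner_pos[OF d] by force
  moreover have "(-1) \<odot>\<^bsub>H\<^esub> y = \<ominus>\<^bsub>H\<^esub> y"
    using smult_minus_1[of y] assms by (simp add: class_ring_simps)
  ultimately show ?thesis
    using assms unfolding d_def by (metis M.minus_equality M.minus_minus scale_closed M.add.inv_closed)
qed

lemma Cauchy_Schwarz:
  assumes x: "x \<in> carrier H" and y: "y \<in> carrier H"
  shows "(cmod (inner H x y))\<^sup>2 \<le> Re (inner H x x) * Re (inner H y y)"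
proof (cases "x = \<zero>\<^bsub>H\<^esub>")
  case False
  define a where "a = Re (inner H x x)"
  have a: "a > 0" "inner H x x = complex_of_real a"
    using inner_pos[OF x False] inner_self[OF x] unfolding a_def by auto
  define c where "c = inner H x y"
  \<comment> \<open>The component of \<open>y\<close> orthogonal to \<open>x\<close>. Its squared
    norm is \<open>inner H y y - (cmod c)\<^sup>2 / a\<close>, and nonnegativity of that number is
    the claim.\<close>
  define z where "z = y \<oplus>\<^bsub>H\<^esub> (- (c / a)) \<odot>\<^bsub>H\<^esub> x"
  have z: "z \<in> carrier H" using x y unfolding z_def by auto
  have cy: "inner H y x = cnj c" unfolding c_def using x y by (rule inner_cnj)
  have "inner H z z = inner H y y - c * cnj c / a"
    using a(1) x y unfolding z_def
    by (simp add: inner_add inner_add_left inner_smult inner_smult_left a(2) cy flip: c_def)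
  also have "c * cnj c / a = complex_of_real ((cmod c)\<^sup>2 / a)"
    by (simp add: complex_mult_cnj cmod_power2)
  finally have "Re (inner H z z) = Re (inner H y y) - (cmod c)\<^sup>2 / a" by simp
  with inner_self_nonneg[OF z] have "(cmod c)\<^sup>2 / a \<le> Re (inner H y y)" by linarith
  with a(1) show ?thesis unfolding a_def[symmetric] c_def[symmetric]
    by (simp add: field_simps)
qed (use y in simp)

section \<open>Orthonormal sets and existence of orthonormal bases\<close>

definition orthonormal :: "'a set \<Rightarrow> bool" where
  "orthonormal S \<longleftrightarrow> finite S \<and> S \<subseteq> carrier H \<and> (\<forall>x\<in>S. \<forall>y\<in>S. inner H x y = of_bool (x = y))"

text \<open>For orthonormal \<open>S\<close> this is the orthogonal projection onto the span of
  \<open>S\<close>.\<close>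

definition expansion :: "'a set \<Rightarrow> 'a \<Rightarrow> 'a" where
  "expansion S x = finsum H (\<lambda>b. inner H b x \<odot>\<^bsub>H\<^esub> b) S"

lemma inner_expansion:
  assumes "orthonormal S" "b \<in> S" "x \<in> carrier H"
  shows "inner H b (expansion S x) = inner H b x"
proof -
  have S: "finite S" "S \<subseteq> carrier H" using assms unfolding orthonormal_def by auto
  have "inner H b (expansion S x) = (\<Sum>b'\<in>S. inner H b (inner H b' x \<odot>\<^bsub>H\<^esub> b'))"
    unfolding expansion_def using S assms by (intro inner_finsum_right) auto
  also have "\<dots> = (\<Sum>b'\<in>S. inner H b' x * of_bool (b = b'))"
    using S assms by (intro sum.cong refl, subst inner_smult) (auto simp: orthonormal_def)
  also have "\<dots> = inner H b x" using S assms by simp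
  finally show ?thesis .
qed

text \<open>Bounds the size of an orthonormal set by the dimension, so that a largest one
  exists.\<close>

lemma orthonormal_lin_indpt: "orthonormal S \<Longrightarrow> \<not> lin_dep S"
proof (rule finite_lin_indpt2)
  fix a assume S: "orthonormal S" and z: "lincomb a S = \<zero>\<^bsub>H\<^esub>"
  then have c: "finite S" "S \<subseteq> carrier H" by (auto simp: orthonormal_def)
  show "\<forall>v\<in>S. a v = \<zero>\<^bsub>complex_ring\<^esub>"
  proof
    fix v assume v: "v \<in> S"
    have "0 = inner H v (lincomb a S)" using z v c by auto
    also have "\<dots> = (\<Sum>b\<in>S. inner H v (a b \<odot>\<^bsub>H\<^esub> b))"
      unfolding lincomb_def using c v by (intro inner_finsum_right) auto
    also have "\<dots> = (\<Sum>b\<in>S. a b * of_bool (v = b))"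
      using S c v by (intro sum.cong refl, subst inner_smult) (auto simp: orthonormal_def)
    also have "\<dots> = a v" using c v by simp
    finally show "a v = \<zero>\<^bsub>complex_ring\<^esub>" by simp
  qed
qed (auto simp: orthonormal_def)

text \<open>In a linear combination of orthonormal vectors the coefficients are forced to be inner
  products. Later proofs use the expansion formula in place of spans.\<close>

lemma onb_iff_expansion:
  "onb H B \<longleftrightarrow> orthonormal B \<and> (\<forall>x\<in>carrier H. expansion B x = x)"
proof safe
  assume B: "onb H B"
  then show o: "orthonormal B" unfolding onb_def orthonormal_def by auto
  fix x assume x: "x \<in> carrier H"
  have c: "finite B" "B \<subseteq> carrier H" using o by (auto simp: orthonormal_def)
  have "x \<in> span B" using B x unfolding onb_def by auto
  then obtain a where a: "x = lincomb a B"
    using finite_span[OF c] by auto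
  have "a b = inner H b x" if "b \<in> B" for b
  proof -
    have "inner H b x = (\<Sum>b'\<in>B. inner H b (a b' \<odot>\<^bsub>H\<^esub> b'))"
      unfolding a lincomb_def using c that by (intro inner_finsum_right) auto
    also have "\<dots> = (\<Sum>b'\<in>B. a b' * of_bool (b = b'))"
      using o c that by (intro sum.cong refl, subst inner_smult) (auto simp: orthonormal_def)
    also have "\<dots> = a b" using c that by simp
    finally show ?thesis by simp
  qed
  then show "expansion B x = x"
    unfolding expansion_def using c
    by (subst (2) a, unfold lincomb_def, intro finsum_cong') auto
next
  assume o: "orthonormal B" and e: "\<forall>x\<in>carrier H. expansion B x = x"
  have c: "finite B" "B \<subseteq> carrier H" using o by (auto simp: orthonormal_def)
  have "x \<in> span B" if "x \<in> carrier H" for x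
  proof -
    have "x = lincomb (\<lambda>b. inner H b x) B" using e that unfolding lincomb_def expansion_def by simp
    then show ?thesis unfolding finite_span[OF c] by auto
  qed
  moreover have "span B \<subseteq> carrier H" using c by (intro span_is_subset2) auto
  ultimately show "onb H B" using o unfolding onb_def orthonormal_def by auto
qed

text \<open>An orthonormal set \<open>S\<close> of maximal cardinality is a basis: if some
  \<open>x\<close> differed from its projection, the residual \<open>z\<close> would be a nonzero
  vector orthogonal to \<open>S\<close>, and normalising it to \<open>e\<close> would give a larger
  orthonormal set. This replaces the Gram-Schmidt recursion.\<close>

lemma onb_exists: "\<exists>B. onb H B"
proof -
  define n where "n = Max (card ` {S. orthonormal S})"
  have "card S \<le> dim" if "orthonormal S" for S
    using that by (intro li_le_dim(2)[OF finite_dimensional] orthonormal_lin_indpt)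
      (simp_all add: orthonormal_def)
  then have "card ` {S. orthonormal S} \<subseteq> {..dim}" by blast
  then have fin: "finite (card ` {S. orthonormal S})"
    by (rule finite_subset) simp
  have "orthonormal {}" by (simp add: orthonormal_def)
  then have "n \<in> card ` {S. orthonormal S}" unfolding n_def using fin by (intro Max_in) auto
  then obtain S where S: "orthonormal S" "card S = n" by auto
  have max: "card T \<le> n" if "orthonormal T" for T
    unfolding n_def using fin that by (intro Max_ge) auto
  have c: "finite S" "S \<subseteq> carrier H" using S by (auto simp: orthonormal_def)
  have "expansion S x = x" if x: "x \<in> carrier H" for x
  proof (rule ccontr)
    assume ne: "expansion S x \<noteq> x"
    have ex: "expansion S x \<in> carrier H" unfolding expansion_def using c x by auto
    define z where "z = x \<oplus>\<^bsub>H\<^esub> (-1) \<odot>\<^bsub>H\<^esub> expansion S x"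
    have z: "z \<in> carrier H" using x ex unfolding z_def by auto
    have orth: "inner H b z = 0" if "b \<in> S" for b
      using inner_expansion[OF S(1) that x] c that x ex unfolding z_def
      by (auto simp: inner_add inner_smult)
    have "z \<noteq> \<zero>\<^bsub>H\<^esub>"
    proof
      assume "z = \<zero>\<^bsub>H\<^esub>"
      have "inner H w (expansion S x) = inner H w x" if "w \<in> carrier H" for w
      proof -
        have "0 = inner H w z" using that \<open>z = \<zero>\<^bsub>H\<^esub>\<close> by simp
        also have "\<dots> = inner H w x - inner H w (expansion S x)"
          using that x ex unfolding z_def by (simp add: inner_add inner_smult)
        finally show ?thesis by simp
      qed
      with ne show False using eq_of_inner_eq[OF ex x] by blast
    qed
    define r where "r = Re (inner H z z)"
    have r: "r > 0" "inner H z z = complex_of_real r"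
      using inner_pos[OF z \<open>z \<noteq> \<zero>\<^bsub>H\<^esub>\<close>] inner_self[OF z] unfolding r_def by auto
    define e where "e = complex_of_real (1 / sqrt r) \<odot>\<^bsub>H\<^esub> z"
    have e: "e \<in> carrier H" using z unfolding e_def by auto
    have "inner H e e = complex_of_real (1 / sqrt r) * (complex_of_real (1 / sqrt r) * complex_of_real r)"
      unfolding e_def using z by (simp only: inner_smult inner_smult_left r(2) scale_closed
          complex_cnj_complex_of_real)
    also have "\<dots> = complex_of_real (1 / sqrt r * (1 / sqrt r * r))" by (simp only: of_real_mult)
    also have "1 / sqrt r * (1 / sqrt r * r) = 1" using r(1) by (simp add: field_simps)
    finally have ee: "inner H e e = 1" by simp
    have eo: "inner H b e = 0" "inner H e b = 0" if "b \<in> S" for b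
    proof -
      show "inner H b e = 0" unfolding e_def using that c z orth by (auto simp: inner_smult)
      then show "inner H e b = 0" using inner_cnj[of b e] that c e by auto
    qed
    have "e \<notin> S" using eo(1) ee by force
    moreover have "orthonormal (insert e S)"
      using S(1) e ee eo \<open>e \<notin> S\<close> unfolding orthonormal_def by auto
    ultimately show False using max[of "insert e S"] c S by simp
  qed
  with S show ?thesis using onb_iff_expansion by auto
qed

end

text \<open>The very choice that occurs in the inner product of \<open>tensor_space\<close>, so that
  this inner product is by definition a sum over \<open>bas H\<close> and
  \<open>bas K\<close>.\<close>

definition bas :: "'a hilb \<Rightarrow> 'a set" where
  "bas H = (SOME B. onb H B)"

context fd_hilbert
begin

lemma onb_bas: "onb H (bas H)"
  unfolding bas_def using onb_exists by (rule someI_ex)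

lemma onb_finite: "onb H B \<Longrightarrow> finite B"
  and onb_carrier: "onb H B \<Longrightarrow> b \<in> B \<Longrightarrow> b \<in> carrier H"
  and onb_inner: "onb H B \<Longrightarrow> b \<in> B \<Longrightarrow> b' \<in> B \<Longrightarrow> inner H b b' = of_bool (b = b')"
  unfolding onb_def by auto

lemma onb_expand: "onb H B \<Longrightarrow> x \<in> carrier H \<Longrightarrow> finsum H (\<lambda>b. inner H b x \<odot>\<^bsub>H\<^esub> b) B = x"
  using onb_iff_expansion unfolding expansion_def by auto

lemma onbI:
  assumes "finite B" "B \<subseteq> carrier H" "\<And>x y. x \<in> B \<Longrightarrow> y \<in> B \<Longrightarrow> inner H x y = of_bool (x = y)"
    and "\<And>x. x \<in> carrier H \<Longrightarrow> finsum H (\<lambda>b. inner H b x \<odot>\<^bsub>H\<^esub> b) B = x"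
  shows "onb H B"
  using assms unfolding onb_iff_expansion orthonormal_def expansion_def by auto

end

subsection \<open>Linear maps\<close>

lemma lin_src: "f \<in> lin H K \<Longrightarrow> src f = H"
  and lin_tgt: "f \<in> lin H K \<Longrightarrow> tgt f = K"
  and lin_closed: "f \<in> lin H K \<Longrightarrow> x \<in> carrier H \<Longrightarrow> app f x \<in> carrier K"
  and lin_outside: "f \<in> lin H K \<Longrightarrow> x \<notin> carrier H \<Longrightarrow> app f x = \<zero>\<^bsub>K\<^esub>"
  and lin_add: "f \<in> lin H K \<Longrightarrow> x \<in> carrier H \<Longrightarrow> y \<in> carrier H \<Longrightarrow>
    app f (x \<oplus>\<^bsub>H\<^esub> y) = app f x \<oplus>\<^bsub>K\<^esub> app f y"
  and lin_smult: "f \<in> lin H K \<Longrightarrow> x \<in> carrier H \<Longrightarrow> app f (c \<odot>\<^bsub>H\<^esub> x) = c \<odot>\<^bsub>K\<^esub> app f x"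
  unfolding lin_def LinearCombinations.module_hom_def by auto

lemma linI:
  assumes "src f = H" "tgt f = K" "\<And>x. x \<in> carrier H \<Longrightarrow> app f x \<in> carrier K"
    "\<And>x y. x \<in> carrier H \<Longrightarrow> y \<in> carrier H \<Longrightarrow> app f (x \<oplus>\<^bsub>H\<^esub> y) = app f x \<oplus>\<^bsub>K\<^esub> app f y"
    "\<And>c x. x \<in> carrier H \<Longrightarrow> app f (c \<odot>\<^bsub>H\<^esub> x) = c \<odot>\<^bsub>K\<^esub> app f x"
    "\<And>x. x \<notin> carrier H \<Longrightarrow> app f x = \<zero>\<^bsub>K\<^esub>"
  shows "f \<in> lin H K"
  using assms unfolding lin_def LinearCombinations.module_hom_def by auto

lemma lin_eqI:
  assumes "f \<in> lin H K" "g \<in> lin H K" "\<And>x. x \<in> carrier H \<Longrightarrow> app f x = app g x"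
  shows "f = g"
proof (rule arr.equality)
  show "app f = app g"
    using assms lin_outside[OF assms(1)] lin_outside[OF assms(2)] by (metis ext)
qed (use assms in \<open>simp_all add: lin_src lin_tgt\<close>)

section \<open>Linear maps determined by a basis or by a sesquilinear form\<close>

context
  fixes H :: "'a hilb" and K :: "'b hilb"
  assumes H: "fd_hilbert H" and K: "fd_hilbert K"
begin

interpretation H: fd_hilbert H by (rule H)
interpretation K: fd_hilbert K by (rule K)

lemma lin_zero:
  assumes "f \<in> lin H K" shows "app f \<zero>\<^bsub>H\<^esub> = \<zero>\<^bsub>K\<^esub>"
proof -
  have "app f (0 \<odot>\<^bsub>H\<^esub> \<zero>\<^bsub>H\<^esub>) = 0 \<odot>\<^bsub>K\<^esub> app f \<zero>\<^bsub>H\<^esub>"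
    using assms by (intro lin_smult) auto
  moreover have "app f \<zero>\<^bsub>H\<^esub> \<in> carrier K" using assms by (intro lin_closed) auto
  ultimately show ?thesis by simp
qed

lemma lin_finsum:
  assumes f: "f \<in> lin H K" and F: "\<And>a. a \<in> A \<Longrightarrow> F a \<in> carrier H"
  shows "app f (finsum H F A) = finsum K (\<lambda>a. app f (F a)) A"
  using F
proof (induction A rule: infinite_finite_induct)
  case (insert a A)
  then have "finsum H F (insert a A) = F a \<oplus>\<^bsub>H\<^esub> finsum H F A"
    by (intro H.finsum_insert) auto
  moreover from insert have "finsum K (\<lambda>a. app f (F a)) (insert a A) =
      app f (F a) \<oplus>\<^bsub>K\<^esub> finsum K (\<lambda>a. app f (F a)) A"
    by (intro K.finsum_insert) (auto intro!: lin_closed[OF f])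
  ultimately show ?case using insert by (simp add: lin_add[OF f])
qed (simp_all add: lin_zero[OF f])

lemma lin_eq_onbI:
  assumes f: "f \<in> lin H K" and g: "g \<in> lin H K" and B: "onb H B"
    and eq: "\<And>b. b \<in> B \<Longrightarrow> app f b = app g b"
  shows "f = g"
proof (rule lin_eqI[OF f g])
  fix x assume x: "x \<in> carrier H"
  note [simp] = H.onb_carrier[OF B]
  have *: "app h x = finsum K (\<lambda>b. inner H b x \<odot>\<^bsub>K\<^esub> app h b) B" if h: "h \<in> lin H K" for h
  proof -
    have "app h x = app h (finsum H (\<lambda>b. inner H b x \<odot>\<^bsub>H\<^esub> b) B)"
      using x by (simp add: H.onb_expand[OF B])
    also have "\<dots> = finsum K (\<lambda>b. app h (inner H b x \<odot>\<^bsub>H\<^esub> b)) B"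
      by (intro lin_finsum[OF h]) auto
    also have "\<dots> = finsum K (\<lambda>b. inner H b x \<odot>\<^bsub>K\<^esub> app h b) B"
      by (intro K.finsum_cong' refl) (auto simp: lin_smult[OF h] intro!: lin_closed[OF h])
    finally show ?thesis .
  qed
  show "app f x = app g x"
    unfolding *[OF f] *[OF g]
    by (intro K.finsum_cong' refl) (auto simp: eq intro!: lin_closed[OF g])
qed

lemma lin_extend_onb:
  assumes B: "onb H B" and g: "\<And>b. b \<in> B \<Longrightarrow> g b \<in> carrier K"
  obtains f where "f \<in> lin H K" "\<And>b. b \<in> B \<Longrightarrow> app f b = g b"
proof
  note [simp] = H.onb_carrier[OF B] H.onb_finite[OF B]
  define f where "f = \<lparr>src = H, tgt = K, app = (\<lambda>x. if x \<in> carrier H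
    then finsum K (\<lambda>b. inner H b x \<odot>\<^bsub>K\<^esub> g b) B else \<zero>\<^bsub>K\<^esub>)\<rparr>"
  show "f \<in> lin H K"
  proof (rule linI)
    fix x y assume x: "x \<in> carrier H" and y: "y \<in> carrier H"
    show "app f (x \<oplus>\<^bsub>H\<^esub> y) = app f x \<oplus>\<^bsub>K\<^esub> app f y"
    proof (rule K.eq_of_inner_eq)
      fix z assume "z \<in> carrier K"
      then show "inner K z (app f (x \<oplus>\<^bsub>H\<^esub> y)) = inner K z (app f x \<oplus>\<^bsub>K\<^esub> app f y)"
        using x y g unfolding f_def
        by (simp add: K.inner_add K.inner_finsum_right K.inner_smult H.inner_add ring_distribs sum.distrib)
    qed (use x y g in \<open>auto simp: f_def\<close>)
  next
    fix c x assume x: "x \<in> carrier H"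
    show "app f (c \<odot>\<^bsub>H\<^esub> x) = c \<odot>\<^bsub>K\<^esub> app f x"
    proof (rule K.eq_of_inner_eq)
      fix z assume "z \<in> carrier K"
      then show "inner K z (app f (c \<odot>\<^bsub>H\<^esub> x)) = inner K z (c \<odot>\<^bsub>K\<^esub> app f x)"
        using x g unfolding f_def
        by (simp add: K.inner_finsum_right K.inner_smult H.inner_smult sum_distrib_left mult.assoc)
    qed (use x g in \<open>auto simp: f_def\<close>)
  qed (use g in \<open>auto simp: f_def\<close>)
  fix b assume b: "b \<in> B"
  show "app f b = g b"
  proof (rule K.eq_of_inner_eq)
    fix z assume z: "z \<in> carrier K"
    have "inner K z (app f b) = (\<Sum>b'\<in>B. of_bool (b' = b) * inner K z (g b'))"
      using z b g unfolding f_def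
      by (simp add: K.inner_finsum_right K.inner_smult H.onb_inner[OF B])
    also have "\<dots> = inner K z (g b)" using b by simp
    finally show "inner K z (app f b) = inner K z (g b)" .
  qed (use b g in \<open>auto simp: f_def\<close>)
qed

text \<open>The finite-dimensional Riesz representation: the coefficient of \<open>f x\<close> along
  a basis vector \<open>b\<close> must be \<open>\<beta> b x\<close>, and antilinearity in the first
  argument extends the defining identity from the basis to all \<open>y\<close>. Adjoints, unitors,
  slices and weak limits of operators are all obtained this way.\<close>

lemma lin_of_form:
  assumes "\<And>y x x'. y \<in> carrier K \<Longrightarrow> x \<in> carrier H \<Longrightarrow> x' \<in> carrier H \<Longrightarrow> \<beta> y (x \<oplus>\<^bsub>H\<^esub> x') = \<beta> y x + \<beta> y x'"
    "\<And>y x c. y \<in> carrier K \<Longrightarrow> x \<in> carrier H \<Longrightarrow> \<beta> y (c \<odot>\<^bsub>H\<^esub> x) = c * \<beta> y x"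
    "\<And>y y' x. y \<in> carrier K \<Longrightarrow> y' \<in> carrier K \<Longrightarrow> x \<in> carrier H \<Longrightarrow> \<beta> (y \<oplus>\<^bsub>K\<^esub> y') x = \<beta> y x + \<beta> y' x"
    "\<And>y x c. y \<in> carrier K \<Longrightarrow> x \<in> carrier H \<Longrightarrow> \<beta> (c \<odot>\<^bsub>K\<^esub> y) x = cnj c * \<beta> y x"
  obtains f where "f \<in> lin H K" "\<And>x y. x \<in> carrier H \<Longrightarrow> y \<in> carrier K \<Longrightarrow> inner K y (app f x) = \<beta> y x"
proof
  note B = K.onb_bas
  note [simp] = K.onb_carrier[OF B] K.onb_finite[OF B]
  define f where "f = \<lparr>src = H, tgt = K, app = (\<lambda>x. if x \<in> carrier H
    then finsum K (\<lambda>b. \<beta> b x \<odot>\<^bsub>K\<^esub> b) (bas K) else \<zero>\<^bsub>K\<^esub>)\<rparr>"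
  have \<beta>0: "\<beta> \<zero>\<^bsub>K\<^esub> x = 0" if "x \<in> carrier H" for x
    using assms(4)[of "\<zero>\<^bsub>K\<^esub>" x 0] that by simp
  have \<beta>sum: "\<beta> (finsum K F A) x = (\<Sum>a\<in>A. \<beta> (F a) x)"
    if "x \<in> carrier H" "\<And>a. a \<in> A \<Longrightarrow> F a \<in> carrier K" for x A and F :: "'b \<Rightarrow> 'b"
    using that(2)
  proof (induction A rule: infinite_finite_induct)
    case (insert a A)
    then have "finsum K F (insert a A) = F a \<oplus>\<^bsub>K\<^esub> finsum K F A"
      by (intro K.finsum_insert) auto
    with insert that(1) show ?case by (simp add: assms(3))
  qed (use that(1) \<beta>0 in auto)
  show form: "inner K y (app f x) = \<beta> y x" if x: "x \<in> carrier H" and y: "y \<in> carrier K" for x y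
  proof -
    have "inner K y (app f x) = (\<Sum>b\<in>bas K. \<beta> b x * inner K y b)"
      unfolding f_def using x y by (simp add: K.inner_finsum_right K.inner_smult)
    also have "\<dots> = (\<Sum>b\<in>bas K. cnj (inner K b y) * \<beta> b x)"
      using y by (intro sum.cong refl, subst K.inner_cnj[of _ y]) auto
    also have "\<dots> = \<beta> (finsum K (\<lambda>b. inner K b y \<odot>\<^bsub>K\<^esub> b) (bas K)) x"
      using x by (simp add: \<beta>sum assms(4))
    also have "\<dots> = \<beta> y x" using y by (simp add: K.onb_expand[OF B])
    finally show ?thesis .
  qed
  have cl: "app f x \<in> carrier K" if "x \<in> carrier H" for x
    unfolding f_def using that by auto
  show "f \<in> lin H K"
  proof (rule linI)
    fix x y assume x: "x \<in> carrier H" and y: "y \<in> carrier H"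
    show "app f (x \<oplus>\<^bsub>H\<^esub> y) = app f x \<oplus>\<^bsub>K\<^esub> app f y"
      using x y by (intro K.eq_of_inner_eq) (auto simp: K.inner_add form cl assms(1))
  next
    fix c x assume x: "x \<in> carrier H"
    show "app f (c \<odot>\<^bsub>H\<^esub> x) = c \<odot>\<^bsub>K\<^esub> app f x"
      using x by (intro K.eq_of_inner_eq) (auto simp: K.inner_smult form cl assms(2))
  qed (auto simp: f_def)
qed

lemma lin_eq_formI:
  assumes f: "f \<in> lin H K" and g: "g \<in> lin H K"
    and eq: "\<And>x y. x \<in> carrier H \<Longrightarrow> y \<in> carrier K \<Longrightarrow> inner K y (app f x) = inner K y (app g x)"
  shows "f = g"
  using assms by (intro lin_eqI[OF f g] K.eq_of_inner_eq) (auto intro: lin_closed)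

lemma adj_unique:
  assumes f: "f \<in> lin H K" and g: "g \<in> lin K H"
    and eq: "\<And>x y. x \<in> carrier H \<Longrightarrow> y \<in> carrier K \<Longrightarrow> inner K (app f x) y = inner H x (app g y)"
  shows "adj f = g"
  unfolding adj_def lin_src[OF f] lin_tgt[OF f]
proof (rule the_equality)
  fix g' assume g': "g' \<in> lin K H \<and>
    (\<forall>x\<in>carrier H. \<forall>y\<in>carrier K. inner K (app f x) y = inner H x (app g' y))"
  then show "g' = g"
    using eq g by (intro lin_eqI[of g' K H g] H.eq_of_inner_eq) (auto intro: lin_closed)
qed (use g eq in auto)

end

section \<open>Adjoints and composition\<close>

context
  fixes H :: "'a hilb" and K :: "'b hilb"
  assumes H: "fd_hilbert H" and K: "fd_hilbert K"
begin

interpretation H: fd_hilbert H by (rule H)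
interpretation K: fd_hilbert K by (rule K)

text \<open>\<open>inner K (app f x) y\<close> is linear in \<open>y\<close> and antilinear in
  \<open>x\<close>, so the Riesz argument applies with the roles of source and target
  exchanged.\<close>

lemma adj_spec:
  assumes f: "f \<in> lin H K"
  shows adj_lin: "adj f \<in> lin K H"
    and inner_adj_right: "x \<in> carrier H \<Longrightarrow> y \<in> carrier K \<Longrightarrow> inner H x (app (adj f) y) = inner K (app f x) y"
proof -
  obtain g where "g \<in> lin K H"
    and "\<And>y x. y \<in> carrier K \<Longrightarrow> x \<in> carrier H \<Longrightarrow> inner H x (app g y) = inner K (app f x) y"
  proof (rule lin_of_form[OF K H, of "\<lambda>x y. inner K (app f x) y"])
  qed (auto simp: lin_closed[OF f] lin_add[OF f] lin_smult[OF f] K.inner_add K.inner_add_left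
      K.inner_smult K.inner_smult_left)
  moreover from this have "adj f = g" by (intro adj_unique[OF H K f]) auto
  ultimately show "adj f \<in> lin K H"
    "x \<in> carrier H \<Longrightarrow> y \<in> carrier K \<Longrightarrow> inner H x (app (adj f) y) = inner K (app f x) y" by auto
qed

lemma inner_adj_left:
  assumes f: "f \<in> lin H K" and x: "x \<in> carrier H" and y: "y \<in> carrier K"
  shows "inner H (app (adj f) y) x = inner K y (app f x)"
  using H.inner_cnj[of x "app (adj f) y"] K.inner_cnj[of "app f x" y] inner_adj_right[OF f x y]
    lin_closed[OF adj_lin[OF f] y] lin_closed[OF f x] x y by simp

end

lemma comp_lin:
  assumes f: "f \<in> lin H K" and g: "g \<in> lin K L"
    and K: "fd_hilbert K" and L: "fd_hilbert L"
  shows "g \<circ>\<^sub>M f \<in> lin H L"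
  by (rule linI) (auto simp: comp_map_def lin_src[OF f] lin_tgt[OF g] lin_add[OF f] lin_smult[OF f]
      lin_add[OF g] lin_smult[OF g] lin_outside[OF f] lin_zero[OF K L g]
      lin_closed[OF f] lin_closed[OF g])

lemma comp_app [simp]: "app (g \<circ>\<^sub>M f) x = app g (app f x)"
  by (simp add: comp_map_def)

lemma comp_map_assoc: "(h \<circ>\<^sub>M g) \<circ>\<^sub>M f = h \<circ>\<^sub>M (g \<circ>\<^sub>M f)"
  by (simp add: comp_map_def comp_assoc)

lemma idm_lin [intro, simp]: "fd_hilbert H \<Longrightarrow> idm H \<in> lin H H"
proof -
  assume "fd_hilbert H"
  then interpret fd_hilbert H .
  show ?thesis by (rule linI) (auto simp: idm_def)
qed

lemma idm_app [simp]: "x \<in> carrier H \<Longrightarrow> app (idm H) x = x"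
  by (simp add: idm_def)

lemma comp_idm_right:
  assumes "fd_hilbert H" "fd_hilbert K" "f \<in> lin H K" shows "f \<circ>\<^sub>M idm H = f"
  using assms by (intro lin_eqI[of _ H K] comp_lin[of _ H H]) auto

lemma comp_idm_left:
  assumes "fd_hilbert H" "fd_hilbert K" "f \<in> lin H K" shows "idm K \<circ>\<^sub>M f = f"
  using assms by (intro lin_eqI[of _ H K] comp_lin[of _ H K]) (auto simp: lin_closed)

section \<open>Concrete Hilbert spaces\<close>

text \<open>Spanning by an indexed family: for pure tensors of basis vectors this avoids having to
  know beforehand that distinct indices give distinct vectors.\<close>

lemma (in vectorspace) fin_dim_of_family:
  assumes I: "finite I" and g: "\<And>i. i \<in> I \<Longrightarrow> g i \<in> carrier V"
    and exp: "\<And>x. x \<in> carrier V \<Longrightarrow> \<exists>c. c \<in> I \<rightarrow> carrier K \<and> x = finsum V (\<lambda>i. c i \<odot>\<^bsub>V\<^esub> g i) I"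
  shows fin_dim
proof -
  have gV: "g ` I \<subseteq> carrier V" using g by auto
  interpret S: submodule K "span (g ` I)" V using gV by (rule span_is_submodule)
  have "finsum V (\<lambda>i. c i \<odot>\<^bsub>V\<^esub> g i) J \<in> span (g ` I)"
    if "J \<subseteq> I" "c \<in> I \<rightarrow> carrier K" for c J
    using finite_subset[OF that(1) I] that(1)
  proof (induction J rule: finite_induct)
    case empty
    show ?case using span_is_submodule[OF gV] by (simp add: submodule_def)
  next
    case (insert j J)
    have "finsum V (\<lambda>i. c i \<odot>\<^bsub>V\<^esub> g i) (insert j J) = c j \<odot>\<^bsub>V\<^esub> g j \<oplus>\<^bsub>V\<^esub> finsum V (\<lambda>i. c i \<odot>\<^bsub>V\<^esub> g i) J"
      using insert g that(2) by (intro finsum_insert) (auto simp: Pi_def)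
    moreover have "g j \<in> span (g ` I)" using insert gV in_own_span[OF gV] by auto
    then have "c j \<odot>\<^bsub>V\<^esub> g j \<in> span (g ` I)" using that(2) insert by (intro S.smult_closed) auto
    ultimately show ?case using insert S.m_closed by auto
  qed
  then have "x \<in> span (g ` I)" if "x \<in> carrier V" for x using exp[OF that] by auto
  moreover have "span (g ` I) \<subseteq> carrier V" using gV by (intro span_is_subset2) auto
  ultimately show ?thesis unfolding fin_dim_def using I gV by (intro exI[of _ "g ` I"]) auto
qed

text \<open>Orthonormality in the indexed sense makes the family injective, since equal members with
  different indices would have inner product both 0 and 1. The sum over indices can then be
  reindexed as a sum over the set of vectors.\<close>

lemma (in fd_hilbert) onb_of_family:
  assumes I: "finite I" and g: "\<And>i. i \<in> I \<Longrightarrow> g i \<in> carrier H"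
    and on: "\<And>i j. i \<in> I \<Longrightarrow> j \<in> I \<Longrightarrow> inner H (g i) (g j) = of_bool (i = j)"
    and exp: "\<And>x. x \<in> carrier H \<Longrightarrow> finsum H (\<lambda>i. inner H (g i) x \<odot>\<^bsub>H\<^esub> g i) I = x"
  shows "onb H (g ` I)"
proof (rule onbI)
  have inj: "inj_on g I"
    by (rule inj_onI) (metis on of_bool_eq(1,2) zero_neq_one)
  show "inner H x y = of_bool (x = y)" if "x \<in> g ` I" "y \<in> g ` I" for x y
    using that on inj by (auto simp: inj_on_def)
  show "finsum H (\<lambda>b. inner H b x \<odot>\<^bsub>H\<^esub> b) (g ` I) = x" if "x \<in> carrier H" for x
    using exp[OF that] g inj by (subst finsum_reindex) auto
qed (use I g in auto)

lemma Re_cnj_mult_self: "Re (cnj z * z) = (cmod z)\<^sup>2"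
  unfolding cmod_power2 by (simp add: power2_eq_square)

lemma (in fd_hilbert) eq_of_inner_onb:
  assumes B: "onb H B" and x: "x \<in> carrier H" and y: "y \<in> carrier H"
    and eq: "\<And>b. b \<in> B \<Longrightarrow> inner H b x = inner H b y"
  shows "x = y"
proof -
  have "x = finsum H (\<lambda>b. inner H b x \<odot>\<^bsub>H\<^esub> b) B" by (simp add: onb_expand[OF B x])
  also have "\<dots> = finsum H (\<lambda>b. inner H b y \<odot>\<^bsub>H\<^esub> b) B"
    by (rule finsum_cong') (auto simp: eq onb_carrier[OF B])
  also have "\<dots> = y" by (simp add: onb_expand[OF B y])
  finally show ?thesis .
qed

lemma complex_field: "field complex_ring"
  by (rule class_field)

lemma fd_hilbertI:
  assumes "vectorspace complex_ring H" "finite I" "\<And>i. i \<in> I \<Longrightarrow> g i \<in> carrier H"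
    "\<And>x. x \<in> carrier H \<Longrightarrow> \<exists>c. x = finsum H (\<lambda>i. c i \<odot>\<^bsub>H\<^esub> g i) I"
    "\<And>x y z. \<lbrakk>x \<in> carrier H; y \<in> carrier H; z \<in> carrier H\<rbrakk>
        \<Longrightarrow> inner H x (y \<oplus>\<^bsub>H\<^esub> z) = inner H x y + inner H x z"
    "\<And>x y c. \<lbrakk>x \<in> carrier H; y \<in> carrier H\<rbrakk> \<Longrightarrow> inner H x (c \<odot>\<^bsub>H\<^esub> y) = c * inner H x y"
    "\<And>x y. \<lbrakk>x \<in> carrier H; y \<in> carrier H\<rbrakk> \<Longrightarrow> inner H y x = cnj (inner H x y)"
    "\<And>x. \<lbrakk>x \<in> carrier H; x \<noteq> \<zero>\<^bsub>H\<^esub>\<rbrakk> \<Longrightarrow> 0 < Re (inner H x x)"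
  shows "fd_hilbert H"
proof -
  interpret vectorspace complex_ring H by fact
  have fin_dim using assms(2,3)
  proof (rule fin_dim_of_family)
    fix x assume "x \<in> carrier H"
    from assms(4)[OF this] show "\<exists>c. c \<in> I \<rightarrow> carrier complex_ring \<and> x = finsum H (\<lambda>i. c i \<odot>\<^bsub>H\<^esub> g i) I"
      by simp
  qed
  then show ?thesis
    by (intro fd_hilbert.intro fd_hilbert_axioms.intro vectorspace_axioms)
      (assumption | rule assms; assumption)+
qed

subsection \<open>The scalars and functions on a finite set\<close>

lemma unit_space_simps [simp]:
  "carrier unit_space = UNIV" "\<zero>\<^bsub>unit_space\<^esub> = 0" "x \<oplus>\<^bsub>unit_space\<^esub> y = x + y"
  "c \<odot>\<^bsub>unit_space\<^esub> x = c * x" "inner unit_space x y = cnj x * y"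
  by (simp_all add: unit_space_def)

lemma vectorspace_unit_space: "vectorspace complex_ring unit_space"
proof (rule vs_criteria[OF complex_field], goal_cases)
  case 3 then show ?case by (auto intro: exI[of _ "- _"] add.right_inverse)
qed (auto simp: algebra_simps)

lemma fd_hilbert_unit_space [simp]: "fd_hilbert unit_space"
proof -
  interpret vectorspace complex_ring unit_space by (rule vectorspace_unit_space)
  show ?thesis
  proof (rule fd_hilbertI[OF vectorspace_axioms, of "{()}" "\<lambda>_. 1"])
    fix x
    show "\<exists>c. x = finsum unit_space (\<lambda>i. c i \<odot>\<^bsub>unit_space\<^esub> 1) {()}"
      by (rule exI[of _ "\<lambda>_. x"], subst finsum_insert) auto
    assume "x \<noteq> \<zero>\<^bsub>unit_space\<^esub>"
    then have "x \<noteq> 0" by simp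
    then show "0 < Re (inner unit_space x x)"
      by (simp add: complex_neq_0 flip: power2_eq_square)
  qed (auto simp: algebra_simps)
qed

lemma onb_unit_space: "onb unit_space {1}"
proof -
  interpret fd_hilbert unit_space by simp
  show ?thesis by (rule onbI) auto
qed

lemma fun_space_simps [simp]:
  "x \<in> carrier (fun_space V) \<longleftrightarrow> (\<forall>v. v \<notin> V \<longrightarrow> x v = 0)" "\<zero>\<^bsub>fun_space V\<^esub> = (\<lambda>_. 0)"
  "x \<oplus>\<^bsub>fun_space V\<^esub> y = (\<lambda>v. x v + y v)" "c \<odot>\<^bsub>fun_space V\<^esub> x = (\<lambda>v. c * x v)"
  "inner (fun_space V) x y = (\<Sum>v\<in>V. cnj (x v) * y v)"
  by (simp_all add: fun_space_def)

lemma vectorspace_fun_space: "vectorspace complex_ring (fun_space V)"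
proof (rule vs_criteria[OF complex_field], goal_cases)
  case 3
  show ?case
  proof
    fix v assume "v \<in> carrier (fun_space V)"
    then show "\<exists>w\<in>carrier (fun_space V). v \<oplus>\<^bsub>fun_space V\<^esub> w = \<zero>\<^bsub>fun_space V\<^esub>"
      by (intro bexI[of _ "\<lambda>u. - v u"]) auto
  qed
qed (auto simp: algebra_simps)

lemma finsum_fun_space:
  assumes "\<And>a. a \<in> A \<Longrightarrow> F a \<in> carrier (fun_space V)"
  shows "finsum (fun_space V) F A v = (\<Sum>a\<in>A. F a v)"
  using assms
proof (induction A rule: infinite_finite_induct)
  case (insert a A)
  interpret vectorspace complex_ring "fun_space V" by (rule vectorspace_fun_space)
  from insert have "finsum (fun_space V) F (insert a A) = F a \<oplus>\<^bsub>fun_space V\<^esub> finsum (fun_space V) F A"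
    by (intro finsum_insert) auto
  with insert show ?case by simp
next
  case (infinite A)
  interpret vectorspace complex_ring "fun_space V" by (rule vectorspace_fun_space)
  show ?case using infinite by (simp add: finsum_infinite)
next
  case empty
  interpret vectorspace complex_ring "fun_space V" by (rule vectorspace_fun_space)
  show ?case using finsum_empty by simp
qed

lemma ket_closed [simp]: "v \<in> V \<Longrightarrow> ket v \<in> carrier (fun_space V)"
  by (auto simp: ket_def)

lemma inner_ket_left:
  assumes "finite V" "v \<in> V" shows "inner (fun_space V) (ket v) x = x v"
proof -
  have "inner (fun_space V) (ket v) x = (\<Sum>w\<in>V. if w = v then x w else 0)"
    by (auto simp: ket_def intro!: sum.cong)
  also have "\<dots> = x v" using assms by simp
  finally show ?thesis .
qed

lemma ket_apply: "ket v w = of_bool (v = w)"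
  by (auto simp: ket_def)

lemma fun_space_expand:
  assumes "finite V" "x \<in> carrier (fun_space V)"
  shows "finsum (fun_space V) (\<lambda>v. x v \<odot>\<^bsub>fun_space V\<^esub> ket v) V = x"
proof
  fix w
  have "finsum (fun_space V) (\<lambda>v. x v \<odot>\<^bsub>fun_space V\<^esub> ket v) V w = (\<Sum>v\<in>V. if v = w then x v else 0)"
    by (subst finsum_fun_space) (auto simp: ket_def intro!: sum.cong)
  also have "\<dots> = x w" using assms by auto
  finally show "finsum (fun_space V) (\<lambda>v. x v \<odot>\<^bsub>fun_space V\<^esub> ket v) V w = x w" .
qed

lemma fd_hilbert_fun_space:
  assumes V: "finite V" shows "fd_hilbert (fun_space V)"
proof (rule fd_hilbertI[OF vectorspace_fun_space V, of ket])
  fix x assume x: "x \<in> carrier (fun_space V)"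
  show "\<exists>c. x = finsum (fun_space V) (\<lambda>i. c i \<odot>\<^bsub>fun_space V\<^esub> ket i) V"
    using fun_space_expand[OF V x] by (intro exI[of _ x]) simp
  assume "x \<noteq> \<zero>\<^bsub>fun_space V\<^esub>"
  then obtain v where v: "x v \<noteq> 0" by auto
  with x have vV: "v \<in> V" by auto
  have "Re (inner (fun_space V) x x) = (\<Sum>v\<in>V. (cmod (x v))\<^sup>2)"
    by (simp only: fun_space_simps Re_sum Re_cnj_mult_self)
  also have "\<dots> > 0" using v vV V by (intro sum_pos2[of _ v]) auto
  finally show "0 < Re (inner (fun_space V) x x)" .
qed (use V in \<open>auto simp: algebra_simps sum.distrib sum_distrib_left ket_def\<close>)

lemma onb_fun_space: "finite V \<Longrightarrow> onb (fun_space V) (ket ` V)"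
proof -
  assume V: "finite V"
  interpret fd_hilbert "fun_space V" using V by (rule fd_hilbert_fun_space)
  show ?thesis
  proof (rule onb_of_family[OF V])
    fix x assume x: "x \<in> carrier (fun_space V)"
    have "finsum (fun_space V) (\<lambda>v. inner (fun_space V) (ket v) x \<odot>\<^bsub>fun_space V\<^esub> ket v) V =
        finsum (fun_space V) (\<lambda>v. x v \<odot>\<^bsub>fun_space V\<^esub> ket v) V"
      by (rule finsum_cong') (auto simp: inner_ket_left[OF V] intro!: scale_closed ket_closed simp del: fun_space_simps)
    with fun_space_expand[OF V x]
    show "finsum (fun_space V) (\<lambda>v. inner (fun_space V) (ket v) x \<odot>\<^bsub>fun_space V\<^esub> ket v) V = x"
      by simp
  qed (simp_all only: ket_closed inner_ket_left[OF V] ket_apply, auto)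
qed

subsection \<open>Tensor products\<close>

lemma tensor_space_simps [simp]:
  "\<zero>\<^bsub>H \<otimes>\<^sub>H K\<^esub> = (\<lambda>_. 0)" "\<phi> \<oplus>\<^bsub>H \<otimes>\<^sub>H K\<^esub> \<psi> = (\<lambda>p. \<phi> p + \<psi> p)" "c \<odot>\<^bsub>H \<otimes>\<^sub>H K\<^esub> \<phi> = (\<lambda>p. c * \<phi> p)"
  by (simp_all add: tensor_space_def)

lemma inner_tensor_space:
  "inner (H \<otimes>\<^sub>H K) \<phi> \<psi> = (\<Sum>e\<in>bas H. \<Sum>f\<in>bas K. cnj (\<phi> (e, f)) * \<psi> (e, f))"
  by (simp add: tensor_space_def bas_def sum.cartesian_product)

lemma tensor_carrierI:
  assumes "\<And>a a' b. a \<in> carrier H \<Longrightarrow> a' \<in> carrier H \<Longrightarrow> b \<in> carrier K \<Longrightarrow>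
          \<phi> (a \<oplus>\<^bsub>H\<^esub> a', b) = \<phi> (a, b) + \<phi> (a', b)"
    "\<And>a b b'. a \<in> carrier H \<Longrightarrow> b \<in> carrier K \<Longrightarrow> b' \<in> carrier K \<Longrightarrow>
          \<phi> (a, b \<oplus>\<^bsub>K\<^esub> b') = \<phi> (a, b) + \<phi> (a, b')"
    "\<And>c a b. a \<in> carrier H \<Longrightarrow> b \<in> carrier K \<Longrightarrow> \<phi> (c \<odot>\<^bsub>H\<^esub> a, b) = cnj c * \<phi> (a, b)"
    "\<And>c a b. a \<in> carrier H \<Longrightarrow> b \<in> carrier K \<Longrightarrow> \<phi> (a, c \<odot>\<^bsub>K\<^esub> b) = cnj c * \<phi> (a, b)"
    "\<And>a b. a \<notin> carrier H \<or> b \<notin> carrier K \<Longrightarrow> \<phi> (a, b) = 0"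
  shows "\<phi> \<in> carrier (H \<otimes>\<^sub>H K)"
  using assms by (auto simp: tensor_space_def)

lemma tensor_add_left: "\<phi> \<in> carrier (H \<otimes>\<^sub>H K) \<Longrightarrow> a \<in> carrier H \<Longrightarrow> a' \<in> carrier H \<Longrightarrow> b \<in> carrier K \<Longrightarrow>
    \<phi> (a \<oplus>\<^bsub>H\<^esub> a', b) = \<phi> (a, b) + \<phi> (a', b)"
  and tensor_add_right: "\<phi> \<in> carrier (H \<otimes>\<^sub>H K) \<Longrightarrow> a \<in> carrier H \<Longrightarrow> b \<in> carrier K \<Longrightarrow> b' \<in> carrier K \<Longrightarrow>
    \<phi> (a, b \<oplus>\<^bsub>K\<^esub> b') = \<phi> (a, b) + \<phi> (a, b')"
  and tensor_smult_left: "\<phi> \<in> carrier (H \<otimes>\<^sub>H K) \<Longrightarrow> a \<in> carrier H \<Longrightarrow> b \<in> carrier K \<Longrightarrow>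
    \<phi> (c \<odot>\<^bsub>H\<^esub> a, b) = cnj c * \<phi> (a, b)"
  and tensor_smult_right: "\<phi> \<in> carrier (H \<otimes>\<^sub>H K) \<Longrightarrow> a \<in> carrier H \<Longrightarrow> b \<in> carrier K \<Longrightarrow>
    \<phi> (a, c \<odot>\<^bsub>K\<^esub> b) = cnj c * \<phi> (a, b)"
  and tensor_outside: "\<phi> \<in> carrier (H \<otimes>\<^sub>H K) \<Longrightarrow> a \<notin> carrier H \<or> b \<notin> carrier K \<Longrightarrow> \<phi> (a, b) = 0"
  by (auto simp: tensor_space_def)

lemmas tensor_form = tensor_add_left tensor_add_right tensor_smult_left tensor_smult_right tensor_outside

lemma vectorspace_tensor_space: "vectorspace complex_ring (H \<otimes>\<^sub>H K)"
proof (rule vs_criteria[OF complex_field], goal_cases)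
  case 3
  show ?case
  proof
    fix v assume v: "v \<in> carrier (H \<otimes>\<^sub>H K)"
    then show "\<exists>w\<in>carrier (H \<otimes>\<^sub>H K). v \<oplus>\<^bsub>H \<otimes>\<^sub>H K\<^esub> w = \<zero>\<^bsub>H \<otimes>\<^sub>H K\<^esub>"
      by (intro bexI[of _ "\<lambda>u. - v u"] tensor_carrierI) (auto simp: tensor_form[OF v])
  qed
qed (auto intro!: tensor_carrierI simp: tensor_form algebra_simps)

lemma finsum_tensor_space:
  assumes "\<And>a. a \<in> A \<Longrightarrow> F a \<in> carrier (H \<otimes>\<^sub>H K)"
  shows "finsum (H \<otimes>\<^sub>H K) F A p = (\<Sum>a\<in>A. F a p)"
proof -
  interpret vectorspace complex_ring "H \<otimes>\<^sub>H K" by (rule vectorspace_tensor_space)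
  show ?thesis using assms
  proof (induction A rule: infinite_finite_induct)
    case (insert a A)
    from insert have "finsum (H \<otimes>\<^sub>H K) F (insert a A) = F a \<oplus>\<^bsub>H \<otimes>\<^sub>H K\<^esub> finsum (H \<otimes>\<^sub>H K) F A"
      by (intro finsum_insert) auto
    with insert show ?case by simp
  qed simp_all
qed

lemma pure_apply: "a \<in> carrier H \<Longrightarrow> b \<in> carrier K \<Longrightarrow> pure H K h k (a, b) = inner H a h * inner K b k"
  by (simp add: pure_def)

context
  fixes H :: "'a hilb" and K :: "'b hilb"
  assumes H: "fd_hilbert H" and K: "fd_hilbert K"
begin

interpretation H: fd_hilbert H by (rule H)
interpretation K: fd_hilbert K by (rule K)

lemma pure_closed [simp, intro]:
  "h \<in> carrier H \<Longrightarrow> k \<in> carrier K \<Longrightarrow> pure H K h k \<in> carrier (H \<otimes>\<^sub>H K)"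
  by (rule tensor_carrierI)
    (auto simp: pure_def H.inner_add_left H.inner_smult_left K.inner_add_left K.inner_smult_left algebra_simps)

lemma pure_add_left: "h \<in> carrier H \<Longrightarrow> h' \<in> carrier H \<Longrightarrow>
    pure H K (h \<oplus>\<^bsub>H\<^esub> h') k = pure H K h k \<oplus>\<^bsub>H \<otimes>\<^sub>H K\<^esub> pure H K h' k"
  and pure_add_right: "k \<in> carrier K \<Longrightarrow> k' \<in> carrier K \<Longrightarrow>
    pure H K h (k \<oplus>\<^bsub>K\<^esub> k') = pure H K h k \<oplus>\<^bsub>H \<otimes>\<^sub>H K\<^esub> pure H K h k'"
  and pure_smult_left: "h \<in> carrier H \<Longrightarrow> pure H K (c \<odot>\<^bsub>H\<^esub> h) k = c \<odot>\<^bsub>H \<otimes>\<^sub>H K\<^esub> pure H K h k"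
  and pure_smult_right: "k \<in> carrier K \<Longrightarrow> pure H K h (c \<odot>\<^bsub>K\<^esub> k) = c \<odot>\<^bsub>H \<otimes>\<^sub>H K\<^esub> pure H K h k"
  by (auto simp: pure_def fun_eq_iff H.inner_add K.inner_add H.inner_smult K.inner_smult algebra_simps)

lemma pure_finsum_right:
  assumes "\<And>a. a \<in> A \<Longrightarrow> F a \<in> carrier K" "h \<in> carrier H"
  shows "pure H K h (finsum K F A) = finsum (H \<otimes>\<^sub>H K) (\<lambda>a. pure H K h (F a)) A"
proof
  fix p
  show "pure H K h (finsum K F A) p = finsum (H \<otimes>\<^sub>H K) (\<lambda>a. pure H K h (F a)) A p"
    using assms pure_closed by (cases p, subst finsum_tensor_space)
      (blast, auto simp: pure_def K.inner_finsum_right sum_distrib_left)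
qed

lemma tensor_form_zero:
  assumes \<phi>: "\<phi> \<in> carrier (H \<otimes>\<^sub>H K)" and h: "h \<in> carrier H" and k: "k \<in> carrier K"
  shows "\<phi> (\<zero>\<^bsub>H\<^esub>, k) = 0" "\<phi> (h, \<zero>\<^bsub>K\<^esub>) = 0"
  using tensor_smult_left[OF \<phi> h k, of 0] tensor_smult_right[OF \<phi> h k, of 0] h k by auto

lemma tensor_form_finsum_left:
  assumes \<phi>: "\<phi> \<in> carrier (H \<otimes>\<^sub>H K)" and k: "k \<in> carrier K"
    and F: "\<And>a. a \<in> A \<Longrightarrow> F a \<in> carrier H"
  shows "\<phi> (finsum H F A, k) = (\<Sum>a\<in>A. \<phi> (F a, k))"
  using F
proof (induction A rule: infinite_finite_induct)
  case (insert a A)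
  then have "finsum H F (insert a A) = F a \<oplus>\<^bsub>H\<^esub> finsum H F A"
    by (intro H.finsum_insert) auto
  with insert k show ?case by (simp add: tensor_add_left[OF \<phi>])
qed (use k tensor_form_zero[OF \<phi> _ k] in auto)

lemma tensor_eqI:
  assumes "\<phi> \<in> carrier (H \<otimes>\<^sub>H K)" "\<psi> \<in> carrier (H \<otimes>\<^sub>H K)"
    "\<And>h k. h \<in> carrier H \<Longrightarrow> k \<in> carrier K \<Longrightarrow> \<phi> (h, k) = \<psi> (h, k)"
  shows "\<phi> = \<psi>"
proof
  fix p :: "'a \<times> 'b"
  obtain h k where "p = (h, k)" by (cases p)
  then show "\<phi> p = \<psi> p"
    using assms(3)[of h k] tensor_outside[OF assms(1), of h k] tensor_outside[OF assms(2), of h k]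
    by (cases "h \<in> carrier H \<and> k \<in> carrier K") auto
qed

text \<open>The coefficients are conjugated because the forms are antilinear in both
  arguments.\<close>

lemma tensor_form_expand:
  assumes \<phi>: "\<phi> \<in> carrier (H \<otimes>\<^sub>H K)" and B: "onb H B" and C: "onb K C"
    and h: "h \<in> carrier H" and k: "k \<in> carrier K"
  shows "\<phi> (h, k) = (\<Sum>e\<in>B. \<Sum>f\<in>C. cnj (inner H e h) * cnj (inner K f k) * \<phi> (e, f))"
proof -
  note [simp] = H.onb_carrier[OF B] K.onb_carrier[OF C]
  note l = tensor_form_finsum_left[OF \<phi> k]
  have r: "\<phi> (e, finsum K F A) = (\<Sum>a\<in>A. \<phi> (e, F a))"
    if "e \<in> carrier H" "\<And>a. a \<in> A \<Longrightarrow> F a \<in> carrier K" for e and F :: "'b \<Rightarrow> 'b" and A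
    using that(2)
  proof (induction A rule: infinite_finite_induct)
    case (insert a A)
    then have "finsum K F (insert a A) = F a \<oplus>\<^bsub>K\<^esub> finsum K F A"
      by (intro K.finsum_insert) auto
    with insert that show ?case by (simp add: tensor_add_right[OF \<phi>])
  qed (use that k tensor_form_zero[OF \<phi>] in auto)
  have "\<phi> (h, k) = \<phi> (finsum H (\<lambda>e. inner H e h \<odot>\<^bsub>H\<^esub> e) B, k)"
    using h by (simp add: H.onb_expand[OF B])
  also have "\<dots> = (\<Sum>e\<in>B. cnj (inner H e h) * \<phi> (e, k))"
    using h k by (subst l) (auto simp: tensor_smult_left[OF \<phi>])
  also have "\<dots> = (\<Sum>e\<in>B. cnj (inner H e h) * \<phi> (e, finsum K (\<lambda>f. inner K f k \<odot>\<^bsub>K\<^esub> f) C))"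
    using k by (simp add: K.onb_expand[OF C])
  also have "\<dots> = (\<Sum>e\<in>B. cnj (inner H e h) * (\<Sum>f\<in>C. cnj (inner K f k) * \<phi> (e, f)))"
    using h k by (intro sum.cong refl, subst r) (auto simp: tensor_smult_right[OF \<phi>])
  finally show ?thesis by (simp add: sum_distrib_left mult.assoc)
qed

text \<open>Shows that pure tensors span: the coefficient at \<open>e \<otimes> f\<close> is the
  value of the form at \<open>(e, f)\<close>.\<close>

lemma tensor_expand:
  assumes \<phi>: "\<phi> \<in> carrier (H \<otimes>\<^sub>H K)" and B: "onb H B" and C: "onb K C"
  shows "finsum (H \<otimes>\<^sub>H K) (\<lambda>(e, f). \<phi> (e, f) \<odot>\<^bsub>H \<otimes>\<^sub>H K\<^esub> pure H K e f) (B \<times> C) = \<phi>"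
proof
  fix p :: "'a \<times> 'b"
  interpret vectorspace complex_ring "H \<otimes>\<^sub>H K" by (rule vectorspace_tensor_space)
  obtain h k where p: "p = (h, k)" by (cases p)
  note [simp] = H.onb_carrier[OF B] K.onb_carrier[OF C]
  have *: "finsum (H \<otimes>\<^sub>H K) (\<lambda>(e, f). \<phi> (e, f) \<odot>\<^bsub>H \<otimes>\<^sub>H K\<^esub> pure H K e f) (B \<times> C) p =
      (\<Sum>e\<in>B. \<Sum>f\<in>C. \<phi> (e, f) * pure H K e f (h, k))"
    unfolding sum.cartesian_product p
    by (subst finsum_tensor_space) (auto intro!: smult_closed sum.cong simp del: tensor_space_simps(3), simp)
  show "finsum (H \<otimes>\<^sub>H K) (\<lambda>(e, f). \<phi> (e, f) \<odot>\<^bsub>H \<otimes>\<^sub>H K\<^esub> pure H K e f) (B \<times> C) p = \<phi> p"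
  proof (cases "h \<in> carrier H \<and> k \<in> carrier K")
    case True
    have "(\<Sum>e\<in>B. \<Sum>f\<in>C. \<phi> (e, f) * pure H K e f (h, k)) =
        (\<Sum>e\<in>B. \<Sum>f\<in>C. cnj (inner H e h) * cnj (inner K f k) * \<phi> (e, f))"
    proof (intro sum.cong refl)
      fix e f assume "e \<in> B" "f \<in> C"
      then have "inner H h e = cnj (inner H e h)" "inner K k f = cnj (inner K f k)"
        using True by (auto intro: H.inner_cnj K.inner_cnj)
      then show "\<phi> (e, f) * pure H K e f (h, k) = cnj (inner H e h) * cnj (inner K f k) * \<phi> (e, f)"
        using True by (simp add: pure_apply)
    qed
    with * True tensor_form_expand[OF \<phi> B C, of h k] show ?thesis by (simp only: p)
  next
    case False
    then show ?thesis unfolding * by (auto simp: p tensor_outside[OF \<phi>] pure_def)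
  qed
qed

text \<open>The reproducing property: evaluation at \<open>(h, k)\<close> is the inner product with
  \<open>h \<otimes> k\<close>. It translates between forms and vectors in everything that
  follows.\<close>

lemma inner_pure_left:
  assumes \<phi>: "\<phi> \<in> carrier (H \<otimes>\<^sub>H K)" and h: "h \<in> carrier H" and k: "k \<in> carrier K"
  shows "inner (H \<otimes>\<^sub>H K) (pure H K h k) \<phi> = \<phi> (h, k)"
  unfolding inner_tensor_space tensor_form_expand[OF \<phi> H.onb_bas K.onb_bas h k]
  using h k H.onb_carrier[OF H.onb_bas] K.onb_carrier[OF K.onb_bas]
  by (intro sum.cong refl) (auto simp: pure_apply)

lemma fd_hilbert_tensor_space [simp, intro]: "fd_hilbert (H \<otimes>\<^sub>H K)"
proof (rule fd_hilbertI[OF vectorspace_tensor_space, of "bas H \<times> bas K" "\<lambda>(e, f). pure H K e f"])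
  note [simp] = H.onb_carrier[OF H.onb_bas] K.onb_carrier[OF K.onb_bas]
  note [simp] = H.onb_finite[OF H.onb_bas] K.onb_finite[OF K.onb_bas]
  fix x assume x: "x \<in> carrier (H \<otimes>\<^sub>H K)"
  show "\<exists>c. x = finsum (H \<otimes>\<^sub>H K) (\<lambda>i. c i \<odot>\<^bsub>H \<otimes>\<^sub>H K\<^esub> (case i of (e, f) \<Rightarrow> pure H K e f)) (bas H \<times> bas K)"
    using tensor_expand[OF x H.onb_bas K.onb_bas]
    by (intro exI[of _ x]) (simp add: case_prod_unfold)
  assume "x \<noteq> \<zero>\<^bsub>H \<otimes>\<^sub>H K\<^esub>"
  then obtain h k where "x (h, k) \<noteq> 0" by (auto simp: fun_eq_iff)
  moreover from this have "h \<in> carrier H" "k \<in> carrier K" using tensor_outside[OF x] by auto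
  \<comment> \<open>A form that vanished on all pairs of basis vectors would vanish everywhere;
    hence a nonzero form has a nonzero summand in its squared norm.\<close>
  ultimately have "(\<Sum>e\<in>bas H. \<Sum>f\<in>bas K. cnj (inner H e h) * cnj (inner K f k) * x (e, f)) \<noteq> 0"
    using tensor_form_expand[OF x H.onb_bas K.onb_bas, of h k] by simp
  then obtain e f where ef: "e \<in> bas H" "f \<in> bas K" "x (e, f) \<noteq> 0"
    by (metis (no_types, lifting) mult_eq_0_iff sum.neutral)
  have "Re (inner (H \<otimes>\<^sub>H K) x x) = (\<Sum>(e, f)\<in>bas H \<times> bas K. (cmod (x (e, f)))\<^sup>2)"
    unfolding inner_tensor_space Re_sum Re_cnj_mult_self by (simp only: sum.cartesian_product)
  also have "\<dots> > 0" using ef by (intro sum_pos2[of _ "(e, f)"]) auto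
  finally show "0 < Re (inner (H \<otimes>\<^sub>H K) x x)" .
qed (use H.onb_finite[OF H.onb_bas] K.onb_finite[OF K.onb_bas] H.onb_carrier[OF H.onb_bas]
      K.onb_carrier[OF K.onb_bas] in
    \<open>auto simp: inner_tensor_space algebra_simps sum.distrib sum_distrib_left\<close>)

lemma inner_pure_pure:
  "h \<in> carrier H \<Longrightarrow> k \<in> carrier K \<Longrightarrow> h' \<in> carrier H \<Longrightarrow> k' \<in> carrier K \<Longrightarrow>
    inner (H \<otimes>\<^sub>H K) (pure H K h k) (pure H K h' k') = inner H h h' * inner K k k'"
  by (simp add: inner_pure_left pure_apply)

lemma onb_tensor:
  assumes B: "onb H B" and C: "onb K C"
  shows "onb (H \<otimes>\<^sub>H K) ((\<lambda>(e, f). pure H K e f) ` (B \<times> C))"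
proof -
  interpret T: fd_hilbert "H \<otimes>\<^sub>H K" by (rule fd_hilbert_tensor_space)
  note [simp] = H.onb_carrier[OF B] K.onb_carrier[OF C]
  show ?thesis
  proof (rule T.onb_of_family)
    fix x assume x: "x \<in> carrier (H \<otimes>\<^sub>H K)"
    have "finsum (H \<otimes>\<^sub>H K) (\<lambda>i. inner (H \<otimes>\<^sub>H K) (case i of (e, f) \<Rightarrow> pure H K e f) x \<odot>\<^bsub>H \<otimes>\<^sub>H K\<^esub>
        (case i of (e, f) \<Rightarrow> pure H K e f)) (B \<times> C) =
      finsum (H \<otimes>\<^sub>H K) (\<lambda>(e, f). x (e, f) \<odot>\<^bsub>H \<otimes>\<^sub>H K\<^esub> pure H K e f) (B \<times> C)"
      by (rule T.finsum_cong') (auto simp: inner_pure_left[OF x] simp del: tensor_space_simps)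
    also have "\<dots> = x" by (rule tensor_expand[OF x B C])
    finally show "finsum (H \<otimes>\<^sub>H K) (\<lambda>i. inner (H \<otimes>\<^sub>H K) (case i of (e, f) \<Rightarrow> pure H K e f) x \<odot>\<^bsub>H \<otimes>\<^sub>H K\<^esub>
        (case i of (e, f) \<Rightarrow> pure H K e f)) (B \<times> C) = x" .
  qed (use H.onb_finite[OF B] K.onb_finite[OF C] in
    \<open>auto simp: inner_pure_pure H.onb_inner[OF B] K.onb_inner[OF C]\<close>)
qed

text \<open>The uniqueness half of each \<open>THE\<close> that is specified on pure
  tensors.\<close>

lemma lin_eq_pureI:
  assumes L: "fd_hilbert L" and f: "f \<in> lin (H \<otimes>\<^sub>H K) L" and g: "g \<in> lin (H \<otimes>\<^sub>H K) L"
    and eq: "\<And>h k. h \<in> carrier H \<Longrightarrow> k \<in> carrier K \<Longrightarrow> app f (pure H K h k) = app g (pure H K h k)"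
  shows "f = g"
proof (rule lin_eq_onbI[OF fd_hilbert_tensor_space L f g onb_tensor[OF H.onb_bas K.onb_bas]])
  fix b assume "b \<in> (\<lambda>(e, f). pure H K e f) ` (bas H \<times> bas K)"
  then obtain e e' where "e \<in> bas H" "e' \<in> bas K" "b = pure H K e e'" by auto
  then show "app f b = app g b"
    using eq H.onb_carrier[OF H.onb_bas] K.onb_carrier[OF K.onb_bas] by simp
qed

end

section \<open>The associator and its inverse\<close>

context
  fixes H :: "'a hilb" and K :: "'b hilb" and L :: "'c hilb"
  assumes H: "fd_hilbert H" and K: "fd_hilbert K" and L: "fd_hilbert L"
begin

interpretation H: fd_hilbert H by (rule H)
interpretation K: fd_hilbert K by (rule K)
interpretation L: fd_hilbert L by (rule L)
interpretation HK: fd_hilbert "H \<otimes>\<^sub>H K" by (rule fd_hilbert_tensor_space[OF H K])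
interpretation KL: fd_hilbert "K \<otimes>\<^sub>H L" by (rule fd_hilbert_tensor_space[OF K L])

lemma lin_eq_pure_leftI:
  assumes M: "fd_hilbert M" and f: "f \<in> lin ((H \<otimes>\<^sub>H K) \<otimes>\<^sub>H L) M" and g: "g \<in> lin ((H \<otimes>\<^sub>H K) \<otimes>\<^sub>H L) M"
    and eq: "\<And>h k l. h \<in> carrier H \<Longrightarrow> k \<in> carrier K \<Longrightarrow> l \<in> carrier L \<Longrightarrow>
      app f (pure (H \<otimes>\<^sub>H K) L (pure H K h k) l) = app g (pure (H \<otimes>\<^sub>H K) L (pure H K h k) l)"
  shows "f = g"
proof (rule lin_eq_onbI[OF _ M f g onb_tensor[OF HK.fd_hilbert_axioms L onb_tensor[OF H K H.onb_bas K.onb_bas] L.onb_bas]])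
  show "fd_hilbert ((H \<otimes>\<^sub>H K) \<otimes>\<^sub>H L)" by (rule fd_hilbert_tensor_space[OF HK.fd_hilbert_axioms L])
  fix b assume "b \<in> (\<lambda>(e, f). pure (H \<otimes>\<^sub>H K) L e f) ` ((\<lambda>(e, f). pure H K e f) ` (bas H \<times> bas K) \<times> bas L)"
  then obtain e e' e'' where "e \<in> bas H" "e' \<in> bas K" "e'' \<in> bas L" "b = pure (H \<otimes>\<^sub>H K) L (pure H K e e') e''"
    by auto
  then show "app f b = app g b"
    using eq H.onb_carrier[OF H.onb_bas] K.onb_carrier[OF K.onb_bas] L.onb_carrier[OF L.onb_bas] by simp
qed

lemma lin_eq_pure_rightI:
  assumes M: "fd_hilbert M" and f: "f \<in> lin (H \<otimes>\<^sub>H (K \<otimes>\<^sub>H L)) M" and g: "g \<in> lin (H \<otimes>\<^sub>H (K \<otimes>\<^sub>H L)) M"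
    and eq: "\<And>h k l. h \<in> carrier H \<Longrightarrow> k \<in> carrier K \<Longrightarrow> l \<in> carrier L \<Longrightarrow>
      app f (pure H (K \<otimes>\<^sub>H L) h (pure K L k l)) = app g (pure H (K \<otimes>\<^sub>H L) h (pure K L k l))"
  shows "f = g"
proof (rule lin_eq_onbI[OF _ M f g onb_tensor[OF H KL.fd_hilbert_axioms H.onb_bas onb_tensor[OF K L K.onb_bas L.onb_bas]]])
  show "fd_hilbert (H \<otimes>\<^sub>H (K \<otimes>\<^sub>H L))" by (rule fd_hilbert_tensor_space[OF H KL.fd_hilbert_axioms])
  fix b assume "b \<in> (\<lambda>(e, f). pure H (K \<otimes>\<^sub>H L) e f) ` (bas H \<times> (\<lambda>(e, f). pure K L e f) ` (bas K \<times> bas L))"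
  then obtain e e' e'' where "e \<in> bas H" "e' \<in> bas K" "e'' \<in> bas L" "b = pure H (K \<otimes>\<^sub>H L) e (pure K L e' e'')"
    by auto
  then show "app f b = app g b"
    using eq H.onb_carrier[OF H.onb_bas] K.onb_carrier[OF K.onb_bas] L.onb_carrier[OF L.onb_bas] by simp
qed

text \<open>Since \<open>\<langle>h \<otimes> \<psi>, T \<phi>\<rangle>\<close> is the value of \<open>T \<phi>\<close> at \<open>(h, \<psi>)\<close>, the associator is forced to be
  \<open>\<phi> \<mapsto> (h, \<psi>) \<mapsto> \<Sum>\<^sub>e \<Sum>\<^sub>f cnj (\<psi> (e, f)) \<phi> (h \<otimes> e, f)\<close>.\<close>

lemma assoc_exists:
  "\<exists>T. T \<in> lin ((H \<otimes>\<^sub>H K) \<otimes>\<^sub>H L) (H \<otimes>\<^sub>H (K \<otimes>\<^sub>H L)) \<and>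
    (\<forall>h \<in> carrier H. \<forall>k \<in> carrier K. \<forall>l \<in> carrier L.
      app T (pure (H \<otimes>\<^sub>H K) L (pure H K h k) l) = pure H (K \<otimes>\<^sub>H L) h (pure K L k l))"
proof -
  let ?T = "\<lparr>src = (H \<otimes>\<^sub>H K) \<otimes>\<^sub>H L, tgt = H \<otimes>\<^sub>H (K \<otimes>\<^sub>H L),
    app = (\<lambda>\<phi>. if \<phi> \<in> carrier ((H \<otimes>\<^sub>H K) \<otimes>\<^sub>H L) then (\<lambda>(h, \<psi>).
      if h \<in> carrier H \<and> \<psi> \<in> carrier (K \<otimes>\<^sub>H L)
      then \<Sum>e\<in>bas K. \<Sum>f\<in>bas L. cnj (\<psi> (e, f)) * \<phi> (pure H K h e, f) else 0) else (\<lambda>_. 0))\<rparr>"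
  note bc = K.onb_carrier[OF K.onb_bas] L.onb_carrier[OF L.onb_bas]
  note [simp] = bc
  show ?thesis
  proof (intro exI[of _ ?T] conjI ballI)
    show "?T \<in> lin ((H \<otimes>\<^sub>H K) \<otimes>\<^sub>H L) (H \<otimes>\<^sub>H (K \<otimes>\<^sub>H L))"
    proof (rule linI)
      fix \<phi> assume \<phi>: "\<phi> \<in> carrier ((H \<otimes>\<^sub>H K) \<otimes>\<^sub>H L)"
      note p = pure_add_left[OF H K] pure_smult_left[OF H K] pure_closed[OF H K]
      show "app ?T \<phi> \<in> carrier (H \<otimes>\<^sub>H (K \<otimes>\<^sub>H L))"
      proof (rule tensor_carrierI)
        fix h h' \<psi> assume h: "h \<in> carrier H" "h' \<in> carrier H" and \<psi>: "\<psi> \<in> carrier (K \<otimes>\<^sub>H L)"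
        have "\<phi> (pure H K (h \<oplus>\<^bsub>H\<^esub> h') e, f) = \<phi> (pure H K h e, f) + \<phi> (pure H K h' e, f)"
          if "e \<in> bas K" "f \<in> bas L" for e f
          unfolding p(1)[OF h] using h that by (intro tensor_add_left[OF \<phi>] p(3) bc)
        then show "app ?T \<phi> (h \<oplus>\<^bsub>H\<^esub> h', \<psi>) = app ?T \<phi> (h, \<psi>) + app ?T \<phi> (h', \<psi>)"
          using h \<psi> \<phi> by (simp add: ring_distribs sum.distrib cong: sum.cong)
      next
        fix h \<psi> c assume h: "h \<in> carrier H" and \<psi>: "\<psi> \<in> carrier (K \<otimes>\<^sub>H L)"
        have "\<phi> (pure H K (c \<odot>\<^bsub>H\<^esub> h) e, f) = cnj c * \<phi> (pure H K h e, f)"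
          if "e \<in> bas K" "f \<in> bas L" for e f
          unfolding p(2)[OF h] using h that by (intro tensor_smult_left[OF \<phi>] p(3) bc)
        then show "app ?T \<phi> (c \<odot>\<^bsub>H\<^esub> h, \<psi>) = cnj c * app ?T \<phi> (h, \<psi>)"
          using h \<psi> \<phi> by (simp add: sum_distrib_left mult.left_commute cong: sum.cong)
        have "c \<odot>\<^bsub>K \<otimes>\<^sub>H L\<^esub> \<psi> \<in> carrier (K \<otimes>\<^sub>H L)" using \<psi> by (rule KL.scale_closed)
        then show "app ?T \<phi> (h, c \<odot>\<^bsub>K \<otimes>\<^sub>H L\<^esub> \<psi>) = cnj c * app ?T \<phi> (h, \<psi>)"
          using h \<psi> \<phi> by (simp add: sum_distrib_left mult.assoc)
      next
        fix h \<psi> \<psi>' assume h: "h \<in> carrier H" and \<psi>: "\<psi> \<in> carrier (K \<otimes>\<^sub>H L)" "\<psi>' \<in> carrier (K \<otimes>\<^sub>H L)"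
        have "\<psi> \<oplus>\<^bsub>K \<otimes>\<^sub>H L\<^esub> \<psi>' \<in> carrier (K \<otimes>\<^sub>H L)" using \<psi> by (rule KL.add_closed)
        then show "app ?T \<phi> (h, \<psi> \<oplus>\<^bsub>K \<otimes>\<^sub>H L\<^esub> \<psi>') = app ?T \<phi> (h, \<psi>) + app ?T \<phi> (h, \<psi>')"
          using h \<psi> \<phi> by (simp add: ring_distribs sum.distrib)
      qed auto
      fix c
      have "c \<odot>\<^bsub>(H \<otimes>\<^sub>H K) \<otimes>\<^sub>H L\<^esub> \<phi> \<in> carrier ((H \<otimes>\<^sub>H K) \<otimes>\<^sub>H L)"
        using \<phi> by (rule fd_hilbert.scale_closed[OF fd_hilbert_tensor_space[OF HK.fd_hilbert_axioms L]])
      then show "app ?T (c \<odot>\<^bsub>(H \<otimes>\<^sub>H K) \<otimes>\<^sub>H L\<^esub> \<phi>) = c \<odot>\<^bsub>H \<otimes>\<^sub>H K \<otimes>\<^sub>H L\<^esub> app ?T \<phi>"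
        using \<phi> by (auto simp: fun_eq_iff sum_distrib_left mult.left_commute)
    next
      fix \<phi> \<phi>' assume \<phi>: "\<phi> \<in> carrier ((H \<otimes>\<^sub>H K) \<otimes>\<^sub>H L)" "\<phi>' \<in> carrier ((H \<otimes>\<^sub>H K) \<otimes>\<^sub>H L)"
      have "\<phi> \<oplus>\<^bsub>(H \<otimes>\<^sub>H K) \<otimes>\<^sub>H L\<^esub> \<phi>' \<in> carrier ((H \<otimes>\<^sub>H K) \<otimes>\<^sub>H L)"
        using \<phi> by (rule fd_hilbert.add_closed[OF fd_hilbert_tensor_space[OF HK.fd_hilbert_axioms L]])
      then show "app ?T (\<phi> \<oplus>\<^bsub>(H \<otimes>\<^sub>H K) \<otimes>\<^sub>H L\<^esub> \<phi>') = app ?T \<phi> \<oplus>\<^bsub>H \<otimes>\<^sub>H K \<otimes>\<^sub>H L\<^esub> app ?T \<phi>'"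
        using \<phi> by (auto simp: fun_eq_iff ring_distribs sum.distrib)
    qed auto
    fix h k l assume h: "h \<in> carrier H" and k: "k \<in> carrier K" and l: "l \<in> carrier L"
    have p: "pure (H \<otimes>\<^sub>H K) L (pure H K h k) l \<in> carrier ((H \<otimes>\<^sub>H K) \<otimes>\<^sub>H L)"
      using h k l by (intro pure_closed HK.fd_hilbert_axioms L H K)
    show "app ?T (pure (H \<otimes>\<^sub>H K) L (pure H K h k) l) = pure H (K \<otimes>\<^sub>H L) h (pure K L k l)"
    proof
      fix q :: "'a \<times> ('b \<times> 'c \<Rightarrow> complex)"
      obtain h' \<psi> where q: "q = (h', \<psi>)" by (cases q)
      show "app ?T (pure (H \<otimes>\<^sub>H K) L (pure H K h k) l) q = pure H (K \<otimes>\<^sub>H L) h (pure K L k l) q"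
      proof (cases "h' \<in> carrier H \<and> \<psi> \<in> carrier (K \<otimes>\<^sub>H L)")
        case True
        have "app ?T (pure (H \<otimes>\<^sub>H K) L (pure H K h k) l) q =
            (\<Sum>e\<in>bas K. \<Sum>f\<in>bas L. cnj (\<psi> (e, f)) * (inner H h' h * (inner K e k * inner L f l)))"
          using True p h k l
          by (auto simp: q pure_apply inner_pure_pure[OF H K] pure_closed[OF H K] intro!: sum.cong)
        also have "\<dots> = inner H h' h * inner (K \<otimes>\<^sub>H L) \<psi> (pure K L k l)"
          unfolding inner_tensor_space using k l
          by (simp add: pure_apply sum_distrib_left mult.left_commute)
        finally show ?thesis using True h k l by (simp add: q pure_apply)
      qed (use p in \<open>auto simp: q pure_def\<close>)
    qed
  qed
qed

lemma assoc_spec: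
  "assoc H K L \<in> lin ((H \<otimes>\<^sub>H K) \<otimes>\<^sub>H L) (H \<otimes>\<^sub>H (K \<otimes>\<^sub>H L)) \<and>
    (\<forall>h \<in> carrier H. \<forall>k \<in> carrier K. \<forall>l \<in> carrier L.
      app (assoc H K L) (pure (H \<otimes>\<^sub>H K) L (pure H K h k) l) = pure H (K \<otimes>\<^sub>H L) h (pure K L k l))"
  unfolding assoc_def
proof (rule theI'[OF ex_ex1I[OF assoc_exists]], elim conjE)
  fix T T'
  assume "T \<in> lin ((H \<otimes>\<^sub>H K) \<otimes>\<^sub>H L) (H \<otimes>\<^sub>H (K \<otimes>\<^sub>H L))"
    "T' \<in> lin ((H \<otimes>\<^sub>H K) \<otimes>\<^sub>H L) (H \<otimes>\<^sub>H (K \<otimes>\<^sub>H L))"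
    "\<forall>h \<in> carrier H. \<forall>k \<in> carrier K. \<forall>l \<in> carrier L.
      app T (pure (H \<otimes>\<^sub>H K) L (pure H K h k) l) = pure H (K \<otimes>\<^sub>H L) h (pure K L k l)"
    "\<forall>h \<in> carrier H. \<forall>k \<in> carrier K. \<forall>l \<in> carrier L.
      app T' (pure (H \<otimes>\<^sub>H K) L (pure H K h k) l) = pure H (K \<otimes>\<^sub>H L) h (pure K L k l)"
  then show "T = T'"
    by (intro lin_eq_pure_leftI[OF fd_hilbert_tensor_space[OF H KL.fd_hilbert_axioms]]) simp_all
qed

lemmas assoc_lin = assoc_spec[THEN conjunct1]

lemma app_assoc [simp]:
  "h \<in> carrier H \<Longrightarrow> k \<in> carrier K \<Longrightarrow> l \<in> carrier L \<Longrightarrow>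
    app (assoc H K L) (pure (H \<otimes>\<^sub>H K) L (pure H K h k) l) = pure H (K \<otimes>\<^sub>H L) h (pure K L k l)"
  using assoc_spec by blast

text \<open>The associator preserves inner products of pure tensors, so its adjoint undoes it on
  pure tensors.\<close>

lemma app_adj_assoc:
  assumes h: "h \<in> carrier H" and k: "k \<in> carrier K" and l: "l \<in> carrier L"
  shows "app (adj (assoc H K L)) (pure H (K \<otimes>\<^sub>H L) h (pure K L k l)) = pure (H \<otimes>\<^sub>H K) L (pure H K h k) l"
proof -
  interpret HK_L: fd_hilbert "(H \<otimes>\<^sub>H K) \<otimes>\<^sub>H L" by (rule fd_hilbert_tensor_space[OF HK.fd_hilbert_axioms L])
  interpret H_KL: fd_hilbert "H \<otimes>\<^sub>H (K \<otimes>\<^sub>H L)" by (rule fd_hilbert_tensor_space[OF H KL.fd_hilbert_axioms])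
  note a = assoc_lin
  note p = pure_closed[OF H KL.fd_hilbert_axioms] pure_closed[OF K L] pure_closed[OF H K]
    pure_closed[OF HK.fd_hilbert_axioms L]
  show ?thesis
  proof (rule HK_L.eq_of_inner_onb[OF onb_tensor[OF HK.fd_hilbert_axioms L onb_tensor[OF H K H.onb_bas K.onb_bas] L.onb_bas]])
    show "app (adj (assoc H K L)) (pure H (K \<otimes>\<^sub>H L) h (pure K L k l)) \<in> carrier ((H \<otimes>\<^sub>H K) \<otimes>\<^sub>H L)"
      using h k l by (intro lin_closed[OF adj_lin[OF HK_L.fd_hilbert_axioms H_KL.fd_hilbert_axioms a]] p)
    show "pure (H \<otimes>\<^sub>H K) L (pure H K h k) l \<in> carrier ((H \<otimes>\<^sub>H K) \<otimes>\<^sub>H L)"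
      using h k l by (intro p)
    fix b assume "b \<in> (\<lambda>(e, f). pure (H \<otimes>\<^sub>H K) L e f) ` ((\<lambda>(e, f). pure H K e f) ` (bas H \<times> bas K) \<times> bas L)"
    then obtain e e' e'' where "e \<in> bas H" "e' \<in> bas K" "e'' \<in> bas L" "b = pure (H \<otimes>\<^sub>H K) L (pure H K e e') e''"
      by auto
    then show "inner ((H \<otimes>\<^sub>H K) \<otimes>\<^sub>H L) b (app (adj (assoc H K L)) (pure H (K \<otimes>\<^sub>H L) h (pure K L k l))) =
        inner ((H \<otimes>\<^sub>H K) \<otimes>\<^sub>H L) b (pure (H \<otimes>\<^sub>H K) L (pure H K h k) l)"
      using h k l H.onb_carrier[OF H.onb_bas] K.onb_carrier[OF K.onb_bas] L.onb_carrier[OF L.onb_bas]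
      by (simp add: inner_adj_right[OF HK_L.fd_hilbert_axioms H_KL.fd_hilbert_axioms a] p
          inner_pure_pure[OF H K] inner_pure_pure[OF K L] inner_pure_pure[OF HK.fd_hilbert_axioms L]
          inner_pure_pure[OF H KL.fd_hilbert_axioms])
  qed
qed

text \<open>Evaluating at a pure tensor is an inner product, and the adjoint moves the rebracketing
  to the pure tensor. Thus the associator is understood on arbitrary forms, not only on pure
  tensors.\<close>

lemma assoc_apply:
  assumes \<phi>: "\<phi> \<in> carrier ((H \<otimes>\<^sub>H K) \<otimes>\<^sub>H L)" and h: "h \<in> carrier H" and k: "k \<in> carrier K" and l: "l \<in> carrier L"
  shows "app (assoc H K L) \<phi> (h, pure K L k l) = \<phi> (pure H K h k, l)"
proof -
  have fd: "fd_hilbert ((H \<otimes>\<^sub>H K) \<otimes>\<^sub>H L)" "fd_hilbert (H \<otimes>\<^sub>H (K \<otimes>\<^sub>H L))"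
    by (intro fd_hilbert_tensor_space H K L)+
  have "app (assoc H K L) \<phi> (h, pure K L k l) =
      inner (H \<otimes>\<^sub>H (K \<otimes>\<^sub>H L)) (pure H (K \<otimes>\<^sub>H L) h (pure K L k l)) (app (assoc H K L) \<phi>)"
    using h k l by (intro inner_pure_left[symmetric] H KL.fd_hilbert_axioms pure_closed K L lin_closed[OF assoc_lin \<phi>])
  also have "\<dots> = inner ((H \<otimes>\<^sub>H K) \<otimes>\<^sub>H L) (app (adj (assoc H K L)) (pure H (K \<otimes>\<^sub>H L) h (pure K L k l))) \<phi>"
    using h k l by (intro inner_adj_left[symmetric] fd assoc_lin \<phi> pure_closed H KL.fd_hilbert_axioms K L)
  also have "\<dots> = \<phi> (pure H K h k, l)"
    unfolding app_adj_assoc[OF h k l]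
    using h k l by (intro inner_pure_left HK.fd_hilbert_axioms L \<phi> pure_closed H K)
  finally show ?thesis .
qed

text \<open>Unitarity of the associator: existence of the inverse comes from the adjoint, without a
  second explicit formula.\<close>

lemma assoc_inv_eq_adj: "assoc_inv H K L = adj (assoc H K L)"
  unfolding assoc_inv_def
proof (rule the_equality, intro conjI ballI)
  have *: "adj (assoc H K L) \<in> lin (H \<otimes>\<^sub>H (K \<otimes>\<^sub>H L)) ((H \<otimes>\<^sub>H K) \<otimes>\<^sub>H L)"
    by (intro adj_lin assoc_lin fd_hilbert_tensor_space HK.fd_hilbert_axioms KL.fd_hilbert_axioms H L)
  then show "adj (assoc H K L) \<in> lin (H \<otimes>\<^sub>H (K \<otimes>\<^sub>H L)) ((H \<otimes>\<^sub>H K) \<otimes>\<^sub>H L)" .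
  fix T assume "T \<in> lin (H \<otimes>\<^sub>H (K \<otimes>\<^sub>H L)) ((H \<otimes>\<^sub>H K) \<otimes>\<^sub>H L) \<and> (\<forall>h\<in>carrier H. \<forall>k\<in>carrier K. \<forall>l\<in>carrier L.
      app T (pure H (K \<otimes>\<^sub>H L) h (pure K L k l)) = pure (H \<otimes>\<^sub>H K) L (pure H K h k) l)"
  then show "T = adj (assoc H K L)"
    using * app_adj_assoc
    by (intro lin_eq_pure_rightI[OF fd_hilbert_tensor_space[OF HK.fd_hilbert_axioms L]]) simp_all
qed (rule app_adj_assoc)

lemma assoc_inv_lin: "assoc_inv H K L \<in> lin (H \<otimes>\<^sub>H (K \<otimes>\<^sub>H L)) ((H \<otimes>\<^sub>H K) \<otimes>\<^sub>H L)"
  unfolding assoc_inv_eq_adj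
  by (intro adj_lin assoc_lin fd_hilbert_tensor_space HK.fd_hilbert_axioms KL.fd_hilbert_axioms H L)

lemma app_assoc_inv [simp]:
  "h \<in> carrier H \<Longrightarrow> k \<in> carrier K \<Longrightarrow> l \<in> carrier L \<Longrightarrow>
    app (assoc_inv H K L) (pure H (K \<otimes>\<^sub>H L) h (pure K L k l)) = pure (H \<otimes>\<^sub>H K) L (pure H K h k) l"
  unfolding assoc_inv_eq_adj by (rule app_adj_assoc)

lemma assoc_inv_apply:
  assumes \<phi>: "\<phi> \<in> carrier (H \<otimes>\<^sub>H (K \<otimes>\<^sub>H L))" and h: "h \<in> carrier H" and k: "k \<in> carrier K" and l: "l \<in> carrier L"
  shows "app (assoc_inv H K L) \<phi> (pure H K h k, l) = \<phi> (h, pure K L k l)"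
proof -
  have fd: "fd_hilbert ((H \<otimes>\<^sub>H K) \<otimes>\<^sub>H L)" "fd_hilbert (H \<otimes>\<^sub>H (K \<otimes>\<^sub>H L))"
    by (intro fd_hilbert_tensor_space H K L)+
  have "app (assoc_inv H K L) \<phi> (pure H K h k, l) =
      inner ((H \<otimes>\<^sub>H K) \<otimes>\<^sub>H L) (pure (H \<otimes>\<^sub>H K) L (pure H K h k) l) (app (assoc_inv H K L) \<phi>)"
    using h k l by (intro inner_pure_left[symmetric] L HK.fd_hilbert_axioms pure_closed H K lin_closed[OF assoc_inv_lin \<phi>])
  also have "\<dots> = inner (H \<otimes>\<^sub>H (K \<otimes>\<^sub>H L)) (app (assoc H K L) (pure (H \<otimes>\<^sub>H K) L (pure H K h k) l)) \<phi>"
    unfolding assoc_inv_eq_adj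
    using h k l by (intro inner_adj_right fd assoc_lin \<phi> pure_closed L HK.fd_hilbert_axioms K H)
  also have "\<dots> = \<phi> (h, pure K L k l)"
    unfolding app_assoc[OF h k l]
    using h k l by (intro inner_pure_left H KL.fd_hilbert_axioms \<phi> pure_closed K L)
  finally show ?thesis .
qed

end

section \<open>The unitors and their inverses\<close>

context
  fixes H :: "'a hilb"
  assumes H: "fd_hilbert H"
begin

interpretation H: fd_hilbert H by (rule H)

text \<open>The inverse sends \<open>h\<close> to \<open>1 \<otimes> h\<close>, and evaluation at
  \<open>(1, h)\<close> is the inner product with that vector; this dictates the form from which the
  unitor is built.\<close>

private lemma lunit_form:
  obtains f where "f \<in> lin (unit_space \<otimes>\<^sub>H H) H"
    "\<And>\<phi> h. \<phi> \<in> carrier (unit_space \<otimes>\<^sub>H H) \<Longrightarrow> h \<in> carrier H \<Longrightarrow> inner H h (app f \<phi>) = \<phi> (1, h)"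
    "\<And>z h. h \<in> carrier H \<Longrightarrow> app f (pure unit_space H z h) = z \<odot>\<^bsub>H\<^esub> h"
proof -
  obtain f where f: "f \<in> lin (unit_space \<otimes>\<^sub>H H) H"
    and form: "\<And>\<phi> h. \<phi> \<in> carrier (unit_space \<otimes>\<^sub>H H) \<Longrightarrow> h \<in> carrier H \<Longrightarrow> inner H h (app f \<phi>) = \<phi> (1, h)"
    by (rule lin_of_form[OF fd_hilbert_tensor_space[OF fd_hilbert_unit_space H] H, of "\<lambda>h \<phi>. \<phi> (1, h)"])
      (auto simp: tensor_form)
  have "app f (pure unit_space H z h) = z \<odot>\<^bsub>H\<^esub> h" if h: "h \<in> carrier H" for z h
    using h by (intro H.eq_of_inner_eq)
      (auto intro!: lin_closed[OF f] pure_closed[OF fd_hilbert_unit_space H]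
       simp: form pure_closed[OF fd_hilbert_unit_space H] pure_apply H.inner_smult)
  with f form show thesis by (rule that)
qed

lemma lunit_spec:
  "lunit H \<in> lin (unit_space \<otimes>\<^sub>H H) H \<and>
    (\<forall>z. \<forall>h \<in> carrier H. app (lunit H) (pure unit_space H z h) = z \<odot>\<^bsub>H\<^esub> h)"
  unfolding lunit_def
proof (rule theI'[OF ex_ex1I])
  obtain f where "f \<in> lin (unit_space \<otimes>\<^sub>H H) H"
    "\<And>z h. h \<in> carrier H \<Longrightarrow> app f (pure unit_space H z h) = z \<odot>\<^bsub>H\<^esub> h"
    by (rule lunit_form) (rule that)
  then show "\<exists>T. T \<in> lin (unit_space \<otimes>\<^sub>H H) H \<and>
    (\<forall>z. \<forall>h \<in> carrier H. app T (pure unit_space H z h) = z \<odot>\<^bsub>H\<^esub> h)" by blast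
  fix T T'
  assume "T \<in> lin (unit_space \<otimes>\<^sub>H H) H \<and> (\<forall>z. \<forall>h \<in> carrier H. app T (pure unit_space H z h) = z \<odot>\<^bsub>H\<^esub> h)"
    "T' \<in> lin (unit_space \<otimes>\<^sub>H H) H \<and> (\<forall>z. \<forall>h \<in> carrier H. app T' (pure unit_space H z h) = z \<odot>\<^bsub>H\<^esub> h)"
  then show "T = T'" by (intro lin_eq_pureI[OF fd_hilbert_unit_space H H]) auto
qed

lemmas lunit_lin = lunit_spec[THEN conjunct1]

lemma app_lunit [simp]: "h \<in> carrier H \<Longrightarrow> app (lunit H) (pure unit_space H z h) = z \<odot>\<^bsub>H\<^esub> h"
  using lunit_spec by blast

text \<open>Describes the unitor on arbitrary forms, as is needed after applying the counit to a
  vector that is not a pure tensor.\<close>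

lemma inner_lunit:
  assumes \<phi>: "\<phi> \<in> carrier (unit_space \<otimes>\<^sub>H H)" and h: "h \<in> carrier H"
  shows "inner H h (app (lunit H) \<phi>) = \<phi> (1, h)"
proof -
  obtain f where f: "f \<in> lin (unit_space \<otimes>\<^sub>H H) H"
    and form: "\<And>\<phi> h. \<phi> \<in> carrier (unit_space \<otimes>\<^sub>H H) \<Longrightarrow> h \<in> carrier H \<Longrightarrow> inner H h (app f \<phi>) = \<phi> (1, h)"
    and pure: "\<And>z h. h \<in> carrier H \<Longrightarrow> app f (pure unit_space H z h) = z \<odot>\<^bsub>H\<^esub> h"
    by (rule lunit_form) (rule that)
  have "lunit H = f"
    by (rule lin_eq_pureI[OF fd_hilbert_unit_space H H lunit_lin f]) (simp add: pure)
  then show ?thesis using form[OF \<phi> h] by simp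
qed

lemma runit_spec:
  "runit H \<in> lin (H \<otimes>\<^sub>H unit_space) H \<and>
    (\<forall>h \<in> carrier H. \<forall>z. app (runit H) (pure H unit_space h z) = z \<odot>\<^bsub>H\<^esub> h)"
  unfolding runit_def
proof (rule theI'[OF ex_ex1I])
  interpret T: fd_hilbert "H \<otimes>\<^sub>H unit_space" by (rule fd_hilbert_tensor_space[OF H fd_hilbert_unit_space])
  obtain f where f: "f \<in> lin (H \<otimes>\<^sub>H unit_space) H"
    and form: "\<And>\<phi> h. \<phi> \<in> carrier (H \<otimes>\<^sub>H unit_space) \<Longrightarrow> h \<in> carrier H \<Longrightarrow> inner H h (app f \<phi>) = \<phi> (h, 1)"
    by (rule lin_of_form[OF T.fd_hilbert_axioms H, of "\<lambda>h \<phi>. \<phi> (h, 1)"])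
      (auto simp: tensor_form)
  have "app f (pure H unit_space h z) = z \<odot>\<^bsub>H\<^esub> h" if h: "h \<in> carrier H" for z h
    using h by (intro H.eq_of_inner_eq)
      (auto intro!: lin_closed[OF f] pure_closed[OF H fd_hilbert_unit_space]
       simp: form pure_closed[OF H fd_hilbert_unit_space] pure_apply H.inner_smult)
  with f show "\<exists>T. T \<in> lin (H \<otimes>\<^sub>H unit_space) H \<and>
    (\<forall>h \<in> carrier H. \<forall>z. app T (pure H unit_space h z) = z \<odot>\<^bsub>H\<^esub> h)" by blast
  fix T T'
  assume "T \<in> lin (H \<otimes>\<^sub>H unit_space) H \<and> (\<forall>h \<in> carrier H. \<forall>z. app T (pure H unit_space h z) = z \<odot>\<^bsub>H\<^esub> h)"
    "T' \<in> lin (H \<otimes>\<^sub>H unit_space) H \<and> (\<forall>h \<in> carrier H. \<forall>z. app T' (pure H unit_space h z) = z \<odot>\<^bsub>H\<^esub> h)"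
  then show "T = T'" by (intro lin_eq_pureI[OF H fd_hilbert_unit_space H]) auto
qed

lemmas runit_lin = runit_spec[THEN conjunct1]

lemma app_runit [simp]: "h \<in> carrier H \<Longrightarrow> app (runit H) (pure H unit_space h z) = z \<odot>\<^bsub>H\<^esub> h"
  using runit_spec by blast

lemma lunit_inv_spec:
  "lunit_inv H \<in> lin H (unit_space \<otimes>\<^sub>H H) \<and> (\<forall>h \<in> carrier H. app (lunit_inv H) h = pure unit_space H 1 h)"
  unfolding lunit_inv_def
proof (rule theI'[OF ex_ex1I])
  show "\<exists>T. T \<in> lin H (unit_space \<otimes>\<^sub>H H) \<and> (\<forall>h \<in> carrier H. app T h = pure unit_space H 1 h)"
    by (rule exI[of _ "\<lparr>src = H, tgt = unit_space \<otimes>\<^sub>H H,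
        app = (\<lambda>h. if h \<in> carrier H then pure unit_space H 1 h else \<zero>\<^bsub>unit_space \<otimes>\<^sub>H H\<^esub>)\<rparr>"])
      (auto intro!: linI simp: pure_closed[OF fd_hilbert_unit_space H] pure_add_right[OF fd_hilbert_unit_space H]
        pure_smult_right[OF fd_hilbert_unit_space H] simp del: tensor_space_simps)
qed (auto intro: lin_eqI)

lemmas lunit_inv_lin = lunit_inv_spec[THEN conjunct1]

lemma app_lunit_inv [simp]: "h \<in> carrier H \<Longrightarrow> app (lunit_inv H) h = pure unit_space H 1 h"
  using lunit_inv_spec by blast

lemma runit_inv_spec:
  "runit_inv H \<in> lin H (H \<otimes>\<^sub>H unit_space) \<and> (\<forall>h \<in> carrier H. app (runit_inv H) h = pure H unit_space h 1)"
  unfolding runit_inv_def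
proof (rule theI'[OF ex_ex1I])
  show "\<exists>T. T \<in> lin H (H \<otimes>\<^sub>H unit_space) \<and> (\<forall>h \<in> carrier H. app T h = pure H unit_space h 1)"
    by (rule exI[of _ "\<lparr>src = H, tgt = H \<otimes>\<^sub>H unit_space,
        app = (\<lambda>h. if h \<in> carrier H then pure H unit_space h 1 else \<zero>\<^bsub>H \<otimes>\<^sub>H unit_space\<^esub>)\<rparr>"])
      (auto intro!: linI simp: pure_closed[OF H fd_hilbert_unit_space] pure_add_left[OF H fd_hilbert_unit_space]
        pure_smult_left[OF H fd_hilbert_unit_space] simp del: tensor_space_simps)
qed (auto intro: lin_eqI)

lemmas runit_inv_lin = runit_inv_spec[THEN conjunct1]

lemma app_runit_inv [simp]: "h \<in> carrier H \<Longrightarrow> app (runit_inv H) h = pure H unit_space h 1"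
  using runit_inv_spec by blast

end

text \<open>Pairing \<open>(f \<otimes> g) \<phi>\<close> with \<open>a \<otimes> b\<close> moves
  both maps to the other side, so \<open>f \<otimes> g\<close> can only be precomposition with the
  two adjoints. That formula proves existence and, as \<open>tensor_map_apply\<close>, is what later
  computations of components use.\<close>

lemma tensor_map_spec:
  assumes H: "fd_hilbert H" and K: "fd_hilbert K" and H': "fd_hilbert H'" and K': "fd_hilbert K'"
    and f: "f \<in> lin H H'" and g: "g \<in> lin K K'"
  shows tensor_map_lin: "f \<otimes>\<^sub>M g \<in> lin (H \<otimes>\<^sub>H K) (H' \<otimes>\<^sub>H K')"
    and app_tensor_map: "\<And>h k. h \<in> carrier H \<Longrightarrow> k \<in> carrier K \<Longrightarrow>
      app (f \<otimes>\<^sub>M g) (pure H K h k) = pure H' K' (app f h) (app g k)"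
    and tensor_map_apply: "\<And>\<phi> a b. \<phi> \<in> carrier (H \<otimes>\<^sub>H K) \<Longrightarrow> a \<in> carrier H' \<Longrightarrow> b \<in> carrier K' \<Longrightarrow>
      app (f \<otimes>\<^sub>M g) \<phi> (a, b) = \<phi> (app (adj f) a, app (adj g) b)"
proof -
  interpret H: fd_hilbert H by (rule H)
  interpret K: fd_hilbert K by (rule K)
  interpret H': fd_hilbert H' by (rule H')
  interpret K': fd_hilbert K' by (rule K')
  interpret HK: fd_hilbert "H \<otimes>\<^sub>H K" by (rule fd_hilbert_tensor_space[OF H K])
  note af = adj_lin[OF H H' f] note ag = adj_lin[OF K K' g]
  let ?T = "\<lparr>src = H \<otimes>\<^sub>H K, tgt = H' \<otimes>\<^sub>H K', app = (\<lambda>\<phi>. if \<phi> \<in> carrier (H \<otimes>\<^sub>H K)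
    then (\<lambda>(a, b). if a \<in> carrier H' \<and> b \<in> carrier K' then \<phi> (app (adj f) a, app (adj g) b) else 0)
    else (\<lambda>_. 0))\<rparr>"
  have T: "?T \<in> lin (H \<otimes>\<^sub>H K) (H' \<otimes>\<^sub>H K')"
  proof (rule linI)
    fix \<phi> assume \<phi>: "\<phi> \<in> carrier (H \<otimes>\<^sub>H K)"
    show "app ?T \<phi> \<in> carrier (H' \<otimes>\<^sub>H K')"
      by (rule tensor_carrierI)
        (use \<phi> in \<open>auto simp: lin_add[OF af] lin_add[OF ag] lin_smult[OF af] lin_smult[OF ag]
          lin_closed[OF af] lin_closed[OF ag] tensor_form[OF \<phi>]\<close>)
    fix c
    show "app ?T (c \<odot>\<^bsub>H \<otimes>\<^sub>H K\<^esub> \<phi>) = c \<odot>\<^bsub>H' \<otimes>\<^sub>H K'\<^esub> app ?T \<phi>"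
      using HK.scale_closed[OF \<phi>] \<phi> by (auto simp: fun_eq_iff)
  next
    fix \<phi> \<psi> assume \<phi>: "\<phi> \<in> carrier (H \<otimes>\<^sub>H K)" "\<psi> \<in> carrier (H \<otimes>\<^sub>H K)"
    show "app ?T (\<phi> \<oplus>\<^bsub>H \<otimes>\<^sub>H K\<^esub> \<psi>) = app ?T \<phi> \<oplus>\<^bsub>H' \<otimes>\<^sub>H K'\<^esub> app ?T \<psi>"
      using HK.add_closed[OF \<phi>] \<phi> by (auto simp: fun_eq_iff)
  qed auto
  have Tp: "app ?T (pure H K h k) = pure H' K' (app f h) (app g k)"
    if "h \<in> carrier H" "k \<in> carrier K" for h k
    using that
    by (auto simp: fun_eq_iff pure_def[of H'] pure_closed[OF H K] pure_apply lin_closed[OF af] lin_closed[OF ag]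
        inner_adj_left[OF H H' f] inner_adj_left[OF K K' g])
  have eq: "f \<otimes>\<^sub>M g = ?T"
    unfolding tensor_map_def lin_src[OF f] lin_src[OF g] lin_tgt[OF f] lin_tgt[OF g]
  proof (rule the_equality, safe)
    fix S assume S: "S \<in> lin (H \<otimes>\<^sub>H K) (H' \<otimes>\<^sub>H K')"
      "\<forall>h\<in>carrier H. \<forall>k\<in>carrier K. app S (pure H K h k) = pure H' K' (app f h) (app g k)"
    show "S = ?T"
      using S by (intro lin_eq_pureI[OF H K fd_hilbert_tensor_space[OF H' K'] S(1) T]) (simp only: Tp)
  qed (use T Tp in auto)
  show "f \<otimes>\<^sub>M g \<in> lin (H \<otimes>\<^sub>H K) (H' \<otimes>\<^sub>H K')"
    unfolding eq by (rule T)
  show "app (f \<otimes>\<^sub>M g) (pure H K h k) = pure H' K' (app f h) (app g k)"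
    if "h \<in> carrier H" "k \<in> carrier K" for h k
    unfolding eq using that by (rule Tp)
  show "app (f \<otimes>\<^sub>M g) \<phi> (a, b) = \<phi> (app (adj f) a, app (adj g) b)"
    if "\<phi> \<in> carrier (H \<otimes>\<^sub>H K)" "a \<in> carrier H'" "b \<in> carrier K'" for \<phi> a b
    unfolding eq using that by simp
qed

lemma lin_eq_pure_onbI:
  assumes H: "fd_hilbert H" and K: "fd_hilbert K" and L: "fd_hilbert L"
    and B: "onb H B" and C: "onb K C"
    and f: "f \<in> lin (H \<otimes>\<^sub>H K) L" and g: "g \<in> lin (H \<otimes>\<^sub>H K) L"
    and eq: "\<And>h k. h \<in> B \<Longrightarrow> k \<in> C \<Longrightarrow> app f (pure H K h k) = app g (pure H K h k)"
  shows "f = g"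
proof (rule lin_eq_onbI[OF fd_hilbert_tensor_space[OF H K] L f g onb_tensor[OF H K B C]])
  fix b assume "b \<in> (\<lambda>(e, f). pure H K e f) ` (B \<times> C)"
  then obtain e e' where "e \<in> B" "e' \<in> C" "b = pure H K e e'" by auto
  then show "app f b = app g b" using eq by simp
qed

lemma adj_adj:
  assumes H: "fd_hilbert H" and K: "fd_hilbert K" and f: "f \<in> lin H K"
  shows "adj (adj f) = f"
  by (rule adj_unique[OF K H adj_lin[OF H K f] f]) (simp add: inner_adj_left[OF H K f])

section \<open>The Frobenius algebra of functions on a finite set\<close>

context
  fixes V :: "'v set"
  assumes V: "finite V"
begin

private abbreviation (input) X :: "('v \<Rightarrow> complex) hilb" where "X \<equiv> fun_space V"

interpretation X: fd_hilbert X by (rule fd_hilbert_fun_space[OF V])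

text \<open>On forms, multiplication is restriction to the diagonal pairs
  \<open>(ket v, ket v)\<close>.\<close>

lemma frob_mult_spec:
  shows frob_mult_lin: "frob_mult V \<in> lin (X \<otimes>\<^sub>H X) X"
    and app_frob_mult: "v \<in> V \<Longrightarrow> w \<in> V \<Longrightarrow>
      app (frob_mult V) (pure X X (ket v) (ket w)) = (if v = w then ket v else \<zero>\<^bsub>X\<^esub>)"
proof -
  note XX = X.fd_hilbert_axioms X.fd_hilbert_axioms
  interpret XX: fd_hilbert "X \<otimes>\<^sub>H X" by (rule fd_hilbert_tensor_space[OF XX])
  have "frob_mult V \<in> lin (X \<otimes>\<^sub>H X) X \<and> (\<forall>v \<in> V. \<forall>w \<in> V. app (frob_mult V) (pure X X (ket v) (ket w)) =
      (if v = w then ket v else \<zero>\<^bsub>X\<^esub>))"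
    unfolding frob_mult_def
  proof (rule theI'[OF ex_ex1I])
    let ?T = "\<lparr>src = X \<otimes>\<^sub>H X, tgt = X, app = (\<lambda>\<phi>. if \<phi> \<in> carrier (X \<otimes>\<^sub>H X)
      then (\<lambda>v. if v \<in> V then \<phi> (ket v, ket v) else 0) else (\<lambda>_. 0))\<rparr>"
    show "\<exists>T. T \<in> lin (X \<otimes>\<^sub>H X) X \<and> (\<forall>v \<in> V. \<forall>w \<in> V. app T (pure X X (ket v) (ket w)) =
        (if v = w then ket v else \<zero>\<^bsub>X\<^esub>))"
    proof (intro exI[of _ ?T] conjI ballI)
      show "?T \<in> lin (X \<otimes>\<^sub>H X) X"
      proof (rule linI)
        fix \<phi> \<psi> assume "\<phi> \<in> carrier (X \<otimes>\<^sub>H X)" "\<psi> \<in> carrier (X \<otimes>\<^sub>H X)"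
        with XX.add_closed[OF this] show "app ?T (\<phi> \<oplus>\<^bsub>X \<otimes>\<^sub>H X\<^esub> \<psi>) = app ?T \<phi> \<oplus>\<^bsub>X\<^esub> app ?T \<psi>"
          by (auto simp: fun_eq_iff)
      next
        fix c \<phi> assume "\<phi> \<in> carrier (X \<otimes>\<^sub>H X)"
        with XX.scale_closed[OF this] show "app ?T (c \<odot>\<^bsub>X \<otimes>\<^sub>H X\<^esub> \<phi>) = c \<odot>\<^bsub>X\<^esub> app ?T \<phi>"
          by (auto simp: fun_eq_iff)
      qed auto
      fix v w assume "v \<in> V" "w \<in> V"
      then show "app ?T (pure X X (ket v) (ket w)) = (if v = w then ket v else \<zero>\<^bsub>X\<^esub>)"
        by (auto simp: fun_eq_iff pure_closed[OF XX] pure_apply inner_ket_left[OF V] ket_apply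
            simp del: fun_space_simps(5) fun_space_simps(1))
    qed
  next
    fix S T
    assume "S \<in> lin (X \<otimes>\<^sub>H X) X \<and> (\<forall>v \<in> V. \<forall>w \<in> V. app S (pure X X (ket v) (ket w)) = (if v = w then ket v else \<zero>\<^bsub>X\<^esub>))"
      "T \<in> lin (X \<otimes>\<^sub>H X) X \<and> (\<forall>v \<in> V. \<forall>w \<in> V. app T (pure X X (ket v) (ket w)) = (if v = w then ket v else \<zero>\<^bsub>X\<^esub>))"
    then show "S = T"
      by (intro lin_eq_pure_onbI[OF XX X.fd_hilbert_axioms onb_fun_space[OF V] onb_fun_space[OF V]]) auto
  qed
  then show "frob_mult V \<in> lin (X \<otimes>\<^sub>H X) X" "v \<in> V \<Longrightarrow> w \<in> V \<Longrightarrow>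
      app (frob_mult V) (pure X X (ket v) (ket w)) = (if v = w then ket v else \<zero>\<^bsub>X\<^esub>)" by blast+
qed

lemma frob_comult_lin: "frob_comult V \<in> lin X (X \<otimes>\<^sub>H X)"
  unfolding frob_comult_def
  by (intro adj_lin fd_hilbert_tensor_space X.fd_hilbert_axioms frob_mult_lin)

lemma adj_frob_comult: "adj (frob_comult V) = frob_mult V"
  unfolding frob_comult_def
  by (rule adj_adj[OF fd_hilbert_tensor_space[OF X.fd_hilbert_axioms X.fd_hilbert_axioms]
        X.fd_hilbert_axioms frob_mult_lin])

text \<open>The comultiplication is only given as the adjoint of \<open>m\<close>, so its values are
  found by testing against the basis \<open>|u\<rangle> \<otimes> |v\<rangle>\<close>.\<close>

lemma app_frob_comult:
  assumes w: "w \<in> V" shows "app (frob_comult V) (ket w) = pure X X (ket w) (ket w)"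
proof -
  note XX = X.fd_hilbert_axioms X.fd_hilbert_axioms
  interpret XX: fd_hilbert "X \<otimes>\<^sub>H X" by (rule fd_hilbert_tensor_space[OF XX])
  show ?thesis
  proof (rule XX.eq_of_inner_onb[OF onb_tensor[OF XX onb_fun_space[OF V] onb_fun_space[OF V]]])
    show "app (frob_comult V) (ket w) \<in> carrier (X \<otimes>\<^sub>H X)"
      using w by (intro lin_closed[OF frob_comult_lin] ket_closed)
    show "pure X X (ket w) (ket w) \<in> carrier (X \<otimes>\<^sub>H X)" using w by (intro pure_closed XX ket_closed)
    fix b assume "b \<in> (\<lambda>(e, f). pure X X e f) ` (ket ` V \<times> ket ` V)"
    then obtain u v where uv: "u \<in> V" "v \<in> V" "b = pure X X (ket u) (ket v)" by auto
    have "inner (X \<otimes>\<^sub>H X) b (app (frob_comult V) (ket w)) = inner X (app (frob_mult V) b) (ket w)"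
      unfolding frob_comult_def using uv w
      by (intro inner_adj_right frob_mult_lin X.fd_hilbert_axioms XX.fd_hilbert_axioms ket_closed)
        (auto intro!: pure_closed XX simp del: fun_space_simps simp: ket_closed)
    also have "\<dots> = inner (X \<otimes>\<^sub>H X) b (pure X X (ket w) (ket w))"
      unfolding uv using uv w
      by (auto simp: app_frob_mult inner_pure_pure[OF XX] inner_ket_left[OF V] ket_apply
          simp del: fun_space_simps)
    finally show "inner (X \<otimes>\<^sub>H X) b (app (frob_comult V) (ket w)) = inner (X \<otimes>\<^sub>H X) b (pure X X (ket w) (ket w))" .
  qed
qed

lemma frob_unit_spec:
  shows frob_unit_lin: "frob_unit V \<in> lin unit_space X"
    and app_frob_unit: "app (frob_unit V) 1 = finsum X ket V"
proof -
  let ?s = "\<lambda>w. \<Sum>v\<in>V. ket v w"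
  have s: "finsum X ket V = ?s"
    by (rule ext, subst finsum_fun_space) (auto simp: ket_apply)
  have sX: "?s \<in> carrier X"
    unfolding s[symmetric] by (rule X.fsum_closed) (rule ket_closed)
  have "frob_unit V \<in> lin unit_space X \<and> app (frob_unit V) 1 = ?s"
    unfolding frob_unit_def
  proof (rule theI'[OF ex_ex1I])
    show "\<exists>T. T \<in> lin unit_space X \<and> app T 1 = ?s"
      using sX by (intro exI[of _ "\<lparr>src = unit_space, tgt = X, app = (\<lambda>z. z \<odot>\<^bsub>X\<^esub> ?s)\<rparr>"])
        (auto intro!: linI simp: ring_distribs mult.assoc)
  next
    fix S T
    assume "S \<in> lin unit_space X \<and> app S 1 = ?s" "T \<in> lin unit_space X \<and> app T 1 = ?s"
    then show "S = T"
      by (intro lin_eq_onbI[OF fd_hilbert_unit_space X.fd_hilbert_axioms _ _ onb_unit_space]) auto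
  qed
  then show "frob_unit V \<in> lin unit_space X" "app (frob_unit V) 1 = finsum X ket V"
    unfolding s by blast+
qed

lemma frob_counit_lin: "frob_counit V \<in> lin X unit_space"
  unfolding frob_counit_def
  by (intro adj_lin fd_hilbert_unit_space X.fd_hilbert_axioms frob_unit_lin)

lemma adj_frob_counit: "adj (frob_counit V) = frob_unit V"
  unfolding frob_counit_def
  by (rule adj_adj[OF fd_hilbert_unit_space X.fd_hilbert_axioms frob_unit_lin])

lemma app_frob_counit: "v \<in> V \<Longrightarrow> app (frob_counit V) (ket v) = 1"
proof -
  assume v: "v \<in> V"
  have "inner unit_space 1 (app (frob_counit V) (ket v)) = inner X (app (frob_unit V) 1) (ket v)"
    unfolding frob_counit_def
    by (rule inner_adj_right[OF fd_hilbert_unit_space X.fd_hilbert_axioms frob_unit_lin])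
      (use v in \<open>auto simp: ket_apply\<close>)
  also have "\<dots> = (\<Sum>w\<in>V. inner X (ket w) (ket v))"
    unfolding app_frob_unit using v by (intro X.inner_finsum_left ket_closed)
  also have "\<dots> = 1" using v V by (simp add: inner_ket_left[OF V] ket_apply del: fun_space_simps)
  finally show ?thesis by simp
qed

end

lemma adjacency_map_spec:
  fixes G :: "'v pair_pre_digraph"
  assumes V: "finite (pverts G)"
  shows adjacency_map_lin: "adjacency_map G \<in> lin (fun_space (pverts G)) (fun_space (pverts G))"
    and app_adjacency_map: "w \<in> pverts G \<Longrightarrow> app (adjacency_map G) (ket w) =
      finsum (fun_space (pverts G)) (\<lambda>v. adjacency G v w \<odot>\<^bsub>fun_space (pverts G)\<^esub> ket v) (pverts G)"
proof -
  let ?V = "pverts G" let ?X = "fun_space ?V"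
  interpret X: fd_hilbert ?X by (rule fd_hilbert_fun_space[OF V])
  have s: "finsum ?X (\<lambda>v. adjacency G v w \<odot>\<^bsub>?X\<^esub> ket v) ?V = (\<lambda>u. \<Sum>v\<in>?V. adjacency G v w * ket v u)" for w
    by (rule ext, subst finsum_fun_space) (auto simp: ket_apply)
  have sX: "(\<lambda>u. \<Sum>v\<in>?V. adjacency G v w * ket v u) \<in> carrier ?X" for w
    unfolding s[symmetric] by (intro X.fsum_closed X.scale_closed ket_closed)
  have "adjacency_map G \<in> lin ?X ?X \<and>
      (\<forall>w\<in>?V. app (adjacency_map G) (ket w) = (\<lambda>u. \<Sum>v\<in>?V. adjacency G v w * ket v u))"
    unfolding adjacency_map_def
  proof (rule theI'[OF ex_ex1I])
    \<comment> \<open>A function on the basis vectors is required here, so the vertex is recovered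
      from its ket by \<open>SOME\<close>; this is legitimate because \<open>ket\<close> is
      injective.\<close>
    obtain f where f: "f \<in> lin ?X ?X"
      "\<And>b. b \<in> ket ` ?V \<Longrightarrow> app f b = (\<lambda>u. \<Sum>v\<in>?V. adjacency G v (SOME w. b = ket w) * ket v u)"
      by (rule lin_extend_onb[OF X.fd_hilbert_axioms X.fd_hilbert_axioms onb_fun_space[OF V],
          of "\<lambda>b u. \<Sum>v\<in>?V. adjacency G v (SOME w. b = ket w) * ket v u"]) (rule sX, blast)
    have [simp]: "(SOME w'. ket w = ket w') = w" for w :: 'v
    proof (rule some_equality)
      fix w' assume "ket w = ket w'"
      from fun_cong[OF this, of w] show "w' = w" by (simp add: ket_apply)
    qed simp
    show "\<exists>T. T \<in> lin ?X ?X \<and> (\<forall>w\<in>?V. app T (ket w) = (\<lambda>u. \<Sum>v\<in>?V. adjacency G v w * ket v u))"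
      using f by auto
  next
    fix S T
    assume "S \<in> lin ?X ?X \<and> (\<forall>w\<in>?V. app S (ket w) = (\<lambda>u. \<Sum>v\<in>?V. adjacency G v w * ket v u))"
      "T \<in> lin ?X ?X \<and> (\<forall>w\<in>?V. app T (ket w) = (\<lambda>u. \<Sum>v\<in>?V. adjacency G v w * ket v u))"
    then show "S = T"
      by (intro lin_eq_onbI[OF X.fd_hilbert_axioms X.fd_hilbert_axioms _ _ onb_fun_space[OF V]]) auto
  qed
  then show "adjacency_map G \<in> lin ?X ?X" "w \<in> ?V \<Longrightarrow> app (adjacency_map G) (ket w) =
      finsum ?X (\<lambda>v. adjacency G v w \<odot>\<^bsub>?X\<^esub> ket v) ?V"
    unfolding s by blast+
qed

section \<open>Slices of vectors in a tensor product with the function space\<close>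

text \<open>The map \<open>\<langle>v| \<otimes> id\<close>, which reads off the component of a
  vector at the vertex \<open>v\<close>. It is chosen by its sesquilinear form, which determines
  it.\<close>

definition slice :: "'v set \<Rightarrow> 'a hilb \<Rightarrow> 'v \<Rightarrow> (('v \<Rightarrow> complex) \<times> 'a \<Rightarrow> complex, 'a) arr" where
  "slice V K v = (SOME f. f \<in> lin (fun_space V \<otimes>\<^sub>H K) K \<and>
    (\<forall>\<phi>\<in>carrier (fun_space V \<otimes>\<^sub>H K). \<forall>k\<in>carrier K. inner K k (app f \<phi>) = \<phi> (ket v, k)))"

context
  fixes V :: "'v set" and K :: "'a hilb"
  assumes V: "finite V" and K: "fd_hilbert K"
begin

interpretation X: fd_hilbert "fun_space V" by (rule fd_hilbert_fun_space[OF V])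
interpretation K: fd_hilbert K by (rule K)
interpretation XK: fd_hilbert "fun_space V \<otimes>\<^sub>H K"
  by (rule fd_hilbert_tensor_space[OF X.fd_hilbert_axioms K])

lemma slice_spec:
  assumes v: "v \<in> V"
  shows slice_lin: "slice V K v \<in> lin (fun_space V \<otimes>\<^sub>H K) K"
    and inner_slice: "\<phi> \<in> carrier (fun_space V \<otimes>\<^sub>H K) \<Longrightarrow> k \<in> carrier K \<Longrightarrow>
      inner K k (app (slice V K v) \<phi>) = \<phi> (ket v, k)"
proof -
  obtain f where "f \<in> lin (fun_space V \<otimes>\<^sub>H K) K"
    "\<And>\<phi> k. \<phi> \<in> carrier (fun_space V \<otimes>\<^sub>H K) \<Longrightarrow> k \<in> carrier K \<Longrightarrow> inner K k (app f \<phi>) = \<phi> (ket v, k)"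
    by (rule lin_of_form[OF XK.fd_hilbert_axioms K, of "\<lambda>k \<phi>. \<phi> (ket v, k)"])
      (use v in \<open>auto simp: tensor_form simp del: fun_space_simps\<close>)
  then have "\<exists>f. f \<in> lin (fun_space V \<otimes>\<^sub>H K) K \<and>
    (\<forall>\<phi>\<in>carrier (fun_space V \<otimes>\<^sub>H K). \<forall>k\<in>carrier K. inner K k (app f \<phi>) = \<phi> (ket v, k))" by blast
  from someI_ex[OF this, folded slice_def] show "slice V K v \<in> lin (fun_space V \<otimes>\<^sub>H K) K"
    "\<phi> \<in> carrier (fun_space V \<otimes>\<^sub>H K) \<Longrightarrow> k \<in> carrier K \<Longrightarrow>
      inner K k (app (slice V K v) \<phi>) = \<phi> (ket v, k)" by blast+
qed

lemma slice_closed: "v \<in> V \<Longrightarrow> \<phi> \<in> carrier (fun_space V \<otimes>\<^sub>H K) \<Longrightarrow> app (slice V K v) \<phi> \<in> carrier K"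
  by (rule lin_closed[OF slice_lin])

lemma slice_pure:
  assumes v: "v \<in> V" and x: "x \<in> carrier (fun_space V)" and k: "k \<in> carrier K"
  shows "app (slice V K v) (pure (fun_space V) K x k) = x v \<odot>\<^bsub>K\<^esub> k"
  using assms pure_closed[OF X.fd_hilbert_axioms K x k]
  by (intro K.eq_of_inner_eq slice_closed)
    (auto simp: inner_slice pure_apply K.inner_smult inner_ket_left[OF V] simp del: fun_space_simps)

lemma slice_ket:
  assumes v: "v \<in> V" and w: "w \<in> V" and k: "k \<in> carrier K"
  shows "app (slice V K v) (pure (fun_space V) K (ket w) k) = (if v = w then k else \<zero>\<^bsub>K\<^esub>)"
  using slice_pure[OF v ket_closed[OF w] k] k by (simp add: ket_apply)

lemma slice_eqI:
  assumes \<phi>: "\<phi> \<in> carrier (fun_space V \<otimes>\<^sub>H K)" and \<psi>: "\<psi> \<in> carrier (fun_space V \<otimes>\<^sub>H K)"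
    and eq: "\<And>v. v \<in> V \<Longrightarrow> app (slice V K v) \<phi> = app (slice V K v) \<psi>"
  shows "\<phi> = \<psi>"
proof (rule XK.eq_of_inner_onb[OF onb_tensor[OF X.fd_hilbert_axioms K onb_fun_space[OF V] K.onb_bas] \<phi> \<psi>])
  fix b assume "b \<in> (\<lambda>(e, f). pure (fun_space V) K e f) ` (ket ` V \<times> bas K)"
  then obtain v k where v: "v \<in> V" and k: "k \<in> bas K" and b: "b = pure (fun_space V) K (ket v) k" by auto
  from k have k: "k \<in> carrier K" by (rule K.onb_carrier[OF K.onb_bas])
  show "inner (fun_space V \<otimes>\<^sub>H K) b \<phi> = inner (fun_space V \<otimes>\<^sub>H K) b \<psi>"
    unfolding b inner_pure_left[OF X.fd_hilbert_axioms K \<phi> ket_closed[OF v] k]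
      inner_pure_left[OF X.fd_hilbert_axioms K \<psi> ket_closed[OF v] k]
    using inner_slice[OF v \<phi> k] inner_slice[OF v \<psi> k] eq[OF v] by simp
qed

text \<open>The adjoint of \<open>\<langle>v| \<otimes> id\<close> inserts
  \<open>|v\<rangle>\<close>. It is computed because \<open>tensor_map_apply\<close> expresses a
  tensor product of maps by adjoints, and slices occur as tensor factors below.\<close>

lemma adj_slice:
  assumes v: "v \<in> V" and k: "k \<in> carrier K"
  shows "app (adj (slice V K v)) k = pure (fun_space V) K (ket v) k"
proof (rule XK.eq_of_inner_eq)
  note p = pure_closed[OF X.fd_hilbert_axioms K ket_closed[OF v] k]
  show "app (adj (slice V K v)) k \<in> carrier (fun_space V \<otimes>\<^sub>H K)"
    by (rule lin_closed[OF adj_lin[OF XK.fd_hilbert_axioms K slice_lin[OF v]] k])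
  show "pure (fun_space V) K (ket v) k \<in> carrier (fun_space V \<otimes>\<^sub>H K)" by (rule p)
  fix \<phi> assume \<phi>: "\<phi> \<in> carrier (fun_space V \<otimes>\<^sub>H K)"
  have "inner (fun_space V \<otimes>\<^sub>H K) \<phi> (app (adj (slice V K v)) k) = inner K (app (slice V K v) \<phi>) k"
    by (rule inner_adj_right[OF XK.fd_hilbert_axioms K slice_lin[OF v] \<phi> k])
  also have "\<dots> = cnj (inner K k (app (slice V K v) \<phi>))"
    by (rule K.inner_cnj[OF k slice_closed[OF v \<phi>]])
  also have "\<dots> = cnj (inner (fun_space V \<otimes>\<^sub>H K) (pure (fun_space V) K (ket v) k) \<phi>)"
    unfolding inner_slice[OF v \<phi> k] inner_pure_left[OF X.fd_hilbert_axioms K \<phi> ket_closed[OF v] k] ..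
  also have "\<dots> = inner (fun_space V \<otimes>\<^sub>H K) \<phi> (pure (fun_space V) K (ket v) k)"
    by (rule XK.inner_cnj[OF p \<phi>, symmetric])
  finally show "inner (fun_space V \<otimes>\<^sub>H K) \<phi> (app (adj (slice V K v)) k) =
      inner (fun_space V \<otimes>\<^sub>H K) \<phi> (pure (fun_space V) K (ket v) k)" .
qed

end

lemma adj_idm: "fd_hilbert H \<Longrightarrow> adj (idm H) = idm H"
  by (rule adj_unique[of H H]) auto

text \<open>Functoriality of the tensor product; it splits the cap
  \<open>\<epsilon> m \<otimes> id\<close> in condition (iii) into two known maps.\<close>

lemma tensor_map_comp:
  assumes fd: "fd_hilbert H" "fd_hilbert K" "fd_hilbert H'" "fd_hilbert K'" "fd_hilbert H''" "fd_hilbert K''"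
    and f: "f \<in> lin H H'" and g: "g \<in> lin K K'" and f': "f' \<in> lin H' H''" and g': "g' \<in> lin K' K''"
  shows "(f' \<circ>\<^sub>M f) \<otimes>\<^sub>M (g' \<circ>\<^sub>M g) = (f' \<otimes>\<^sub>M g') \<circ>\<^sub>M (f \<otimes>\<^sub>M g)"
proof (rule lin_eq_pureI[OF fd(1,2)])
  note c = comp_lin[OF f f' fd(3,5)] comp_lin[OF g g' fd(4,6)]
  show "fd_hilbert (H'' \<otimes>\<^sub>H K'')" using fd by auto
  show "(f' \<circ>\<^sub>M f) \<otimes>\<^sub>M (g' \<circ>\<^sub>M g) \<in> lin (H \<otimes>\<^sub>H K) (H'' \<otimes>\<^sub>H K'')"
    by (intro tensor_map_lin fd c)
  show "(f' \<otimes>\<^sub>M g') \<circ>\<^sub>M (f \<otimes>\<^sub>M g) \<in> lin (H \<otimes>\<^sub>H K) (H'' \<otimes>\<^sub>H K'')"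
    by (rule comp_lin[OF tensor_map_lin[OF fd(1-4) f g] tensor_map_lin[OF fd(3-6) f' g']])
      (use fd in auto)
  fix h k assume "h \<in> carrier H" "k \<in> carrier K"
  then show "app ((f' \<circ>\<^sub>M f) \<otimes>\<^sub>M (g' \<circ>\<^sub>M g)) (pure H K h k) = app ((f' \<otimes>\<^sub>M g') \<circ>\<^sub>M (f \<otimes>\<^sub>M g)) (pure H K h k)"
    by (simp add: app_tensor_map[OF fd(1,2,5,6) c] app_tensor_map[OF fd(1-4) f g]
        app_tensor_map[OF fd(3-6) f' g'] lin_closed[OF f] lin_closed[OF g])
qed

lemma tensor_map_idm:
  assumes "fd_hilbert H" "fd_hilbert K" shows "idm H \<otimes>\<^sub>M idm K = idm (H \<otimes>\<^sub>H K)"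
  by (rule lin_eq_pureI[OF assms])
    (use assms in \<open>auto simp: app_tensor_map[OF assms assms] intro!: tensor_map_lin\<close>)

section \<open>Structure maps in terms of components\<close>

context
  fixes V :: "'v set" and K :: "'a hilb"
  assumes V: "finite V" and K: "fd_hilbert K"
begin

interpretation X: fd_hilbert "fun_space V" by (rule fd_hilbert_fun_space[OF V])
interpretation K: fd_hilbert K by (rule K)
interpretation XK: fd_hilbert "fun_space V \<otimes>\<^sub>H K"
  by (rule fd_hilbert_tensor_space[OF X.fd_hilbert_axioms K])
interpretation XX: fd_hilbert "fun_space V \<otimes>\<^sub>H fun_space V"
  by (rule fd_hilbert_tensor_space[OF X.fd_hilbert_axioms X.fd_hilbert_axioms])

private abbreviation (input) X' :: "('v \<Rightarrow> complex) hilb" where "X' \<equiv> fun_space V"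

lemma slice_id_tensor:
  assumes L: "fd_hilbert L" and g: "g \<in> lin K L" and v: "v \<in> V"
    and \<phi>: "\<phi> \<in> carrier (X' \<otimes>\<^sub>H K)"
  shows "app (slice V L v) (app (idm X' \<otimes>\<^sub>M g) \<phi>) = app g (app (slice V K v) \<phi>)"
proof (rule fd_hilbert.eq_of_inner_eq[OF L])
  note t = tensor_map_spec[OF X.fd_hilbert_axioms K X.fd_hilbert_axioms L idm_lin[OF X.fd_hilbert_axioms] g]
  note t\<phi> = lin_closed[OF t(1) \<phi>]
  show "app (slice V L v) (app (idm X' \<otimes>\<^sub>M g) \<phi>) \<in> carrier L"
    by (rule slice_closed[OF V L v t\<phi>])
  show "app g (app (slice V K v) \<phi>) \<in> carrier L"
    by (rule lin_closed[OF g slice_closed[OF V K v \<phi>]])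
  fix l assume l: "l \<in> carrier L"
  note gl = lin_closed[OF adj_lin[OF K L g] l]
  have "inner L l (app (slice V L v) (app (idm X' \<otimes>\<^sub>M g) \<phi>)) = \<phi> (ket v, app (adj g) l)"
    using v unfolding inner_slice[OF V L v t\<phi> l] t(3)[OF \<phi> ket_closed[OF v] l]
    by (simp add: adj_idm[OF X.fd_hilbert_axioms] del: fun_space_simps)
  also have "\<dots> = inner L l (app g (app (slice V K v) \<phi>))"
    unfolding inner_slice[OF V K v \<phi> gl, symmetric]
    by (rule inner_adj_left[OF K L g slice_closed[OF V K v \<phi>] l])
  finally show "inner L l (app (slice V L v) (app (idm X' \<otimes>\<^sub>M g) \<phi>)) = inner L l (app g (app (slice V K v) \<phi>))" .
qed

lemma tensor_form_ket_expand:
  assumes \<phi>: "\<phi> \<in> carrier (X' \<otimes>\<^sub>H K)" and x: "x \<in> carrier X'" and k: "k \<in> carrier K"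
  shows "\<phi> (x, k) = (\<Sum>u\<in>V. cnj (x u) * \<phi> (ket u, k))"
proof -
  have "\<phi> (x, k) = \<phi> (finsum X' (\<lambda>u. x u \<odot>\<^bsub>X'\<^esub> ket u) V, k)"
    unfolding fun_space_expand[OF V x] ..
  also have "\<dots> = (\<Sum>u\<in>V. \<phi> (x u \<odot>\<^bsub>X'\<^esub> ket u, k))"
    by (intro tensor_form_finsum_left[OF X.fd_hilbert_axioms K \<phi> k] X.scale_closed ket_closed)
  also have "\<dots> = (\<Sum>u\<in>V. cnj (x u) * \<phi> (ket u, k))"
    by (intro sum.cong refl tensor_smult_left[OF \<phi>] ket_closed k)
  finally show ?thesis .
qed

text \<open>The components are mixed by the matrix of \<open>f\<close>. A matrix entry first appears
  conjugated, through the adjoint, and the antilinearity of the form in its first argument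
  conjugates it back.\<close>

lemma slice_tensor_id:
  assumes f: "f \<in> lin X' X'" and v: "v \<in> V" and \<phi>: "\<phi> \<in> carrier (X' \<otimes>\<^sub>H K)"
  shows "app (slice V K v) (app (f \<otimes>\<^sub>M idm K) \<phi>) =
    finsum K (\<lambda>u. app f (ket u) v \<odot>\<^bsub>K\<^esub> app (slice V K u) \<phi>) V"
proof (rule K.eq_of_inner_eq)
  note t = tensor_map_spec[OF X.fd_hilbert_axioms K X.fd_hilbert_axioms K f idm_lin[OF K]]
  note t\<phi> = lin_closed[OF t(1) \<phi>]
  note af = adj_lin[OF X.fd_hilbert_axioms X.fd_hilbert_axioms f]
  show "app (slice V K v) (app (f \<otimes>\<^sub>M idm K) \<phi>) \<in> carrier K"
    by (rule slice_closed[OF V K v t\<phi>])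
  show "finsum K (\<lambda>u. app f (ket u) v \<odot>\<^bsub>K\<^esub> app (slice V K u) \<phi>) V \<in> carrier K"
    by (intro K.fsum_closed K.scale_closed slice_closed[OF V K] \<phi>)
  fix k assume k: "k \<in> carrier K"
  have "inner K k (app (slice V K v) (app (f \<otimes>\<^sub>M idm K) \<phi>)) = \<phi> (app (adj f) (ket v), k)"
    unfolding inner_slice[OF V K v t\<phi> k] t(3)[OF \<phi> ket_closed[OF v] k]
    using k by (simp add: adj_idm[OF K])
  also have "\<dots> = (\<Sum>u\<in>V. cnj (app (adj f) (ket v) u) * \<phi> (ket u, k))"
    by (rule tensor_form_ket_expand[OF \<phi> lin_closed[OF af ket_closed[OF v]] k])
  also have "\<dots> = (\<Sum>u\<in>V. app f (ket u) v * inner K k (app (slice V K u) \<phi>))"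
  proof (intro sum.cong refl arg_cong2[where f = "(*)"])
    fix u assume u: "u \<in> V"
    note fu = lin_closed[OF f ket_closed[OF u]]
    have "app (adj f) (ket v) u = inner X' (ket u) (app (adj f) (ket v))"
      by (rule inner_ket_left[OF V u, symmetric])
    also have "\<dots> = inner X' (app f (ket u)) (ket v)"
      by (rule inner_adj_right[OF X.fd_hilbert_axioms X.fd_hilbert_axioms f ket_closed[OF u] ket_closed[OF v]])
    also have "\<dots> = cnj (inner X' (ket v) (app f (ket u)))"
      by (rule X.inner_cnj[OF ket_closed[OF v] fu])
    finally show "cnj (app (adj f) (ket v) u) = app f (ket u) v"
      by (simp only: inner_ket_left[OF V v] complex_cnj_cnj)
    show "\<phi> (ket u, k) = inner K k (app (slice V K u) \<phi>)"
      by (rule inner_slice[OF V K u \<phi> k, symmetric])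
  qed
  also have "\<dots> = inner K k (finsum K (\<lambda>u. app f (ket u) v \<odot>\<^bsub>K\<^esub> app (slice V K u) \<phi>) V)"
    using k slice_closed[OF V K _ \<phi>] by (subst K.inner_finsum_right) (auto simp: K.inner_smult)
  finally show "inner K k (app (slice V K v) (app (f \<otimes>\<^sub>M idm K) \<phi>)) =
    inner K k (finsum K (\<lambda>u. app f (ket u) v \<odot>\<^bsub>K\<^esub> app (slice V K u) \<phi>) V)" .
qed

text \<open>The adjoint of the counit is the unit, which sends 1 to the sum of all kets. Hence
  applying the counit adds up the components.\<close>

lemma counit_slice:
  assumes \<phi>: "\<phi> \<in> carrier (X' \<otimes>\<^sub>H K)"
  shows "app (lunit K) (app (frob_counit V \<otimes>\<^sub>M idm K) \<phi>) = finsum K (\<lambda>v. app (slice V K v) \<phi>) V"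
proof (rule K.eq_of_inner_eq)
  note t = tensor_map_spec[OF X.fd_hilbert_axioms K fd_hilbert_unit_space K frob_counit_lin[OF V] idm_lin[OF K]]
  note t\<phi> = lin_closed[OF t(1) \<phi>]
  show "app (lunit K) (app (frob_counit V \<otimes>\<^sub>M idm K) \<phi>) \<in> carrier K"
    by (rule lin_closed[OF lunit_lin[OF K] t\<phi>])
  show "finsum K (\<lambda>v. app (slice V K v) \<phi>) V \<in> carrier K"
    by (intro K.fsum_closed slice_closed[OF V K] \<phi>)
  fix k assume k: "k \<in> carrier K"
  have "inner K k (app (lunit K) (app (frob_counit V \<otimes>\<^sub>M idm K) \<phi>)) = \<phi> (finsum X' ket V, k)"
    unfolding inner_lunit[OF K t\<phi> k]
    using k by (subst t(3)[OF \<phi> _ k]) (simp_all add: adj_idm[OF K] adj_frob_counit[OF V] app_frob_unit[OF V])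
  also have "\<dots> = (\<Sum>v\<in>V. \<phi> (ket v, k))"
    by (intro tensor_form_finsum_left[OF X.fd_hilbert_axioms K \<phi> k] ket_closed)
  also have "\<dots> = inner K k (finsum K (\<lambda>v. app (slice V K v) \<phi>) V)"
    using k slice_closed[OF V K _ \<phi>] inner_slice[OF V K _ \<phi> k] by (subst K.inner_finsum_right) auto
  finally show "inner K k (app (lunit K) (app (frob_counit V \<otimes>\<^sub>M idm K) \<phi>)) =
    inner K k (finsum K (\<lambda>v. app (slice V K v) \<phi>) V)" .
qed

text \<open>Evaluating at \<open>|v\<rangle> \<otimes> |w\<rangle>\<close> applies the adjoint
  \<open>m\<close> of the comultiplication to this pair, which leaves only the diagonal.\<close>

lemma slice_slice_comult:
  assumes \<phi>: "\<phi> \<in> carrier (X' \<otimes>\<^sub>H K)" and v: "v \<in> V" and w: "w \<in> V"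
  shows "app (slice V K w) (app (slice V (X' \<otimes>\<^sub>H K) v) (app (assoc X' X' K) (app (frob_comult V \<otimes>\<^sub>M idm K) \<phi>))) =
    (if v = w then app (slice V K v) \<phi> else \<zero>\<^bsub>K\<^esub>)"
proof (rule K.eq_of_inner_eq)
  note t = tensor_map_spec[OF X.fd_hilbert_axioms K XX.fd_hilbert_axioms K frob_comult_lin[OF V] idm_lin[OF K]]
  note t\<phi> = lin_closed[OF t(1) \<phi>]
  note a\<phi> = lin_closed[OF assoc_lin[OF X.fd_hilbert_axioms X.fd_hilbert_axioms K] t\<phi>]
  note s\<phi> = slice_closed[OF V XK.fd_hilbert_axioms v a\<phi>]
  show "app (slice V K w) (app (slice V (X' \<otimes>\<^sub>H K) v) (app (assoc X' X' K) (app (frob_comult V \<otimes>\<^sub>M idm K) \<phi>))) \<in> carrier K"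
    by (rule slice_closed[OF V K w s\<phi>])
  show "(if v = w then app (slice V K v) \<phi> else \<zero>\<^bsub>K\<^esub>) \<in> carrier K"
    using slice_closed[OF V K v \<phi>] by (cases "v = w") simp_all
  fix k assume k: "k \<in> carrier K"
  note pk = pure_closed[OF X.fd_hilbert_axioms K ket_closed[OF w] k]
  note pp = pure_closed[OF X.fd_hilbert_axioms X.fd_hilbert_axioms ket_closed[OF v] ket_closed[OF w]]
  have "inner K k (app (slice V K w) (app (slice V (X' \<otimes>\<^sub>H K) v) (app (assoc X' X' K) (app (frob_comult V \<otimes>\<^sub>M idm K) \<phi>)))) =
    app (assoc X' X' K) (app (frob_comult V \<otimes>\<^sub>M idm K) \<phi>) (ket v, pure X' K (ket w) k)"
    unfolding inner_slice[OF V K w s\<phi> k] inner_slice[OF V XK.fd_hilbert_axioms v a\<phi> pk, symmetric]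
    by (rule inner_pure_left[OF X.fd_hilbert_axioms K s\<phi> ket_closed[OF w] k, symmetric])
  also have "\<dots> = \<phi> (if v = w then ket v else \<zero>\<^bsub>X'\<^esub>, k)"
    unfolding assoc_apply[OF X.fd_hilbert_axioms X.fd_hilbert_axioms K t\<phi> ket_closed[OF v] ket_closed[OF w] k]
      t(3)[OF \<phi> pp k] adj_frob_comult[OF V] app_frob_mult[OF V v w]
    using k by (simp add: adj_idm[OF K])
  also have "\<dots> = inner K k (if v = w then app (slice V K v) \<phi> else \<zero>\<^bsub>K\<^esub>)"
    using inner_slice[OF V K v \<phi> k] tensor_form_zero(1)[OF X.fd_hilbert_axioms K \<phi> ket_closed[OF v] k] k
    by (cases "v = w") simp_all
  finally show "inner K k (app (slice V K w) (app (slice V (X' \<otimes>\<^sub>H K) v) (app (assoc X' X' K) (app (frob_comult V \<otimes>\<^sub>M idm K) \<phi>)))) =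
    inner K k (if v = w then app (slice V K v) \<phi> else \<zero>\<^bsub>K\<^esub>)" .
qed

text \<open>Dual to the comultiplication: the adjoint of \<open>m\<close> doubles
  \<open>|v\<rangle>\<close>, so the component at \<open>v\<close> of the product is the diagonal
  double component.\<close>

lemma slice_mult:
  assumes \<chi>: "\<chi> \<in> carrier (X' \<otimes>\<^sub>H (X' \<otimes>\<^sub>H K))" and v: "v \<in> V"
  shows "app (slice V K v) (app (frob_mult V \<otimes>\<^sub>M idm K) (app (assoc_inv X' X' K) \<chi>)) =
    app (slice V K v) (app (slice V (X' \<otimes>\<^sub>H K) v) \<chi>)"
proof (rule K.eq_of_inner_eq)
  note a\<chi> = lin_closed[OF assoc_inv_lin[OF X.fd_hilbert_axioms X.fd_hilbert_axioms K] \<chi>]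
  note t = tensor_map_spec[OF XX.fd_hilbert_axioms K X.fd_hilbert_axioms K frob_mult_lin[OF V] idm_lin[OF K]]
  note t\<chi> = lin_closed[OF t(1) a\<chi>]
  note s\<chi> = slice_closed[OF V XK.fd_hilbert_axioms v \<chi>]
  show "app (slice V K v) (app (frob_mult V \<otimes>\<^sub>M idm K) (app (assoc_inv X' X' K) \<chi>)) \<in> carrier K"
    by (rule slice_closed[OF V K v t\<chi>])
  show "app (slice V K v) (app (slice V (X' \<otimes>\<^sub>H K) v) \<chi>) \<in> carrier K"
    by (rule slice_closed[OF V K v s\<chi>])
  fix k assume k: "k \<in> carrier K"
  note pk = pure_closed[OF X.fd_hilbert_axioms K ket_closed[OF v] k]
  have "inner K k (app (slice V K v) (app (frob_mult V \<otimes>\<^sub>M idm K) (app (assoc_inv X' X' K) \<chi>))) =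
      \<chi> (ket v, pure X' K (ket v) k)"
    unfolding inner_slice[OF V K v t\<chi> k] t(3)[OF a\<chi> ket_closed[OF v] k]
      frob_comult_def[symmetric] app_frob_comult[OF V v]
    using k assoc_inv_apply[OF X.fd_hilbert_axioms X.fd_hilbert_axioms K \<chi> ket_closed[OF v] ket_closed[OF v] k]
    by (simp add: adj_idm[OF K])
  also have "\<dots> = inner K k (app (slice V K v) (app (slice V (X' \<otimes>\<^sub>H K) v) \<chi>))"
    unfolding inner_slice[OF V K v s\<chi> k] inner_slice[OF V XK.fd_hilbert_axioms v \<chi> pk, symmetric]
    by (rule inner_pure_left[OF X.fd_hilbert_axioms K s\<chi> ket_closed[OF v] k])
  finally show "inner K k (app (slice V K v) (app (frob_mult V \<otimes>\<^sub>M idm K) (app (assoc_inv X' X' K) \<chi>))) =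
    inner K k (app (slice V K v) (app (slice V (X' \<otimes>\<^sub>H K) v) \<chi>))" .
qed

lemma slice_assoc:
  assumes L: "fd_hilbert L" and \<xi>: "\<xi> \<in> carrier ((X' \<otimes>\<^sub>H K) \<otimes>\<^sub>H L)" and v: "v \<in> V"
  shows "app (slice V (K \<otimes>\<^sub>H L) v) (app (assoc X' K L) \<xi>) = app (slice V K v \<otimes>\<^sub>M idm L) \<xi>"
proof (rule tensor_eqI[OF K L])
  interpret KL: fd_hilbert "K \<otimes>\<^sub>H L" by (rule fd_hilbert_tensor_space[OF K L])
  note t = tensor_map_spec[OF XK.fd_hilbert_axioms L K L slice_lin[OF V K v] idm_lin[OF L]]
  note a\<xi> = lin_closed[OF assoc_lin[OF X.fd_hilbert_axioms K L] \<xi>]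
  note s\<xi> = slice_closed[OF V KL.fd_hilbert_axioms v a\<xi>]
  show "app (slice V (K \<otimes>\<^sub>H L) v) (app (assoc X' K L) \<xi>) \<in> carrier (K \<otimes>\<^sub>H L)" by (rule s\<xi>)
  show "app (slice V K v \<otimes>\<^sub>M idm L) \<xi> \<in> carrier (K \<otimes>\<^sub>H L)" by (rule lin_closed[OF t(1) \<xi>])
  fix k l assume k: "k \<in> carrier K" and l: "l \<in> carrier L"
  have "app (slice V (K \<otimes>\<^sub>H L) v) (app (assoc X' K L) \<xi>) (k, l) = \<xi> (pure X' K (ket v) k, l)"
    unfolding inner_pure_left[OF K L s\<xi> k l, symmetric] inner_slice[OF V KL.fd_hilbert_axioms v a\<xi> pure_closed[OF K L k l]]
    by (rule assoc_apply[OF X.fd_hilbert_axioms K L \<xi> ket_closed[OF v] k l])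
  then show "app (slice V (K \<otimes>\<^sub>H L) v) (app (assoc X' K L) \<xi>) (k, l) = app (slice V K v \<otimes>\<^sub>M idm L) \<xi> (k, l)"
    unfolding t(3)[OF \<xi> k l] adj_slice[OF V K v k] using l by (simp add: adj_idm[OF L])
qed

text \<open>The map \<open>\<epsilon> m\<close> is the cap of the self-duality of \<complex>^V: it
  contracts two legs by summing over equal indices.\<close>

lemma counit_mult_slice:
  assumes \<chi>: "\<chi> \<in> carrier (X' \<otimes>\<^sub>H (X' \<otimes>\<^sub>H K))"
  shows "app (lunit K) (app ((frob_counit V \<circ>\<^sub>M frob_mult V) \<otimes>\<^sub>M idm K) (app (assoc_inv X' X' K) \<chi>)) =
    finsum K (\<lambda>v. app (slice V K v) (app (slice V (X' \<otimes>\<^sub>H K) v) \<chi>)) V"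
proof -
  note a\<chi> = lin_closed[OF assoc_inv_lin[OF X.fd_hilbert_axioms X.fd_hilbert_axioms K] \<chi>]
  note t\<chi> = lin_closed[OF tensor_map_lin[OF XX.fd_hilbert_axioms K X.fd_hilbert_axioms K frob_mult_lin[OF V] idm_lin[OF K]] a\<chi>]
  have "(frob_counit V \<circ>\<^sub>M frob_mult V) \<otimes>\<^sub>M idm K =
      (frob_counit V \<otimes>\<^sub>M idm K) \<circ>\<^sub>M (frob_mult V \<otimes>\<^sub>M idm K)"
    using tensor_map_comp[OF XX.fd_hilbert_axioms K X.fd_hilbert_axioms K fd_hilbert_unit_space K
        frob_mult_lin[OF V] idm_lin[OF K] frob_counit_lin[OF V] idm_lin[OF K]]
    by (simp add: comp_idm_right[OF K K idm_lin[OF K]])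
  then have "app (lunit K) (app ((frob_counit V \<circ>\<^sub>M frob_mult V) \<otimes>\<^sub>M idm K) (app (assoc_inv X' X' K) \<chi>)) =
      finsum K (\<lambda>v. app (slice V K v) (app (frob_mult V \<otimes>\<^sub>M idm K) (app (assoc_inv X' X' K) \<chi>))) V"
    by (simp add: counit_slice[OF t\<chi>])
  also have "\<dots> = finsum K (\<lambda>v. app (slice V K v) (app (slice V (X' \<otimes>\<^sub>H K) v) \<chi>)) V"
    by (rule K.finsum_cong')
      (auto simp: slice_mult[OF \<chi>] intro!: slice_closed[OF V K] slice_closed[OF V XK.fd_hilbert_axioms] \<chi>)
  finally show ?thesis .
qed

end

section \<open>Quantum isomorphisms as magic unitaries\<close>

text \<open>The operators \<open>P\<^sub>v\<^sub>w\<close> on \<open>H\<close> with \<open>P (h \<otimes> |w\<rangle>) = \<Sum>\<^sub>v |v\<rangle> \<otimes> P\<^sub>v\<^sub>w h\<close>.\<close>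

definition entry :: "'v set \<Rightarrow> 'h hilb \<Rightarrow> ('v, 'h) qmap \<Rightarrow> 'v \<Rightarrow> 'v \<Rightarrow> ('h, 'h) arr" where
  "entry V H P v w = \<lparr>src = H, tgt = H, app = (\<lambda>h. if h \<in> carrier H
    then app (slice V H v) (app P (pure H (fun_space V) h (ket w))) else \<zero>\<^bsub>H\<^esub>)\<rparr>"

text \<open>The map with matrix \<open>a\<close>, inverse to \<open>entry\<close>. A general \<phi>
  can be evaluated but is not given as a sum of pure tensors, so \<open>a v w\<close> acts through
  its adjoint on the argument; \<open>cnj (x v)\<close> is the inner product of \<open>x\<close>
  with \<open>ket v\<close>.\<close>

definition of_entries :: "'v set \<Rightarrow> 'h hilb \<Rightarrow> ('v \<Rightarrow> 'v \<Rightarrow> ('h, 'h) arr) \<Rightarrow> ('v, 'h) qmap" where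
  "of_entries V H a = \<lparr>src = H \<otimes>\<^sub>H fun_space V, tgt = fun_space V \<otimes>\<^sub>H H,
    app = (\<lambda>\<phi>. if \<phi> \<in> carrier (H \<otimes>\<^sub>H fun_space V)
      then (\<lambda>(x, h). if x \<in> carrier (fun_space V) \<and> h \<in> carrier H
        then \<Sum>v\<in>V. \<Sum>w\<in>V. cnj (x v) * \<phi> (app (adj (a v w)) h, ket w) else 0) else (\<lambda>_. 0))\<rparr>"

text \<open>A magic unitary in the sense of quantum permutation groups that commutes with the
  adjacency matrix. Sums are taken after application to a vector, so that they are finite sums in
  \<open>H\<close> and not in the operator algebra.\<close>

definition magic_unitary :: "'v pair_pre_digraph \<Rightarrow> 'h hilb \<Rightarrow> ('v \<Rightarrow> 'v \<Rightarrow> ('h, 'h) arr) \<Rightarrow> bool" where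
  "magic_unitary G H a \<longleftrightarrow> (let V = pverts G in
    (\<forall>v\<in>V. \<forall>w\<in>V. a v w \<in> lin H H \<and> a v w \<circ>\<^sub>M a v w = a v w \<and> adj (a v w) = a v w) \<and>
    (\<forall>w\<in>V. \<forall>h\<in>carrier H. finsum H (\<lambda>v. app (a v w) h) V = h) \<and>
    (\<forall>v\<in>V. \<forall>h\<in>carrier H. finsum H (\<lambda>w. app (a v w) h) V = h) \<and>
    (\<forall>v\<in>V. \<forall>w\<in>V. \<forall>h\<in>carrier H.
      finsum H (\<lambda>u. adjacency G v u \<odot>\<^bsub>H\<^esub> app (a u w) h) V =
      finsum H (\<lambda>u. adjacency G u w \<odot>\<^bsub>H\<^esub> app (a v u) h) V))"

text \<open>The identity \<open>\<Sum>\<^sub>v \<parallel>p\<^sub>v p\<^sub>u h\<parallel>\<^sup>2 = \<parallel>p\<^sub>u h\<parallel>\<^sup>2\<close> leaves no room for the terms with \<open>v \<noteq> u\<close>.\<close>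

lemma projections_orthogonal:
  assumes H: "fd_hilbert H" and V: "finite V"
    and p: "\<And>v. v \<in> V \<Longrightarrow> p v \<in> lin H H \<and> p v \<circ>\<^sub>M p v = p v \<and> adj (p v) = p v"
    and sum: "\<And>h. h \<in> carrier H \<Longrightarrow> finsum H (\<lambda>v. app (p v) h) V = h"
    and u: "u \<in> V" and v: "v \<in> V" and h: "h \<in> carrier H"
  shows "app (p v) (app (p u) h) = (if v = u then app (p u) h else \<zero>\<^bsub>H\<^esub>)"
proof (cases "v = u")
  case True
  then show ?thesis using p[OF u] by (metis comp_app)
next
  case False
  interpret H: fd_hilbert H by (rule H)
  have pl: "app (p w) x \<in> carrier H" if "w \<in> V" "x \<in> carrier H" for w x
    using p[OF that(1)] that(2) by (blast intro: lin_closed)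
  define g where "g = app (p u) h"
  have g: "g \<in> carrier H" unfolding g_def using u h by (rule pl)
  have pw: "inner H (app (p w) g) (app (p w) g) = inner H g (app (p w) g)" if w: "w \<in> V" for w
  proof -
    have "inner H g (app (adj (p w)) (app (p w) g)) = inner H (app (p w) g) (app (p w) g)"
      using p[OF w] pl[OF w g] g by (intro inner_adj_right[OF H H]) auto
    moreover have "app (p w) (app (p w) g) = app (p w) g" using p[OF w] by (metis comp_app)
    ultimately show ?thesis using p[OF w] by simp
  qed
  have "(\<Sum>w\<in>V. inner H (app (p w) g) (app (p w) g)) = inner H g (finsum H (\<lambda>w. app (p w) g) V)"
    using g pl by (subst H.inner_finsum_right) (auto simp: pw)
  also have "\<dots> = inner H g g" using sum[OF g] by simp
  finally have "(\<Sum>w\<in>V. Re (inner H (app (p w) g) (app (p w) g))) = Re (inner H g g)"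
    by (simp only: flip: Re_sum)
  moreover have "app (p u) g = g" unfolding g_def using p[OF u] by (metis comp_app)
  ultimately have "(\<Sum>w\<in>V - {u}. Re (inner H (app (p w) g) (app (p w) g))) = 0"
    by (simp add: sum.remove[OF V u])
  then have "Re (inner H (app (p v) g) (app (p v) g)) = 0"
    using V v False g pl by (subst (asm) sum_nonneg_eq_0_iff) (auto intro: H.inner_self_nonneg)
  then have "app (p v) g = \<zero>\<^bsub>H\<^esub>" using H.inner_pos[OF pl[OF v g]] by force
  with False show ?thesis by (simp add: g_def)
qed

context
  fixes V :: "'v set" and H :: "'h hilb"
  assumes V: "finite V" and H: "fd_hilbert H"
begin

interpretation X: fd_hilbert "fun_space V" by (rule fd_hilbert_fun_space[OF V])
interpretation H: fd_hilbert H by (rule H)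

private abbreviation (input) Y :: "('v \<Rightarrow> complex) hilb" where "Y \<equiv> fun_space V"

lemma pure_ket_closed:
  "h \<in> carrier H \<Longrightarrow> w \<in> V \<Longrightarrow> pure H Y h (ket w) \<in> carrier (H \<otimes>\<^sub>H Y)"
  by (intro pure_closed H X.fd_hilbert_axioms ket_closed)

lemma app_entry: "h \<in> carrier H \<Longrightarrow> app (entry V H P v w) h = app (slice V H v) (app P (pure H Y h (ket w)))"
  by (simp add: entry_def)

lemma entry_lin:
  assumes P: "P \<in> lin (H \<otimes>\<^sub>H Y) (Y \<otimes>\<^sub>H H)" and v: "v \<in> V" and w: "w \<in> V"
  shows "entry V H P v w \<in> lin H H"
proof (rule linI)
  note cl = lin_closed[OF P pure_ket_closed[OF _ w]]
  note s = slice_lin[OF V H v]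
  fix x assume x: "x \<in> carrier H"
  show "app (entry V H P v w) x \<in> carrier H"
    using lin_closed[OF s cl[OF x]] x by (simp add: app_entry)
  show "app (entry V H P v w) (c \<odot>\<^bsub>H\<^esub> x) = c \<odot>\<^bsub>H\<^esub> app (entry V H P v w) x" for c
    using x by (simp add: app_entry pure_smult_left[OF H X.fd_hilbert_axioms] lin_smult[OF P pure_ket_closed[OF _ w]]
        lin_smult[OF s cl] del: tensor_space_simps)
  fix y assume y: "y \<in> carrier H"
  show "app (entry V H P v w) (x \<oplus>\<^bsub>H\<^esub> y) = app (entry V H P v w) x \<oplus>\<^bsub>H\<^esub> app (entry V H P v w) y"
    using x y by (simp add: app_entry pure_add_left[OF H X.fd_hilbert_axioms] lin_add[OF P pure_ket_closed[OF _ w] pure_ket_closed[OF _ w]]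
        lin_add[OF s cl cl] del: tensor_space_simps)
qed (simp_all add: entry_def)

lemma lin_eq_ketI:
  assumes L: "fd_hilbert L" and f: "f \<in> lin (H \<otimes>\<^sub>H Y) L" and g: "g \<in> lin (H \<otimes>\<^sub>H Y) L"
    and eq: "\<And>h w. h \<in> carrier H \<Longrightarrow> w \<in> V \<Longrightarrow> app f (pure H Y h (ket w)) = app g (pure H Y h (ket w))"
  shows "f = g"
  by (rule lin_eq_pure_onbI[OF H X.fd_hilbert_axioms L H.onb_bas onb_fun_space[OF V] f g])
    (use eq H.onb_carrier[OF H.onb_bas] in blast)

lemma eq_of_entries:
  assumes P: "P \<in> lin (H \<otimes>\<^sub>H Y) (Y \<otimes>\<^sub>H H)" and Q: "Q \<in> lin (H \<otimes>\<^sub>H Y) (Y \<otimes>\<^sub>H H)"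
    and eq: "\<And>v w. v \<in> V \<Longrightarrow> w \<in> V \<Longrightarrow> entry V H P v w = entry V H Q v w"
  shows "P = Q"
proof (rule lin_eq_ketI[OF fd_hilbert_tensor_space[OF X.fd_hilbert_axioms H] P Q])
  fix h w assume h: "h \<in> carrier H" and w: "w \<in> V"
  show "app P (pure H Y h (ket w)) = app Q (pure H Y h (ket w))"
  proof (rule slice_eqI[OF V H lin_closed[OF P pure_ket_closed[OF h w]] lin_closed[OF Q pure_ket_closed[OF h w]]])
    fix v assume "v \<in> V"
    then show "app (slice V H v) (app P (pure H Y h (ket w))) = app (slice V H v) (app Q (pure H Y h (ket w)))"
      using eq[OF _ w] by (simp flip: app_entry[OF h])
  qed
qed

lemma of_entries_lin:
  assumes a: "\<And>v w. v \<in> V \<Longrightarrow> w \<in> V \<Longrightarrow> a v w \<in> lin H H"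
  shows "of_entries V H a \<in> lin (H \<otimes>\<^sub>H Y) (Y \<otimes>\<^sub>H H)"
proof (rule linI)
  interpret HY: fd_hilbert "H \<otimes>\<^sub>H Y" by (rule fd_hilbert_tensor_space[OF H X.fd_hilbert_axioms])
  note aa = adj_lin[OF H H a]
  fix \<phi> assume \<phi>: "\<phi> \<in> carrier (H \<otimes>\<^sub>H Y)"
  show "app (of_entries V H a) \<phi> \<in> carrier (Y \<otimes>\<^sub>H H)"
  proof (rule tensor_carrierI)
    fix x h h' assume x: "x \<in> carrier Y" and h: "h \<in> carrier H" "h' \<in> carrier H"
    have "\<phi> (app (adj (a v w)) (h \<oplus>\<^bsub>H\<^esub> h'), ket w) =
        \<phi> (app (adj (a v w)) h, ket w) + \<phi> (app (adj (a v w)) h', ket w)" if "v \<in> V" "w \<in> V" for v w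
      unfolding lin_add[OF aa[OF that] h] using that
      by (intro tensor_add_left[OF \<phi>] lin_closed[OF aa] h ket_closed)
    then show "app (of_entries V H a) \<phi> (x, h \<oplus>\<^bsub>H\<^esub> h') =
        app (of_entries V H a) \<phi> (x, h) + app (of_entries V H a) \<phi> (x, h')"
      using x h \<phi> by (simp add: of_entries_def ring_distribs sum.distrib cong: sum.cong del: fun_space_simps)
  next
    fix x h c assume x: "x \<in> carrier Y" and h: "h \<in> carrier H"
    have "\<phi> (app (adj (a v w)) (c \<odot>\<^bsub>H\<^esub> h), ket w) = cnj c * \<phi> (app (adj (a v w)) h, ket w)"
      if "v \<in> V" "w \<in> V" for v w
      unfolding lin_smult[OF aa[OF that] h] using that
      by (intro tensor_smult_left[OF \<phi>] lin_closed[OF aa] h ket_closed)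
    then show "app (of_entries V H a) \<phi> (x, c \<odot>\<^bsub>H\<^esub> h) = cnj c * app (of_entries V H a) \<phi> (x, h)"
      using x h \<phi> by (simp add: of_entries_def sum_distrib_left mult.left_commute cong: sum.cong del: fun_space_simps)
    have "c \<odot>\<^bsub>Y\<^esub> x \<in> carrier Y" using x by (rule X.scale_closed)
    then show "app (of_entries V H a) \<phi> (c \<odot>\<^bsub>Y\<^esub> x, h) = cnj c * app (of_entries V H a) \<phi> (x, h)"
      using x h \<phi> by (simp add: of_entries_def sum_distrib_left mult.assoc)
  next
    fix x x' h assume x: "x \<in> carrier Y" "x' \<in> carrier Y" and h: "h \<in> carrier H"
    have "x \<oplus>\<^bsub>Y\<^esub> x' \<in> carrier Y" using x by (rule X.add_closed)
    then show "app (of_entries V H a) \<phi> (x \<oplus>\<^bsub>Y\<^esub> x', h) =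
        app (of_entries V H a) \<phi> (x, h) + app (of_entries V H a) \<phi> (x', h)"
      using x h \<phi> by (simp add: of_entries_def ring_distribs sum.distrib)
  qed (auto simp: of_entries_def)
  show "app (of_entries V H a) (c \<odot>\<^bsub>H \<otimes>\<^sub>H Y\<^esub> \<phi>) = c \<odot>\<^bsub>Y \<otimes>\<^sub>H H\<^esub> app (of_entries V H a) \<phi>" for c
    using HY.scale_closed[OF \<phi>] \<phi>
    by (auto simp: of_entries_def fun_eq_iff sum_distrib_left mult.left_commute)
  fix \<psi> assume \<psi>: "\<psi> \<in> carrier (H \<otimes>\<^sub>H Y)"
  show "app (of_entries V H a) (\<phi> \<oplus>\<^bsub>H \<otimes>\<^sub>H Y\<^esub> \<psi>) = app (of_entries V H a) \<phi> \<oplus>\<^bsub>Y \<otimes>\<^sub>H H\<^esub> app (of_entries V H a) \<psi>"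
    using HY.add_closed[OF \<phi> \<psi>] \<phi> \<psi>
    by (auto simp: of_entries_def fun_eq_iff ring_distribs sum.distrib)
qed (auto simp: of_entries_def)

lemma entry_of_entries:
  assumes a: "\<And>v w. v \<in> V \<Longrightarrow> w \<in> V \<Longrightarrow> a v w \<in> lin H H" and v: "v \<in> V" and w: "w \<in> V"
  shows "entry V H (of_entries V H a) v w = a v w"
proof (rule lin_eq_formI[OF H H entry_lin[OF of_entries_lin[OF a] v w] a[OF v w]])
  fix h k assume h: "h \<in> carrier H" and k: "k \<in> carrier H"
  note p = pure_ket_closed[OF h w]
  have "inner H k (app (entry V H (of_entries V H a) v w) h) =
      app (of_entries V H a) (pure H Y h (ket w)) (ket v, k)"
    unfolding app_entry[OF h]
    by (rule inner_slice[OF V H v lin_closed[OF of_entries_lin[OF a] p] k])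
  also have "\<dots> = (\<Sum>v'\<in>V. \<Sum>w'\<in>V. cnj (ket v v') * pure H Y h (ket w) (app (adj (a v' w')) k, ket w'))"
    using p k ket_closed[OF v] by (simp add: of_entries_def del: fun_space_simps)
  \<comment> \<open>Both kets act as Kronecker deltas, which collapse the double sum to the single
    entry at \<open>(v, w)\<close>; the adjoint in \<open>of_entries\<close> is undone by the inner
    product.\<close>
  also have "\<dots> = (\<Sum>v'\<in>V. if v' = v then (\<Sum>w'\<in>V. if w' = w then inner H k (app (a v' w') h) else 0) else 0)"
  proof (rule sum.cong[OF refl])
    fix v' assume v': "v' \<in> V"
    have "pure H Y h (ket w) (app (adj (a v' w')) k, ket w') = (if w' = w then inner H k (app (a v' w') h) else 0)"
      if w': "w' \<in> V" for w'
      unfolding pure_apply[OF lin_closed[OF adj_lin[OF H H a[OF v' w']] k] ket_closed[OF w']]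
        inner_adj_left[OF H H a[OF v' w'] h k] inner_ket_left[OF V w'] ket_apply by simp
    then have "(\<Sum>w'\<in>V. cnj (ket v v') * pure H Y h (ket w) (app (adj (a v' w')) k, ket w')) =
        (\<Sum>w'\<in>V. cnj (ket v v') * (if w' = w then inner H k (app (a v' w') h) else 0))"
      by (intro sum.cong refl) simp
    also have "\<dots> = (if v' = v then (\<Sum>w'\<in>V. if w' = w then inner H k (app (a v' w') h) else 0) else 0)"
      by (simp add: ket_apply)
    finally show "(\<Sum>w'\<in>V. cnj (ket v v') * pure H Y h (ket w) (app (adj (a v' w')) k, ket w')) =
        (if v' = v then (\<Sum>w'\<in>V. if w' = w then inner H k (app (a v' w') h) else 0) else 0)" .
  qed
  also have "\<dots> = inner H k (app (a v w) h)" using V v w by simp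
  finally show "inner H k (app (entry V H (of_entries V H a) v w) h) = inner H k (app (a v w) h)" .
qed

end

section \<open>The conditions on \<open>P\<close> as conditions on its entries\<close>

context
  fixes V :: "'v set" and H :: "'h hilb" and P :: "('v, 'h) qmap"
  assumes V: "finite V" and H: "fd_hilbert H"
    and P: "P \<in> lin (H \<otimes>\<^sub>H fun_space V) (fun_space V \<otimes>\<^sub>H H)"
begin

private abbreviation (input) Q where "Q \<equiv> fun_space V"
private abbreviation (input) a where "a \<equiv> entry V H P"

interpretation Q: fd_hilbert Q by (rule fd_hilbert_fun_space[OF V])
interpretation H: fd_hilbert H by (rule H)

text \<open>The spaces through which the composites in the conditions pass, listed so that later
  proofs can select them by position.\<close>

lemma fd_hilbert_spaces:
  "fd_hilbert Q" "fd_hilbert (Q \<otimes>\<^sub>H Q)" "fd_hilbert (Q \<otimes>\<^sub>H H)" "fd_hilbert (H \<otimes>\<^sub>H Q)"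
  "fd_hilbert (Q \<otimes>\<^sub>H (Q \<otimes>\<^sub>H H))" "fd_hilbert ((Q \<otimes>\<^sub>H H) \<otimes>\<^sub>H Q)" "fd_hilbert (Q \<otimes>\<^sub>H (H \<otimes>\<^sub>H Q))"
  "fd_hilbert ((H \<otimes>\<^sub>H Q) \<otimes>\<^sub>H Q)" "fd_hilbert (H \<otimes>\<^sub>H (Q \<otimes>\<^sub>H Q))"
  using Q.fd_hilbert_axioms H by auto

private lemmas fd = fd_hilbert_spaces
private lemmas fds = H fd fd_hilbert_unit_space
private lemmas idX = idm_lin[OF fd(1)]
private lemmas idH = idm_lin[OF H]
private lemmas PidX = tensor_map_spec[OF fd(4,1,3,1) P idX]
private lemmas idXP = tensor_map_spec[OF fd(1,4,1,3) idX P]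
private lemmas as = assoc_lin[OF fd(1) H fd(1)]
private lemmas ai = assoc_inv_lin[OF H fd(1,1)]

private lemmas a_lin = entry_lin[OF V H P]

lemma entry_closed: "v \<in> V \<Longrightarrow> w \<in> V \<Longrightarrow> h \<in> carrier H \<Longrightarrow> app (a v w) h \<in> carrier H"
  by (rule lin_closed[OF a_lin])

lemma app_pure_ket_closed: "h \<in> carrier H \<Longrightarrow> w \<in> V \<Longrightarrow> app P (pure H Q h (ket w)) \<in> carrier (Q \<otimes>\<^sub>H H)"
  by (rule lin_closed[OF P pure_ket_closed[OF V H]])

private lemma pure_kets: "u \<in> V \<Longrightarrow> w \<in> V \<Longrightarrow> pure Q Q (ket u) (ket w) \<in> carrier (Q \<otimes>\<^sub>H Q)"
  by (intro pure_closed fd ket_closed)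

lemma slice_app_pure_ket: "h \<in> carrier H \<Longrightarrow> app (slice V H v) (app P (pure H Q h (ket w))) = app (a v w) h"
  by (simp add: app_entry[OF V H])

private lemma slice_zero: "fd_hilbert K \<Longrightarrow> v \<in> V \<Longrightarrow> app (slice V K v) \<zero>\<^bsub>Q \<otimes>\<^sub>H K\<^esub> = \<zero>\<^bsub>K\<^esub>"
  by (rule lin_zero[OF _ _ slice_lin[OF V]]) (auto simp: fd)

lemma eq_iff_slices:
  assumes "S \<in> lin (H \<otimes>\<^sub>H Q) (Q \<otimes>\<^sub>H H)" "T \<in> lin (H \<otimes>\<^sub>H Q) (Q \<otimes>\<^sub>H H)"
  shows "S = T \<longleftrightarrow> (\<forall>h\<in>carrier H. \<forall>w\<in>V. \<forall>v\<in>V.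
    app (slice V H v) (app S (pure H Q h (ket w))) = app (slice V H v) (app T (pure H Q h (ket w))))"
proof (intro iffI lin_eq_ketI[OF V H fd(3) assms])
  fix h w assume "\<forall>h\<in>carrier H. \<forall>w\<in>V. \<forall>v\<in>V.
    app (slice V H v) (app S (pure H Q h (ket w))) = app (slice V H v) (app T (pure H Q h (ket w)))"
    "h \<in> carrier H" "w \<in> V"
  then show "app S (pure H Q h (ket w)) = app T (pure H Q h (ket w))"
    by (intro slice_eqI[OF V H] lin_closed[OF assms(1)] lin_closed[OF assms(2)] pure_ket_closed[OF V H]) auto
qed simp

text \<open>Conditions (i), (iv) and (v) compare maps with three different shapes of source and
  target; this criterion and the next two reduce each of them to an equality of components.\<close>

private lemma eq_iff_slices_slices:
  assumes "S \<in> lin (H \<otimes>\<^sub>H Q) (Q \<otimes>\<^sub>H (Q \<otimes>\<^sub>H H))" "T \<in> lin (H \<otimes>\<^sub>H Q) (Q \<otimes>\<^sub>H (Q \<otimes>\<^sub>H H))"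
  shows "S = T \<longleftrightarrow> (\<forall>h\<in>carrier H. \<forall>w\<in>V. \<forall>v\<in>V. \<forall>v'\<in>V.
    app (slice V H v') (app (slice V (Q \<otimes>\<^sub>H H) v) (app S (pure H Q h (ket w)))) =
    app (slice V H v') (app (slice V (Q \<otimes>\<^sub>H H) v) (app T (pure H Q h (ket w)))))"
proof (intro iffI lin_eq_ketI[OF V H fd(5) assms])
  fix h w assume *: "\<forall>h\<in>carrier H. \<forall>w\<in>V. \<forall>v\<in>V. \<forall>v'\<in>V.
    app (slice V H v') (app (slice V (Q \<otimes>\<^sub>H H) v) (app S (pure H Q h (ket w)))) =
    app (slice V H v') (app (slice V (Q \<otimes>\<^sub>H H) v) (app T (pure H Q h (ket w))))"
    and h: "h \<in> carrier H" and w: "w \<in> V"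
  note c = lin_closed[OF assms(1) pure_ket_closed[OF V H h w]] lin_closed[OF assms(2) pure_ket_closed[OF V H h w]]
  show "app S (pure H Q h (ket w)) = app T (pure H Q h (ket w))"
    using * h w by (intro slice_eqI[OF V fd(3) c] slice_eqI[OF V H] slice_closed[OF V fd(3)] c) auto
qed simp

private lemma eq_iff_slices_mult:
  assumes "S \<in> lin (H \<otimes>\<^sub>H (Q \<otimes>\<^sub>H Q)) (Q \<otimes>\<^sub>H H)" "T \<in> lin (H \<otimes>\<^sub>H (Q \<otimes>\<^sub>H Q)) (Q \<otimes>\<^sub>H H)"
  shows "S = T \<longleftrightarrow> (\<forall>h\<in>carrier H. \<forall>w\<in>V. \<forall>w'\<in>V. \<forall>v\<in>V.
    app (slice V H v) (app S (pure H (Q \<otimes>\<^sub>H Q) h (pure Q Q (ket w) (ket w')))) =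
    app (slice V H v) (app T (pure H (Q \<otimes>\<^sub>H Q) h (pure Q Q (ket w) (ket w')))))"
proof (intro iffI lin_eq_pure_onbI[OF H fd(2,3) H.onb_bas onb_tensor[OF fd(1,1) onb_fun_space[OF V] onb_fun_space[OF V]] assms])
  fix h k assume *: "\<forall>h\<in>carrier H. \<forall>w\<in>V. \<forall>w'\<in>V. \<forall>v\<in>V.
    app (slice V H v) (app S (pure H (Q \<otimes>\<^sub>H Q) h (pure Q Q (ket w) (ket w')))) =
    app (slice V H v) (app T (pure H (Q \<otimes>\<^sub>H Q) h (pure Q Q (ket w) (ket w'))))"
    and "h \<in> bas H" "k \<in> (\<lambda>(e, f). pure Q Q e f) ` (ket ` V \<times> ket ` V)"
  then obtain w w' where k: "w \<in> V" "w' \<in> V" "k = pure Q Q (ket w) (ket w')" and h: "h \<in> carrier H"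
    using H.onb_carrier[OF H.onb_bas] by auto
  have p: "pure H (Q \<otimes>\<^sub>H Q) h k \<in> carrier (H \<otimes>\<^sub>H (Q \<otimes>\<^sub>H Q))"
    unfolding k using h k by (intro pure_closed H fd pure_kets)
  show "app S (pure H (Q \<otimes>\<^sub>H Q) h k) = app T (pure H (Q \<otimes>\<^sub>H Q) h k)"
    using * h k(1,2) by (intro slice_eqI[OF V H] lin_closed[OF assms(1) p] lin_closed[OF assms(2) p]) (auto simp: k(3))
qed simp

private lemma eq_iff_slices_unit:
  assumes "S \<in> lin H (Q \<otimes>\<^sub>H H)" "T \<in> lin H (Q \<otimes>\<^sub>H H)"
  shows "S = T \<longleftrightarrow> (\<forall>h\<in>carrier H. \<forall>v\<in>V. app (slice V H v) (app S h) = app (slice V H v) (app T h))"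
proof (intro iffI lin_eqI[OF assms])
  fix h assume "\<forall>h\<in>carrier H. \<forall>v\<in>V. app (slice V H v) (app S h) = app (slice V H v) (app T h)" "h \<in> carrier H"
  then show "app S h = app T h"
    by (intro slice_eqI[OF V H] lin_closed[OF assms(1)] lin_closed[OF assms(2)]) auto
qed simp

private lemma PP_closed:
  assumes h: "h \<in> carrier H" and w: "w \<in> V" and w': "w' \<in> V"
  shows "app (assoc Q H Q) (app (P \<otimes>\<^sub>M idm Q) (app (assoc_inv H Q Q)
      (pure H (Q \<otimes>\<^sub>H Q) h (pure Q Q (ket w) (ket w'))))) \<in> carrier (Q \<otimes>\<^sub>H (H \<otimes>\<^sub>H Q))"
  by (rule lin_closed[OF as lin_closed[OF PidX(1) lin_closed[OF ai pure_closed[OF H fd(2) h pure_kets[OF w w']]]]])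

text \<open>\<open>P\<close> acts on \<open>h\<close> and the first ket, while the second ket is
  carried along: reading off the first output leg at \<open>v\<close> leaves the entry applied to
  \<open>h\<close> together with the untouched ket.\<close>

private lemma slice_PP:
  assumes h: "h \<in> carrier H" and w: "w \<in> V" and w': "w' \<in> V" and v: "v \<in> V"
  shows "app (slice V (H \<otimes>\<^sub>H Q) v) (app (assoc Q H Q) (app (P \<otimes>\<^sub>M idm Q) (app (assoc_inv H Q Q)
      (pure H (Q \<otimes>\<^sub>H Q) h (pure Q Q (ket w) (ket w')))))) = pure H Q (app (a v w) h) (ket w')"
proof -
  note hw = pure_ket_closed[OF V H h w]
  have "app (P \<otimes>\<^sub>M idm Q) (app (assoc_inv H Q Q) (pure H (Q \<otimes>\<^sub>H Q) h (pure Q Q (ket w) (ket w')))) =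
      pure (Q \<otimes>\<^sub>H H) Q (app P (pure H Q h (ket w))) (ket w')"
    unfolding app_assoc_inv[OF H fd(1,1) h ket_closed[OF w] ket_closed[OF w']] PidX(2)[OF hw ket_closed[OF w']]
      idm_app[OF ket_closed[OF w']] ..
  moreover have "pure (Q \<otimes>\<^sub>H H) Q (app P (pure H Q h (ket w))) (ket w') \<in> carrier ((Q \<otimes>\<^sub>H H) \<otimes>\<^sub>H Q)"
    by (intro pure_closed fd app_pure_ket_closed h w ket_closed w')
  ultimately show ?thesis
    using tensor_map_spec(2)[OF fd(3,1) H fd(1) slice_lin[OF V H v] idX app_pure_ket_closed[OF h w] ket_closed[OF w']]
      slice_app_pure_ket[OF h, of v w] w'
    by (simp add: slice_assoc[OF V H fd(1) _ v] del: fun_space_simps)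
qed

text \<open>The double application of \<open>P\<close> shared by conditions (i) and (iv). The second
  \<open>P\<close> receives \<open>a v w h\<close> and the second ket, which explains the order of
  the products of entries below.\<close>

private lemma slice_PPP:
  assumes h: "h \<in> carrier H" and w: "w \<in> V" and w': "w' \<in> V" and v: "v \<in> V"
  shows "app (slice V (Q \<otimes>\<^sub>H H) v) (app (idm Q \<otimes>\<^sub>M P) (app (assoc Q H Q) (app (P \<otimes>\<^sub>M idm Q) (app (assoc_inv H Q Q)
      (pure H (Q \<otimes>\<^sub>H Q) h (pure Q Q (ket w) (ket w'))))))) = app P (pure H Q (app (a v w) h) (ket w'))"
  unfolding slice_id_tensor[OF V fd(4,3) P v PP_closed[OF h w w']] slice_PP[OF assms] ..

text \<open>On the left the comultiplication copies the output index, giving a diagonal; on the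
  right it copies the input index \<open>w\<close>, so that two entries of the same column are
  multiplied.\<close>

lemma comult_condition_iff:
  "assoc Q Q H \<circ>\<^sub>M (frob_comult V \<otimes>\<^sub>M idm H) \<circ>\<^sub>M P =
     (idm Q \<otimes>\<^sub>M P) \<circ>\<^sub>M assoc Q H Q \<circ>\<^sub>M (P \<otimes>\<^sub>M idm Q) \<circ>\<^sub>M assoc_inv H Q Q \<circ>\<^sub>M (idm H \<otimes>\<^sub>M frob_comult V)
   \<longleftrightarrow> (\<forall>h\<in>carrier H. \<forall>w\<in>V. \<forall>v\<in>V. \<forall>v'\<in>V.
     app (a v' w) (app (a v w) h) = (if v = v' then app (a v w) h else \<zero>\<^bsub>H\<^esub>))"
proof -
  note \<Delta> = frob_comult_lin[OF V]
  note \<Delta>H = tensor_map_spec[OF fd(1) H fd(2) H \<Delta> idH]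
  note H\<Delta> = tensor_map_spec[OF H fd(1) H fd(2) idH \<Delta>]
  let ?L = "assoc Q Q H \<circ>\<^sub>M (frob_comult V \<otimes>\<^sub>M idm H) \<circ>\<^sub>M P"
  let ?R = "(idm Q \<otimes>\<^sub>M P) \<circ>\<^sub>M assoc Q H Q \<circ>\<^sub>M (P \<otimes>\<^sub>M idm Q) \<circ>\<^sub>M assoc_inv H Q Q \<circ>\<^sub>M (idm H \<otimes>\<^sub>M frob_comult V)"
  have L: "?L \<in> lin (H \<otimes>\<^sub>H Q) (Q \<otimes>\<^sub>H (Q \<otimes>\<^sub>H H))"
    using fds by (intro comp_lin[OF comp_lin[OF P \<Delta>H(1)] assoc_lin[OF fd(1,1) H]]) auto
  have R: "?R \<in> lin (H \<otimes>\<^sub>H Q) (Q \<otimes>\<^sub>H (Q \<otimes>\<^sub>H H))"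
    using fds by (intro comp_lin[OF comp_lin[OF comp_lin[OF comp_lin[OF H\<Delta>(1) ai] PidX(1)] as] idXP(1)]) auto
  have l: "app (slice V H v') (app (slice V (Q \<otimes>\<^sub>H H) v) (app ?L (pure H Q h (ket w)))) =
      (if v = v' then app (a v w) h else \<zero>\<^bsub>H\<^esub>)"
    if "h \<in> carrier H" "w \<in> V" "v \<in> V" "v' \<in> V" for h w v v'
    using that by (simp add: slice_slice_comult[OF V H app_pure_ket_closed] slice_app_pure_ket)
  have r: "app (slice V H v') (app (slice V (Q \<otimes>\<^sub>H H) v) (app ?R (pure H Q h (ket w)))) =
      app (a v' w) (app (a v w) h)"
    if "h \<in> carrier H" "w \<in> V" "v \<in> V" "v' \<in> V" for h w v v'
    using that by (simp add: H\<Delta>(2) app_frob_comult[OF V] slice_PPP slice_app_pure_ket entry_closed del: fun_space_simps)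
  show ?thesis unfolding eq_iff_slices_slices[OF L R] by (auto simp: l r simp del: comp_app)
qed

lemma counit_condition_iff:
  "lunit H \<circ>\<^sub>M (frob_counit V \<otimes>\<^sub>M idm H) \<circ>\<^sub>M P = runit H \<circ>\<^sub>M (idm H \<otimes>\<^sub>M frob_counit V)
   \<longleftrightarrow> (\<forall>w\<in>V. \<forall>h\<in>carrier H. finsum H (\<lambda>v. app (a v w) h) V = h)"
proof -
  note \<epsilon> = frob_counit_lin[OF V]
  note \<epsilon>H = tensor_map_spec[OF fd(1) H fd_hilbert_unit_space H \<epsilon> idH]
  note H\<epsilon> = tensor_map_spec[OF H fd(1) H fd_hilbert_unit_space idH \<epsilon>]
  let ?L = "lunit H \<circ>\<^sub>M (frob_counit V \<otimes>\<^sub>M idm H) \<circ>\<^sub>M P"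
  let ?R = "runit H \<circ>\<^sub>M (idm H \<otimes>\<^sub>M frob_counit V)"
  have L: "?L \<in> lin (H \<otimes>\<^sub>H Q) H"
    using fds by (intro comp_lin[OF comp_lin[OF P \<epsilon>H(1)] lunit_lin[OF H]]) auto
  have R: "?R \<in> lin (H \<otimes>\<^sub>H Q) H"
    using fds by (intro comp_lin[OF H\<epsilon>(1) runit_lin[OF H]]) auto
  have l: "app ?L (pure H Q h (ket w)) = finsum H (\<lambda>v. app (a v w) h) V"
    if "h \<in> carrier H" "w \<in> V" for h w
    using that by (simp add: counit_slice[OF V H app_pure_ket_closed] slice_app_pure_ket)
  have r: "app ?R (pure H Q h (ket w)) = h" if "h \<in> carrier H" "w \<in> V" for h w
    using that by (simp add: H\<epsilon>(2) app_frob_counit[OF V] app_runit[OF H] del: fun_space_simps)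
  have "?L = ?R \<longleftrightarrow> (\<forall>w\<in>V. \<forall>h\<in>carrier H. app ?L (pure H Q h (ket w)) = app ?R (pure H Q h (ket w)))"
    using lin_eq_ketI[OF V H H L R] by metis
  then show ?thesis by (simp add: l r del: comp_app cong: ball_cong)
qed

text \<open>Dual to the comultiplication: the output indices are identified by \<open>m\<close>, so
  that two entries of the same row are multiplied, and the left side vanishes unless the input kets
  agree.\<close>

lemma mult_condition_iff:
  "P \<circ>\<^sub>M (idm H \<otimes>\<^sub>M frob_mult V) =
     (frob_mult V \<otimes>\<^sub>M idm H) \<circ>\<^sub>M assoc_inv Q Q H \<circ>\<^sub>M (idm Q \<otimes>\<^sub>M P) \<circ>\<^sub>M assoc Q H Q \<circ>\<^sub>M
     (P \<otimes>\<^sub>M idm Q) \<circ>\<^sub>M assoc_inv H Q Q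
   \<longleftrightarrow> (\<forall>h\<in>carrier H. \<forall>w\<in>V. \<forall>w'\<in>V. \<forall>v\<in>V.
     app (a v w') (app (a v w) h) = (if w = w' then app (a v w) h else \<zero>\<^bsub>H\<^esub>))"
proof -
  note m = frob_mult_lin[OF V]
  note mH = tensor_map_spec[OF fd(2) H fd(1) H m idH]
  note Hm = tensor_map_spec[OF H fd(2) H fd(1) idH m]
  let ?L = "P \<circ>\<^sub>M (idm H \<otimes>\<^sub>M frob_mult V)"
  let ?R = "(frob_mult V \<otimes>\<^sub>M idm H) \<circ>\<^sub>M assoc_inv Q Q H \<circ>\<^sub>M (idm Q \<otimes>\<^sub>M P) \<circ>\<^sub>M assoc Q H Q \<circ>\<^sub>M
     (P \<otimes>\<^sub>M idm Q) \<circ>\<^sub>M assoc_inv H Q Q"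
  have L: "?L \<in> lin (H \<otimes>\<^sub>H (Q \<otimes>\<^sub>H Q)) (Q \<otimes>\<^sub>H H)"
    using fds by (intro comp_lin[OF Hm(1) P]) auto
  have R: "?R \<in> lin (H \<otimes>\<^sub>H (Q \<otimes>\<^sub>H Q)) (Q \<otimes>\<^sub>H H)"
    using fds by (intro comp_lin[OF comp_lin[OF comp_lin[OF comp_lin[OF comp_lin[OF ai PidX(1)] as] idXP(1)]
            assoc_inv_lin[OF fd(1,1) H]] mH(1)]) auto
  have l: "app (slice V H v) (app ?L (pure H (Q \<otimes>\<^sub>H Q) h (pure Q Q (ket w) (ket w')))) =
      (if w = w' then app (a v w) h else \<zero>\<^bsub>H\<^esub>)"
    if "h \<in> carrier H" "w \<in> V" "w' \<in> V" "v \<in> V" for h w w' v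
  proof -
    \<comment> \<open>For different kets the product is zero, and \<open>P\<close> is then applied
      to \<open>h \<otimes> 0\<close>.\<close>
    have "pure H Q h \<zero>\<^bsub>Q\<^esub> = \<zero>\<^bsub>H \<otimes>\<^sub>H Q\<^esub>"
      using pure_smult_right[OF H fd(1) Q.zero_in_carrier, of h 0] by simp
    then show ?thesis
      using that lin_zero[OF fd(4,3) P] slice_zero[OF H]
      by (simp add: Hm(2)[OF _ pure_kets] app_frob_mult[OF V] slice_app_pure_ket)
  qed
  have r: "app (slice V H v) (app ?R (pure H (Q \<otimes>\<^sub>H Q) h (pure Q Q (ket w) (ket w')))) =
      app (a v w') (app (a v w) h)"
    if "h \<in> carrier H" "w \<in> V" "w' \<in> V" "v \<in> V" for h w w' v
    using that by (simp add: slice_mult[OF V H lin_closed[OF idXP(1) PP_closed]] slice_PPP slice_app_pure_ket entry_closed)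
  show ?thesis unfolding eq_iff_slices_mult[OF L R]
    by (simp only: l r eq_commute[of "if _ then _ else _"] cong: ball_cong)
qed

lemma unit_condition_iff:
  "P \<circ>\<^sub>M (idm H \<otimes>\<^sub>M frob_unit V) \<circ>\<^sub>M runit_inv H = (frob_unit V \<otimes>\<^sub>M idm H) \<circ>\<^sub>M lunit_inv H
   \<longleftrightarrow> (\<forall>v\<in>V. \<forall>h\<in>carrier H. finsum H (\<lambda>w. app (a v w) h) V = h)"
proof -
  note u = frob_unit_lin[OF V]
  note uH = tensor_map_spec[OF fd_hilbert_unit_space H fd(1) H u idH]
  note Hu = tensor_map_spec[OF H fd_hilbert_unit_space H fd(1) idH u]
  let ?L = "P \<circ>\<^sub>M (idm H \<otimes>\<^sub>M frob_unit V) \<circ>\<^sub>M runit_inv H"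
  let ?R = "(frob_unit V \<otimes>\<^sub>M idm H) \<circ>\<^sub>M lunit_inv H"
  have L: "?L \<in> lin H (Q \<otimes>\<^sub>H H)"
    using fds by (intro comp_lin[OF comp_lin[OF runit_inv_lin[OF H] Hu(1)] P]) auto
  have R: "?R \<in> lin H (Q \<otimes>\<^sub>H H)"
    using fds by (intro comp_lin[OF lunit_inv_lin[OF H] uH(1)]) auto
  have l: "app (slice V H v) (app ?L h) = finsum H (\<lambda>w. app (a v w) h) V"
    if h: "h \<in> carrier H" and v: "v \<in> V" for h v
  proof -
    have "app ?L h = app P (pure H Q h (finsum Q ket V))"
      using h by (simp add: app_runit_inv[OF H] Hu(2) app_frob_unit[OF V])
    also have "\<dots> = app P (finsum (H \<otimes>\<^sub>H Q) (\<lambda>w. pure H Q h (ket w)) V)"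
      using h by (subst pure_finsum_right[OF H fd(1)]) (auto simp del: fun_space_simps)
    also have "\<dots> = finsum (Q \<otimes>\<^sub>H H) (\<lambda>w. app P (pure H Q h (ket w))) V"
      by (rule lin_finsum[OF fd(4,3) P pure_ket_closed[OF V H h]])
    finally show ?thesis
      using lin_finsum[OF fd(3) H slice_lin[OF V H v] app_pure_ket_closed[OF h]] h
      by (simp add: slice_app_pure_ket)
  qed
  have r: "app (slice V H v) (app ?R h) = h" if h: "h \<in> carrier H" and v: "v \<in> V" for h v
  proof -
    have "app ?R h = pure Q H (finsum Q ket V) h"
      using h by (simp add: app_lunit_inv[OF H] uH(2) app_frob_unit[OF V])
    moreover have "finsum Q ket V v = 1"
      using v V by (subst finsum_fun_space[OF ket_closed]) (auto simp: ket_apply)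
    ultimately show ?thesis using h v by (simp add: slice_pure[OF V H v Q.fsum_closed[OF ket_closed] h] del: fun_space_simps)
  qed
  show ?thesis unfolding eq_iff_slices_unit[OF L R] by (auto simp: l r simp del: comp_app)
qed

private lemma inner_adj_pure:
  assumes v: "v \<in> V" and w: "w \<in> V" and x: "x \<in> carrier H" and y: "y \<in> carrier H"
  shows "inner (H \<otimes>\<^sub>H Q) (pure H Q x (ket w)) (app (adj P) (pure Q H (ket v) y)) = inner H x (app (adj (a v w)) y)"
proof -
  note p = pure_ket_closed[OF V H x w] and q = pure_closed[OF fd(1) H ket_closed[OF v] y]
  note Pp = app_pure_ket_closed[OF x w]
  have "inner (H \<otimes>\<^sub>H Q) (pure H Q x (ket w)) (app (adj P) (pure Q H (ket v) y)) =
      cnj (inner (Q \<otimes>\<^sub>H H) (pure Q H (ket v) y) (app P (pure H Q x (ket w))))"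
    unfolding inner_adj_right[OF fd(4,3) P p q]
    by (rule fd_hilbert.inner_cnj[OF fd(3) q Pp])
  also have "\<dots> = cnj (inner H y (app (a v w) x))"
    unfolding inner_pure_left[OF fd(1) H Pp ket_closed[OF v] y] slice_app_pure_ket[OF x, symmetric]
      inner_slice[OF V H v Pp y] ..
  also have "\<dots> = inner H (app (a v w) x) y"
    by (rule H.inner_cnj[OF y entry_closed[OF v w x], symmetric])
  also have "\<dots> = inner H x (app (adj (a v w)) y)"
    by (rule inner_adj_right[OF H H a_lin[OF v w] x y, symmetric])
  finally show ?thesis .
qed

text \<open>The right side bends both \<complex>^V legs of \<open>P\<close> with cup and cap and
  thereby transposes the matrix of \<open>P\<close> in its vertex indices without touching the
  entries: it sends \<open>|v\<rangle> \<otimes> y\<close> to the sum over \<open>u\<close> of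
  \<open>a v u y \<otimes> |u\<rangle>\<close>. The adjoint of \<open>P\<close> transposes in the
  same way but also takes adjoints of the entries, so equality means that the entries are
  selfadjoint.\<close>

lemma adjoint_condition_iff:
  "adj P =
     lunit (H \<otimes>\<^sub>H Q) \<circ>\<^sub>M ((frob_counit V \<circ>\<^sub>M frob_mult V) \<otimes>\<^sub>M (idm H \<otimes>\<^sub>M idm Q)) \<circ>\<^sub>M
     assoc_inv Q Q (H \<otimes>\<^sub>H Q) \<circ>\<^sub>M (idm Q \<otimes>\<^sub>M assoc Q H Q) \<circ>\<^sub>M
     (idm Q \<otimes>\<^sub>M (P \<otimes>\<^sub>M idm Q)) \<circ>\<^sub>M
     (idm Q \<otimes>\<^sub>M assoc_inv H Q Q) \<circ>\<^sub>M assoc Q H (Q \<otimes>\<^sub>H Q) \<circ>\<^sub>M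
     ((idm Q \<otimes>\<^sub>M idm H) \<otimes>\<^sub>M (frob_comult V \<circ>\<^sub>M frob_unit V)) \<circ>\<^sub>M runit_inv (Q \<otimes>\<^sub>H H)
   \<longleftrightarrow> (\<forall>v\<in>V. \<forall>w\<in>V. adj (a v w) = a v w)" (is "_ = ?R \<longleftrightarrow> _")
proof -
  note \<epsilon>m = comp_lin[OF frob_mult_lin[OF V] frob_counit_lin[OF V] fd(1) fd_hilbert_unit_space]
  note \<Delta>u = comp_lin[OF frob_unit_lin[OF V] frob_comult_lin[OF V] fd(1,2)]
  have fd': "fd_hilbert ((Q \<otimes>\<^sub>H H) \<otimes>\<^sub>H (Q \<otimes>\<^sub>H Q))" "fd_hilbert (Q \<otimes>\<^sub>H (H \<otimes>\<^sub>H (Q \<otimes>\<^sub>H Q)))"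
    "fd_hilbert (Q \<otimes>\<^sub>H ((H \<otimes>\<^sub>H Q) \<otimes>\<^sub>H Q))" "fd_hilbert (Q \<otimes>\<^sub>H ((Q \<otimes>\<^sub>H H) \<otimes>\<^sub>H Q))"
    "fd_hilbert (Q \<otimes>\<^sub>H (Q \<otimes>\<^sub>H (H \<otimes>\<^sub>H Q)))" "fd_hilbert ((Q \<otimes>\<^sub>H Q) \<otimes>\<^sub>H (H \<otimes>\<^sub>H Q))"
    "fd_hilbert (unit_space \<otimes>\<^sub>H (H \<otimes>\<^sub>H Q))"
    using fds by auto
  note idXH = tensor_map_idm[OF fd(1) H] and idHX = tensor_map_idm[OF H fd(1)]
  note t1 = tensor_map_spec[OF fd(3) fd_hilbert_unit_space fd(3,2) idm_lin[OF fd(3)] \<Delta>u]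
  note t2 = assoc_lin[OF fd(1) H fd(2)]
  note t3 = tensor_map_spec[OF fd(1,9,1,8) idX ai]
  note t4 = tensor_map_spec[OF fd(1,8,1,6) idX PidX(1)]
  note t5 = tensor_map_spec[OF fd(1,6,1,7) idX as]
  note t6 = assoc_inv_lin[OF fd(1,1,4)]
  note t7 = tensor_map_spec[OF fd(2,4) fd_hilbert_unit_space fd(4) \<epsilon>m idm_lin[OF fd(4)]]
  note t8 = lunit_lin[OF fd(4)]
  note t0 = runit_inv_lin[OF fd(3)]
  have R: "?R \<in> lin (Q \<otimes>\<^sub>H H) (H \<otimes>\<^sub>H Q)"
    unfolding idXH idHX
    using fds fd' by (intro comp_lin[OF comp_lin[OF comp_lin[OF comp_lin[OF comp_lin[OF comp_lin[OF comp_lin[OF comp_lin[OF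
      t0 t1(1)] t2] t3(1)] t4(1)] t5(1)] t6] t7(1)] t8]) auto
  have val: "inner (H \<otimes>\<^sub>H Q) (pure H Q x (ket w)) (app ?R (pure Q H (ket v) y)) = inner H x (app (a v w) y)"
    if v: "v \<in> V" and w: "w \<in> V" and x: "x \<in> carrier H" and y: "y \<in> carrier H" for v w x y
  proof -
    interpret HX: fd_hilbert "H \<otimes>\<^sub>H Q" by (rule fd)
    \<comment> \<open>The cup: the value of \<open>\<Delta> u\<close> at 1.\<close>
    define \<delta> where "\<delta> = finsum (Q \<otimes>\<^sub>H Q) (\<lambda>u. pure Q Q (ket u) (ket u)) V"
    have \<delta>: "\<delta> \<in> carrier (Q \<otimes>\<^sub>H Q)"
      unfolding \<delta>_def by (intro fd_hilbert.fsum_closed fd pure_kets)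
    have y\<delta>: "pure H (Q \<otimes>\<^sub>H Q) y \<delta> \<in> carrier (H \<otimes>\<^sub>H (Q \<otimes>\<^sub>H Q))"
      by (rule pure_closed[OF H fd(2) y \<delta>])
    \<comment> \<open>The result of applying \<open>P\<close> to \<open>y\<close> and the first leg
      of the cup; the incoming \<open>|v\<rangle>\<close> waits on the left to be contracted with
      the first leg of \<open>\<eta>\<close>.\<close>
    define \<eta> where "\<eta> = app (assoc Q H Q) (app (P \<otimes>\<^sub>M idm Q) (app (assoc_inv H Q Q) (pure H (Q \<otimes>\<^sub>H Q) y \<delta>)))"
    have \<eta>: "\<eta> \<in> carrier (Q \<otimes>\<^sub>H (H \<otimes>\<^sub>H Q))"
      unfolding \<eta>_def by (rule lin_closed[OF as lin_closed[OF PidX(1) lin_closed[OF ai y\<delta>]]])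
    have 1: "app (frob_comult V \<circ>\<^sub>M frob_unit V) 1 = \<delta>"
    proof -
      have "app (frob_comult V \<circ>\<^sub>M frob_unit V) 1 = finsum (Q \<otimes>\<^sub>H Q) (\<lambda>u. app (frob_comult V) (ket u)) V"
        unfolding comp_app app_frob_unit[OF V]
        by (rule lin_finsum[OF fd(1,2) frob_comult_lin[OF V] ket_closed])
      also have "\<dots> = \<delta>"
        unfolding \<delta>_def
        by (rule abelian_monoid.finsum_cong')
          (auto simp: app_frob_comult[OF V] pure_kets intro!: abelian_group.axioms(1) module.axioms
            fd_hilbert.axioms vectorspace.axioms fd simp del: fun_space_simps)
      finally show ?thesis .
    qed
    have vy: "pure Q H (ket v) y \<in> carrier (Q \<otimes>\<^sub>H H)" by (rule pure_closed[OF fd(1) H ket_closed[OF v] y])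
    have 2: "app (idm Q \<otimes>\<^sub>M assoc Q H Q) (app (idm Q \<otimes>\<^sub>M (P \<otimes>\<^sub>M idm Q)) (app (idm Q \<otimes>\<^sub>M assoc_inv H Q Q)
        (app (assoc Q H (Q \<otimes>\<^sub>H Q)) (app ((idm Q \<otimes>\<^sub>M idm H) \<otimes>\<^sub>M (frob_comult V \<circ>\<^sub>M frob_unit V))
          (app (runit_inv (Q \<otimes>\<^sub>H H)) (pure Q H (ket v) y)))))) = pure Q (Q \<otimes>\<^sub>H (H \<otimes>\<^sub>H Q)) (ket v) \<eta>"
      unfolding idXH app_runit_inv[OF fd(3) vy]
      using ket_closed[OF v] vy y \<delta> y\<delta> lin_closed[OF ai y\<delta>] lin_closed[OF PidX(1) lin_closed[OF ai y\<delta>]] 1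
      by (simp add: t1(2) t3(2) t4(2) t5(2) app_assoc[OF fd(1) H fd(2)] \<eta>_def del: fun_space_simps comp_app)
    note v\<eta> = pure_closed[OF fd(1) fd(7) ket_closed[OF v] \<eta>]
    have "app ?R (pure Q H (ket v) y) = app (lunit (H \<otimes>\<^sub>H Q)) (app ((frob_counit V \<circ>\<^sub>M frob_mult V) \<otimes>\<^sub>M idm (H \<otimes>\<^sub>H Q))
        (app (assoc_inv Q Q (H \<otimes>\<^sub>H Q)) (pure Q (Q \<otimes>\<^sub>H (H \<otimes>\<^sub>H Q)) (ket v) \<eta>)))"
      by (simp only: comp_app[of _ _ "_ :: _ \<Rightarrow> complex"] idHX 2)
    also have "\<dots> = finsum (H \<otimes>\<^sub>H Q)
        (\<lambda>u. app (slice V (H \<otimes>\<^sub>H Q) u) (app (slice V (Q \<otimes>\<^sub>H (H \<otimes>\<^sub>H Q)) u) (pure Q (Q \<otimes>\<^sub>H (H \<otimes>\<^sub>H Q)) (ket v) \<eta>))) V"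
      by (rule counit_mult_slice[OF V fd(4) v\<eta>])
    \<comment> \<open>The waiting factor \<open>|v\<rangle>\<close> makes only the term
      \<open>u = v\<close> of the cap survive, so the contraction is the component of
      \<open>\<eta>\<close> at \<open>v\<close>.\<close>
    also have "\<dots> = finsum (H \<otimes>\<^sub>H Q) (\<lambda>u. if v = u then app (slice V (H \<otimes>\<^sub>H Q) u) \<eta> else \<zero>\<^bsub>H \<otimes>\<^sub>H Q\<^esub>) V"
      using slice_zero[OF fd(4)] slice_closed[OF V fd(4) _ \<eta>]
      by (intro HX.finsum_cong') (auto simp: slice_ket[OF V fd(7) _ v \<eta>] simp del: tensor_space_simps)
    also have "\<dots> = app (slice V (H \<otimes>\<^sub>H Q) v) \<eta>"
      using slice_closed[OF V fd(4) _ \<eta>] by (intro HX.add.finprod_singleton V v) auto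
    also have "\<dots> = finsum (H \<otimes>\<^sub>H Q) (\<lambda>u. pure H Q (app (a v u) y) (ket u)) V"
    proof -
      have "pure H (Q \<otimes>\<^sub>H Q) y \<delta> = finsum (H \<otimes>\<^sub>H (Q \<otimes>\<^sub>H Q)) (\<lambda>u. pure H (Q \<otimes>\<^sub>H Q) y (pure Q Q (ket u) (ket u))) V"
        unfolding \<delta>_def by (rule pure_finsum_right[OF H fd(2) pure_kets y])
      moreover define S where "S = slice V (H \<otimes>\<^sub>H Q) v \<circ>\<^sub>M assoc Q H Q \<circ>\<^sub>M (P \<otimes>\<^sub>M idm Q) \<circ>\<^sub>M assoc_inv H Q Q"
      have S: "S \<in> lin (H \<otimes>\<^sub>H (Q \<otimes>\<^sub>H Q)) (H \<otimes>\<^sub>H Q)"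
        unfolding S_def using fds
        by (intro comp_lin[OF comp_lin[OF comp_lin[OF ai PidX(1)] as] slice_lin[OF V fd(4) v]]) auto
      ultimately have "app (slice V (H \<otimes>\<^sub>H Q) v) \<eta> =
          app S (finsum (H \<otimes>\<^sub>H (Q \<otimes>\<^sub>H Q)) (\<lambda>u. pure H (Q \<otimes>\<^sub>H Q) y (pure Q Q (ket u) (ket u))) V)"
        by (simp add: \<eta>_def S_def)
      also have "\<dots> = finsum (H \<otimes>\<^sub>H Q) (\<lambda>u. app S (pure H (Q \<otimes>\<^sub>H Q) y (pure Q Q (ket u) (ket u)))) V"
        by (rule lin_finsum[OF fd(9,4) S pure_closed[OF H fd(2) y pure_kets]])
      also have "\<dots> = finsum (H \<otimes>\<^sub>H Q) (\<lambda>u. pure H Q (app (a v u) y) (ket u)) V"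
        using v y by (intro HX.finsum_cong')
          (auto simp: S_def slice_PP intro!: pure_ket_closed[OF V H] entry_closed simp del: tensor_space_simps)
      finally show ?thesis .
    qed
    finally have "inner (H \<otimes>\<^sub>H Q) (pure H Q x (ket w)) (app ?R (pure Q H (ket v) y)) =
        (\<Sum>u\<in>V. inner (H \<otimes>\<^sub>H Q) (pure H Q x (ket w)) (pure H Q (app (a v u) y) (ket u)))"
      by (simp only:) (rule HX.inner_finsum_right[OF pure_ket_closed[OF V H x w] pure_ket_closed[OF V H entry_closed[OF v _ y]]])
    also have "\<dots> = (\<Sum>u\<in>V. if u = w then inner H x (app (a v u) y) else 0)"
      using x w y v
      by (intro sum.cong refl) (simp add: inner_pure_pure[OF H fd(1)] entry_closed inner_ket_left[OF V] ket_apply del: fun_space_simps)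
    also have "\<dots> = inner H x (app (a v w) y)" using V w by simp
    finally show ?thesis .
  qed
  show ?thesis
  proof
    assume eq: "adj P = ?R"
    show "\<forall>v\<in>V. \<forall>w\<in>V. adj (a v w) = a v w"
    proof (intro ballI)
      fix v w assume v: "v \<in> V" and w: "w \<in> V"
      show "adj (a v w) = a v w"
      proof (rule lin_eq_formI[OF H H adj_lin[OF H H a_lin[OF v w]] a_lin[OF v w]])
        fix y x assume "y \<in> carrier H" "x \<in> carrier H"
        then show "inner H x (app (adj (a v w)) y) = inner H x (app (a v w) y)"
          using inner_adj_pure[OF v w, of x y] val[OF v w, of x y] eq by simp
      qed
    qed
  next
    assume sa: "\<forall>v\<in>V. \<forall>w\<in>V. adj (a v w) = a v w"
    show "adj P = ?R"
    proof (rule lin_eq_pure_onbI[OF fd(1) H fd(4) onb_fun_space[OF V] H.onb_bas adj_lin[OF fd(4,3) P] R])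
      fix e y assume "e \<in> ket ` V" "y \<in> bas H"
      then obtain v where v: "v \<in> V" "e = ket v" and y: "y \<in> carrier H"
        using H.onb_carrier[OF H.onb_bas] by auto
      have vy: "pure Q H e y \<in> carrier (Q \<otimes>\<^sub>H H)"
        unfolding v(2) by (rule pure_closed[OF fd(1) H ket_closed[OF v(1)] y])
      show "app (adj P) (pure Q H e y) = app ?R (pure Q H e y)"
      proof (rule fd_hilbert.eq_of_inner_onb[OF fd(4) onb_tensor[OF H fd(1) H.onb_bas onb_fun_space[OF V]]
            lin_closed[OF adj_lin[OF fd(4,3) P] vy] lin_closed[OF R vy]])
        fix b assume "b \<in> (\<lambda>(e, f). pure H Q e f) ` (bas H \<times> ket ` V)"
        then obtain x w where b: "b = pure H Q x (ket w)" and w: "w \<in> V" and x: "x \<in> carrier H"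
          using H.onb_carrier[OF H.onb_bas] by auto
        show "inner (H \<otimes>\<^sub>H Q) b (app (adj P) (pure Q H e y)) = inner (H \<otimes>\<^sub>H Q) b (app ?R (pure Q H e y))"
          unfolding b v(2) inner_adj_pure[OF v(1) w x y] val[OF v(1) w x y] using sa v(1) w by simp
      qed
    qed
  qed
qed

end

text \<open>Acting before \<open>P\<close>, the adjacency matrix mixes the input index and yields
  the matrix product of entries and adjacency; acting after \<open>P\<close>, it mixes the output
  index and yields the product in the other order.\<close>

lemma adjacency_condition_iff:
  fixes G :: "'v pair_pre_digraph" and H :: "'h hilb" and P :: "('v, 'h) qmap"
  assumes V: "finite (pverts G)" and H: "fd_hilbert H"
    and P: "P \<in> lin (H \<otimes>\<^sub>H fun_space (pverts G)) (fun_space (pverts G) \<otimes>\<^sub>H H)"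
  shows "P \<circ>\<^sub>M (idm H \<otimes>\<^sub>M adjacency_map G) = (adjacency_map G \<otimes>\<^sub>M idm H) \<circ>\<^sub>M P \<longleftrightarrow>
    (\<forall>v\<in>pverts G. \<forall>w\<in>pverts G. \<forall>h\<in>carrier H.
      finsum H (\<lambda>u. adjacency G v u \<odot>\<^bsub>H\<^esub> app (entry (pverts G) H P u w) h) (pverts G) =
      finsum H (\<lambda>u. adjacency G u w \<odot>\<^bsub>H\<^esub> app (entry (pverts G) H P v u) h) (pverts G))"
proof -
  let ?V = "pverts G" let ?X = "fun_space ?V"
  interpret X: fd_hilbert ?X by (rule fd_hilbert_fun_space[OF V])
  interpret H: fd_hilbert H by (rule H)
  note fd = fd_hilbert_spaces[OF V H P]
  note fds = H fd fd_hilbert_unit_space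
  note A = adjacency_map_lin[OF V]
  note HA = tensor_map_spec[OF H fd(1) H fd(1) idm_lin[OF H] A]
  note AH = tensor_map_spec[OF fd(1) H fd(1) H A idm_lin[OF H]]
  let ?L = "P \<circ>\<^sub>M (idm H \<otimes>\<^sub>M adjacency_map G)" let ?R = "(adjacency_map G \<otimes>\<^sub>M idm H) \<circ>\<^sub>M P"
  have L: "?L \<in> lin (H \<otimes>\<^sub>H ?X) (?X \<otimes>\<^sub>H H)" using fds by (intro comp_lin[OF HA(1) P]) auto
  have R: "?R \<in> lin (H \<otimes>\<^sub>H ?X) (?X \<otimes>\<^sub>H H)" using fds by (intro comp_lin[OF P AH(1)]) auto
  have l: "app (slice ?V H v) (app ?L (pure H ?X h (ket w))) =
      finsum H (\<lambda>u. adjacency G u w \<odot>\<^bsub>H\<^esub> app (entry ?V H P v u) h) ?V"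
    if h: "h \<in> carrier H" and w: "w \<in> ?V" and v: "v \<in> ?V" for h w v
  proof -
    define S where "S = slice ?V H v \<circ>\<^sub>M P"
    have S: "S \<in> lin (H \<otimes>\<^sub>H ?X) H" unfolding S_def using fds by (intro comp_lin[OF P slice_lin[OF V H v]]) auto
    have "app (slice ?V H v) (app ?L (pure H ?X h (ket w))) =
        app S (pure H ?X h (finsum ?X (\<lambda>u. adjacency G u w \<odot>\<^bsub>?X\<^esub> ket u) ?V))"
      using h ket_closed[OF w] w by (simp add: S_def HA(2) app_adjacency_map[OF V] del: fun_space_simps)
    also have "\<dots> = app S (finsum (H \<otimes>\<^sub>H ?X) (\<lambda>u. pure H ?X h (adjacency G u w \<odot>\<^bsub>?X\<^esub> ket u)) ?V)"
      by (subst pure_finsum_right[OF H fd(1) X.scale_closed[OF ket_closed] h]) auto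
    also have "\<dots> = finsum H (\<lambda>u. app S (pure H ?X h (adjacency G u w \<odot>\<^bsub>?X\<^esub> ket u))) ?V"
      by (rule lin_finsum[OF fd(4) H S pure_closed[OF H fd(1) h X.scale_closed[OF ket_closed]]])
    also have "\<dots> = finsum H (\<lambda>u. adjacency G u w \<odot>\<^bsub>H\<^esub> app (entry ?V H P v u) h) ?V"
    proof (rule H.finsum_cong')
      show "(\<lambda>u. adjacency G u w \<odot>\<^bsub>H\<^esub> app (entry ?V H P v u) h) \<in> ?V \<rightarrow> carrier H"
        using entry_closed[OF V H P v _ h] by auto
      fix u assume u: "u \<in> ?V"
      have "app S (pure H ?X h (adjacency G u w \<odot>\<^bsub>?X\<^esub> ket u)) = adjacency G u w \<odot>\<^bsub>H\<^esub> app S (pure H ?X h (ket u))"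
        unfolding pure_smult_right[OF H fd(1) ket_closed[OF u]]
        by (rule lin_smult[OF S pure_ket_closed[OF V H h u]])
      then show "app S (pure H ?X h (adjacency G u w \<odot>\<^bsub>?X\<^esub> ket u)) = adjacency G u w \<odot>\<^bsub>H\<^esub> app (entry ?V H P v u) h"
        using slice_app_pure_ket[OF V H P h, of v u] by (simp add: S_def)
    qed simp
    finally show ?thesis .
  qed
  have r: "app (slice ?V H v) (app ?R (pure H ?X h (ket w))) =
      finsum H (\<lambda>u. adjacency G v u \<odot>\<^bsub>H\<^esub> app (entry ?V H P u w) h) ?V"
    if h: "h \<in> carrier H" and w: "w \<in> ?V" and v: "v \<in> ?V" for h w v
  proof -
    have "app (adjacency_map G) (ket u) v = adjacency G v u" if "u \<in> ?V" for u
    proof -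
      have "app (adjacency_map G) (ket u) v = (\<Sum>v'\<in>?V. if v' = v then adjacency G v' u else 0)"
        unfolding app_adjacency_map[OF V that]
        by (subst finsum_fun_space[OF X.scale_closed[OF ket_closed]]) (auto simp: ket_apply intro!: sum.cong)
      then show ?thesis using V v by simp
    qed
    then show ?thesis
      using h w v entry_closed[OF V H P _ w h]
      by (simp add: slice_tensor_id[OF V H A v app_pure_ket_closed[OF V H P h w]] slice_app_pure_ket[OF V H P h])
        (rule H.finsum_cong', auto)
  qed
  show ?thesis unfolding eq_iff_slices[OF V H P L R]
  proof (intro iffI ballI)
    fix v w h
    assume *: "\<forall>h\<in>carrier H. \<forall>w\<in>?V. \<forall>v\<in>?V. app (slice ?V H v) (app ?L (pure H ?X h (ket w))) =
        app (slice ?V H v) (app ?R (pure H ?X h (ket w)))"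
      and v: "v \<in> ?V" and w: "w \<in> ?V" and h: "h \<in> carrier H"
    show "finsum H (\<lambda>u. adjacency G v u \<odot>\<^bsub>H\<^esub> app (entry ?V H P u w) h) ?V =
        finsum H (\<lambda>u. adjacency G u w \<odot>\<^bsub>H\<^esub> app (entry ?V H P v u) h) ?V"
      unfolding l[OF h w v, symmetric] r[OF h w v, symmetric] using * h w v by simp
  next
    fix h w v
    assume *: "\<forall>v\<in>?V. \<forall>w\<in>?V. \<forall>h\<in>carrier H.
        finsum H (\<lambda>u. adjacency G v u \<odot>\<^bsub>H\<^esub> app (entry ?V H P u w) h) ?V =
        finsum H (\<lambda>u. adjacency G u w \<odot>\<^bsub>H\<^esub> app (entry ?V H P v u) h) ?V"
      and h: "h \<in> carrier H" and w: "w \<in> ?V" and v: "v \<in> ?V"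
    show "app (slice ?V H v) (app ?L (pure H ?X h (ket w))) = app (slice ?V H v) (app ?R (pure H ?X h (ket w)))"
      unfolding l[OF h w v] r[OF h w v] using * h w v by simp
  qed
qed

theorem quantum_iso_iff_magic_unitary:
  fixes G :: "'v pair_pre_digraph" and H :: "'h hilb" and P :: "('v, 'h) qmap"
  assumes V: "finite (pverts G)"
  shows "quantum_iso G H P \<longleftrightarrow> fd_hilbert H \<and>
    P \<in> lin (H \<otimes>\<^sub>H fun_space (pverts G)) (fun_space (pverts G) \<otimes>\<^sub>H H) \<and>
    magic_unitary G H (entry (pverts G) H P)"
proof (cases "fd_hilbert H \<and> P \<in> lin (H \<otimes>\<^sub>H fun_space (pverts G)) (fun_space (pverts G) \<otimes>\<^sub>H H)")
  case True
  let ?V = "pverts G" let ?a = "entry ?V H P"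
  have H: "fd_hilbert H" and P: "P \<in> lin (H \<otimes>\<^sub>H fun_space ?V) (fun_space ?V \<otimes>\<^sub>H H)" using True by auto
  note al = entry_lin[OF V H P]
  let ?col = "\<forall>w\<in>?V. \<forall>h\<in>carrier H. finsum H (\<lambda>v. app (?a v w) h) ?V = h"
  let ?row = "\<forall>v\<in>?V. \<forall>h\<in>carrier H. finsum H (\<lambda>w. app (?a v w) h) ?V = h"
  let ?sa = "\<forall>v\<in>?V. \<forall>w\<in>?V. adj (?a v w) = ?a v w"
  let ?c1 = "\<forall>h\<in>carrier H. \<forall>w\<in>?V. \<forall>v\<in>?V. \<forall>v'\<in>?V.
     app (?a v' w) (app (?a v w) h) = (if v = v' then app (?a v w) h else \<zero>\<^bsub>H\<^esub>)"
  let ?c4 = "\<forall>h\<in>carrier H. \<forall>w\<in>?V. \<forall>w'\<in>?V. \<forall>v\<in>?V.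
     app (?a v w') (app (?a v w) h) = (if w = w' then app (?a v w) h else \<zero>\<^bsub>H\<^esub>)"
  let ?idem = "\<forall>v\<in>?V. \<forall>w\<in>?V. ?a v w \<circ>\<^sub>M ?a v w = ?a v w"
  have idem: ?idem if ?c1
  proof (intro ballI)
    fix v w assume v: "v \<in> ?V" and w: "w \<in> ?V"
    show "?a v w \<circ>\<^sub>M ?a v w = ?a v w"
      using that v w by (intro lin_eqI[OF comp_lin[OF al al H H] al]) auto
  qed
  have c1: ?c1 if sa: ?sa and i: ?idem and c: ?col
  proof (intro ballI)
    fix h w v v' assume *: "h \<in> carrier H" "w \<in> ?V" "v \<in> ?V" "v' \<in> ?V"
    show "app (?a v' w) (app (?a v w) h) = (if v = v' then app (?a v w) h else \<zero>\<^bsub>H\<^esub>)"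
      using projections_orthogonal[OF H V, of "\<lambda>v. ?a v w" v v' h] sa i c * al by auto
  qed
  have c4: ?c4 if sa: ?sa and i: ?idem and r: ?row
  proof (intro ballI)
    fix h w w' v assume *: "h \<in> carrier H" "w \<in> ?V" "w' \<in> ?V" "v \<in> ?V"
    show "app (?a v w') (app (?a v w) h) = (if w = w' then app (?a v w) h else \<zero>\<^bsub>H\<^esub>)"
      using projections_orthogonal[OF H V, of "\<lambda>w. ?a v w" w w' h] sa i r * al by auto
  qed
  let ?adj = "\<forall>v\<in>?V. \<forall>w\<in>?V. \<forall>h\<in>carrier H.
      finsum H (\<lambda>u. adjacency G v u \<odot>\<^bsub>H\<^esub> app (?a u w) h) ?V =
      finsum H (\<lambda>u. adjacency G u w \<odot>\<^bsub>H\<^esub> app (?a v u) h) ?V"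
  have m: "magic_unitary G H ?a \<longleftrightarrow> ?idem \<and> ?sa \<and> ?col \<and> ?row \<and> ?adj"
    unfolding magic_unitary_def Let_def using al by (simp add: ball_conj_distrib)
  \<comment> \<open>Idempotence is the diagonal case of column orthogonality. In the other direction
    it has to be fed, together with selfadjointness and one of the two sum conditions, into the
    argument on projections, once for columns and once for rows.\<close>
  have logic: "(T \<and> L \<and> c1 \<and> c \<and> s \<and> c4 \<and> r \<and> A) = (T \<and> L \<and> i \<and> s \<and> c \<and> r \<and> A)"
    if "c1 \<Longrightarrow> i" "s \<Longrightarrow> i \<Longrightarrow> c \<Longrightarrow> c1" "s \<Longrightarrow> i \<Longrightarrow> r \<Longrightarrow> c4" for T L c1 c s c4 r A i
    using that by blast
  show ?thesis
    unfolding quantum_iso_def Let_def comult_condition_iff[OF V H P] counit_condition_iff[OF V H P]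
      mult_condition_iff[OF V H P] unit_condition_iff[OF V H P] adjoint_condition_iff[OF V H P]
      adjacency_condition_iff[OF V H P] m
    by (rule logic) (rule idem c1 c4; assumption)+
qed (auto simp: quantum_iso_def Let_def)

section \<open>The free star algebra\<close>

lemma free_star_alg_simps [simp]:
  "x \<otimes>\<^bsub>free_star_alg X\<^esub> y = x * y" "\<one>\<^bsub>free_star_alg X\<^esub> = 1" "\<zero>\<^bsub>free_star_alg X\<^esub> = 0"
  "x \<oplus>\<^bsub>free_star_alg X\<^esub> y = x + y" "c \<odot>\<^bsub>free_star_alg X\<^esub> x = free_scale c x"
  "star (free_star_alg X) x = free_star x"
  by (simp_all add: free_star_alg_def)

lemma free_carrier_iff:
  "x \<in> carrier (free_star_alg X) \<longleftrightarrow> (\<forall>w\<in>Poly_Mapping.keys x. fst ` set (letters w) \<subseteq> X)"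
  by (simp add: free_star_alg_def)

lemma letters_plus [simp]: "letters (v + w) = letters v @ letters w"
  by (simp add: plus_star_word_def)

lemma letters_zero [simp]: "letters 0 = []"
  by (simp add: zero_star_word_def)

lemma word_star_word_star [simp]: "word_star (word_star w) = w"
proof -
  have "(\<lambda>(g, b). (g, \<not> b)) \<circ> (\<lambda>(g :: 'a, b). (g, \<not> b)) = id" by auto
  then show ?thesis by (simp add: word_star_def rev_map)
qed

lemma word_star_plus: "word_star (v + w) = word_star w + word_star v"
  by (simp add: word_star_def plus_star_word_def)

lemma word_star_zero [simp]: "word_star 0 = 0"
  by (simp add: word_star_def zero_star_word_def)

lemma letters_word_star: "fst ` set (letters (word_star w)) = fst ` set (letters w)"
  by (force simp: word_star_def)

text \<open>Replaces the sum over keys in the definition by a coefficientwise formula, from which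
  additivity and involutivity follow without tracking supports.\<close>

lemma lookup_free_star: "Poly_Mapping.lookup (free_star x) w = cnj (Poly_Mapping.lookup x (word_star w))"
proof -
  have "Poly_Mapping.lookup (free_star x) w =
      (\<Sum>v\<in>Poly_Mapping.keys x. if v = word_star w then cnj (Poly_Mapping.lookup x v) else 0)"
    unfolding free_star_def lookup_sum lookup_single
    by (intro sum.cong refl) (auto simp: when_def)
  also have "\<dots> = cnj (Poly_Mapping.lookup x (word_star w))"
    by (simp add: in_keys_iff)
  finally show ?thesis .
qed

lemma free_star_add: "free_star (x + y) = free_star x + free_star y"
  by (rule poly_mapping_eqI) (simp add: lookup_free_star lookup_add)

lemma free_star_diff: "free_star (x - y) = free_star x - free_star y"
  by (rule poly_mapping_eqI) (simp add: lookup_free_star lookup_minus)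

lemma free_star_zero [simp]: "free_star 0 = 0"
  by (rule poly_mapping_eqI) (simp add: lookup_free_star)

lemma free_star_free_star [simp]: "free_star (free_star x) = x"
  by (rule poly_mapping_eqI) (simp add: lookup_free_star)

lemma free_star_single: "free_star (Poly_Mapping.single w c) = Poly_Mapping.single (word_star w) (cnj c)"
  by (rule poly_mapping_eqI) (auto simp: lookup_free_star lookup_single when_def)

lemma free_star_one [simp]: "free_star 1 = 1"
  using free_star_single[of 0 1] by simp

lemma free_scale_single: "free_scale c (Poly_Mapping.single w d) = Poly_Mapping.single w (c * d)"
  by (simp add: free_scale_def mult_single)

lemma free_scale_add: "free_scale c (x + y) = free_scale c x + free_scale c y"
  by (simp add: free_scale_def distrib_left)

lemma free_scale_diff: "free_scale c (x - y) = free_scale c x - free_scale c y"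
  by (simp add: free_scale_def right_diff_distrib)

lemma free_scale_scale: "free_scale c (free_scale d x) = free_scale (c * d) x"
  by (simp add: free_scale_def mult_single flip: mult.assoc)

lemma free_scale_one [simp]: "free_scale 1 x = x"
  by (simp add: free_scale_def)

lemma free_scale_zero [simp]: "free_scale 0 x = 0" "free_scale c 0 = 0"
  by (simp_all add: free_scale_def)

lemma free_scale_add_left: "free_scale (c + d) x = free_scale c x + free_scale d x"
  by (simp add: free_scale_def single_add distrib_right)

lemma free_scale_minus_one: "free_scale (-1) x = - x"
  by (simp add: free_scale_def single_uminus)

lemma free_zero_closed [simp]: "0 \<in> carrier (free_star_alg X)"
  by (simp add: free_carrier_iff)

lemma free_one_closed [simp]: "1 \<in> carrier (free_star_alg X)"
  by (simp add: free_carrier_iff)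

lemma free_single_closed: "fst ` set (letters w) \<subseteq> X \<Longrightarrow> Poly_Mapping.single w c \<in> carrier (free_star_alg X)"
  by (simp add: free_carrier_iff)

lemma free_gen_closed [simp]: "g \<in> X \<Longrightarrow> gen g \<in> carrier (free_star_alg X)"
  unfolding gen_def by (rule free_single_closed) simp

lemma free_add_closed [simp]:
  "x \<in> carrier (free_star_alg X) \<Longrightarrow> y \<in> carrier (free_star_alg X) \<Longrightarrow> x + y \<in> carrier (free_star_alg X)"
  using keys_add[of x y] unfolding free_carrier_iff by blast

lemma free_mult_closed [simp]:
  assumes "x \<in> carrier (free_star_alg X)" "y \<in> carrier (free_star_alg X)"
  shows "x * y \<in> carrier (free_star_alg X)"
  unfolding free_carrier_iff
proof
  fix w assume "w \<in> Poly_Mapping.keys (x * y)"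
  then obtain u v where "w = u + v" "u \<in> Poly_Mapping.keys x" "v \<in> Poly_Mapping.keys y"
    using keys_mult[of x y] by blast
  with assms show "fst ` set (letters w) \<subseteq> X" unfolding free_carrier_iff by (auto simp: image_Un)
qed

lemma free_scale_closed [simp]: "x \<in> carrier (free_star_alg X) \<Longrightarrow> free_scale c x \<in> carrier (free_star_alg X)"
  unfolding free_scale_def by (intro free_mult_closed free_single_closed) auto

lemma free_uminus_closed [simp]: "x \<in> carrier (free_star_alg X) \<Longrightarrow> - x \<in> carrier (free_star_alg X)"
  by (simp add: free_scale_minus_one[symmetric] del: minus_mult_minus)

lemma free_diff_closed [simp]:
  "x \<in> carrier (free_star_alg X) \<Longrightarrow> y \<in> carrier (free_star_alg X) \<Longrightarrow> x - y \<in> carrier (free_star_alg X)"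
  by (simp only: diff_conv_add_uminus free_add_closed free_uminus_closed)

lemma free_sum_closed [simp]:
  "(\<And>i. i \<in> I \<Longrightarrow> f i \<in> carrier (free_star_alg X)) \<Longrightarrow> sum f I \<in> carrier (free_star_alg X)"
  by (induction I rule: infinite_finite_induct) auto

lemma free_star_closed [simp]: "x \<in> carrier (free_star_alg X) \<Longrightarrow> free_star x \<in> carrier (free_star_alg X)"
  unfolding free_carrier_iff
proof
  fix w assume x: "\<forall>w\<in>Poly_Mapping.keys x. fst ` set (letters w) \<subseteq> X" and "w \<in> Poly_Mapping.keys (free_star x)"
  then have "word_star w \<in> Poly_Mapping.keys x" by (simp add: in_keys_iff lookup_free_star)
  with x letters_word_star[of w] show "fst ` set (letters w) \<subseteq> X" by metis
qed

lemma free_sum_singles: "(\<Sum>w\<in>Poly_Mapping.keys x. Poly_Mapping.single w (Poly_Mapping.lookup x w)) = x"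
  by (rule poly_mapping_eqI) (simp add: lookup_sum lookup_single when_def in_keys_iff)

lemma free_induct [consumes 1, case_names zero single add]:
  assumes x: "x \<in> carrier (free_star_alg X)"
    and zero: "P 0"
    and single: "\<And>w c. fst ` set (letters w) \<subseteq> X \<Longrightarrow> P (Poly_Mapping.single w c)"
    and add: "\<And>y z. y \<in> carrier (free_star_alg X) \<Longrightarrow> z \<in> carrier (free_star_alg X) \<Longrightarrow> P y \<Longrightarrow> P z \<Longrightarrow> P (y + z)"
  shows "P x"
proof -
  let ?s = "\<lambda>w. Poly_Mapping.single w (Poly_Mapping.lookup x w)"
  have "P (sum ?s S) \<and> sum ?s S \<in> carrier (free_star_alg X)" if "S \<subseteq> Poly_Mapping.keys x" for S
    using finite_subset[OF that finite_keys] that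
  proof (induction S rule: finite_induct)
    case (insert w S)
    then have "fst ` set (letters w) \<subseteq> X" using x unfolding free_carrier_iff by blast
    with insert show ?case by (simp add: add single free_single_closed)
  qed (simp add: zero)
  from this[of "Poly_Mapping.keys x"] show ?thesis by (simp add: free_sum_singles)
qed

lemma free_star_mult: "free_star (x * y) = free_star y * free_star x"
proof -
  \<comment> \<open>With all generators allowed, every element lies in the carrier, so that
    induction over the carrier applies to arbitrary elements.\<close>
  have U: "z \<in> carrier (free_star_alg UNIV)" for z :: "'a free_elem" by (simp add: free_carrier_iff)
  show ?thesis
    using U[of x]
  proof (induction x rule: free_induct)
    case (single v c)
    show ?case using U[of y]
      by (induction y rule: free_induct)
        (simp_all add: mult_single free_star_single word_star_plus distrib_left distrib_right free_star_add mult.commute)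
  qed (simp_all add: distrib_left distrib_right free_star_add)
qed

lemma lookup_free_scale: "Poly_Mapping.lookup (free_scale c x) w = c * Poly_Mapping.lookup x w"
  unfolding free_scale_def mult_map_scale_conv_mult[symmetric] by (simp add: map.rep_eq when_def)

lemma free_star_scale: "free_star (free_scale c x) = free_scale (cnj c) (free_star x)"
  by (rule poly_mapping_eqI) (simp add: lookup_free_star lookup_free_scale)

section \<open>The universal seminorm and the completion\<close>

locale free_cstar_seminorm =
  fixes X :: "'g set" and p :: "'g free_elem \<Rightarrow> real"
  assumes seminorm: "cstar_seminorm (free_star_alg X) p"
begin

lemma nonneg: "x \<in> carrier (free_star_alg X) \<Longrightarrow> 0 \<le> p x"
  and triangle: "x \<in> carrier (free_star_alg X) \<Longrightarrow> y \<in> carrier (free_star_alg X) \<Longrightarrow> p (x + y) \<le> p x + p y"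
  and scale: "x \<in> carrier (free_star_alg X) \<Longrightarrow> p (free_scale c x) = cmod c * p x"
  and mult: "x \<in> carrier (free_star_alg X) \<Longrightarrow> y \<in> carrier (free_star_alg X) \<Longrightarrow> p (x * y) \<le> p x * p y"
  and cstar: "x \<in> carrier (free_star_alg X) \<Longrightarrow> p (free_star x * x) = (p x)\<^sup>2"
  using seminorm unfolding cstar_seminorm_def by auto

lemma zero [simp]: "p 0 = 0"
  using scale[of 0 0] by simp

lemma uminus: "x \<in> carrier (free_star_alg X) \<Longrightarrow> p (- x) = p x"
  using scale[of x "-1"] by (simp add: free_scale_minus_one)

lemma minus_commute: "x \<in> carrier (free_star_alg X) \<Longrightarrow> y \<in> carrier (free_star_alg X) \<Longrightarrow> p (x - y) = p (y - x)"
  using uminus[of "x - y"] by simp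

lemma reverse_triangle: "x \<in> carrier (free_star_alg X) \<Longrightarrow> y \<in> carrier (free_star_alg X) \<Longrightarrow> p x \<le> p (x - y) + p y"
  using triangle[of "x - y" y] by simp

lemma triangle_trans:
  "x \<in> carrier (free_star_alg X) \<Longrightarrow> y \<in> carrier (free_star_alg X) \<Longrightarrow> z \<in> carrier (free_star_alg X) \<Longrightarrow>
    p (x - z) \<le> p (x - y) + p (y - z)"
  using triangle[of "x - y" "y - z"] by simp

text \<open>The C*-identity bounds the square of \<open>p x\<close> by
  \<open>p (free_star x) * p x\<close>, and one factor is cancelled.\<close>

lemma star_le:
  assumes x: "x \<in> carrier (free_star_alg X)" shows "p x \<le> p (free_star x)"
proof (cases "p x = 0")
  case False
  with nonneg[OF x] have "0 < p x" by simp
  moreover have "p x * p x \<le> p (free_star x) * p x"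
    using mult[OF free_star_closed[OF x] x] cstar[OF x] by (simp add: power2_eq_square)
  ultimately show ?thesis by simp
qed (use nonneg[OF free_star_closed[OF x]] in simp)

lemma star: "x \<in> carrier (free_star_alg X) \<Longrightarrow> p (free_star x) = p x"
  using star_le[of x] star_le[of "free_star x"] by simp

lemma one_le: "p 1 \<le> 1"
proof -
  have "p 1 = (p 1)\<^sup>2" using cstar[of 1] by simp
  then show ?thesis by (metis le_numeral_extra(4) less_eq_real_def nonneg free_one_closed power2_eq_square
        mult_cancel_left mult.right_neutral linorder_not_less zero_le_one)
qed

lemma mult_diff:
  assumes "x \<in> carrier (free_star_alg X)" "y \<in> carrier (free_star_alg X)"
    "x' \<in> carrier (free_star_alg X)" "y' \<in> carrier (free_star_alg X)"
  shows "p (x * y - x' * y') \<le> p x * p (y - y') + p (x - x') * p y'"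
proof -
  have "x * y - x' * y' = x * (y - y') + (x - x') * y'" by (simp add: algebra_simps)
  also have "p \<dots> \<le> p (x * (y - y')) + p ((x - x') * y')" using assms by (intro triangle) auto
  also have "\<dots> \<le> p x * p (y - y') + p (x - x') * p y'" using assms by (intro add_mono mult) auto
  finally show ?thesis .
qed

lemma word_le:
  assumes gen: "\<And>g. g \<in> X \<Longrightarrow> p (gen g) \<le> 1" and w: "fst ` set (letters w) \<subseteq> X"
  shows "p (Poly_Mapping.single w 1) \<le> 1"
proof -
  have "p (Poly_Mapping.single (Word l) 1) \<le> 1" if "fst ` set l \<subseteq> X" for l
    using that
  proof (induction l)
    case Nil
    show ?case using one_le by (simp flip: zero_star_word_def)
  next
    case (Cons a l)
    obtain g b where a: "a = (g, b)" by (cases a)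
    have g: "g \<in> X" using Cons.prems a by simp
    let ?a = "Poly_Mapping.single (Word [a]) 1 :: 'g free_elem"
    have ac: "?a \<in> carrier (free_star_alg X)" using g a by (intro free_single_closed) simp
    have lc: "Poly_Mapping.single (Word l) 1 \<in> carrier (free_star_alg X)"
      using Cons.prems by (intro free_single_closed) simp
    have "?a = (if b then free_star (gen g) else gen g)"
      by (simp add: a gen_def free_star_single word_star_def)
    then have a1: "p ?a \<le> 1" using gen[OF g] star[OF free_gen_closed[OF g]] by (simp split: if_splits)
    have "Poly_Mapping.single (Word (a # l)) 1 = ?a * Poly_Mapping.single (Word l) 1"
      by (simp add: mult_single plus_star_word_def)
    then have "p (Poly_Mapping.single (Word (a # l)) 1) \<le> p ?a * p (Poly_Mapping.single (Word l) 1)"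
      using mult[OF ac lc] by simp
    also have "\<dots> \<le> 1 * 1" using Cons nonneg[OF lc] a1 by (intro mult_mono) auto
    finally show ?case by simp
  qed
  from this[of "letters w"] w show ?thesis by simp
qed

text \<open>The bound does not involve \<open>p\<close>. This uniformity is what makes the supremum
  over all seminorms finite once the relations bound the generators.\<close>

lemma le_sum_coefficients:
  assumes gen: "\<And>g. g \<in> X \<Longrightarrow> p (gen g) \<le> 1" and x: "x \<in> carrier (free_star_alg X)"
  shows "p x \<le> (\<Sum>w\<in>Poly_Mapping.keys x. cmod (Poly_Mapping.lookup x w))"
proof -
  let ?s = "\<lambda>w. Poly_Mapping.single w (Poly_Mapping.lookup x w)"
  have "p (sum ?s S) \<le> (\<Sum>w\<in>S. cmod (Poly_Mapping.lookup x w))" if "S \<subseteq> Poly_Mapping.keys x" for S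
    using finite_subset[OF that finite_keys] that
  proof (induction S rule: finite_induct)
    case (insert w S)
    have w: "fst ` set (letters w) \<subseteq> X" using insert x unfolding free_carrier_iff by blast
    have c: "sum ?s S \<in> carrier (free_star_alg X)"
      using insert x unfolding free_carrier_iff[of x] by (intro free_sum_closed free_single_closed) blast
    have "?s w = free_scale (Poly_Mapping.lookup x w) (Poly_Mapping.single w 1)"
      by (simp add: free_scale_single)
    then have "p (?s w) = cmod (Poly_Mapping.lookup x w) * p (Poly_Mapping.single w 1)"
      by (simp add: scale free_single_closed w)
    also have "\<dots> \<le> cmod (Poly_Mapping.lookup x w)"
      using word_le[OF gen w] by (simp add: mult_left_le)
    finally have "p (?s w) \<le> cmod (Poly_Mapping.lookup x w)" .
    moreover have "p (?s w + sum ?s S) \<le> p (?s w) + p (sum ?s S)"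
      by (rule triangle[OF free_single_closed[OF w] c])
    moreover have "p (sum ?s S) \<le> (\<Sum>w\<in>S. cmod (Poly_Mapping.lookup x w))" using insert by simp
    ultimately show ?case using insert(1,2) by simp
  qed simp
  from this[of "Poly_Mapping.keys x"] show ?thesis by (simp add: free_sum_singles)
qed

end

text \<open>The bound \<open>B\<close> is chosen before \<open>p\<close>: it says that the set in
  \<open>univ_seminorm\<close> is bounded above, without which its \<open>Sup\<close> would carry no
  information.\<close>

locale cstar_presentation =
  fixes X :: "'g set" and R :: "'g free_elem set"
  assumes bounded: "x \<in> carrier (free_star_alg X) \<Longrightarrow>
    \<exists>B. \<forall>p. cstar_seminorm (free_star_alg X) p \<longrightarrow> (\<forall>r\<in>R. p r = 0) \<longrightarrow> p x \<le> B"
    and relations_closed: "R \<subseteq> carrier (free_star_alg X)"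
begin

abbreviation F where "F \<equiv> free_star_alg X"
abbreviation u where "u \<equiv> univ_seminorm X R"

lemma seminorm_le_univ:
  assumes "cstar_seminorm F p" "\<And>r. r \<in> R \<Longrightarrow> p r = 0" "x \<in> carrier F"
  shows "p x \<le> u x"
  unfolding univ_seminorm_def
proof (rule cSup_upper)
  show "p x \<in> {p x | p. cstar_seminorm F p \<and> (\<forall>r\<in>R. p r = 0)}" using assms by blast
  show "bdd_above {p x | p. cstar_seminorm F p \<and> (\<forall>r\<in>R. p r = 0)}"
    using bounded[OF assms(3)] by (auto simp: bdd_above_def)
qed

lemma univ_le:
  assumes "\<And>p. cstar_seminorm F p \<Longrightarrow> (\<And>r. r \<in> R \<Longrightarrow> p r = 0) \<Longrightarrow> p x \<le> c"
  shows "u x \<le> c"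
  unfolding univ_seminorm_def
proof (rule cSup_least)
  \<comment> \<open>The zero seminorm vanishes on the relations, so the supremum is taken over a
    nonempty set.\<close>
  have "cstar_seminorm F (\<lambda>_. 0)" by (simp add: cstar_seminorm_def)
  then show "{p x | p. cstar_seminorm F p \<and> (\<forall>r\<in>R. p r = 0)} \<noteq> {}" by auto
qed (use assms in auto)

lemma univ_nonneg: "x \<in> carrier F \<Longrightarrow> 0 \<le> u x"
  using seminorm_le_univ[of "\<lambda>_. 0" x] by (simp add: cstar_seminorm_def)

lemma cstar_seminorm_univ: "cstar_seminorm F u"
  unfolding cstar_seminorm_def free_star_alg_simps
proof (intro conjI ballI allI)
  fix x assume x: "x \<in> carrier F"
  show "0 \<le> u x" using x by (rule univ_nonneg)
  have scale_le: "u (free_scale c y) \<le> cmod c * u y" if "y \<in> carrier F" for c y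
  proof (rule univ_le)
    fix p assume p: "cstar_seminorm F p" "\<And>r. r \<in> R \<Longrightarrow> p r = 0"
    interpret p: free_cstar_seminorm X p by (standard, fact)
    show "p (free_scale c y) \<le> cmod c * u y"
      using seminorm_le_univ[OF p that] that by (simp add: p.scale mult_left_mono)
  qed
  fix c
  show "u (free_scale c x) = cmod c * u x"
  proof (cases "c = 0")
    case True
    then show ?thesis using scale_le[OF x, of 0] univ_nonneg[of 0] by simp
  next
    case False
    \<comment> \<open>The reverse inequality is the one already shown, applied to
      \<open>inverse c\<close> and the scaled element.\<close>
    have "u (free_scale (inverse c) (free_scale c x)) \<le> cmod (inverse c) * u (free_scale c x)"
      using x by (intro scale_le) simp
    then have "cmod c * u x \<le> u (free_scale c x)"
      using False by (simp add: free_scale_scale norm_inverse norm_divide field_simps)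
    with scale_le[OF x, of c] show ?thesis by simp
  qed
  show "u (free_star x * x) = (u x)\<^sup>2"
  proof (rule antisym)
    show "u (free_star x * x) \<le> (u x)\<^sup>2"
    proof (rule univ_le)
      fix p assume p: "cstar_seminorm F p" "\<And>r. r \<in> R \<Longrightarrow> p r = 0"
      interpret p: free_cstar_seminorm X p by (standard, fact)
      show "p (free_star x * x) \<le> (u x)\<^sup>2"
        using seminorm_le_univ[OF p x] p.nonneg[OF x] by (simp add: p.cstar[OF x] power_mono)
    qed
    have xx: "free_star x * x \<in> carrier F" using x by simp
    \<comment> \<open>The C*-identity holds for each \<open>p\<close>; written with a square root it
      bounds \<open>p x\<close> by a number independent of \<open>p\<close>, so the supremum can be
      taken.\<close>
    have "u x \<le> sqrt (u (free_star x * x))"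
    proof (rule univ_le)
      fix p assume p: "cstar_seminorm F p" "\<And>r. r \<in> R \<Longrightarrow> p r = 0"
      interpret p: free_cstar_seminorm X p by (standard, fact)
      show "p x \<le> sqrt (u (free_star x * x))"
        using seminorm_le_univ[OF p xx] by (intro real_le_rsqrt) (simp add: p.cstar[OF x])
    qed
    then show "(u x)\<^sup>2 \<le> u (free_star x * x)"
      using univ_nonneg[OF x] univ_nonneg[OF xx] by (metis real_sqrt_le_iff real_sqrt_abs abs_of_nonneg)
  qed
  fix y assume y: "y \<in> carrier F"
  show "u (x + y) \<le> u x + u y"
  proof (rule univ_le)
    fix p assume p: "cstar_seminorm F p" "\<And>r. r \<in> R \<Longrightarrow> p r = 0"
    interpret p: free_cstar_seminorm X p by (standard, fact)
    show "p (x + y) \<le> u x + u y"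
      using seminorm_le_univ[OF p x] seminorm_le_univ[OF p y] p.triangle[OF x y] by linarith
  qed
  show "u (x * y) \<le> u x * u y"
  proof (rule univ_le)
    fix p assume p: "cstar_seminorm F p" "\<And>r. r \<in> R \<Longrightarrow> p r = 0"
    interpret p: free_cstar_seminorm X p by (standard, fact)
    have "p x * p y \<le> u x * u y"
      using seminorm_le_univ[OF p x] seminorm_le_univ[OF p y] p.nonneg[OF x] p.nonneg[OF y] univ_nonneg[OF x]
      by (intro mult_mono) auto
    with p.mult[OF x y] show "p (x * y) \<le> u x * u y" by linarith
  qed
qed

sublocale u: free_cstar_seminorm X u
  by standard (rule cstar_seminorm_univ)

lemma univ_relation: "r \<in> R \<Longrightarrow> u r = 0"
proof (rule antisym)
  assume r: "r \<in> R"
  show "u r \<le> 0" by (rule univ_le) (simp add: r)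
  show "0 \<le> u r" using r relations_closed by (intro univ_nonneg) blast
qed

section \<open>Cauchy sequences modulo null sequences\<close>

abbreviation C where "C \<equiv> cauchy_ring X R"
abbreviation N where "N \<equiv> null_seqs X R"

lemma C_simps [simp]:
  "s \<otimes>\<^bsub>C\<^esub> t = (\<lambda>n. s n * t n)" "\<one>\<^bsub>C\<^esub> = (\<lambda>n. 1)" "\<zero>\<^bsub>C\<^esub> = (\<lambda>n. 0)" "s \<oplus>\<^bsub>C\<^esub> t = (\<lambda>n. s n + t n)"
  by (simp_all add: cauchy_ring_def)

lemma C_iff: "s \<in> carrier C \<longleftrightarrow> (\<forall>n. s n \<in> carrier F) \<and>
    (\<forall>e>0. \<exists>M. \<forall>m\<ge>M. \<forall>n\<ge>M. u (s m - s n) < e)"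
  by (simp add: cauchy_ring_def)

lemma C_F [simp]: "s \<in> carrier C \<Longrightarrow> s n \<in> carrier F"
  by (simp add: C_iff)

lemma C_cauchy: "s \<in> carrier C \<Longrightarrow> 0 < e \<Longrightarrow> \<exists>M. \<forall>m\<ge>M. \<forall>n\<ge>M. u (s m - s n) < e"
  by (simp add: C_iff)

lemma N_iff: "s \<in> N \<longleftrightarrow> s \<in> carrier C \<and> (\<lambda>n. u (s n)) \<longlonglongrightarrow> 0"
  by (simp add: null_seqs_def)

lemma const_C [simp]: "x \<in> carrier F \<Longrightarrow> (\<lambda>_. x) \<in> carrier C"
  by (simp add: C_iff)

lemma C_bounded:
  assumes s: "s \<in> carrier C"
  obtains B where "0 < B" "\<And>n. u (s n) \<le> B"
proof -
  obtain M where M: "\<And>m n. m \<ge> M \<Longrightarrow> n \<ge> M \<Longrightarrow> u (s m - s n) < 1"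
    using C_cauchy[OF s, of 1] by auto
  \<comment> \<open>The maximum covers the indices up to \<open>M\<close>, and the added 1 covers
    the tail, whose terms differ from \<open>s M\<close> by less than 1. It also makes
    \<open>B\<close> positive, as is needed when dividing by it.\<close>
  define B where "B = Max ((\<lambda>n. u (s n)) ` {..M}) + 1"
  have B: "u (s n) \<le> B - 1" if "n \<le> M" for n
    unfolding B_def using that by simp
  have "u (s n) \<le> B" for n
  proof (cases "n \<le> M")
    case False
    then show ?thesis using M[of n M] B[of M] u.reverse_triangle[of "s n" "s M"] s by force
  qed (use B in force)
  moreover have "0 < B" using B[of 0] univ_nonneg[of "s 0"] s by force
  ultimately show thesis using that by blast
qed

lemma add_C [simp]:
  assumes s: "s \<in> carrier C" and t: "t \<in> carrier C" shows "(\<lambda>n. s n + t n) \<in> carrier C"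
  unfolding C_iff
proof (intro conjI allI impI)
  fix e :: real assume "0 < e"
  then obtain M M' where M: "\<forall>m\<ge>M. \<forall>n\<ge>M. u (s m - s n) < e / 2" and M': "\<forall>m\<ge>M'. \<forall>n\<ge>M'. u (t m - t n) < e / 2"
    using C_cauchy[OF s, of "e / 2"] C_cauchy[OF t, of "e / 2"] by auto
  show "\<exists>M. \<forall>m\<ge>M. \<forall>n\<ge>M. u (s m + t m - (s n + t n)) < e"
  proof (intro exI[of _ "max M M'"] allI impI)
    fix m n assume "max M M' \<le> m" "max M M' \<le> n"
    then have st: "u (s m - s n) < e / 2" "u (t m - t n) < e / 2" using M M' by auto
    have "u (s m + t m - (s n + t n)) = u ((s m - s n) + (t m - t n))" by (simp add: algebra_simps)
    also have "\<dots> \<le> u (s m - s n) + u (t m - t n)"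
      using s t by (intro u.triangle) auto
    also have "\<dots> < e" using st by linarith
    finally show "u (s m + t m - (s n + t n)) < e" .
  qed
qed (use s t in simp)

lemma mult_C [simp]:
  assumes s: "s \<in> carrier C" and t: "t \<in> carrier C" shows "(\<lambda>n. s n * t n) \<in> carrier C"
  unfolding C_iff
proof (intro conjI allI impI)
  fix e :: real assume e: "0 < e"
  obtain A where A: "0 < A" "\<And>n. u (s n) \<le> A" by (rule C_bounded[OF s]) (rule that)
  obtain B where B: "0 < B" "\<And>n. u (t n) \<le> B" by (rule C_bounded[OF t]) (rule that)
  obtain M M' where M: "\<forall>m\<ge>M. \<forall>n\<ge>M. u (s m - s n) < e / (2 * B)"
    and M': "\<forall>m\<ge>M'. \<forall>n\<ge>M'. u (t m - t n) < e / (2 * A)"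
    using C_cauchy[OF s, of "e / (2 * B)"] C_cauchy[OF t, of "e / (2 * A)"] e A B by auto
  show "\<exists>M. \<forall>m\<ge>M. \<forall>n\<ge>M. u (s m * t m - s n * t n) < e"
  proof (intro exI[of _ "max M M'"] allI impI)
    fix m n :: nat assume "max M M' \<le> m" "max M M' \<le> n"
    then have st: "u (s m - s n) < e / (2 * B)" "u (t m - t n) < e / (2 * A)" using M M' by auto
    have "u (s m * t m - s n * t n) \<le> u (s m) * u (t m - t n) + u (s m - s n) * u (t n)"
      using s t by (intro u.mult_diff) auto
    also have "\<dots> \<le> A * u (t m - t n) + u (s m - s n) * B"
      using A B s t by (intro add_mono mult_right_mono mult_left_mono u.nonneg) auto
    also have "\<dots> < A * (e / (2 * A)) + e / (2 * B) * B"
      using A B st by (intro add_strict_mono mult_strict_left_mono mult_strict_right_mono)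
    also have "\<dots> = e" using A B by simp
    finally show "u (s m * t m - s n * t n) < e" .
  qed
qed (use s t in simp)

lemma scale_C [simp]:
  assumes s: "s \<in> carrier C" shows "(\<lambda>n. free_scale c (s n)) \<in> carrier C"
  unfolding free_scale_def by (intro mult_C const_C s free_single_closed) simp

lemma uminus_C [simp]: "s \<in> carrier C \<Longrightarrow> (\<lambda>n. - s n) \<in> carrier C"
  using scale_C[of s "-1"] by (simp add: free_scale_minus_one)

lemma diff_C [simp]: "s \<in> carrier C \<Longrightarrow> t \<in> carrier C \<Longrightarrow> (\<lambda>n. s n - t n) \<in> carrier C"
  using add_C[of s "\<lambda>n. - t n"] by simp

lemma star_C [simp]:
  assumes s: "s \<in> carrier C" shows "(\<lambda>n. free_star (s n)) \<in> carrier C"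
  using s by (auto simp: C_iff u.star simp flip: free_star_diff)

lemma ring_C: "ring C"
proof (rule ringI)
  show "abelian_group C"
    by (rule abelian_groupI) (auto simp: algebra_simps intro!: bexI[of _ "\<lambda>n. - _ n"])
  show "Group.monoid C"
    by (rule monoidI) (auto simp: mult.assoc)
qed (auto simp: algebra_simps)

lemma null_add: "s \<in> N \<Longrightarrow> t \<in> N \<Longrightarrow> (\<lambda>n. s n + t n) \<in> N"
  unfolding N_iff
proof safe
  assume *: "s \<in> carrier C" "t \<in> carrier C" "(\<lambda>n. u (s n)) \<longlonglongrightarrow> 0" "(\<lambda>n. u (t n)) \<longlonglongrightarrow> 0"
  show "(\<lambda>n. u (s n + t n)) \<longlonglongrightarrow> 0"
    by (rule tendsto_sandwich[OF _ _ tendsto_const tendsto_add_zero[OF *(3,4)]])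
      (use * in \<open>auto intro!: always_eventually u.nonneg u.triangle\<close>)
qed simp

lemma null_mult_left:
  assumes s: "s \<in> N" and t: "t \<in> carrier C" shows "(\<lambda>n. t n * s n) \<in> N"
proof -
  obtain B where B: "\<And>n. u (t n) \<le> B" using C_bounded[OF t] by blast
  have s': "s \<in> carrier C" "(\<lambda>n. u (s n)) \<longlonglongrightarrow> 0" using s by (auto simp: N_iff)
  have b: "u (t n * s n) \<le> B * u (s n)" for n
  proof -
    have "u (t n * s n) \<le> u (t n) * u (s n)" using s' t by (intro u.mult) simp_all
    also have "\<dots> \<le> B * u (s n)" using s' by (intro mult_right_mono B u.nonneg) simp
    finally show ?thesis .
  qed
  have nn: "0 \<le> u (t n * s n)" for n using s' t by (intro u.nonneg) simp
  have "(\<lambda>n. u (t n * s n)) \<longlonglongrightarrow> 0"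
    by (rule tendsto_sandwich[OF _ _ tendsto_const tendsto_mult_right_zero[OF s'(2), of B]])
      (simp_all only: b nn eventually_True)
  with s' t show ?thesis by (simp add: N_iff)
qed

lemma null_star: "s \<in> N \<Longrightarrow> (\<lambda>n. free_star (s n)) \<in> N"
  by (auto simp: N_iff u.star)

text \<open>The star preserves null sequences and reverses products, so this is the left-handed case
  conjugated by the star.\<close>

lemma null_mult_right:
  assumes s: "s \<in> N" and t: "t \<in> carrier C" shows "(\<lambda>n. s n * t n) \<in> N"
  using null_star[OF null_mult_left[OF null_star[OF s] star_C[OF t]]] by (simp add: free_star_mult)

lemma null_uminus: "s \<in> N \<Longrightarrow> (\<lambda>n. - s n) \<in> N"
  by (auto simp: N_iff u.uminus)

lemma ideal_N: "ideal N C"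
proof (rule idealI[OF ring_C])
  interpret ring C by (rule ring_C)
  have z: "(\<lambda>_. 0) \<in> N" by (simp add: N_iff)
  show "subgroup N (add_monoid C)"
  proof (rule group.subgroupI[OF a_group])
    show "N \<subseteq> carrier (add_monoid C)" by (auto simp: N_iff)
    show "N \<noteq> {}" using z by blast
    fix s assume s: "s \<in> N"
    then have sC: "s \<in> carrier C" by (simp add: N_iff)
    have "\<ominus>\<^bsub>C\<^esub> s = (\<lambda>n. - s n)"
      using sC by (intro minus_equality) auto
    then show "inv\<^bsub>add_monoid C\<^esub> s \<in> N"
      using null_uminus[OF s] by (simp add: a_inv_def)
    fix t assume "t \<in> N"
    then show "s \<otimes>\<^bsub>add_monoid C\<^esub> t \<in> N" using s null_add by simp
  qed
qed (simp_all add: null_mult_left null_mult_right)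

abbreviation A where "A \<equiv> universal_cstar X R"

definition cls :: "(nat \<Rightarrow> 'g free_elem) \<Rightarrow> (nat \<Rightarrow> 'g free_elem) set" where
  "cls s = N +>\<^bsub>C\<^esub> s"

lemma cls_eq: "cls s = {\<lambda>n. d n + s n | d. d \<in> N}"
  by (auto simp: cls_def a_r_coset_def')

lemma mem_cls_iff: "s \<in> carrier C \<Longrightarrow> t \<in> cls s \<longleftrightarrow> t \<in> carrier C \<and> (\<lambda>n. u (t n - s n)) \<longlonglongrightarrow> 0"
proof safe
  assume s: "s \<in> carrier C" and "t \<in> cls s"
  then obtain d where d: "d \<in> N" "t = (\<lambda>n. d n + s n)" by (auto simp: cls_eq)
  then show "t \<in> carrier C" "(\<lambda>n. u (t n - s n)) \<longlonglongrightarrow> 0" using s by (simp_all add: N_iff)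
next
  assume *: "s \<in> carrier C" "t \<in> carrier C" "(\<lambda>n. u (t n - s n)) \<longlonglongrightarrow> 0"
  then have "(\<lambda>n. t n - s n) \<in> N" by (simp add: N_iff)
  then show "t \<in> cls s" unfolding cls_eq by (auto intro!: exI[of _ "\<lambda>n. t n - s n"])
qed

lemma self_mem_cls: "s \<in> carrier C \<Longrightarrow> s \<in> cls s"
  by (simp add: mem_cls_iff)

lemma cls_eqI:
  assumes s: "s \<in> carrier C" and t: "t \<in> carrier C" and st: "(\<lambda>n. u (s n - t n)) \<longlonglongrightarrow> 0"
  shows "cls s = cls t"
proof -
  have "s \<in> N +>\<^bsub>C\<^esub> t" using mem_cls_iff[OF t] s st by (simp add: cls_def)
  moreover interpret ideal N C by (rule ideal_N)
  from calculation t have "N +>\<^bsub>C\<^esub> t = N +>\<^bsub>C\<^esub> s" by (intro a_repr_independence is_additive_subgroup a_subgroup)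
  then show ?thesis by (simp add: cls_def)
qed

lemma carrier_A: "carrier A = cls ` carrier C"
  by (auto simp: universal_cstar_def Let_def FactRing_def A_RCOSETS_def' cls_def)

lemma one_A: "\<one>\<^bsub>A\<^esub> = cls (\<lambda>_. 1)"
  by (simp add: universal_cstar_def Let_def FactRing_def cls_def)

lemma add_A: "s \<in> carrier C \<Longrightarrow> t \<in> carrier C \<Longrightarrow> cls s \<oplus>\<^bsub>A\<^esub> cls t = cls (\<lambda>n. s n + t n)"
proof -
  interpret ideal N C by (rule ideal_N)
  show "s \<in> carrier C \<Longrightarrow> t \<in> carrier C \<Longrightarrow> cls s \<oplus>\<^bsub>A\<^esub> cls t = cls (\<lambda>n. s n + t n)"
    by (simp add: universal_cstar_def Let_def FactRing_def cls_def a_rcos_sum)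
qed

lemma mult_A: "s \<in> carrier C \<Longrightarrow> t \<in> carrier C \<Longrightarrow> cls s \<otimes>\<^bsub>A\<^esub> cls t = cls (\<lambda>n. s n * t n)"
proof -
  interpret ideal N C by (rule ideal_N)
  show "s \<in> carrier C \<Longrightarrow> t \<in> carrier C \<Longrightarrow> cls s \<otimes>\<^bsub>A\<^esub> cls t = cls (\<lambda>n. s n * t n)"
    by (simp add: universal_cstar_def Let_def FactRing_def cls_def rcoset_mult_add)
qed

lemma null_scale: "d \<in> N \<Longrightarrow> (\<lambda>n. free_scale c (d n)) \<in> N"
  unfolding free_scale_def by (rule null_mult_left) (auto intro!: const_C free_single_closed)

text \<open>The scaled representatives together with the null sequences added back form a full
  coset: a scaled null sequence is null and is absorbed, also for \<open>c = 0\<close>.\<close>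

lemma smult_A: "s \<in> carrier C \<Longrightarrow> c \<odot>\<^bsub>A\<^esub> cls s = cls (\<lambda>n. free_scale c (s n))"
proof -
  have "c \<odot>\<^bsub>A\<^esub> cls s = {\<lambda>n. d n + free_scale c (d' n + s n) | d d'. d \<in> N \<and> d' \<in> N}"
    by (auto simp: universal_cstar_def Let_def set_add_def set_mult_def cls_eq)
  also have "\<dots> = cls (\<lambda>n. free_scale c (s n))"
    unfolding cls_eq
  proof safe
    fix d d' assume "d \<in> N" "d' \<in> N"
    then show "\<exists>d''. (\<lambda>n. d n + free_scale c (d' n + s n)) = (\<lambda>n. d'' n + free_scale c (s n)) \<and> d'' \<in> N"
      by (intro exI[of _ "\<lambda>n. d n + free_scale c (d' n)"])
        (auto simp: free_scale_add add.assoc intro!: null_add null_scale)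
  next
    fix d assume "d \<in> N"
    then show "\<exists>d' d''. (\<lambda>n. d n + free_scale c (s n)) = (\<lambda>n. d' n + free_scale c (d'' n + s n)) \<and> d' \<in> N \<and> d'' \<in> N"
      by (intro exI[of _ d] exI[of _ "\<lambda>_. 0"]) (auto simp: N_iff)
  qed
  finally show ?thesis .
qed

lemma star_A: "star A (cls s) = cls (\<lambda>n. free_star (s n))"
  unfolding cls_eq universal_cstar_def Let_def
proof (simp, safe)
  fix d assume "d \<in> N"
  then show "\<exists>d'. (\<lambda>n. free_star (d n + s n)) = (\<lambda>n. d' n + free_star (s n)) \<and> d' \<in> N"
    by (intro exI[of _ "\<lambda>n. free_star (d n)"]) (auto simp: free_star_add null_star)
  show "(\<lambda>n. d n + free_star (s n)) \<in> (\<lambda>s n. free_star (s n)) ` {\<lambda>n. d n + s n | d. d \<in> N}"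
    by (rule image_eqI[of _ _ "\<lambda>n. free_star (d n) + s n"])
      (use null_star[OF \<open>d \<in> N\<close>] in \<open>auto simp: free_star_add\<close>)
qed

end

section \<open>The operator norm\<close>

definition nrm :: "'a hilb \<Rightarrow> 'a \<Rightarrow> real" where
  "nrm H x = sqrt (Re (inner H x x))"

text \<open>The infimum of all admissible bounds, not a supremum over unit vectors, so that the zero
  space, which has no unit vectors, needs no special case and gives norm 0.\<close>

definition opn :: "'a hilb \<Rightarrow> ('a, 'a) arr \<Rightarrow> real" where
  "opn H T = Inf {c. 0 \<le> c \<and> (\<forall>h\<in>carrier H. nrm H (app T h) \<le> c * nrm H h)}"

context fd_hilbert
begin

lemma nrm_nonneg [simp]: "x \<in> carrier H \<Longrightarrow> 0 \<le> nrm H x"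
  by (simp add: nrm_def inner_self_nonneg)

lemma nrm_sq: "x \<in> carrier H \<Longrightarrow> (nrm H x)\<^sup>2 = Re (inner H x x)"
  by (simp add: nrm_def inner_self_nonneg)

lemma nrm_zero [simp]: "nrm H \<zero>\<^bsub>H\<^esub> = 0"
  by (simp add: nrm_def)

lemma norm_inner_le:
  assumes "x \<in> carrier H" "y \<in> carrier H" shows "cmod (inner H x y) \<le> nrm H x * nrm H y"
proof (rule power2_le_imp_le)
  show "(cmod (inner H x y))\<^sup>2 \<le> (nrm H x * nrm H y)\<^sup>2"
    unfolding power_mult_distrib nrm_sq[OF assms(1)] nrm_sq[OF assms(2)] by (rule Cauchy_Schwarz[OF assms])
qed (use assms in simp)

lemma nrm_scale: "x \<in> carrier H \<Longrightarrow> nrm H (c \<odot>\<^bsub>H\<^esub> x) = cmod c * nrm H x"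
proof -
  assume x: "x \<in> carrier H"
  have "inner H (c \<odot>\<^bsub>H\<^esub> x) (c \<odot>\<^bsub>H\<^esub> x) = complex_of_real ((cmod c)\<^sup>2) * inner H x x"
    unfolding complex_norm_square mult.assoc
    unfolding inner_smult[OF scale_closed[OF x] x] inner_smult_left[OF x x] ..
  also have "Re \<dots> = (cmod c)\<^sup>2 * Re (inner H x x)" by (simp only: times_complex.sel Re_complex_of_real Im_complex_of_real mult_zero_left diff_zero)
  finally show ?thesis by (simp add: nrm_def real_sqrt_mult)
qed

lemma nrm_add:
  assumes x: "x \<in> carrier H" and y: "y \<in> carrier H"
  shows "nrm H (x \<oplus>\<^bsub>H\<^esub> y) \<le> nrm H x + nrm H y"
proof (rule power2_le_imp_le)
  have "Re (inner H (x \<oplus>\<^bsub>H\<^esub> y) (x \<oplus>\<^bsub>H\<^esub> y)) =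
      Re (inner H x x) + Re (inner H y y) + Re (inner H x y) + Re (inner H y x)"
    using x y by (simp add: inner_add inner_add_left)
  also have "Re (inner H y x) = Re (inner H x y)" using inner_cnj[OF x y] by simp
  finally show "(nrm H (x \<oplus>\<^bsub>H\<^esub> y))\<^sup>2 \<le> (nrm H x + nrm H y)\<^sup>2"
    using x y complex_Re_le_cmod[of "inner H x y"] norm_inner_le[OF x y]
    by (simp add: nrm_sq power2_sum)
qed (use x y in simp)

lemma nrm_finsum:
  assumes "\<And>a. a \<in> A \<Longrightarrow> F a \<in> carrier H"
  shows "nrm H (finsum H F A) \<le> (\<Sum>a\<in>A. nrm H (F a))"
  using assms
proof (induction A rule: infinite_finite_induct)
  case (insert a A)
  then have "finsum H F (insert a A) = F a \<oplus>\<^bsub>H\<^esub> finsum H F A" by (intro finsum_insert) auto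
  moreover have "nrm H (F a \<oplus>\<^bsub>H\<^esub> finsum H F A) \<le> nrm H (F a) + nrm H (finsum H F A)"
    using insert by (intro nrm_add fsum_closed) auto
  moreover have "nrm H (finsum H F A) \<le> (\<Sum>a\<in>A. nrm H (F a))" using insert by simp
  ultimately show ?case using insert(1,2) by simp
qed simp_all

text \<open>Finite dimension enters here: the norms of the images of an orthonormal basis add up to
  a bound. It makes the set in \<open>opn\<close> nonempty.\<close>

lemma operator_bounded:
  assumes T: "T \<in> lin H H"
  shows "\<exists>c\<ge>0. \<forall>h\<in>carrier H. nrm H (app T h) \<le> c * nrm H h"
proof (intro exI conjI ballI)
  note B = onb_bas
  note [simp] = onb_carrier[OF B] lin_closed[OF T]
  show "0 \<le> (\<Sum>b\<in>bas H. nrm H (app T b))" by (rule sum_nonneg) simp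
  fix h assume h: "h \<in> carrier H"
  have "app T h = app T (finsum H (\<lambda>b. inner H b h \<odot>\<^bsub>H\<^esub> b) (bas H))" using onb_expand[OF B h] by simp
  also have "\<dots> = finsum H (\<lambda>b. app T (inner H b h \<odot>\<^bsub>H\<^esub> b)) (bas H)"
    by (rule lin_finsum[OF fd_hilbert_axioms fd_hilbert_axioms T]) simp
  also have "nrm H \<dots> \<le> (\<Sum>b\<in>bas H. nrm H (app T (inner H b h \<odot>\<^bsub>H\<^esub> b)))"
    by (rule nrm_finsum) simp
  also have "\<dots> \<le> (\<Sum>b\<in>bas H. nrm H (app T b) * nrm H h)"
  proof (rule sum_mono)
    fix b assume b: "b \<in> bas H"
    have "cmod (inner H b h) \<le> nrm H b * nrm H h" using b h by (intro norm_inner_le) simp_all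
    also have "nrm H b = 1" using onb_inner[OF B b b] by (simp add: nrm_def)
    finally show "nrm H (app T (inner H b h \<odot>\<^bsub>H\<^esub> b)) \<le> nrm H (app T b) * nrm H h"
      using b by (simp add: lin_smult[OF T] nrm_scale mult.commute[of "nrm H (app T b)"] mult_right_mono)
  qed
  finally show "nrm H (app T h) \<le> (\<Sum>b\<in>bas H. nrm H (app T b)) * nrm H h"
    by (simp add: sum_distrib_right)
qed

lemma opn_le: "0 \<le> c \<Longrightarrow> (\<And>h. h \<in> carrier H \<Longrightarrow> nrm H (app T h) \<le> c * nrm H h) \<Longrightarrow> opn H T \<le> c"
  unfolding opn_def by (rule cInf_lower) (auto intro: bdd_belowI[of _ 0])

lemma opn_nonneg: "T \<in> lin H H \<Longrightarrow> 0 \<le> opn H T"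
  unfolding opn_def by (rule cInf_greatest) (use operator_bounded[of T] in auto)

lemma opn_bound:
  assumes T: "T \<in> lin H H" and h: "h \<in> carrier H"
  shows "nrm H (app T h) \<le> opn H T * nrm H h"
proof (cases "nrm H h = 0")
  case True
  then show ?thesis using operator_bounded[OF T] h by force
next
  case False
  then have pos: "0 < nrm H h" using nrm_nonneg[OF h] by simp
  have "nrm H (app T h) / nrm H h \<le> opn H T"
    unfolding opn_def
  proof (rule cInf_greatest)
    fix c assume "c \<in> {c. 0 \<le> c \<and> (\<forall>h\<in>carrier H. nrm H (app T h) \<le> c * nrm H h)}"
    then show "nrm H (app T h) / nrm H h \<le> c" using h pos by (simp add: divide_le_eq)
  qed (use operator_bounded[OF T] in auto)
  with pos show ?thesis by (simp add: divide_le_eq)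
qed

lemma opn_comp:
  assumes S: "S \<in> lin H H" and T: "T \<in> lin H H" shows "opn H (S \<circ>\<^sub>M T) \<le> opn H S * opn H T"
proof (rule opn_le)
  fix h assume h: "h \<in> carrier H"
  have "nrm H (app S (app T h)) \<le> opn H S * nrm H (app T h)" by (rule opn_bound[OF S lin_closed[OF T h]])
  also have "\<dots> \<le> opn H S * (opn H T * nrm H h)"
    by (intro mult_left_mono opn_bound T h opn_nonneg S)
  finally show "nrm H (app (S \<circ>\<^sub>M T) h) \<le> opn H S * opn H T * nrm H h" by (simp add: mult.assoc)
qed (simp add: opn_nonneg S T)

text \<open>The squared norm of \<open>T h\<close> is the inner product of \<open>h\<close> with
  \<open>adj T (T h)\<close>, to which Cauchy-Schwarz applies.\<close>

lemma opn_sq_le: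
  assumes T: "T \<in> lin H H" shows "(opn H T)\<^sup>2 \<le> opn H (adj T \<circ>\<^sub>M T)"
proof -
  note aT = adj_lin[OF fd_hilbert_axioms fd_hilbert_axioms T]
  note aTT = comp_lin[OF T aT fd_hilbert_axioms fd_hilbert_axioms]
  have "opn H T \<le> sqrt (opn H (adj T \<circ>\<^sub>M T))"
  proof (rule opn_le)
    fix h assume h: "h \<in> carrier H"
    note Th = lin_closed[OF T h]
    have "(nrm H (app T h))\<^sup>2 = Re (inner H h (app (adj T \<circ>\<^sub>M T) h))"
      by (simp add: nrm_sq[OF Th] inner_adj_right[OF fd_hilbert_axioms fd_hilbert_axioms T h Th])
    also have "\<dots> \<le> nrm H h * nrm H (app (adj T \<circ>\<^sub>M T) h)"
      by (rule order_trans[OF complex_Re_le_cmod norm_inner_le[OF h lin_closed[OF aTT h]]])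
    also have "\<dots> \<le> nrm H h * (opn H (adj T \<circ>\<^sub>M T) * nrm H h)"
      using h by (intro mult_left_mono opn_bound aTT) simp_all
    also have "\<dots> = (sqrt (opn H (adj T \<circ>\<^sub>M T)) * nrm H h)\<^sup>2"
      using opn_nonneg[OF aTT] by (simp add: power_mult_distrib power2_eq_square)
    finally show "nrm H (app T h) \<le> sqrt (opn H (adj T \<circ>\<^sub>M T)) * nrm H h"
      by (rule power2_le_imp_le) (use h opn_nonneg[OF aTT] in simp)
  qed (simp add: opn_nonneg[OF aTT])
  then have "(opn H T)\<^sup>2 \<le> (sqrt (opn H (adj T \<circ>\<^sub>M T)))\<^sup>2" by (rule power_mono) (rule opn_nonneg[OF T])
  then show ?thesis using opn_nonneg[OF aTT] by simp
qed

text \<open>The squared norm of \<open>adj T h\<close> is an inner product of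
  \<open>T (adj T h)\<close> with \<open>h\<close>; Cauchy-Schwarz and cancellation of one factor
  give the bound, the case of a zero factor being separate.\<close>

lemma opn_adj_le:
  assumes T: "T \<in> lin H H" shows "opn H (adj T) \<le> opn H T"
proof (rule opn_le[OF opn_nonneg[OF T]])
  note aT = adj_lin[OF fd_hilbert_axioms fd_hilbert_axioms T]
  fix h assume h: "h \<in> carrier H"
  note ah = lin_closed[OF aT h]
  have "nrm H (app (adj T) h) * nrm H (app (adj T) h) = Re (inner H (app T (app (adj T) h)) h)"
    using nrm_sq[OF ah] inner_adj_right[OF fd_hilbert_axioms fd_hilbert_axioms T ah h]
    by (simp add: power2_eq_square)
  also have "\<dots> \<le> nrm H (app T (app (adj T) h)) * nrm H h"
    by (rule order_trans[OF complex_Re_le_cmod norm_inner_le[OF lin_closed[OF T ah] h]])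
  also have "\<dots> \<le> (opn H T * nrm H (app (adj T) h)) * nrm H h"
    using h by (intro mult_right_mono opn_bound T ah) simp
  finally have *: "nrm H (app (adj T) h) * nrm H (app (adj T) h) \<le> (opn H T * nrm H h) * nrm H (app (adj T) h)"
    by (simp add: mult.assoc mult.commute mult.left_commute)
  show "nrm H (app (adj T) h) \<le> opn H T * nrm H h"
  proof (cases "nrm H (app (adj T) h) = 0")
    case False
    then have "0 < nrm H (app (adj T) h)" using nrm_nonneg[OF ah] by simp
    with * show ?thesis by (rule mult_right_le_imp_le)
  qed (use h opn_nonneg[OF T] in simp)
qed

lemma opn_cstar:
  assumes T: "T \<in> lin H H" shows "opn H (adj T \<circ>\<^sub>M T) = (opn H T)\<^sup>2"
proof (rule antisym)
  note aT = adj_lin[OF fd_hilbert_axioms fd_hilbert_axioms T]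
  have "opn H (adj T \<circ>\<^sub>M T) \<le> opn H (adj T) * opn H T" by (rule opn_comp[OF aT T])
  also have "\<dots> \<le> opn H T * opn H T" by (intro mult_right_mono opn_adj_le opn_nonneg T)
  finally show "opn H (adj T \<circ>\<^sub>M T) \<le> (opn H T)\<^sup>2" by (simp add: power2_eq_square)
qed (rule opn_sq_le[OF T])

end

section \<open>Representations of the free star algebra\<close>

fun wop :: "'h hilb \<Rightarrow> ('g \<Rightarrow> ('h, 'h) arr) \<Rightarrow> ('g \<times> bool) list \<Rightarrow> ('h, 'h) arr" where
  "wop H a [] = idm H"
| "wop H a ((g, b) # l) = a g \<circ>\<^sub>M wop H a l"

text \<open>The linear extension of \<open>wop\<close> from words to the free algebra, with the sum
  formed in \<open>H\<close> after application to a vector.\<close>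

definition rep :: "'h hilb \<Rightarrow> ('g \<Rightarrow> ('h, 'h) arr) \<Rightarrow> 'g free_elem \<Rightarrow> ('h, 'h) arr" where
  "rep H a x = \<lparr>src = H, tgt = H, app = (\<lambda>h. if h \<in> carrier H
    then finsum H (\<lambda>w. Poly_Mapping.lookup x w \<odot>\<^bsub>H\<^esub> app (wop H a (letters w)) h) (Poly_Mapping.keys x)
    else \<zero>\<^bsub>H\<^esub>)\<rparr>"

text \<open>The letters \<open>g\<close> and \<open>g\<^sup>*\<close> act by the same operator, since the operators are selfadjoint.\<close>

locale selfadjoint_family = fd_hilbert H for H :: "'h hilb" +
  fixes X :: "'g set" and a :: "'g \<Rightarrow> ('h, 'h) arr"
  assumes a_lin: "g \<in> X \<Longrightarrow> a g \<in> lin H H" and a_adj: "g \<in> X \<Longrightarrow> adj (a g) = a g"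
begin

abbreviation \<pi> where "\<pi> \<equiv> rep H a"

lemma wop_lin: "fst ` set l \<subseteq> X \<Longrightarrow> wop H a l \<in> lin H H"
proof (induction l)
  case (Cons p l)
  then show ?case
    by (cases p) (auto intro!: comp_lin[of _ H H] a_lin fd_hilbert_axioms)
qed (simp add: idm_lin fd_hilbert_axioms)

lemma wop_append:
  "fst ` set (l @ l') \<subseteq> X \<Longrightarrow> h \<in> carrier H \<Longrightarrow> app (wop H a (l @ l')) h = app (wop H a l) (app (wop H a l') h)"
proof (induction l)
  case Nil
  then show ?case using lin_closed[OF wop_lin[of l']] by simp
next
  case (Cons p l)
  then show ?case by (cases p) auto
qed

text \<open>The letters act selfadjointly, so moving a word across the inner product one letter at a
  time only reverses it. The flipped flags have no effect on the operators.\<close>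

lemma inner_wop_word_star:
  assumes "fst ` set (letters w) \<subseteq> X" "h \<in> carrier H" "k \<in> carrier H"
  shows "inner H (app (wop H a (letters (word_star w))) k) h = inner H k (app (wop H a (letters w)) h)"
proof -
  have "inner H (app (wop H a (rev (map (\<lambda>(g, b). (g, \<not> b)) l))) k) h = inner H k (app (wop H a l) h)"
    if "fst ` set l \<subseteq> X" "k \<in> carrier H" for l k
    using that
  proof (induction l arbitrary: k)
    case (Cons p l)
    obtain g b where p: "p = (g, b)" by (cases p)
    have g: "g \<in> X" and l: "fst ` set l \<subseteq> X" using Cons.prems p by auto
    have ll: "fst ` set (rev (map (\<lambda>(g, b). (g, \<not> b)) l)) \<subseteq> X" using l by force
    have "app (wop H a (rev (map (\<lambda>(g, b). (g, \<not> b)) (p # l)))) k =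
        app (wop H a (rev (map (\<lambda>(g, b). (g, \<not> b)) l))) (app (a g) k)"
      using ll g Cons.prems lin_closed[OF a_lin[OF g]] by (simp add: p wop_append)
    then have "inner H (app (wop H a (rev (map (\<lambda>(g, b). (g, \<not> b)) (p # l)))) k) h =
        inner H (app (a g) k) (app (wop H a l) h)"
      using Cons.IH[OF l lin_closed[OF a_lin[OF g] Cons.prems(2)]] by simp
    also have "\<dots> = inner H k (app (adj (a g)) (app (wop H a l) h))"
      by (rule inner_adj_right[OF fd_hilbert_axioms fd_hilbert_axioms a_lin[OF g] Cons.prems(2)
            lin_closed[OF wop_lin[OF l] assms(2)], symmetric])
    also have "\<dots> = inner H k (app (wop H a (p # l)) h)" by (simp add: p a_adj[OF g])
    finally show ?case .
  qed (use assms in simp)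
  from this[OF assms(1,3)] show ?thesis by (simp add: word_star_def)
qed

lemma wop_closed: "w \<in> Poly_Mapping.keys x \<Longrightarrow> x \<in> carrier (free_star_alg X) \<Longrightarrow> h \<in> carrier H \<Longrightarrow>
    app (wop H a (letters w)) h \<in> carrier H"
  by (rule lin_closed[OF wop_lin]) (auto simp: free_carrier_iff)

lemma inner_rep:
  assumes x: "x \<in> carrier (free_star_alg X)" and h: "h \<in> carrier H" and k: "k \<in> carrier H"
  shows "inner H k (app (\<pi> x) h) =
    (\<Sum>w\<in>Poly_Mapping.keys x. Poly_Mapping.lookup x w * inner H k (app (wop H a (letters w)) h))"
  using h k wop_closed[OF _ x h] unfolding rep_def by (simp add: inner_finsum_right inner_smult)

lemma rep_closed:
  assumes x: "x \<in> carrier (free_star_alg X)" and h: "h \<in> carrier H"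
  shows "app (\<pi> x) h \<in> carrier H"
  using h wop_closed[OF _ x h] unfolding rep_def by auto

lemma rep_lin:
  assumes x: "x \<in> carrier (free_star_alg X)" shows "\<pi> x \<in> lin H H"
proof (rule linI)
  have w: "fst ` set (letters w) \<subseteq> X" if "w \<in> Poly_Mapping.keys x" for w
    using x that by (auto simp: free_carrier_iff)
  fix h assume h: "h \<in> carrier H"
  show "app (\<pi> x) h \<in> carrier H" by (rule rep_closed[OF x h])
  show "app (\<pi> x) (c \<odot>\<^bsub>H\<^esub> h) = c \<odot>\<^bsub>H\<^esub> app (\<pi> x) h" for c
    using h lin_smult[OF wop_lin[OF w] h] wop_closed[OF _ x h]
    by (intro eq_of_inner_eq) (auto simp: rep_closed[OF x] inner_rep[OF x] inner_smult sum_distrib_left mult.left_commute)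
  fix h' assume h': "h' \<in> carrier H"
  show "app (\<pi> x) (h \<oplus>\<^bsub>H\<^esub> h') = app (\<pi> x) h \<oplus>\<^bsub>H\<^esub> app (\<pi> x) h'"
    using h h' lin_add[OF wop_lin[OF w] h h'] wop_closed[OF _ x h] wop_closed[OF _ x h']
    by (intro eq_of_inner_eq) (auto simp: rep_closed[OF x] inner_rep[OF x] inner_add sum.distrib ring_distribs)
qed (auto simp: rep_def)

lemma rep_add:
  assumes x: "x \<in> carrier (free_star_alg X)" and y: "y \<in> carrier (free_star_alg X)" and h: "h \<in> carrier H"
  shows "app (\<pi> (x + y)) h = app (\<pi> x) h \<oplus>\<^bsub>H\<^esub> app (\<pi> y) h"
proof (rule eq_of_inner_eq)
  fix k assume k: "k \<in> carrier H"
  have "inner H k (app (\<pi> (x + y)) h) = inner H k (app (\<pi> x) h) + inner H k (app (\<pi> y) h)"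
    unfolding inner_rep[OF x h k] inner_rep[OF y h k] inner_rep[OF free_add_closed[OF x y] h k]
    \<comment> \<open>Coefficients may cancel in \<open>x + y\<close>, so the three sums run over
      different supports; the cited rule accounts for the difference.\<close>
    by (rule setsum_keys_plus_distrib) (simp_all add: ring_distribs)
  then show "inner H k (app (\<pi> (x + y)) h) = inner H k (app (\<pi> x) h \<oplus>\<^bsub>H\<^esub> app (\<pi> y) h)"
    using h k x y by (simp add: inner_add rep_closed)
qed (use assms in \<open>simp_all add: rep_closed\<close>)

lemma rep_single:
  assumes w: "fst ` set (letters w) \<subseteq> X" and h: "h \<in> carrier H"
  shows "app (\<pi> (Poly_Mapping.single w c)) h = c \<odot>\<^bsub>H\<^esub> app (wop H a (letters w)) h"
proof -
  note [simp] = lin_closed[OF wop_lin[OF w] h]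
  show ?thesis
    using h by (intro eq_of_inner_eq)
      (auto simp: rep_closed[OF free_single_closed[OF w]] inner_rep[OF free_single_closed[OF w]] inner_smult)
qed

lemma rep_zero: "h \<in> carrier H \<Longrightarrow> app (\<pi> 0) h = \<zero>\<^bsub>H\<^esub>"
  by (simp add: rep_def)

lemma rep_one: "\<pi> 1 = idm H"
proof (rule lin_eqI[OF rep_lin idm_lin])
  fix h assume "h \<in> carrier H"
  then show "app (\<pi> 1) h = app (idm H) h" using rep_single[of 0 h 1] by simp
qed (simp_all add: fd_hilbert_axioms)

lemma rep_gen: "g \<in> X \<Longrightarrow> \<pi> (gen g) = a g"
  by (rule lin_eqI[OF rep_lin a_lin])
    (auto simp: gen_def rep_single lin_closed[OF a_lin] intro!: free_single_closed)

text \<open>Both sides are bilinear, so the claim reduces to words, where it is concatenation. The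
  inner induction keeps the left word fixed.\<close>

lemma rep_mult:
  assumes x: "x \<in> carrier (free_star_alg X)" and y: "y \<in> carrier (free_star_alg X)"
  shows "\<pi> (x * y) = \<pi> x \<circ>\<^sub>M \<pi> y"
proof (rule lin_eqI[OF rep_lin comp_lin[OF rep_lin rep_lin]])
  fix h assume h: "h \<in> carrier H"
  have "app (\<pi> (x * y)) h = app (\<pi> x) (app (\<pi> y) h)"
    using x
  proof (induction x rule: free_induct)
    case zero
    then show ?case using h y by (simp add: rep_zero rep_closed)
  next
    case (single v c)
    note sv = free_single_closed[OF single]
    show ?case using y
    proof (induction y rule: free_induct)
      case zero
      then show ?case using h lin_zero[OF fd_hilbert_axioms fd_hilbert_axioms rep_lin[OF sv]] by (simp add: rep_zero)
    next
      case w: (single w d)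
      have vw: "fst ` set (letters (v + w)) \<subseteq> X" using single w by auto
      show ?case
        using h single w vw lin_closed[OF wop_lin[OF w] h]
        by (simp add: mult_single rep_single wop_append lin_smult[OF wop_lin] scale_scale
            lin_closed[OF wop_lin])
    next
      case (add y z)
      then show ?case
        using h sv by (simp add: distrib_left rep_add rep_closed lin_add[OF rep_lin[OF sv]])
    qed
  next
    case (add x z)
    then show ?case using h y by (simp add: distrib_right rep_add rep_closed)
  qed
  then show "app (\<pi> (x * y)) h = app (\<pi> x \<circ>\<^sub>M \<pi> y) h" by simp
qed (use x y fd_hilbert_axioms in auto)

lemma rep_scale:
  assumes x: "x \<in> carrier (free_star_alg X)" and h: "h \<in> carrier H"
  shows "app (\<pi> (free_scale c x)) h = c \<odot>\<^bsub>H\<^esub> app (\<pi> x) h"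
proof -
  have "\<pi> (free_scale c x) = \<pi> (Poly_Mapping.single 0 c) \<circ>\<^sub>M \<pi> x"
    unfolding free_scale_def by (intro rep_mult free_single_closed x) simp
  then show ?thesis using rep_single[of 0 "app (\<pi> x) h" c] rep_closed[OF x h] by simp
qed

lemma rep_star:
  assumes x: "x \<in> carrier (free_star_alg X)"
  shows "\<pi> (free_star x) = adj (\<pi> x)"
proof (rule adj_unique[OF fd_hilbert_axioms fd_hilbert_axioms rep_lin[OF x] rep_lin[OF free_star_closed[OF x]], symmetric])
  fix h k assume h: "h \<in> carrier H" and k: "k \<in> carrier H"
  show "inner H (app (\<pi> x) h) k = inner H h (app (\<pi> (free_star x)) k)"
    using x
  proof (induction x rule: free_induct)
    case zero
    then show ?case using h k by (simp add: rep_zero)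
  next
    case (single w c)
    have sw: "fst ` set (letters (word_star w)) \<subseteq> X" using single letters_word_star[of w] by simp
    have "inner H (app (wop H a (letters w)) h) k = inner H h (app (wop H a (letters (word_star w))) k)"
      using inner_wop_word_star[OF sw k h] by simp
    then show ?case
      using h k single sw by (simp add: free_star_single rep_single inner_smult inner_smult_left lin_closed[OF wop_lin])
  next
    case (add x y)
    then show ?case using h k by (simp add: free_star_add rep_add inner_add inner_add_left rep_closed)
  qed
qed

lemma cstar_seminorm_rep: "cstar_seminorm (free_star_alg X) (\<lambda>x. opn H (\<pi> x))"
  unfolding cstar_seminorm_def free_star_alg_simps
proof (intro conjI ballI allI)
  fix x assume x: "x \<in> carrier (free_star_alg X)"
  note px = rep_lin[OF x]
  show "0 \<le> opn H (\<pi> x)" by (rule opn_nonneg[OF px])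
  show "opn H (\<pi> (free_star x * x)) = (opn H (\<pi> x))\<^sup>2"
    by (simp add: rep_mult x rep_star opn_cstar[OF px])
  have le: "opn H (\<pi> (free_scale c y)) \<le> cmod c * opn H (\<pi> y)" if y: "y \<in> carrier (free_star_alg X)" for c y
    using opn_bound[OF rep_lin[OF y]] opn_nonneg[OF rep_lin[OF y]] y
    by (intro opn_le) (simp_all add: rep_scale nrm_scale rep_closed mult.assoc mult_left_mono)
  show "opn H (\<pi> (free_scale c x)) = cmod c * opn H (\<pi> x)" for c
  proof (cases "c = 0")
    case True
    then show ?thesis using le[OF x, of 0] opn_nonneg[OF rep_lin[of 0]] by simp
  next
    case False
    have "opn H (\<pi> (free_scale (inverse c) (free_scale c x))) \<le> cmod (inverse c) * opn H (\<pi> (free_scale c x))"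
      using x by (intro le) simp
    then have "cmod c * opn H (\<pi> x) \<le> opn H (\<pi> (free_scale c x))"
      using False by (simp add: free_scale_scale norm_inverse norm_divide field_simps)
    with le[OF x, of c] show ?thesis by simp
  qed
  fix y assume y: "y \<in> carrier (free_star_alg X)"
  note py = rep_lin[OF y]
  show "opn H (\<pi> (x * y)) \<le> opn H (\<pi> x) * opn H (\<pi> y)"
    by (simp add: rep_mult x y opn_comp[OF px py])
  show "opn H (\<pi> (x + y)) \<le> opn H (\<pi> x) + opn H (\<pi> y)"
  proof (rule opn_le)
    fix h assume h: "h \<in> carrier H"
    have "nrm H (app (\<pi> (x + y)) h) \<le> nrm H (app (\<pi> x) h) + nrm H (app (\<pi> y) h)"
      using h x y by (simp add: rep_add nrm_add rep_closed)
    also have "\<dots> \<le> opn H (\<pi> x) * nrm H h + opn H (\<pi> y) * nrm H h"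
      by (intro add_mono opn_bound px py h)
    finally show "nrm H (app (\<pi> (x + y)) h) \<le> (opn H (\<pi> x) + opn H (\<pi> y)) * nrm H h"
      by (simp add: ring_distribs)
  qed (simp add: opn_nonneg px py)
qed

text \<open>A star homomorphism on the free algebra is determined by the generators. The star
  hypothesis is what fixes the value at a starred letter: it is the adjoint of \<open>a g\<close>,
  hence \<open>a g\<close> again.\<close>

lemma hom_eq_rep:
  assumes lin: "\<And>x. x \<in> carrier (free_star_alg X) \<Longrightarrow> \<sigma> x \<in> lin H H"
    and add: "\<And>x y h. x \<in> carrier (free_star_alg X) \<Longrightarrow> y \<in> carrier (free_star_alg X) \<Longrightarrow> h \<in> carrier H \<Longrightarrow>
      app (\<sigma> (x + y)) h = app (\<sigma> x) h \<oplus>\<^bsub>H\<^esub> app (\<sigma> y) h"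
    and scale: "\<And>c x h. x \<in> carrier (free_star_alg X) \<Longrightarrow> h \<in> carrier H \<Longrightarrow>
      app (\<sigma> (free_scale c x)) h = c \<odot>\<^bsub>H\<^esub> app (\<sigma> x) h"
    and mult: "\<And>x y. x \<in> carrier (free_star_alg X) \<Longrightarrow> y \<in> carrier (free_star_alg X) \<Longrightarrow> \<sigma> (x * y) = \<sigma> x \<circ>\<^sub>M \<sigma> y"
    and one: "\<sigma> 1 = idm H"
    and star: "\<And>x. x \<in> carrier (free_star_alg X) \<Longrightarrow> \<sigma> (free_star x) = adj (\<sigma> x)"
    and gen: "\<And>g. g \<in> X \<Longrightarrow> \<sigma> (gen g) = a g"
    and x: "x \<in> carrier (free_star_alg X)"
  shows "\<sigma> x = \<pi> x"
proof (rule lin_eqI[OF lin[OF x] rep_lin[OF x]])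
  have word: "\<sigma> (Poly_Mapping.single (Word l) 1) = wop H a l" if "fst ` set l \<subseteq> X" for l
    using that
  proof (induction l)
    case Nil
    show ?case using one by (simp flip: zero_star_word_def)
  next
    case (Cons p l)
    obtain g b where p: "p = (g, b)" by (cases p)
    have g: "g \<in> X" and l: "fst ` set l \<subseteq> X" using Cons.prems p by auto
    let ?g = "Poly_Mapping.single (Word [p]) 1 :: 'g free_elem"
    have "?g = (if b then free_star (gen g) else gen g)"
      by (simp add: p gen_def free_star_single word_star_def)
    then have "\<sigma> ?g = a g" using gen[OF g] star[OF free_gen_closed[OF g]] a_adj[OF g] by simp
    moreover have "Poly_Mapping.single (Word (p # l)) 1 = ?g * Poly_Mapping.single (Word l) 1"
      by (simp add: mult_single plus_star_word_def)
    moreover have "?g \<in> carrier (free_star_alg X)" "Poly_Mapping.single (Word l) 1 \<in> carrier (free_star_alg X)"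
      using g l p by (simp_all add: free_single_closed)
    ultimately show ?case using mult Cons.IH[OF l] by (simp add: p)
  qed
  fix h assume h: "h \<in> carrier H"
  show "app (\<sigma> x) h = app (\<pi> x) h"
    using x
  proof (induction x rule: free_induct)
    case zero
    have "app (\<sigma> 0) h = 0 \<odot>\<^bsub>H\<^esub> app (\<sigma> 0) h" using scale[of 0 h 0] h by simp
    then show ?case using h lin_closed[OF lin[of 0] h] by (simp add: rep_zero)
  next
    case (single w c)
    have "app (\<sigma> (Poly_Mapping.single w c)) h = c \<odot>\<^bsub>H\<^esub> app (\<sigma> (Poly_Mapping.single w 1)) h"
      using scale[OF free_single_closed[OF single] h, of c 1] by (simp add: free_scale_single)
    then show ?case using word[OF single] rep_single[OF single h] by simp
  next
    case (add y z)
    then show ?case using h assms(2) by (simp add: rep_add)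
  qed
qed

end

section \<open>Representations of the universal algebra\<close>

text \<open>The iterates of \<open>w \<mapsto> (x + w\<^sup>2) / 2\<close>, whose fixed points satisfy \<open>(1 - w)\<^sup>2 = 1 - x\<close>.\<close>

primrec root_iter :: "'g free_elem \<Rightarrow> nat \<Rightarrow> 'g free_elem" where
  "root_iter x 0 = 0"
| "root_iter x (Suc k) = free_scale (1 / 2) (x + root_iter x k * root_iter x k)"

lemma root_iter_closed: "x \<in> carrier (free_star_alg X) \<Longrightarrow> root_iter x k \<in> carrier (free_star_alg X)"
  by (induction k) simp_all

lemma root_iter_star: "free_star x = x \<Longrightarrow> free_star (root_iter x k) = root_iter x k"
  by (induction k) (simp_all add: free_star_scale free_star_add free_star_mult)

section \<open>Convergence of the iteration for the square root\<close>

context free_cstar_seminorm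
begin

text \<open>The constants are matched: if \<open>p w\<close> is at most 1/2, then half of 3/4 + 1/4
  is again 1/2, so the ball of radius 1/2 is mapped to itself.\<close>

lemma root_iter_le:
  assumes x: "x \<in> carrier (free_star_alg X)" "p x \<le> 3 / 4"
  shows "p (root_iter x k) \<le> 1 / 2"
proof (induction k)
  case (Suc k)
  let ?w = "root_iter x k"
  note w = root_iter_closed[OF x(1), of k]
  have "p (?w * ?w) \<le> p ?w * p ?w" by (rule mult[OF w w])
  also have "\<dots> \<le> 1 / 2 * (1 / 2)" using Suc nonneg[OF w] by (intro mult_mono) auto
  finally have "p (x + ?w * ?w) \<le> 1"
    using triangle[OF x(1) free_mult_closed[OF w w]] x(2) by simp
  then show ?case using x w by (simp add: scale)
qed simp

text \<open>Squaring is 1-Lipschitz on the ball of radius 1/2, so each step averages two quantities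
  that are both at most \<open>p (x - y)\<close>. The bound is uniform in the number of iterations,
  as the diagonal argument needs.\<close>

lemma root_iter_lipschitz:
  assumes x: "x \<in> carrier (free_star_alg X)" "p x \<le> 3 / 4" and y: "y \<in> carrier (free_star_alg X)" "p y \<le> 3 / 4"
  shows "p (root_iter x k - root_iter y k) \<le> p (x - y)"
proof (induction k)
  case (Suc k)
  let ?v = "root_iter x k" and ?w = "root_iter y k"
  note v = root_iter_closed[OF x(1), of k] and w = root_iter_closed[OF y(1), of k]
  have "p (?v * ?v - ?w * ?w) \<le> p ?v * p (?v - ?w) + p (?v - ?w) * p ?w" by (rule mult_diff[OF v v w w])
  also have "\<dots> \<le> 1 / 2 * p (?v - ?w) + p (?v - ?w) * (1 / 2)"
    using v w by (intro add_mono mult_right_mono mult_left_mono root_iter_le x y nonneg) auto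
  also have "\<dots> \<le> p (x - y)" using Suc by simp
  finally have "p (?v * ?v - ?w * ?w) \<le> p (x - y)" .
  moreover have "p ((x - y) + (?v * ?v - ?w * ?w)) \<le> p (x - y) + p (?v * ?v - ?w * ?w)"
    using x y v w by (intro triangle) auto
  moreover have "root_iter x (Suc k) - root_iter y (Suc k) = free_scale (1 / 2) ((x - y) + (?v * ?v - ?w * ?w))"
    by (simp add: algebra_simps flip: free_scale_diff)
  ultimately show ?case using x y v w by (simp add: scale del: root_iter.simps)
qed (use nonneg[of "x - y"] x y in simp)

text \<open>On the ball of radius 1/2 squaring does not increase distances, so the halving in the
  iteration gives a contraction with factor 1/2.\<close>

lemma root_iter_step:
  assumes x: "x \<in> carrier (free_star_alg X)" "p x \<le> 3 / 4"
  shows "p (root_iter x (Suc k) - root_iter x k) \<le> (1 / 2) ^ k"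
proof (induction k)
  case 0
  then show ?case using root_iter_le[OF x, of 1] by simp
next
  case (Suc k)
  let ?v = "root_iter x (Suc k)" and ?w = "root_iter x k"
  note v = root_iter_closed[OF x(1), of "Suc k"] and w = root_iter_closed[OF x(1), of k]
  have "p (?v * ?v - ?w * ?w) \<le> p ?v * p (?v - ?w) + p (?v - ?w) * p ?w" by (rule mult_diff[OF v v w w])
  also have "\<dots> \<le> 1 / 2 * p (?v - ?w) + p (?v - ?w) * (1 / 2)"
    using v w by (intro add_mono mult_right_mono mult_left_mono root_iter_le x nonneg) auto
  also have "\<dots> \<le> (1 / 2) ^ k" using Suc by simp
  finally have "p (?v * ?v - ?w * ?w) \<le> (1 / 2) ^ k" .
  moreover have "root_iter x (Suc (Suc k)) - ?v = free_scale (1 / 2) (?v * ?v - ?w * ?w)"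
    by (simp only: root_iter.simps(2)[of x "Suc k"] root_iter.simps(2)[of x k] free_scale_diff[symmetric] add_diff_cancel_left)
  ultimately show ?case using v w by (simp add: scale del: root_iter.simps)
qed

text \<open>The bound is the exact geometric sum of the steps from \<open>k\<close> to
  \<open>k + j\<close>; keeping the subtracted term is what lets the induction close.\<close>

lemma root_iter_tail:
  assumes x: "x \<in> carrier (free_star_alg X)" "p x \<le> 3 / 4"
  shows "p (root_iter x (k + j) - root_iter x k) \<le> 2 * (1 / 2) ^ k - 2 * (1 / 2) ^ (k + j)"
proof (induction j)
  case (Suc j)
  note c = root_iter_closed[OF x(1)]
  have "p (root_iter x (k + Suc j) - root_iter x k) \<le>
      p (root_iter x (Suc (k + j)) - root_iter x (k + j)) + p (root_iter x (k + j) - root_iter x k)"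
    unfolding add_Suc_right by (rule triangle_trans[OF c c c])
  also have "\<dots> \<le> (1 / 2) ^ (k + j) + (2 * (1 / 2) ^ k - 2 * (1 / 2) ^ (k + j))"
    by (intro add_mono root_iter_step[OF x] Suc)
  finally show ?case by simp
qed simp

end

context cstar_presentation
begin

lemma shift_C:
  assumes s: "s \<in> carrier C" shows "(\<lambda>n. s (n + k)) \<in> carrier C"
  unfolding C_iff
proof (intro conjI allI impI)
  fix e :: real assume "0 < e"
  then obtain M where "\<forall>m\<ge>M. \<forall>n\<ge>M. u (s m - s n) < e" using C_cauchy[OF s] by blast
  then show "\<exists>M. \<forall>m\<ge>M. \<forall>n\<ge>M. u (s (m + k) - s (n + k)) < e" by (intro exI[of _ M]) simp
qed (use s in simp)

lemma cls_shift:
  assumes s: "s \<in> carrier C" shows "cls (\<lambda>n. s (n + k)) = cls s"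
proof (rule cls_eqI[OF shift_C[OF s] s])
  show "(\<lambda>n. u (s (n + k) - s n)) \<longlonglongrightarrow> 0"
  proof (rule LIMSEQ_I)
    fix e :: real assume "0 < e"
    then obtain M where "\<forall>m\<ge>M. \<forall>n\<ge>M. u (s m - s n) < e" using C_cauchy[OF s] by blast
    then show "\<exists>M. \<forall>n\<ge>M. norm (u (s (n + k) - s n) - 0) < e"
      using s by (intro exI[of _ M]) (simp add: univ_nonneg)
  qed
qed

text \<open>The diagonal sequence of iterates represents a square root of \<open>1 - x\<close>.\<close>

lemma square_root_exists:
  assumes x: "x \<in> carrier C" and small: "\<And>n. u (x n) \<le> 3 / 4" and star: "\<And>n. free_star (x n) = x n"
  obtains z where "z \<in> carrier C" "\<And>n. free_star (z n) = z n" "cls (\<lambda>n. z n * z n) = cls (\<lambda>n. 1 - x n)"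
proof -
  define w where "w n = root_iter (x n) n" for n
  have xF: "x n \<in> carrier F" for n using x by simp
  have iF: "root_iter (x n) k \<in> carrier F" for n k by (rule root_iter_closed[OF xF])
  have wF: "w n \<in> carrier F" for n unfolding w_def by (rule iF)
  have half: "(\<lambda>n. 2 * (1 / 2 :: real) ^ n) \<longlonglongrightarrow> 0"
    by (intro tendsto_mult_right_zero LIMSEQ_realpow_zero) auto
  \<comment> \<open>Two errors are separated: further iterations with the same input
    \<open>x (n + j)\<close>, controlled geometrically, and the change of input at a fixed number of
    iterations, controlled by the Lipschitz bound.\<close>
  have tail: "u (w (n + j) - w n) \<le> 2 * (1 / 2) ^ n + u (x (n + j) - x n)" for n j
  proof -
    have "u (w (n + j) - w n) \<le> u (root_iter (x (n + j)) (n + j) - root_iter (x (n + j)) n) +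
        u (root_iter (x (n + j)) n - root_iter (x n) n)"
      unfolding w_def by (rule u.triangle_trans[OF iF iF iF])
    also have "\<dots> \<le> (2 * (1 / 2) ^ n - 2 * (1 / 2) ^ (n + j)) + u (x (n + j) - x n)"
      by (intro add_mono u.root_iter_tail u.root_iter_lipschitz xF small)
    also have "\<dots> \<le> 2 * (1 / 2) ^ n + u (x (n + j) - x n)" by simp
    finally show ?thesis .
  qed
  have wC: "w \<in> carrier C"
    unfolding C_iff
  proof (intro conjI allI impI wF)
    fix e :: real assume e: "0 < e"
    obtain M1 where M1: "\<forall>m\<ge>M1. \<forall>n\<ge>M1. u (x m - x n) < e / 2" using C_cauchy[OF x, of "e / 2"] e by auto
    obtain M2 where M2: "\<And>n. n \<ge> M2 \<Longrightarrow> 2 * (1 / 2 :: real) ^ n < e / 2"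
      using LIMSEQ_D[OF half, of "e / 2"] e by auto
    have less: "u (w m - w n) < e" if mn: "max M1 M2 \<le> n" "n \<le> m" for m n
    proof -
      obtain j where j: "m = n + j" using mn le_Suc_ex by blast
      have "u (x m - x n) < e / 2" using M1 mn by simp
      with tail[of n j] M2[of n] mn show ?thesis by (simp add: j)
    qed
    show "\<exists>M. \<forall>m\<ge>M. \<forall>n\<ge>M. u (w m - w n) < e"
    proof (intro exI[of _ "max M1 M2"] allI impI)
      fix m n :: nat assume "max M1 M2 \<le> m" "max M1 M2 \<le> n"
      then show "u (w m - w n) < e"
        using less[of n m] less[of m n] u.minus_commute[OF wF wF, of m n] by (cases "n \<le> m") auto
    qed
  qed
  define z where "z n = 1 - w n" for n
  have zC: "z \<in> carrier C" unfolding z_def using diff_C[OF const_C[OF free_one_closed] wC] .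
  have "u (z n * z n - (1 - x n)) \<le> 2 * (1 / 2) ^ n" for n
  proof -
    have half_sum: "free_scale (1 / 2) y + free_scale (1 / 2) y = y" for y :: "'g free_elem"
      by (simp flip: free_scale_add_left)
    have two: "free_scale 2 y = y + y" for y :: "'g free_elem"
      using free_scale_add_left[of 1 1 y] by simp
    \<comment> \<open>The defect of \<open>z n\<close> as a square root is twice the next step of
      the iteration with the input \<open>x n\<close> held fixed, and such steps tend to
      zero.\<close>
    have "z n * z n - (1 - x n) = free_scale 2 (root_iter (x n) (Suc n) - root_iter (x n) n)"
      using half_sum[of "x n + w n * w n"] unfolding two z_def
      by (simp add: w_def[symmetric] algebra_simps)
    then have "u (z n * z n - (1 - x n)) = 2 * u (root_iter (x n) (Suc n) - root_iter (x n) n)"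
      using u.scale[of "root_iter (x n) (Suc n) - root_iter (x n) n" 2] iF[of n "Suc n"] iF[of n n]
      by (simp del: root_iter.simps)
    then show ?thesis using u.root_iter_step[OF xF[of n] small[of n], of n] by simp
  qed
  then have "(\<lambda>n. u (z n * z n - (1 - x n))) \<longlonglongrightarrow> 0"
    using zC xF by (intro tendsto_sandwich[OF _ _ tendsto_const half]) (auto intro!: always_eventually univ_nonneg)
  then have "cls (\<lambda>n. z n * z n) = cls (\<lambda>n. 1 - x n)"
    using zC x by (intro cls_eqI mult_C diff_C const_C) auto
  moreover have "free_star (z n) = z n" for n
    using root_iter_star[OF star] by (simp add: z_def w_def free_star_diff)
  ultimately show thesis using that[of z] zC by blast
qed

end

section \<open>Automatic continuity of representations\<close>

locale universal_rep = cstar_presentation X R + fd_hilbert H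
  for X :: "'g set" and R and H :: "'h hilb" +
  fixes \<rho> :: "(nat \<Rightarrow> 'g free_elem) set \<Rightarrow> ('h, 'h) arr"
  assumes star_hom: "\<rho> \<in> unital_star_hom (universal_cstar X R) (End H)"
begin

lemma cls_A: "s \<in> carrier C \<Longrightarrow> cls s \<in> carrier A"
  by (simp add: carrier_A)

lemma \<rho>_lin: "s \<in> carrier C \<Longrightarrow> \<rho> (cls s) \<in> lin H H"
  using star_hom cls_A[of s] unfolding unital_star_hom_def Ring.ring_hom_def by (auto simp: End_def)

lemma \<rho>_closed: "s \<in> carrier C \<Longrightarrow> h \<in> carrier H \<Longrightarrow> app (\<rho> (cls s)) h \<in> carrier H"
  by (rule lin_closed[OF \<rho>_lin])

lemma \<rho>_mult:
  assumes s: "s \<in> carrier C" and t: "t \<in> carrier C"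
  shows "\<rho> (cls (\<lambda>n. s n * t n)) = \<rho> (cls s) \<circ>\<^sub>M \<rho> (cls t)"
proof -
  have "\<rho> (cls s \<otimes>\<^bsub>A\<^esub> cls t) = \<rho> (cls s) \<otimes>\<^bsub>End H\<^esub> \<rho> (cls t)"
    using star_hom cls_A[OF s] cls_A[OF t] unfolding unital_star_hom_def Ring.ring_hom_def by blast
  then show ?thesis by (simp add: mult_A[OF s t] End_def)
qed

lemma \<rho>_add:
  assumes s: "s \<in> carrier C" and t: "t \<in> carrier C"
  shows "app (\<rho> (cls (\<lambda>n. s n + t n))) h = app (\<rho> (cls s)) h \<oplus>\<^bsub>H\<^esub> app (\<rho> (cls t)) h"
proof -
  have "\<rho> (cls s \<oplus>\<^bsub>A\<^esub> cls t) = \<rho> (cls s) \<oplus>\<^bsub>End H\<^esub> \<rho> (cls t)"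
    using star_hom cls_A[OF s] cls_A[OF t] unfolding unital_star_hom_def Ring.ring_hom_def by blast
  then show ?thesis by (simp add: add_A[OF s t] End_def)
qed

lemma \<rho>_scale:
  assumes s: "s \<in> carrier C"
  shows "app (\<rho> (cls (\<lambda>n. free_scale c (s n)))) h = c \<odot>\<^bsub>H\<^esub> app (\<rho> (cls s)) h"
proof -
  have "\<rho> (c \<odot>\<^bsub>A\<^esub> cls s) = c \<odot>\<^bsub>End H\<^esub> \<rho> (cls s)"
    using star_hom cls_A[OF s] unfolding unital_star_hom_def by blast
  then show ?thesis by (simp add: smult_A[OF s] End_def)
qed

lemma \<rho>_one: "\<rho> (cls (\<lambda>_. 1)) = idm H"
proof -
  have "\<rho> \<one>\<^bsub>A\<^esub> = \<one>\<^bsub>End H\<^esub>"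
    using star_hom unfolding unital_star_hom_def Ring.ring_hom_def by blast
  then show ?thesis by (simp add: one_A End_def)
qed

lemma \<rho>_star:
  assumes s: "s \<in> carrier C" shows "\<rho> (cls (\<lambda>n. free_star (s n))) = adj (\<rho> (cls s))"
proof -
  have "\<rho> (star A (cls s)) = star (End H) (\<rho> (cls s))"
    using star_hom cls_A[OF s] unfolding unital_star_hom_def by blast
  then show ?thesis by (simp add: star_A End_def)
qed

text \<open>Writing \<open>1 - y\<^sup>* y = z\<^sup>2\<close> with \<open>z\<close> selfadjoint shows that \<open>\<rho> y\<close> is a contraction.\<close>

lemma \<rho>_contraction:
  assumes y: "y \<in> carrier C" and small: "\<And>n. u (y n) \<le> 1 / 2" and h: "h \<in> carrier H"
  shows "nrm H (app (\<rho> (cls y)) h) \<le> nrm H h"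
proof -
  define x where "x n = free_star (y n) * y n" for n
  have x: "x \<in> carrier C" unfolding x_def using y by (intro mult_C star_C)
  have small_x: "u (x n) \<le> 3 / 4" for n
  proof -
    have "u (x n) = (u (y n))\<^sup>2" unfolding x_def using y by (intro u.cstar) simp
    also have "\<dots> \<le> (1 / 2)\<^sup>2" using y by (intro power_mono small univ_nonneg) simp
    finally show ?thesis by (simp add: power2_eq_square)
  qed
  have star_x: "free_star (x n) = x n" for n by (simp add: x_def free_star_mult)
  obtain z where z: "z \<in> carrier C" "\<And>n. free_star (z n) = z n" "cls (\<lambda>n. z n * z n) = cls (\<lambda>n. 1 - x n)"
    by (rule square_root_exists[OF x small_x star_x]) (rule that)
  note yh = \<rho>_closed[OF y h] and zh = \<rho>_closed[OF z(1) h]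
  have az: "adj (\<rho> (cls z)) = \<rho> (cls z)" using \<rho>_star[OF z(1), symmetric] z(2) by simp
  have "\<rho> (cls (\<lambda>n. (1 - x n) + x n)) = idm H" using \<rho>_one by simp
  then have sum: "app (\<rho> (cls (\<lambda>n. 1 - x n))) h \<oplus>\<^bsub>H\<^esub> app (\<rho> (cls x)) h = h"
    using \<rho>_add[OF diff_C[OF const_C[OF free_one_closed] x] x, of h] h by simp
  have "app (\<rho> (cls (\<lambda>n. 1 - x n))) h = app (\<rho> (cls z)) (app (\<rho> (cls z)) h)"
    unfolding z(3)[symmetric] \<rho>_mult[OF z(1) z(1)] by simp
  moreover have "app (\<rho> (cls x)) h = app (adj (\<rho> (cls y))) (app (\<rho> (cls y)) h)"
    unfolding x_def \<rho>_mult[OF star_C[OF y] y] \<rho>_star[OF y] by simp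
  ultimately have eq: "app (\<rho> (cls z)) (app (\<rho> (cls z)) h) \<oplus>\<^bsub>H\<^esub> app (adj (\<rho> (cls y))) (app (\<rho> (cls y)) h) = h"
    using sum by (simp only:)
  note fd = fd_hilbert_axioms fd_hilbert_axioms
  have "inner H h h = inner H h (app (\<rho> (cls z)) (app (\<rho> (cls z)) h)) +
      inner H h (app (adj (\<rho> (cls y))) (app (\<rho> (cls y)) h))"
    using inner_add[OF h \<rho>_closed[OF z(1) zh] lin_closed[OF adj_lin[OF fd \<rho>_lin[OF y]] yh]] unfolding eq .
  also have "inner H h (app (\<rho> (cls z)) (app (\<rho> (cls z)) h)) = inner H (app (\<rho> (cls z)) h) (app (\<rho> (cls z)) h)"
    using inner_adj_right[OF fd \<rho>_lin[OF z(1)] h zh] by (simp add: az)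
  also have "inner H h (app (adj (\<rho> (cls y))) (app (\<rho> (cls y)) h)) = inner H (app (\<rho> (cls y)) h) (app (\<rho> (cls y)) h)"
    by (rule inner_adj_right[OF fd \<rho>_lin[OF y] h yh])
  finally have "Re (inner H (app (\<rho> (cls y)) h) (app (\<rho> (cls y)) h)) \<le> Re (inner H h h)"
    using inner_self_nonneg[OF zh] by simp
  then show ?thesis by (simp add: nrm_def)
qed

text \<open>Rescaling by \<open>1 / (2 * e)\<close> brings the sequence below 1/2, where the
  contraction estimate holds. The factor 2 is the price of that threshold.\<close>

lemma \<rho>_le:
  assumes y: "y \<in> carrier C" and e: "0 < e" and small: "\<And>n. u (y n) \<le> e" and h: "h \<in> carrier H"
  shows "nrm H (app (\<rho> (cls y)) h) \<le> 2 * e * nrm H h"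
proof -
  let ?c = "complex_of_real (1 / (2 * e))"
  have "nrm H (app (\<rho> (cls (\<lambda>n. free_scale ?c (y n)))) h) \<le> nrm H h"
  proof (rule \<rho>_contraction[OF scale_C[OF y] _ h])
    fix n
    have "u (free_scale ?c (y n)) = 1 / (2 * e) * u (y n)"
      using e y by (subst u.scale) (simp_all add: norm_divide norm_mult)
    also have "\<dots> \<le> 1 / (2 * e) * e" using e by (intro mult_left_mono small) simp
    finally show "u (free_scale ?c (y n)) \<le> 1 / 2" using e by simp
  qed
  moreover have "nrm H (app (\<rho> (cls (\<lambda>n. free_scale ?c (y n)))) h) = 1 / (2 * e) * nrm H (app (\<rho> (cls y)) h)"
    unfolding \<rho>_scale[OF y] nrm_scale[OF \<rho>_closed[OF y h]] using e by (simp add: norm_divide norm_mult)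
  ultimately have "1 / (2 * e) * nrm H (app (\<rho> (cls y)) h) \<le> nrm H h" by (simp only:)
  then show ?thesis using e by (simp add: field_simps)
qed

text \<open>The class of a Cauchy sequence is the limit of the classes of its constant terms, and
  the norm estimate carries this over to matrix coefficients. This is what makes values on the free
  algebra decisive.\<close>

lemma \<rho>_continuous:
  assumes s: "s \<in> carrier C" and h: "h \<in> carrier H" and k: "k \<in> carrier H"
  shows "(\<lambda>n. inner H k (app (\<rho> (cls (\<lambda>_. s n))) h)) \<longlonglongrightarrow> inner H k (app (\<rho> (cls s)) h)"
proof (rule LIMSEQ_I)
  fix e :: real assume e: "0 < e"
  define K where "K = nrm H k * nrm H h + 1"
  have K: "0 < K" using h k unfolding K_def by (simp add: add_nonneg_pos)
  define d where "d = e / (2 * K)"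
  have d: "0 < d" using e K by (simp add: d_def)
  obtain M where M: "\<And>m n. m \<ge> M \<Longrightarrow> n \<ge> M \<Longrightarrow> u (s m - s n) < d" using C_cauchy[OF s d] by blast
  show "\<exists>M. \<forall>n\<ge>M. norm (inner H k (app (\<rho> (cls (\<lambda>_. s n))) h) - inner H k (app (\<rho> (cls s)) h)) < e"
  proof (intro exI[of _ M] allI impI)
    fix n assume n: "M \<le> n"
    have c: "(\<lambda>_. s n) \<in> carrier C" using s by simp
    \<comment> \<open>The estimate needs every term of the sequence to be small, not only those from
      some index on; shifting by \<open>M\<close> achieves this and does not change the class of
      \<open>s\<close>.\<close>
    define y where "y m = s n - s (m + M)" for m
    have y: "y \<in> carrier C" unfolding y_def by (rule diff_C[OF c shift_C[OF s]])
    have "cls (\<lambda>m. y m + s (m + M)) = cls (\<lambda>_. s n)" by (simp add: y_def)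
    then have "app (\<rho> (cls (\<lambda>_. s n))) h = app (\<rho> (cls y)) h \<oplus>\<^bsub>H\<^esub> app (\<rho> (cls s)) h"
      using \<rho>_add[OF y shift_C[OF s, of M], of h] by (simp add: cls_shift[OF s])
    then have "inner H k (app (\<rho> (cls (\<lambda>_. s n))) h) - inner H k (app (\<rho> (cls s)) h) = inner H k (app (\<rho> (cls y)) h)"
      using inner_add[OF k \<rho>_closed[OF y h] \<rho>_closed[OF s h]] by simp
    moreover have "norm (inner H k (app (\<rho> (cls y)) h)) < e"
    proof -
      have yd: "u (y m) \<le> d" for m
        unfolding y_def by (rule less_imp_le[OF M[OF n]]) simp
      have "norm (inner H k (app (\<rho> (cls y)) h)) \<le> nrm H k * nrm H (app (\<rho> (cls y)) h)"
        by (rule norm_inner_le[OF k \<rho>_closed[OF y h]])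
      also have "\<dots> \<le> nrm H k * (2 * d * nrm H h)"
        using k by (intro mult_left_mono \<rho>_le[OF y d yd h]) simp
      also have "\<dots> = 2 * d * (nrm H k * nrm H h)" by simp
      also have "\<dots> < 2 * d * K" using d by (simp add: K_def)
      also have "\<dots> = e" using K by (simp add: d_def)
      finally show ?thesis .
    qed
    ultimately show "norm (inner H k (app (\<rho> (cls (\<lambda>_. s n))) h) - inner H k (app (\<rho> (cls s)) h)) < e" by simp
  qed
qed

text \<open>The universal seminorm kills \<open>r\<close>, so its constant sequence is null and has
  the same class as \<open>0\<close> times itself, which is sent to zero by homogeneity.\<close>

lemma \<rho>_relation:
  assumes r: "r \<in> R" and h: "h \<in> carrier H" shows "app (\<rho> (cls (\<lambda>_. r))) h = \<zero>\<^bsub>H\<^esub>"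
proof -
  have rF: "r \<in> carrier F" using r relations_closed by blast
  have "cls (\<lambda>_. r) = cls (\<lambda>_. free_scale 0 r)"
    using rF univ_relation[OF r] by (intro cls_eqI) simp_all
  then show ?thesis using \<rho>_scale[OF const_C[OF rF], of 0 h] \<rho>_closed[OF const_C[OF rF] h] by simp
qed

text \<open>Restriction to constant sequences is a star homomorphism on the free algebra. The
  relations in \<open>sa\<close> make the images of the generators selfadjoint, so it is the one
  built from words.\<close>

lemma \<rho>_const_eq_rep:
  assumes sa: "\<And>g. g \<in> X \<Longrightarrow> gen g - free_star (gen g) \<in> R" and x: "x \<in> carrier F"
  shows "\<rho> (cls (\<lambda>_. x)) = rep H (\<lambda>g. \<rho> (cls (\<lambda>_. gen g))) x"
    and "selfadjoint_family H X (\<lambda>g. \<rho> (cls (\<lambda>_. gen g)))"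
proof -
  show sf: "selfadjoint_family H X (\<lambda>g. \<rho> (cls (\<lambda>_. gen g)))"
  proof (unfold_locales)
    fix g assume g: "g \<in> X"
    note gC = const_C[OF free_gen_closed[OF g]] and gsC = const_C[OF free_star_closed[OF free_gen_closed[OF g]]]
    show gl: "\<rho> (cls (\<lambda>_. gen g)) \<in> lin H H" by (rule \<rho>_lin[OF gC])
    have "cls (\<lambda>_. free_star (gen g)) = cls (\<lambda>_. gen g)"
      using univ_relation[OF sa[OF g]] u.minus_commute[OF free_gen_closed[OF g] free_star_closed[OF free_gen_closed[OF g]]]
      by (intro cls_eqI gC gsC) simp
    then show "adj (\<rho> (cls (\<lambda>_. gen g))) = \<rho> (cls (\<lambda>_. gen g))" using \<rho>_star[OF gC, symmetric] by simp
  qed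
  show "\<rho> (cls (\<lambda>_. x)) = rep H (\<lambda>g. \<rho> (cls (\<lambda>_. gen g))) x"
    by (rule selfadjoint_family.hom_eq_rep[OF sf _ _ _ _ _ _ _ x])
      (simp_all add: \<rho>_lin \<rho>_add[OF const_C const_C] \<rho>_scale[OF const_C] \<rho>_mult[OF const_C const_C] \<rho>_one
        \<rho>_star[OF const_C])
qed

end

section \<open>Extension of a family of operators to the completion\<close>

locale universal_extension = cstar_presentation X R + selfadjoint_family H X a
  for X :: "'g set" and R and H :: "'h hilb" and a +
  assumes vanish: "r \<in> R \<Longrightarrow> h \<in> carrier H \<Longrightarrow> app (rep H a r) h = \<zero>\<^bsub>H\<^esub>"
begin

text \<open>The operator norm of the representation is one of the C*-seminorms over which the
  universal one is the supremum.\<close>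

lemma opn_rep_le: "x \<in> carrier F \<Longrightarrow> opn H (\<pi> x) \<le> u x"
proof (rule seminorm_le_univ[OF cstar_seminorm_rep])
  fix r assume r: "r \<in> R"
  have "opn H (\<pi> r) \<le> 0" by (rule opn_le) (simp_all add: vanish r)
  moreover have "0 \<le> opn H (\<pi> r)" using r relations_closed by (intro opn_nonneg rep_lin) blast
  ultimately show "opn H (\<pi> r) = 0" by simp
qed

lemma norm_inner_rep_le:
  assumes x: "x \<in> carrier F" and h: "h \<in> carrier H" and k: "k \<in> carrier H"
  shows "cmod (inner H k (app (\<pi> x) h)) \<le> u x * (nrm H k * nrm H h)"
proof -
  have "cmod (inner H k (app (\<pi> x) h)) \<le> nrm H k * nrm H (app (\<pi> x) h)"
    by (rule norm_inner_le[OF k rep_closed[OF x h]])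
  also have "\<dots> \<le> nrm H k * (u x * nrm H h)"
    using k h by (intro mult_left_mono order_trans[OF opn_bound[OF rep_lin[OF x] h]] mult_right_mono opn_rep_le x) simp_all
  finally show ?thesis by (simp add: mult.left_commute)
qed

lemma rep_diff:
  assumes x: "x \<in> carrier F" and y: "y \<in> carrier F" and h: "h \<in> carrier H" and k: "k \<in> carrier H"
  shows "inner H k (app (\<pi> (x - y)) h) = inner H k (app (\<pi> x) h) - inner H k (app (\<pi> y) h)"
  using rep_add[OF free_diff_closed[OF x y] y h] assms by (simp add: inner_add rep_closed)

text \<open>The limit in the weak operator topology, expressed by matrix coefficients because
  \<open>H\<close> itself carries no topology.\<close>

definition is_limit :: "(nat \<Rightarrow> 'g free_elem) \<Rightarrow> ('h, 'h) arr \<Rightarrow> bool" where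
  "is_limit s T \<longleftrightarrow> T \<in> lin H H \<and>
    (\<forall>h\<in>carrier H. \<forall>k\<in>carrier H. (\<lambda>n. inner H k (app (\<pi> (s n)) h)) \<longlonglongrightarrow> inner H k (app T h))"

text \<open>The matrix coefficients are Cauchy sequences of complex numbers; their limits are again
  linear in one argument and antilinear in the other, so the Riesz argument produces the
  operator.\<close>

lemma is_limit_exists:
  assumes s: "s \<in> carrier C" shows "\<exists>T. is_limit s T"
proof -
  have conv: "convergent (\<lambda>n. inner H k (app (\<pi> (s n)) h))" if h: "h \<in> carrier H" and k: "k \<in> carrier H" for h k
  proof (rule Cauchy_convergent, rule CauchyI)
    fix e :: real assume e: "0 < e"
    define K where "K = nrm H k * nrm H h + 1"
    have K: "0 < K" using h k unfolding K_def by (simp add: add_nonneg_pos)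
    obtain M where M: "\<forall>m\<ge>M. \<forall>n\<ge>M. u (s m - s n) < e / K"
      using C_cauchy[OF s, of "e / K"] e K by auto
    show "\<exists>M. \<forall>m\<ge>M. \<forall>n\<ge>M. norm (inner H k (app (\<pi> (s m)) h) - inner H k (app (\<pi> (s n)) h)) < e"
    proof (intro exI[of _ M] allI impI)
      fix m n assume mn: "M \<le> m" "M \<le> n"
      have "norm (inner H k (app (\<pi> (s m)) h) - inner H k (app (\<pi> (s n)) h)) \<le> u (s m - s n) * (nrm H k * nrm H h)"
        using norm_inner_rep_le[of "s m - s n" h k] s h k by (simp add: rep_diff)
      also have "\<dots> \<le> u (s m - s n) * K" using s by (intro mult_left_mono univ_nonneg) (simp_all add: K_def)
      also have "\<dots> < e / K * K" using M mn K by (intro mult_strict_right_mono) auto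
      also have "\<dots> = e" using K by simp
      finally show "norm (inner H k (app (\<pi> (s m)) h) - inner H k (app (\<pi> (s n)) h)) < e" .
    qed
  qed
  define \<beta> where "\<beta> k h = lim (\<lambda>n. inner H k (app (\<pi> (s n)) h))" for k h
  have L: "(\<lambda>n. inner H k (app (\<pi> (s n)) h)) \<longlonglongrightarrow> \<beta> k h" if "h \<in> carrier H" "k \<in> carrier H" for h k
    using conv[OF that] unfolding \<beta>_def by (simp add: convergent_LIMSEQ_iff)
  have sF: "s n \<in> carrier F" for n using s by simp
  obtain T where "T \<in> lin H H" "\<And>h k. h \<in> carrier H \<Longrightarrow> k \<in> carrier H \<Longrightarrow> inner H k (app T h) = \<beta> k h"
  proof (rule lin_of_form[OF fd_hilbert_axioms fd_hilbert_axioms, of \<beta>])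
    fix k x y assume k: "k \<in> carrier H" and x: "x \<in> carrier H" and y: "y \<in> carrier H"
    have "(\<lambda>n. inner H k (app (\<pi> (s n)) (x \<oplus>\<^bsub>H\<^esub> y))) \<longlonglongrightarrow> \<beta> k x + \<beta> k y"
      using tendsto_add[OF L[OF x k] L[OF y k]] k x y
      by (simp add: lin_add[OF rep_lin[OF sF]] inner_add rep_closed[OF sF])
    then show "\<beta> k (x \<oplus>\<^bsub>H\<^esub> y) = \<beta> k x + \<beta> k y"
      using L[of "x \<oplus>\<^bsub>H\<^esub> y" k] k x y by (intro LIMSEQ_unique) auto
    have "(\<lambda>n. inner H (x \<oplus>\<^bsub>H\<^esub> y) (app (\<pi> (s n)) k)) \<longlonglongrightarrow> \<beta> x k + \<beta> y k"
      using tendsto_add[OF L[OF k x] L[OF k y]] k x y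
      by (simp add: inner_add_left rep_closed[OF sF])
    then show "\<beta> (x \<oplus>\<^bsub>H\<^esub> y) k = \<beta> x k + \<beta> y k"
      using L[of k "x \<oplus>\<^bsub>H\<^esub> y"] k x y by (intro LIMSEQ_unique) auto
  next
    fix k x c assume k: "k \<in> carrier H" and x: "x \<in> carrier H"
    have "(\<lambda>n. inner H k (app (\<pi> (s n)) (c \<odot>\<^bsub>H\<^esub> x))) \<longlonglongrightarrow> c * \<beta> k x"
      using tendsto_mult_left[OF L[OF x k], of c] k x
      by (simp add: lin_smult[OF rep_lin[OF sF]] inner_smult rep_closed[OF sF])
    then show "\<beta> k (c \<odot>\<^bsub>H\<^esub> x) = c * \<beta> k x"
      using L[of "c \<odot>\<^bsub>H\<^esub> x" k] k x by (intro LIMSEQ_unique) auto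
    have "(\<lambda>n. inner H (c \<odot>\<^bsub>H\<^esub> k) (app (\<pi> (s n)) x)) \<longlonglongrightarrow> cnj c * \<beta> k x"
      using tendsto_mult_left[OF L[OF x k], of "cnj c"] k x
      by (simp add: inner_smult_left rep_closed[OF sF])
    then show "\<beta> (c \<odot>\<^bsub>H\<^esub> k) x = cnj c * \<beta> k x"
      using L[of x "c \<odot>\<^bsub>H\<^esub> k"] k x by (intro LIMSEQ_unique) auto
  qed (rule that)
  then have "is_limit s T" using L by (simp add: is_limit_def)
  then show ?thesis ..
qed

lemma is_limit_unique: "is_limit s S \<Longrightarrow> is_limit s T \<Longrightarrow> S = T"
  unfolding is_limit_def
  by (intro lin_eq_formI[OF fd_hilbert_axioms fd_hilbert_axioms]) (blast intro: LIMSEQ_unique)+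

text \<open>The difference of two representatives is null for the universal seminorm, hence so are
  the differences of their coefficients. This makes the extension well defined on classes.\<close>

lemma is_limit_cls:
  assumes s: "s \<in> carrier C" and t: "t \<in> cls s" and T: "is_limit s T" shows "is_limit t T"
  unfolding is_limit_def
proof (intro conjI ballI)
  fix h k assume h: "h \<in> carrier H" and k: "k \<in> carrier H"
  from t s have tC: "t \<in> carrier C" and ts: "(\<lambda>n. u (t n - s n)) \<longlonglongrightarrow> 0" by (auto simp: mem_cls_iff)
  have "(\<lambda>n. inner H k (app (\<pi> (t n)) h) - inner H k (app (\<pi> (s n)) h)) \<longlonglongrightarrow> 0"
  proof (rule tendsto_norm_zero_cancel, rule tendsto_sandwich[OF _ _ tendsto_const])
    show "(\<lambda>n. u (t n - s n) * (nrm H k * nrm H h)) \<longlonglongrightarrow> 0" by (rule tendsto_mult_left_zero[OF ts])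
    show "\<forall>\<^sub>F n in sequentially. norm (inner H k (app (\<pi> (t n)) h) - inner H k (app (\<pi> (s n)) h)) \<le>
        u (t n - s n) * (nrm H k * nrm H h)"
      using norm_inner_rep_le[OF free_diff_closed h k] s tC h k by (intro always_eventually allI) (simp flip: rep_diff)
  qed simp
  moreover have "(\<lambda>n. inner H k (app (\<pi> (s n)) h)) \<longlonglongrightarrow> inner H k (app T h)"
    using T h k by (simp add: is_limit_def)
  ultimately show "(\<lambda>n. inner H k (app (\<pi> (t n)) h)) \<longlonglongrightarrow> inner H k (app T h)"
    by (rule Lim_transform[rotated])
qed (use T in \<open>simp add: is_limit_def\<close>)

lemma is_limit_const: "x \<in> carrier F \<Longrightarrow> is_limit (\<lambda>_. x) (\<pi> x)"
  by (simp add: is_limit_def rep_lin)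

text \<open>Weak limits are compatible with products because of finite dimension: the coefficients
  of a product are finite sums, over an orthonormal basis, of products of coefficients.\<close>

lemma is_limit_mult:
  assumes s: "s \<in> carrier C" and t: "t \<in> carrier C" and S: "is_limit s S" and T: "is_limit t T"
  shows "is_limit (\<lambda>n. s n * t n) (S \<circ>\<^sub>M T)"
  unfolding is_limit_def
proof (intro conjI ballI)
  have Sl: "S \<in> lin H H" and Tl: "T \<in> lin H H" using S T by (auto simp: is_limit_def)
  show "S \<circ>\<^sub>M T \<in> lin H H" by (rule comp_lin[OF Tl Sl fd_hilbert_axioms fd_hilbert_axioms])
  note [simp] = onb_carrier[OF onb_bas]
  fix h k assume h: "h \<in> carrier H" and k: "k \<in> carrier H"
  have exp: "inner H k (app Q y) = (\<Sum>b\<in>bas H. inner H k (app Q b) * inner H b y)"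
    if Q: "Q \<in> lin H H" and y: "y \<in> carrier H" for Q y
  proof -
    have "app Q y = app Q (finsum H (\<lambda>b. inner H b y \<odot>\<^bsub>H\<^esub> b) (bas H))" using onb_expand[OF onb_bas y] by simp
    also have "\<dots> = finsum H (\<lambda>b. app Q (inner H b y \<odot>\<^bsub>H\<^esub> b)) (bas H)"
      by (rule lin_finsum[OF fd_hilbert_axioms fd_hilbert_axioms Q]) simp
    finally show ?thesis
      using k lin_closed[OF Q]
      by (simp add: inner_finsum_right lin_smult[OF Q] inner_smult mult.commute)
  qed
  have "(\<lambda>n. \<Sum>b\<in>bas H. inner H k (app (\<pi> (s n)) b) * inner H b (app (\<pi> (t n)) h)) \<longlonglongrightarrow>
      (\<Sum>b\<in>bas H. inner H k (app S b) * inner H b (app T h))"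
    using S T h k by (intro tendsto_sum tendsto_mult) (auto simp: is_limit_def)
  then show "(\<lambda>n. inner H k (app (\<pi> (s n * t n)) h)) \<longlonglongrightarrow> inner H k (app (S \<circ>\<^sub>M T) h)"
    using s t h by (simp add: rep_mult exp[OF rep_lin rep_closed] exp[OF Sl lin_closed[OF Tl]])
qed

lemma is_limit_star:
  assumes s: "s \<in> carrier C" and T: "is_limit s T" shows "is_limit (\<lambda>n. free_star (s n)) (adj T)"
  unfolding is_limit_def
proof (intro conjI ballI)
  have Tl: "T \<in> lin H H" using T by (auto simp: is_limit_def)
  note fd = fd_hilbert_axioms fd_hilbert_axioms
  show "adj T \<in> lin H H" by (rule adj_lin[OF fd Tl])
  fix h k assume h: "h \<in> carrier H" and k: "k \<in> carrier H"
  have *: "inner H k (app (adj Q) h) = cnj (inner H h (app Q k))" if Q: "Q \<in> lin H H" for Q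
    using inner_adj_right[OF fd Q k h] inner_cnj[OF h lin_closed[OF Q k]] by simp
  have "(\<lambda>n. cnj (inner H h (app (\<pi> (s n)) k))) \<longlonglongrightarrow> cnj (inner H h (app T k))"
    using T h k by (intro tendsto_cnj) (simp add: is_limit_def)
  then show "(\<lambda>n. inner H k (app (\<pi> (free_star (s n))) h)) \<longlonglongrightarrow> inner H k (app (adj T) h)"
    using s by (simp add: rep_star *[OF rep_lin] *[OF Tl])
qed

lemma End_simps:
  "carrier (End H) = lin H H" "S \<otimes>\<^bsub>End H\<^esub> T = S \<circ>\<^sub>M T" "\<one>\<^bsub>End H\<^esub> = idm H" "star (End H) T = adj T"
  "app (S \<oplus>\<^bsub>End H\<^esub> T) h = app S h \<oplus>\<^bsub>H\<^esub> app T h" "app (c \<odot>\<^bsub>End H\<^esub> T) h = c \<odot>\<^bsub>H\<^esub> app T h"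
  by (simp_all add: End_def)

lemma End_add_closed:
  assumes S: "S \<in> lin H H" and T: "T \<in> lin H H" shows "S \<oplus>\<^bsub>End H\<^esub> T \<in> lin H H"
proof (rule linI)
  note c = lin_closed[OF S] lin_closed[OF T]
  fix x assume x: "x \<in> carrier H"
  show "app (S \<oplus>\<^bsub>End H\<^esub> T) x \<in> carrier H" using c x by (simp add: End_simps)
  show "app (S \<oplus>\<^bsub>End H\<^esub> T) (d \<odot>\<^bsub>H\<^esub> x) = d \<odot>\<^bsub>H\<^esub> app (S \<oplus>\<^bsub>End H\<^esub> T) x" for d
    using c[OF x] x by (intro eq_of_inner_eq)
      (auto simp: End_simps lin_smult[OF S] lin_smult[OF T] inner_add inner_smult ring_distribs)
  fix y assume y: "y \<in> carrier H"
  show "app (S \<oplus>\<^bsub>End H\<^esub> T) (x \<oplus>\<^bsub>H\<^esub> y) = app (S \<oplus>\<^bsub>End H\<^esub> T) x \<oplus>\<^bsub>H\<^esub> app (S \<oplus>\<^bsub>End H\<^esub> T) y"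
    using c[OF x] c[OF y] x y by (intro eq_of_inner_eq)
      (auto simp: End_simps lin_add[OF S] lin_add[OF T] inner_add)
qed (auto simp: End_def lin_outside[OF S] lin_outside[OF T])

lemma End_scale_closed:
  assumes T: "T \<in> lin H H" shows "c \<odot>\<^bsub>End H\<^esub> T \<in> lin H H"
proof (rule linI)
  note cl = lin_closed[OF T]
  fix x assume x: "x \<in> carrier H"
  show "app (c \<odot>\<^bsub>End H\<^esub> T) x \<in> carrier H" using cl x by (simp add: End_simps)
  show "app (c \<odot>\<^bsub>End H\<^esub> T) (d \<odot>\<^bsub>H\<^esub> x) = d \<odot>\<^bsub>H\<^esub> app (c \<odot>\<^bsub>End H\<^esub> T) x" for d
    using cl[OF x] x by (simp add: End_simps lin_smult[OF T] scale_scale mult.commute)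
  fix y assume y: "y \<in> carrier H"
  show "app (c \<odot>\<^bsub>End H\<^esub> T) (x \<oplus>\<^bsub>H\<^esub> y) = app (c \<odot>\<^bsub>End H\<^esub> T) x \<oplus>\<^bsub>H\<^esub> app (c \<odot>\<^bsub>End H\<^esub> T) y"
    using cl[OF x] cl[OF y] x y by (intro eq_of_inner_eq)
      (auto simp: End_simps lin_add[OF T] inner_add inner_smult ring_distribs)
qed (auto simp: End_def lin_outside[OF T])

lemma is_limit_add:
  assumes s: "s \<in> carrier C" and t: "t \<in> carrier C" and S: "is_limit s S" and T: "is_limit t T"
  shows "is_limit (\<lambda>n. s n + t n) (S \<oplus>\<^bsub>End H\<^esub> T)"
  unfolding is_limit_def
proof (intro conjI ballI)
  have Sl: "S \<in> lin H H" and Tl: "T \<in> lin H H" using S T by (auto simp: is_limit_def)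
  then show "S \<oplus>\<^bsub>End H\<^esub> T \<in> lin H H" by (rule End_add_closed)
  fix h k assume h: "h \<in> carrier H" and k: "k \<in> carrier H"
  have "(\<lambda>n. inner H k (app (\<pi> (s n)) h) + inner H k (app (\<pi> (t n)) h)) \<longlonglongrightarrow> inner H k (app S h) + inner H k (app T h)"
    using S T h k by (intro tendsto_add) (auto simp: is_limit_def)
  then show "(\<lambda>n. inner H k (app (\<pi> (s n + t n)) h)) \<longlonglongrightarrow> inner H k (app (S \<oplus>\<^bsub>End H\<^esub> T) h)"
    using s t h k by (simp add: rep_add inner_add rep_closed End_simps lin_closed[OF Sl] lin_closed[OF Tl])
qed

lemma is_limit_scale:
  assumes s: "s \<in> carrier C" and T: "is_limit s T"
  shows "is_limit (\<lambda>n. free_scale c (s n)) (c \<odot>\<^bsub>End H\<^esub> T)"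
  unfolding is_limit_def
proof (intro conjI ballI)
  have Tl: "T \<in> lin H H" using T by (auto simp: is_limit_def)
  then show "c \<odot>\<^bsub>End H\<^esub> T \<in> lin H H" by (rule End_scale_closed)
  fix h k assume h: "h \<in> carrier H" and k: "k \<in> carrier H"
  have "(\<lambda>n. c * inner H k (app (\<pi> (s n)) h)) \<longlonglongrightarrow> c * inner H k (app T h)"
    using T h k by (intro tendsto_mult_left) (auto simp: is_limit_def)
  then show "(\<lambda>n. inner H k (app (\<pi> (free_scale c (s n))) h)) \<longlonglongrightarrow> inner H k (app (c \<odot>\<^bsub>End H\<^esub> T) h)"
    using s h k by (simp add: rep_scale inner_smult rep_closed End_simps lin_closed[OF Tl])
qed

text \<open>The value is attached to a coset through any representative. Restriction to the carrier
  makes \<open>ext\<close> extensional, as \<open>unital_star_hom\<close> demands.\<close>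

definition ext :: "(nat \<Rightarrow> 'g free_elem) set \<Rightarrow> ('h, 'h) arr" where
  "ext = (\<lambda>S\<in>carrier A. THE T. \<exists>s\<in>carrier C. cls s = S \<and> is_limit s T)"

lemma ext_cls:
  assumes s: "s \<in> carrier C" and T: "is_limit s T" shows "ext (cls s) = T"
proof -
  have "(THE T. \<exists>t\<in>carrier C. cls t = cls s \<and> is_limit t T) = T"
  proof (rule the_equality)
    fix T' assume "\<exists>t\<in>carrier C. cls t = cls s \<and> is_limit t T'"
    then obtain t where t: "t \<in> carrier C" "cls t = cls s" "is_limit t T'" by blast
    then have "is_limit t T" using is_limit_cls[OF s _ T] self_mem_cls[OF t(1)] by simp
    with t(3) show "T' = T" by (rule is_limit_unique)
  qed (use s T in blast)
  then show ?thesis using s by (simp add: ext_def carrier_A)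
qed

lemma ext_is_limit:
  assumes s: "s \<in> carrier C" shows "is_limit s (ext (cls s))"
  using is_limit_exists[OF s] ext_cls[OF s] by auto

lemma ext_star_hom: "ext \<in> unital_star_hom A (End H)"
  unfolding unital_star_hom_def
proof (intro CollectI conjI allI ballI)
  show "ext \<in> Ring.ring_hom A (End H)"
  proof (rule ring_hom_memI)
    fix S assume "S \<in> carrier A"
    then obtain s where s: "s \<in> carrier C" "S = cls s" by (auto simp: carrier_A)
    show "ext S \<in> carrier (End H)" using ext_is_limit[OF s(1)] s by (simp add: End_simps is_limit_def)
    fix T assume "T \<in> carrier A"
    then obtain t where t: "t \<in> carrier C" "T = cls t" by (auto simp: carrier_A)
    note l = ext_is_limit[OF s(1)] ext_is_limit[OF t(1)]
    show "ext (S \<otimes>\<^bsub>A\<^esub> T) = ext S \<otimes>\<^bsub>End H\<^esub> ext T"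
      using ext_cls[OF mult_C[OF s(1) t(1)] is_limit_mult[OF s(1) t(1) l]] s t by (simp add: mult_A End_simps)
    show "ext (S \<oplus>\<^bsub>A\<^esub> T) = ext S \<oplus>\<^bsub>End H\<^esub> ext T"
      using ext_cls[OF add_C[OF s(1) t(1)] is_limit_add[OF s(1) t(1) l]] s t by (simp add: add_A)
  next
    show "ext \<one>\<^bsub>A\<^esub> = \<one>\<^bsub>End H\<^esub>"
      using ext_cls[OF const_C is_limit_const, of 1] by (simp add: one_A End_simps rep_one)
  qed
  show "ext \<in> extensional (carrier A)" by (simp add: ext_def)
  fix S assume "S \<in> carrier A"
  then obtain s where s: "s \<in> carrier C" "S = cls s" by (auto simp: carrier_A)
  note l = ext_is_limit[OF s(1)]
  show "ext (c \<odot>\<^bsub>A\<^esub> S) = c \<odot>\<^bsub>End H\<^esub> ext S" for c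
    using ext_cls[OF scale_C[OF s(1)] is_limit_scale[OF s(1) l]] s by (simp add: smult_A)
  show "ext (star A S) = star (End H) (ext S)"
    using ext_cls[OF star_C[OF s(1)] is_limit_star[OF s(1) l]] s by (simp add: star_A End_simps)
qed

lemma ext_gen: "g \<in> X \<Longrightarrow> ext (cls (\<lambda>_. gen g)) = a g"
  using ext_cls[OF const_C is_limit_const, of "gen g"] by (simp add: rep_gen)

end

section \<open>Isomorphic categories\<close>

text \<open>Supplies the category axioms for \<open>QIso\<close> from those of
  \<open>fd_Rep\<close>, so that they are never checked on tensor expressions.\<close>

lemma category_transport:
  assumes D: "category D" and bij: "bij_betw F (Obj D) (Obj C)"
    and hom: "\<And>x y. x \<in> Obj D \<Longrightarrow> y \<in> Obj D \<Longrightarrow> Hom C (F x) (F y) = Hom D x y"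
    and ide: "\<And>x. x \<in> Obj D \<Longrightarrow> Ide C (F x) = Ide D x" and cmp: "Cmp C = Cmp D"
  shows "category C"
proof -
  interpret D: category D by (rule D)
  have obj: "\<exists>x\<in>Obj D. c = F x" if "c \<in> Obj C" for c
    using bij that unfolding bij_betw_def by auto
  show ?thesis
  proof
    fix c assume "c \<in> Obj C"
    then obtain x where "x \<in> Obj D" "c = F x" using obj by blast
    then show "Ide C c \<in> Hom C c c" by (simp add: hom ide D.Ide_in_Hom)
  next
    fix c d f assume "c \<in> Obj C" "d \<in> Obj C" and f: "f \<in> Hom C c d"
    then obtain x y where xy: "x \<in> Obj D" "c = F x" "y \<in> Obj D" "d = F y" using obj by blast
    show "Cmp C f (Ide C c) = f" "Cmp C (Ide C d) f = f"
      using f xy D.Cmp_Ide[of x y f] D.Ide_Cmp[of x y f] by (simp_all add: hom ide cmp)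
  next
    fix c d e f g assume "c \<in> Obj C" "d \<in> Obj C" "e \<in> Obj C" and f: "f \<in> Hom C c d" "g \<in> Hom C d e"
    then obtain x y z where xy: "x \<in> Obj D" "c = F x" "y \<in> Obj D" "d = F y" "z \<in> Obj D" "e = F z"
      using obj by meson
    show "Cmp C g f \<in> Hom C c e"
      using f xy D.Cmp_in_Hom[of x y z f g] by (simp add: hom cmp)
  next
    fix b c d e f g h assume "b \<in> Obj C" "c \<in> Obj C" "d \<in> Obj C" "e \<in> Obj C"
      and f: "f \<in> Hom C b c" "g \<in> Hom C c d" "h \<in> Hom C d e"
    then obtain w x y z where xy: "w \<in> Obj D" "b = F w" "x \<in> Obj D" "c = F x" "y \<in> Obj D" "d = F y" "z \<in> Obj D" "e = F z"
      using obj by meson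
    show "Cmp C h (Cmp C g f) = Cmp C (Cmp C h g) f"
      using f xy D.Cmp_assoc[of w x y z f g h] by (simp add: hom cmp)
  qed
qed

lemma (in category) cat_iso_Ide: "x \<in> Obj C \<Longrightarrow> cat_iso C x x (Ide C x)"
  unfolding cat_iso_def using Ide_in_Hom Cmp_Ide by blast

text \<open>The hom-sets agree as sets of arrows, so both functors act as the identity on arrows and
  the two natural isomorphisms have identity components.\<close>

lemma equivalent_categoriesI:
  assumes D: "category D" and bij: "bij_betw F (Obj D) (Obj C)"
    and hom: "\<And>x y. x \<in> Obj D \<Longrightarrow> y \<in> Obj D \<Longrightarrow> Hom C (F x) (F y) = Hom D x y"
    and ide: "\<And>x. x \<in> Obj D \<Longrightarrow> Ide C (F x) = Ide D x" and cmp: "Cmp C = Cmp D"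
  shows "equivalent_categories C D"
proof -
  interpret D: category D by (rule D)
  interpret C: category C using assms by (rule category_transport)
  define E where "E = inv_into (Obj D) F"
  have E: "E c \<in> Obj D" and FE: "F (E c) = c" if "c \<in> Obj C" for c
    using bij that unfolding E_def bij_betw_def by (auto intro: inv_into_into f_inv_into_f)
  have EF: "E (F x) = x" if "x \<in> Obj D" for x
    using bij that unfolding E_def bij_betw_def by (auto intro: inv_into_f_f)
  have F: "F x \<in> Obj C" if "x \<in> Obj D" for x using bij that unfolding bij_betw_def by auto
  have homE: "Hom D (E c) (E d) = Hom C c d" if "c \<in> Obj C" "d \<in> Obj C" for c d
    using hom[OF E[OF that(1)] E[OF that(2)]] that by (simp add: FE)
  have ideE: "Ide D (E c) = Ide C c" if "c \<in> Obj C" for c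
    using ide[OF E[OF that]] that by (simp add: FE)
  have "cat_functor C D E (\<lambda>x y f. f)"
    by standard (simp_all add: E homE ideE cmp)
  moreover have "cat_functor D C F (\<lambda>x y f. f)"
    by standard (simp_all add: F hom ide cmp)
  moreover have "nat_iso C C (\<lambda>x. x) (\<lambda>x y f. f) (\<lambda>x. F (E x)) (\<lambda>x y f. f) (Ide C)"
    unfolding nat_iso_def
  proof (intro conjI ballI)
    fix c assume "c \<in> Obj C"
    then show "cat_iso C c (F (E c)) (Ide C c)" by (simp add: FE C.cat_iso_Ide)
    fix d f assume "d \<in> Obj C" "f \<in> Hom C c d"
    with \<open>c \<in> Obj C\<close> show "Cmp C (Ide C d) f = Cmp C f (Ide C c)" by (simp add: C.Cmp_Ide C.Ide_Cmp)
  qed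
  moreover have "nat_iso D D (\<lambda>x. E (F x)) (\<lambda>x y f. f) (\<lambda>x. x) (\<lambda>x y f. f) (Ide D)"
    unfolding nat_iso_def
  proof (intro conjI ballI)
    fix c assume "c \<in> Obj D"
    then show "cat_iso D (E (F c)) c (Ide D c)" by (simp add: EF D.cat_iso_Ide)
    fix d f assume "d \<in> Obj D" "f \<in> Hom D c d"
    with \<open>c \<in> Obj D\<close> show "Cmp D (Ide D d) f = Cmp D f (Ide D c)" by (simp add: D.Cmp_Ide D.Ide_Cmp)
  qed
  ultimately show ?thesis
    unfolding equivalent_categories_def using C.category_axioms D by blast
qed

lemma category_fd_Rep:
  fixes A :: "'a star_alg"
  shows "category (fd_Rep A :: ('h hilb \<times> ('a \<Rightarrow> ('h, 'h) arr), ('h, 'h) arr) cat)"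
proof -
  have \<rho>: "\<rho> x \<in> lin H H" if "\<rho> \<in> unital_star_hom A (End H)" "x \<in> carrier A" for \<rho> x and H :: "'h hilb"
  proof -
    have "\<rho> x \<in> carrier (End H)" using that unfolding unital_star_hom_def Ring.ring_hom_def by blast
    then show ?thesis by (simp add: End_def)
  qed
  show ?thesis
  proof
    fix x :: "'h hilb \<times> ('a \<Rightarrow> ('h, 'h) arr)" assume "x \<in> Obj (fd_Rep A)"
    then show "Ide (fd_Rep A) x \<in> Hom (fd_Rep A) x x"
      by (auto simp: fd_Rep_def idm_lin comp_idm_left comp_idm_right \<rho>)
  next
    fix x y z :: "'h hilb \<times> ('a \<Rightarrow> ('h, 'h) arr)" and f g :: "('h, 'h) arr"
    assume xyz: "x \<in> Obj (fd_Rep A)" "y \<in> Obj (fd_Rep A)" "z \<in> Obj (fd_Rep A)"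
      and f: "f \<in> Hom (fd_Rep A) x y" and g: "g \<in> Hom (fd_Rep A) y z"
    obtain H1 \<rho>1 H2 \<rho>2 H3 \<rho>3 where e: "x = (H1, \<rho>1)" "y = (H2, \<rho>2)" "z = (H3, \<rho>3)"
      by (cases x, cases y, cases z) auto
    have "(g \<circ>\<^sub>M f) \<circ>\<^sub>M \<rho>1 a = \<rho>3 a \<circ>\<^sub>M (g \<circ>\<^sub>M f)" if "a \<in> carrier A" for a
    proof -
      have "(g \<circ>\<^sub>M f) \<circ>\<^sub>M \<rho>1 a = g \<circ>\<^sub>M (\<rho>2 a \<circ>\<^sub>M f)" using f that by (simp add: fd_Rep_def e comp_map_assoc)
      also have "\<dots> = (\<rho>3 a \<circ>\<^sub>M g) \<circ>\<^sub>M f" using g that by (simp add: fd_Rep_def e flip: comp_map_assoc)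
      finally show ?thesis by (simp add: comp_map_assoc)
    qed
    then show "Cmp (fd_Rep A) g f \<in> Hom (fd_Rep A) x z"
      using f g xyz by (auto simp: fd_Rep_def e intro: comp_lin)
  qed (auto simp: fd_Rep_def comp_idm_left comp_idm_right comp_map_assoc)
qed

section \<open>The presentation of the quantum automorphism group algebra\<close>

lemma aut_relations_cases:
  assumes "r \<in> aut_relations G"
  obtains i j where "i \<in> pverts G" "j \<in> pverts G" "r = gen (i, j) * gen (i, j) - gen (i, j)"
  | i j where "i \<in> pverts G" "j \<in> pverts G" "r = gen (i, j) - free_star (gen (i, j))"
  | j where "j \<in> pverts G" "r = (\<Sum>i\<in>pverts G. gen (i, j)) - 1"
  | i where "i \<in> pverts G" "r = (\<Sum>j\<in>pverts G. gen (i, j)) - 1"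
  | i j where "i \<in> pverts G" "j \<in> pverts G"
      "r = (\<Sum>k\<in>pverts G. free_scale (adjacency G i k) (gen (k, j))) -
        (\<Sum>k\<in>pverts G. free_scale (adjacency G k j) (gen (i, k)))"
  using assms unfolding aut_relations_def Let_def by blast

lemma aut_relationsI:
  "i \<in> pverts G \<Longrightarrow> j \<in> pverts G \<Longrightarrow> gen (i, j) * gen (i, j) - gen (i, j) \<in> aut_relations G"
  "i \<in> pverts G \<Longrightarrow> j \<in> pverts G \<Longrightarrow> gen (i, j) - free_star (gen (i, j)) \<in> aut_relations G"
  "j \<in> pverts G \<Longrightarrow> (\<Sum>i\<in>pverts G. gen (i, j)) - 1 \<in> aut_relations G"
  "i \<in> pverts G \<Longrightarrow> (\<Sum>j\<in>pverts G. gen (i, j)) - 1 \<in> aut_relations G"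
  "i \<in> pverts G \<Longrightarrow> j \<in> pverts G \<Longrightarrow>
    (\<Sum>k\<in>pverts G. free_scale (adjacency G i k) (gen (k, j))) -
    (\<Sum>k\<in>pverts G. free_scale (adjacency G k j) (gen (i, k))) \<in> aut_relations G"
  unfolding aut_relations_def Let_def by blast+

text \<open>The relations force each generator to be a selfadjoint idempotent up to seminorm zero,
  so the C*-identity gives that the square of \<open>p a\<close> is at most \<open>p a\<close>,
  whence \<open>p a \<le> 1\<close>. The sum of the absolute coefficients is then a bound common to
  all seminorms.\<close>

lemma cstar_presentation_aut: "cstar_presentation (pverts G \<times> pverts G) (aut_relations G)"
proof
  let ?V = "pverts G" let ?X = "?V \<times> ?V"
  show "aut_relations G \<subseteq> carrier (free_star_alg ?X)"
  proof
    fix r assume "r \<in> aut_relations G"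
    then show "r \<in> carrier (free_star_alg ?X)"
      by (cases rule: aut_relations_cases)
        (simp_all only: free_diff_closed free_mult_closed free_star_closed free_one_closed free_gen_closed
          free_sum_closed free_scale_closed mem_Times_iff fst_conv snd_conv simp_thms)
  qed
  fix x assume x: "x \<in> carrier (free_star_alg ?X)"
  have "p x \<le> (\<Sum>w\<in>Poly_Mapping.keys x. cmod (Poly_Mapping.lookup x w))"
    if p: "cstar_seminorm (free_star_alg ?X) p" and R: "\<forall>r\<in>aut_relations G. p r = 0" for p
  proof -
    interpret p: free_cstar_seminorm ?X p by (standard, fact)
    show ?thesis
    proof (rule p.le_sum_coefficients[OF _ x])
      fix g assume "g \<in> ?X"
      then obtain i j where g: "g = (i, j)" "i \<in> ?V" "j \<in> ?V" by auto
      let ?a = "gen (i, j) :: ('a \<times> 'a) free_elem"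
      have a: "?a \<in> carrier (free_star_alg ?X)" using g by simp
      have "p (free_star ?a - ?a) = 0"
        using R aut_relationsI(2)[OF g(2,3)] p.minus_commute[OF a free_star_closed[OF a]] by simp
      then have "p ((free_star ?a - ?a) * ?a) = 0"
        using p.mult[of "free_star ?a - ?a" ?a] p.nonneg[of "(free_star ?a - ?a) * ?a"] a by simp
      moreover have "p (?a * ?a - ?a) = 0" using R aut_relationsI(1)[OF g(2,3)] by blast
      moreover have "p (free_star ?a * ?a) \<le> p ((free_star ?a - ?a) * ?a) + p (?a * ?a - ?a) + p ?a"
      proof -
        \<comment> \<open>The seminorm lives on the free algebra, where the relations do not hold
          literally; the first two summands have seminorm zero and measure the failure of
          selfadjointness and of idempotence.\<close>
        have "free_star ?a * ?a = ((free_star ?a - ?a) * ?a + (?a * ?a - ?a)) + ?a" by (simp add: algebra_simps)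
        then show ?thesis
          using p.triangle[of "(free_star ?a - ?a) * ?a + (?a * ?a - ?a)" ?a]
            p.triangle[of "(free_star ?a - ?a) * ?a" "?a * ?a - ?a"] a by simp
      qed
      ultimately have "(p ?a)\<^sup>2 \<le> p ?a" using p.cstar[OF a] by simp
      then show "p (gen g) \<le> 1" using p.nonneg[OF a] g(1)
        by (cases "p ?a = 0") (simp_all add: power2_eq_square)
    qed
  qed
  then show "\<exists>B. \<forall>p. cstar_seminorm (free_star_alg ?X) p \<longrightarrow> (\<forall>r\<in>aut_relations G. p r = 0) \<longrightarrow> p x \<le> B"
    by blast
qed

context selfadjoint_family
begin

lemma rep_sum:
  assumes "\<And>i. i \<in> I \<Longrightarrow> f i \<in> carrier (free_star_alg X)" and h: "h \<in> carrier H"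
  shows "app (\<pi> (sum f I)) h = finsum H (\<lambda>i. app (\<pi> (f i)) h) I"
  using assms(1)
proof (induction I rule: infinite_finite_induct)
  case (insert i I)
  have "finsum H (\<lambda>i. app (\<pi> (f i)) h) (insert i I) = app (\<pi> (f i)) h \<oplus>\<^bsub>H\<^esub> finsum H (\<lambda>i. app (\<pi> (f i)) h) I"
    using insert h by (intro finsum_insert) (auto simp: rep_closed)
  with insert h show ?case by (simp add: rep_add)
qed (simp_all add: rep_zero h)

lemma rep_diff_eq_zero_iff:
  assumes x: "x \<in> carrier (free_star_alg X)" and y: "y \<in> carrier (free_star_alg X)" and h: "h \<in> carrier H"
  shows "app (\<pi> (x - y)) h = \<zero>\<^bsub>H\<^esub> \<longleftrightarrow> app (\<pi> x) h = app (\<pi> y) h"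
proof -
  let ?d = "app (\<pi> (x - y)) h" and ?y = "app (\<pi> y) h"
  have sum: "app (\<pi> x) h = ?d \<oplus>\<^bsub>H\<^esub> ?y"
    using rep_add[OF free_diff_closed[OF x y] y h] by simp
  have c: "?d \<in> carrier H" "?y \<in> carrier H"
    by (rule rep_closed[OF free_diff_closed[OF x y] h], rule rep_closed[OF y h])
  have "?d \<oplus>\<^bsub>H\<^esub> ?y = ?y \<longleftrightarrow> ?d = \<zero>\<^bsub>H\<^esub>"
    using M.add.right_cancel[of ?y ?d "\<zero>\<^bsub>H\<^esub>"] c by simp
  then show ?thesis by (simp only: sum)
qed

end

lemma magic_unitary_cong:
  fixes G :: "'v pair_pre_digraph" and H :: "'h hilb"
  assumes H: "fd_hilbert H" and m: "magic_unitary G H a"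
    and eq: "\<And>v w. v \<in> pverts G \<Longrightarrow> w \<in> pverts G \<Longrightarrow> b v w = a v w"
  shows "magic_unitary G H b"
proof -
  let ?V = "pverts G"
  interpret fd_hilbert H by (rule H)
  have a: "app (a v w) h \<in> carrier H" if "v \<in> ?V" "w \<in> ?V" "h \<in> carrier H" for v w h
    using m that by (auto simp: magic_unitary_def Let_def intro: lin_closed)
  have "finsum H (\<lambda>v. app (b v w) h) ?V = finsum H (\<lambda>v. app (a v w) h) ?V"
    "finsum H (\<lambda>v. app (b w v) h) ?V = finsum H (\<lambda>v. app (a w v) h) ?V"
    "finsum H (\<lambda>v. c v \<odot>\<^bsub>H\<^esub> app (b v w) h) ?V = finsum H (\<lambda>v. c v \<odot>\<^bsub>H\<^esub> app (a v w) h) ?V"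
    "finsum H (\<lambda>v. c v \<odot>\<^bsub>H\<^esub> app (b w v) h) ?V = finsum H (\<lambda>v. c v \<odot>\<^bsub>H\<^esub> app (a w v) h) ?V"
    if "w \<in> ?V" "h \<in> carrier H" for w h c
    using a that by (auto intro!: finsum_cong' simp: eq)
  then show ?thesis using m by (simp add: magic_unitary_def Let_def eq)
qed

text \<open>Each relation, applied to a vector, is literally one of the clauses of a magic unitary.
  This links matrices of operators with the hypothesis of the extension to the completion.\<close>

lemma magic_unitary_iff_vanish:
  fixes G :: "'v pair_pre_digraph" and H :: "'h hilb"
  assumes sf: "selfadjoint_family H (pverts G \<times> pverts G) (\<lambda>(v, w). a v w)"
  shows "magic_unitary G H a \<longleftrightarrow>
    (\<forall>r\<in>aut_relations G. \<forall>h\<in>carrier H. app (rep H (\<lambda>(v, w). a v w) r) h = \<zero>\<^bsub>H\<^esub>)" (is "_ \<longleftrightarrow> ?R")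
proof -
  let ?V = "pverts G"
  interpret selfadjoint_family H "?V \<times> ?V" "\<lambda>(v, w). a v w" by (rule sf)
  have al: "a v w \<in> lin H H" and aa: "adj (a v w) = a v w" if "v \<in> ?V" "w \<in> ?V" for v w
    using a_lin[of "(v, w)"] a_adj[of "(v, w)"] that by auto
  have g: "gen (v, w) \<in> carrier (free_star_alg (?V \<times> ?V))" if "v \<in> ?V" "w \<in> ?V" for v w using that by simp
  have pg: "\<pi> (gen (v, w)) = a v w" if "v \<in> ?V" "w \<in> ?V" for v w using rep_gen[of "(v, w)"] that by simp
  have r1: "app (\<pi> (gen (v, w) * gen (v, w) - gen (v, w))) h = \<zero>\<^bsub>H\<^esub> \<longleftrightarrow> app (a v w) (app (a v w) h) = app (a v w) h"
    if "v \<in> ?V" "w \<in> ?V" "h \<in> carrier H" for v w h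
    using that by (simp add: rep_diff_eq_zero_iff rep_mult pg)
  \<comment> \<open>There is no equivalence here: \<open>rep\<close> exists as a star representation
    only for selfadjoint families, for which these relations hold automatically.\<close>
  have r2: "app (\<pi> (gen (v, w) - free_star (gen (v, w)))) h = \<zero>\<^bsub>H\<^esub>"
    if "v \<in> ?V" "w \<in> ?V" "h \<in> carrier H" for v w h
    using that by (simp add: rep_diff_eq_zero_iff rep_star pg aa)
  have r3: "app (\<pi> ((\<Sum>i\<in>?V. gen (i, j)) - 1)) h = \<zero>\<^bsub>H\<^esub> \<longleftrightarrow> finsum H (\<lambda>v. app (a v j) h) ?V = h"
    if j: "j \<in> ?V" and h: "h \<in> carrier H" for j h
  proof -
    have "app (\<pi> (\<Sum>i\<in>?V. gen (i, j))) h = finsum H (\<lambda>i. app (\<pi> (gen (i, j))) h) ?V"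
      by (rule rep_sum[OF g h]) (simp_all add: j)
    also have "\<dots> = finsum H (\<lambda>v. app (a v j) h) ?V"
      using j h by (intro finsum_cong') (auto simp: pg lin_closed[OF al])
    finally have "app (\<pi> (\<Sum>i\<in>?V. gen (i, j))) h = finsum H (\<lambda>v. app (a v j) h) ?V" .
    then show ?thesis using j h by (simp add: rep_diff_eq_zero_iff rep_one)
  qed
  have r4: "app (\<pi> ((\<Sum>j\<in>?V. gen (i, j)) - 1)) h = \<zero>\<^bsub>H\<^esub> \<longleftrightarrow> finsum H (\<lambda>w. app (a i w) h) ?V = h"
    if i: "i \<in> ?V" and h: "h \<in> carrier H" for i h
  proof -
    have "app (\<pi> (\<Sum>j\<in>?V. gen (i, j))) h = finsum H (\<lambda>j. app (\<pi> (gen (i, j))) h) ?V"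
      by (rule rep_sum[OF g h]) (simp_all add: i)
    also have "\<dots> = finsum H (\<lambda>w. app (a i w) h) ?V"
      using i h by (intro finsum_cong') (auto simp: pg lin_closed[OF al])
    finally have "app (\<pi> (\<Sum>j\<in>?V. gen (i, j))) h = finsum H (\<lambda>w. app (a i w) h) ?V" .
    then show ?thesis using i h by (simp add: rep_diff_eq_zero_iff rep_one)
  qed
  have r5: "app (\<pi> ((\<Sum>k\<in>?V. free_scale (adjacency G i k) (gen (k, j))) -
      (\<Sum>k\<in>?V. free_scale (adjacency G k j) (gen (i, k))))) h = \<zero>\<^bsub>H\<^esub> \<longleftrightarrow>
      finsum H (\<lambda>k. adjacency G i k \<odot>\<^bsub>H\<^esub> app (a k j) h) ?V = finsum H (\<lambda>k. adjacency G k j \<odot>\<^bsub>H\<^esub> app (a i k) h) ?V"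
    if i: "i \<in> ?V" and j: "j \<in> ?V" and h: "h \<in> carrier H" for i j h
  proof -
    have "app (\<pi> (\<Sum>k\<in>?V. free_scale (adjacency G i k) (gen (k, j)))) h =
        finsum H (\<lambda>k. app (\<pi> (free_scale (adjacency G i k) (gen (k, j)))) h) ?V"
      using i j h by (intro rep_sum free_scale_closed g)
    also have "\<dots> = finsum H (\<lambda>k. adjacency G i k \<odot>\<^bsub>H\<^esub> app (a k j) h) ?V"
      using i j h by (intro finsum_cong') (auto simp: rep_scale pg lin_closed[OF al])
    finally have 1: "app (\<pi> (\<Sum>k\<in>?V. free_scale (adjacency G i k) (gen (k, j)))) h =
        finsum H (\<lambda>k. adjacency G i k \<odot>\<^bsub>H\<^esub> app (a k j) h) ?V" .
    have "app (\<pi> (\<Sum>k\<in>?V. free_scale (adjacency G k j) (gen (i, k)))) h =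
        finsum H (\<lambda>k. app (\<pi> (free_scale (adjacency G k j) (gen (i, k)))) h) ?V"
      using i j h by (intro rep_sum free_scale_closed g)
    also have "\<dots> = finsum H (\<lambda>k. adjacency G k j \<odot>\<^bsub>H\<^esub> app (a i k) h) ?V"
      using i j h by (intro finsum_cong') (auto simp: rep_scale pg lin_closed[OF al])
    finally have 2: "app (\<pi> (\<Sum>k\<in>?V. free_scale (adjacency G k j) (gen (i, k)))) h =
        finsum H (\<lambda>k. adjacency G k j \<odot>\<^bsub>H\<^esub> app (a i k) h) ?V" .
    show ?thesis
      using i j h by (subst rep_diff_eq_zero_iff) (simp_all add: 1 2)
  qed
  show ?thesis
  proof
    assume m: "magic_unitary G H a"
    show ?R
    proof (intro ballI)
      fix r h assume r: "r \<in> aut_relations G" and h: "h \<in> carrier H"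
      from r show "app (\<pi> r) h = \<zero>\<^bsub>H\<^esub>"
      proof (cases rule: aut_relations_cases)
        case (1 i j)
        have "a i j \<circ>\<^sub>M a i j = a i j" using m 1 by (simp add: magic_unitary_def Let_def)
        then show ?thesis using 1 h r1[of i j h] by (metis comp_app)
      next
        case (2 i j)
        then show ?thesis using r2 h by simp
      next
        case (3 j)
        then show ?thesis using r3 h m by (simp add: magic_unitary_def Let_def)
      next
        case (4 i)
        then show ?thesis using r4 h m by (simp add: magic_unitary_def Let_def)
      next
        case (5 i j)
        have "finsum H (\<lambda>k. adjacency G i k \<odot>\<^bsub>H\<^esub> app (a k j) h) ?V = finsum H (\<lambda>k. adjacency G k j \<odot>\<^bsub>H\<^esub> app (a i k) h) ?V"
          using m 5(1,2) h by (simp add: magic_unitary_def Let_def)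
        then show ?thesis unfolding 5(3) using r5[OF 5(1,2) h] by blast
      qed
    qed
  next
    assume R: ?R
    have idem: "a v w \<circ>\<^sub>M a v w = a v w" if v: "v \<in> ?V" and w: "w \<in> ?V" for v w
    proof (rule lin_eqI[OF comp_lin[OF al[OF v w] al[OF v w] fd_hilbert_axioms fd_hilbert_axioms] al[OF v w]])
      fix h assume h: "h \<in> carrier H"
      show "app (a v w \<circ>\<^sub>M a v w) h = app (a v w) h"
        using r1[OF v w h] R aut_relationsI(1)[OF v w] h by simp
    qed
    show "magic_unitary G H a"
      unfolding magic_unitary_def Let_def
    proof (intro conjI ballI)
      fix v w assume v: "v \<in> ?V" and w: "w \<in> ?V"
      show "a v w \<in> lin H H" "adj (a v w) = a v w" "a v w \<circ>\<^sub>M a v w = a v w"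
        using al aa idem v w by auto
      fix h assume h: "h \<in> carrier H"
      show "finsum H (\<lambda>k. adjacency G v k \<odot>\<^bsub>H\<^esub> app (a k w) h) ?V = finsum H (\<lambda>k. adjacency G k w \<odot>\<^bsub>H\<^esub> app (a v k) h) ?V"
        using r5[OF v w h] R aut_relationsI(5)[OF v w] h by blast
    next
      fix w h assume w: "w \<in> ?V" and h: "h \<in> carrier H"
      show "finsum H (\<lambda>v. app (a v w) h) ?V = h"
        using r3[OF w h] R aut_relationsI(3)[OF w] h by blast
    next
      fix v h assume v: "v \<in> ?V" and h: "h \<in> carrier H"
      show "finsum H (\<lambda>w. app (a v w) h) ?V = h"
        using r4[OF v h] R aut_relationsI(4)[OF v] h by blast
    qed
  qed
qed

section \<open>The equivalence\<close>

text \<open>Compare components at \<open>|v\<rangle>\<close> of the images of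
  \<open>h \<otimes> |w\<rangle>\<close>: one side applies \<open>f\<close> after an entry of
  \<open>P\<close>, the other applies an entry of \<open>P'\<close> after \<open>f\<close>.\<close>

lemma intertwiner_iff:
  fixes V :: "'v set" and H H' :: "'h hilb"
  assumes V: "finite V" and H: "fd_hilbert H" and H': "fd_hilbert H'"
    and P: "P \<in> lin (H \<otimes>\<^sub>H fun_space V) (fun_space V \<otimes>\<^sub>H H)"
    and P': "P' \<in> lin (H' \<otimes>\<^sub>H fun_space V) (fun_space V \<otimes>\<^sub>H H')"
    and f: "f \<in> lin H H'"
  shows "(idm (fun_space V) \<otimes>\<^sub>M f) \<circ>\<^sub>M P = P' \<circ>\<^sub>M (f \<otimes>\<^sub>M idm (fun_space V)) \<longleftrightarrow>
    (\<forall>v\<in>V. \<forall>w\<in>V. f \<circ>\<^sub>M entry V H P v w = entry V H' P' v w \<circ>\<^sub>M f)"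
proof -
  let ?X = "fun_space V"
  have X: "fd_hilbert ?X" by (rule fd_hilbert_fun_space[OF V])
  note tl = tensor_map_spec[OF X H X H' idm_lin[OF X] f]
  note tr = tensor_map_spec[OF H X H' X f idm_lin[OF X]]
  let ?L = "(idm ?X \<otimes>\<^sub>M f) \<circ>\<^sub>M P" let ?R = "P' \<circ>\<^sub>M (f \<otimes>\<^sub>M idm ?X)"
  have XH: "fd_hilbert (?X \<otimes>\<^sub>H H)" and XH': "fd_hilbert (?X \<otimes>\<^sub>H H')" and HX': "fd_hilbert (H' \<otimes>\<^sub>H ?X)"
    using X H H' by auto
  have L: "?L \<in> lin (H \<otimes>\<^sub>H ?X) (?X \<otimes>\<^sub>H H')" by (rule comp_lin[OF P tl(1) XH XH'])
  have R: "?R \<in> lin (H \<otimes>\<^sub>H ?X) (?X \<otimes>\<^sub>H H')" by (rule comp_lin[OF tr(1) P' HX' XH'])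
  have l: "app (slice V H' v) (app ?L (pure H ?X h (ket w))) = app (f \<circ>\<^sub>M entry V H P v w) h"
    if h: "h \<in> carrier H" and w: "w \<in> V" and v: "v \<in> V" for h v w
    using slice_id_tensor[OF V H H' f v app_pure_ket_closed[OF V H P h w]] slice_app_pure_ket[OF V H P h, of v w] by simp
  have r: "app (slice V H' v) (app ?R (pure H ?X h (ket w))) = app (entry V H' P' v w \<circ>\<^sub>M f) h"
    if h: "h \<in> carrier H" and w: "w \<in> V" and v: "v \<in> V" for h v w
    using tr(2)[OF h ket_closed[OF w]] slice_app_pure_ket[OF V H' P' lin_closed[OF f h], of v w] ket_closed[OF w]
    by (simp del: fun_space_simps)
  show ?thesis
  proof
    assume eq: "?L = ?R"
    show "\<forall>v\<in>V. \<forall>w\<in>V. f \<circ>\<^sub>M entry V H P v w = entry V H' P' v w \<circ>\<^sub>M f"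
    proof (intro ballI)
      fix v w assume v: "v \<in> V" and w: "w \<in> V"
      show "f \<circ>\<^sub>M entry V H P v w = entry V H' P' v w \<circ>\<^sub>M f"
        by (rule lin_eqI[OF comp_lin[OF entry_lin[OF V H P v w] f H H'] comp_lin[OF f entry_lin[OF V H' P' v w] H' H']])
          (simp only: l[OF _ w v, symmetric] r[OF _ w v, symmetric] eq)
    qed
  next
    assume eq: "\<forall>v\<in>V. \<forall>w\<in>V. f \<circ>\<^sub>M entry V H P v w = entry V H' P' v w \<circ>\<^sub>M f"
    show "?L = ?R"
    proof (rule lin_eq_ketI[OF V H XH' L R])
      fix h w assume h: "h \<in> carrier H" and w: "w \<in> V"
      note p = pure_ket_closed[OF V H h w]
      show "app ?L (pure H ?X h (ket w)) = app ?R (pure H ?X h (ket w))"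
      proof (rule slice_eqI[OF V H' lin_closed[OF L p] lin_closed[OF R p]])
        fix v assume v: "v \<in> V"
        show "app (slice V H' v) (app ?L (pure H ?X h (ket w))) = app (slice V H' v) (app ?R (pure H ?X h (ket w)))"
          unfolding l[OF h w v] r[OF h w v] using eq v w by simp
      qed
    qed
  qed
qed

section \<open>Representations of the algebra and quantum isomorphisms\<close>

context
  fixes G :: "'v pair_pre_digraph"
  assumes V: "finite (pverts G)"
begin

interpretation cstar_presentation "pverts G \<times> pverts G" "aut_relations G"
  by (rule cstar_presentation_aut)

definition aut_gen :: "'v \<Rightarrow> 'v \<Rightarrow> (nat \<Rightarrow> ('v \<times> 'v) free_elem) set" where
  "aut_gen v w = cls (\<lambda>_. gen (v, w))"

definition qiso_of_rep ::
    "'h hilb \<times> ((nat \<Rightarrow> ('v \<times> 'v) free_elem) set \<Rightarrow> ('h, 'h) arr) \<Rightarrow> 'h hilb \<times> ('v, 'h) qmap" where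
  "qiso_of_rep = (\<lambda>(H, \<rho>). (H, of_entries (pverts G) H (\<lambda>v w. \<rho> (aut_gen v w))))"

lemma aut_gen_closed: "v \<in> pverts G \<Longrightarrow> w \<in> pverts G \<Longrightarrow> aut_gen v w \<in> carrier (A_aut G)"
  by (simp add: aut_gen_def A_aut_def carrier_A)

lemma universal_rep_aut:
  "fd_hilbert H \<Longrightarrow> \<rho> \<in> unital_star_hom (A_aut G) (End H) \<Longrightarrow>
    universal_rep (pverts G \<times> pverts G) (aut_relations G) H \<rho>"
  unfolding universal_rep_def universal_rep_axioms_def A_aut_def
  using cstar_presentation_axioms by blast

text \<open>The direction from representations to matrices: on constants a representation is the
  word representation of its generators, and it annihilates the relations, so these generators form
  a magic unitary.\<close>

lemma rep_aut:
  assumes H: "fd_hilbert H" and \<rho>: "\<rho> \<in> unital_star_hom (A_aut G) (End H)"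
  shows rep_aut_family: "selfadjoint_family H (pverts G \<times> pverts G) (\<lambda>(v, w). \<rho> (aut_gen v w))"
    and rep_aut_const: "x \<in> carrier F \<Longrightarrow> \<rho> (cls (\<lambda>_. x)) = rep H (\<lambda>(v, w). \<rho> (aut_gen v w)) x"
    and rep_aut_magic: "magic_unitary G H (\<lambda>v w. \<rho> (aut_gen v w))"
proof -
  interpret \<rho>: universal_rep "pverts G \<times> pverts G" "aut_relations G" H \<rho>
    by (rule universal_rep_aut[OF H \<rho>])
  have e: "(\<lambda>g. \<rho> (cls (\<lambda>_. gen g))) = (\<lambda>(v, w). \<rho> (aut_gen v w))"
    by (auto simp: aut_gen_def)
  have sa: "gen g - free_star (gen g) \<in> aut_relations G" if "g \<in> pverts G \<times> pverts G" for g :: "'v \<times> 'v"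
    using that aut_relationsI(2) by (cases g) auto
  show sf: "selfadjoint_family H (pverts G \<times> pverts G) (\<lambda>(v, w). \<rho> (aut_gen v w))"
    using \<rho>.\<rho>_const_eq_rep(2)[OF sa free_one_closed] unfolding e .
  show c: "\<rho> (cls (\<lambda>_. x)) = rep H (\<lambda>(v, w). \<rho> (aut_gen v w)) x" if "x \<in> carrier F" for x
    using \<rho>.\<rho>_const_eq_rep(1)[OF sa that] unfolding e .
  show "magic_unitary G H (\<lambda>v w. \<rho> (aut_gen v w))"
    unfolding magic_unitary_iff_vanish[OF sf]
  proof (intro ballI)
    fix r h assume r: "r \<in> aut_relations G" and h: "h \<in> carrier H"
    then show "app (rep H (\<lambda>(v, w). \<rho> (aut_gen v w)) r) h = \<zero>\<^bsub>H\<^esub>"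
      using \<rho>.\<rho>_relation[OF r h] c[of r] relations_closed by auto
  qed
qed

lemma rep_aut_lin:
  assumes "fd_hilbert H" "\<rho> \<in> unital_star_hom (A_aut G) (End H)" "v \<in> pverts G" "w \<in> pverts G"
  shows "\<rho> (aut_gen v w) \<in> lin H H"
  using selfadjoint_family.a_lin[OF rep_aut_family[OF assms(1,2)], of "(v, w)"] assms(3,4) by simp

text \<open>The intertwining relation passes from generators to words, by linearity to the free
  algebra, and by automatic continuity of both representations to the completion.\<close>

lemma intertwiner_of_generators:
  assumes H: "fd_hilbert H" and K: "fd_hilbert K"
    and \<rho>: "\<rho> \<in> unital_star_hom (A_aut G) (End H)" and \<sigma>: "\<sigma> \<in> unital_star_hom (A_aut G) (End K)"
    and f: "f \<in> lin H K"
    and eq: "\<And>v w. v \<in> pverts G \<Longrightarrow> w \<in> pverts G \<Longrightarrow> f \<circ>\<^sub>M \<rho> (aut_gen v w) = \<sigma> (aut_gen v w) \<circ>\<^sub>M f"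
    and S: "S \<in> carrier (A_aut G)"
  shows "f \<circ>\<^sub>M \<rho> S = \<sigma> S \<circ>\<^sub>M f"
proof -
  interpret \<rho>: universal_rep "pverts G \<times> pverts G" "aut_relations G" H \<rho>
    by (rule universal_rep_aut[OF H \<rho>])
  interpret \<sigma>: universal_rep "pverts G \<times> pverts G" "aut_relations G" K \<sigma>
    by (rule universal_rep_aut[OF K \<sigma>])
  interpret p: selfadjoint_family H "pverts G \<times> pverts G" "\<lambda>(v, w). \<rho> (aut_gen v w)"
    by (rule rep_aut_family[OF H \<rho>])
  interpret q: selfadjoint_family K "pverts G \<times> pverts G" "\<lambda>(v, w). \<sigma> (aut_gen v w)"
    by (rule rep_aut_family[OF K \<sigma>])
  have word: "app f (app (wop H (\<lambda>(v, w). \<rho> (aut_gen v w)) l) h) = app (wop K (\<lambda>(v, w). \<sigma> (aut_gen v w)) l) (app f h)"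
    if "fst ` set l \<subseteq> pverts G \<times> pverts G" "h \<in> carrier H" for l h
    using that
  proof (induction l)
    case Nil
    then show ?case using lin_closed[OF f] by simp
  next
    case (Cons c l)
    obtain v w b where c: "c = ((v, w), b)" by (metis surj_pair)
    with Cons.prems have "v \<in> pverts G" "w \<in> pverts G" by auto
    with eq have "app f (app (\<rho> (aut_gen v w)) x) = app (\<sigma> (aut_gen v w)) (app f x)" for x
      by (metis comp_app)
    with Cons show ?case by (simp add: c)
  qed
  have const: "app f (app (p.\<pi> x) h) = app (q.\<pi> x) (app f h)" if x: "x \<in> carrier F" and h: "h \<in> carrier H" for x h
    using x
  proof (induction x rule: free_induct)
    case zero
    then show ?case using h lin_closed[OF f h] by (simp add: p.rep_zero q.rep_zero lin_zero[OF H K f])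
  next
    case (single w c)
    then show ?case
      using h lin_closed[OF f h] word[OF single h] lin_closed[OF p.wop_lin[OF single] h]
      by (simp add: p.rep_single q.rep_single lin_smult[OF f])
  next
    case (add x y)
    then show ?case
      using h lin_closed[OF f h] by (simp add: p.rep_add q.rep_add lin_add[OF f] p.rep_closed)
  qed
  obtain s where s: "s \<in> carrier C" "S = cls s" using S by (auto simp: A_aut_def carrier_A)
  show ?thesis
  proof (rule lin_eq_formI[OF H K])
    show "f \<circ>\<^sub>M \<rho> S \<in> lin H K" unfolding s(2) by (rule comp_lin[OF \<rho>.\<rho>_lin[OF s(1)] f H K])
    show "\<sigma> S \<circ>\<^sub>M f \<in> lin H K" unfolding s(2) by (rule comp_lin[OF f \<sigma>.\<rho>_lin[OF s(1)] K K])
    fix h k assume h: "h \<in> carrier H" and k: "k \<in> carrier K"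
    \<comment> \<open>Continuity is known for matrix coefficients of \<open>\<rho>\<close> only, so
      \<open>f\<close> is moved into the other argument as its adjoint before the limit is
      taken.\<close>
    note fh = lin_closed[OF f h] and fk = lin_closed[OF adj_lin[OF H K f] k]
    have sF: "s n \<in> carrier F" for n using s by simp
    have "inner H (app (adj f) k) (app (\<rho> (cls (\<lambda>_. s n))) h) = inner K k (app (\<sigma> (cls (\<lambda>_. s n))) (app f h))" for n
      unfolding inner_adj_left[OF H K f \<rho>.\<rho>_closed[OF const_C[OF sF] h] k]
      using const[OF sF h] rep_aut_const[OF H \<rho> sF] rep_aut_const[OF K \<sigma> sF] by simp
    then have "(\<lambda>n. inner K k (app (\<sigma> (cls (\<lambda>_. s n))) (app f h))) \<longlonglongrightarrow> inner H (app (adj f) k) (app (\<rho> (cls s)) h)"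
      using \<rho>.\<rho>_continuous[OF s(1) h fk] by simp
    then have "inner H (app (adj f) k) (app (\<rho> (cls s)) h) = inner K k (app (\<sigma> (cls s)) (app f h))"
      using \<sigma>.\<rho>_continuous[OF s(1) fh k] by (rule LIMSEQ_unique)
    then show "inner K k (app (f \<circ>\<^sub>M \<rho> S) h) = inner K k (app (\<sigma> S \<circ>\<^sub>M f) h)"
      unfolding inner_adj_left[OF H K f \<rho>.\<rho>_closed[OF s(1) h] k] by (simp add: s(2))
  qed
qed

text \<open>The identity intertwines two representations that agree on generators; extensionality
  covers arguments outside the algebra.\<close>

lemma rep_aut_eqI:
  assumes H: "fd_hilbert H" and \<rho>: "\<rho> \<in> unital_star_hom (A_aut G) (End H)"
    and \<sigma>: "\<sigma> \<in> unital_star_hom (A_aut G) (End H)"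
    and eq: "\<And>v w. v \<in> pverts G \<Longrightarrow> w \<in> pverts G \<Longrightarrow> \<rho> (aut_gen v w) = \<sigma> (aut_gen v w)"
  shows "\<rho> = \<sigma>"
proof (rule extensionalityI)
  show "\<rho> \<in> extensional (carrier (A_aut G))" "\<sigma> \<in> extensional (carrier (A_aut G))"
    using \<rho> \<sigma> by (auto simp: unital_star_hom_def)
  fix S assume S: "S \<in> carrier (A_aut G)"
  then have l: "\<rho> S \<in> lin H H" "\<sigma> S \<in> lin H H"
    using \<rho> \<sigma> unfolding unital_star_hom_def Ring.ring_hom_def by (auto simp: End_def)
  have "idm H \<circ>\<^sub>M \<rho> S = \<sigma> S \<circ>\<^sub>M idm H"
    by (rule intertwiner_of_generators[OF H H \<rho> \<sigma> idm_lin[OF H] _ S])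
      (simp add: eq comp_idm_left[OF H H] comp_idm_right[OF H H] rep_aut_lin[OF H \<sigma>])
  then show "\<rho> S = \<sigma> S" using l by (simp add: comp_idm_left[OF H H] comp_idm_right[OF H H])
qed

text \<open>The direction from matrices to representations: the clauses of a magic unitary are the
  vanishing of the relations, which is what the extension by weak limits requires.\<close>

lemma rep_of_magic_unitary:
  assumes H: "fd_hilbert H" and m: "magic_unitary G H a"
  obtains \<rho> where "\<rho> \<in> unital_star_hom (A_aut G) (End H)"
    "\<And>v w. v \<in> pverts G \<Longrightarrow> w \<in> pverts G \<Longrightarrow> \<rho> (aut_gen v w) = a v w"
proof -
  have sf: "selfadjoint_family H (pverts G \<times> pverts G) (\<lambda>(v, w). a v w)"
    unfolding selfadjoint_family_def selfadjoint_family_axioms_def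
    using H m by (auto simp: magic_unitary_def Let_def)
  interpret e: universal_extension "pverts G \<times> pverts G" "aut_relations G" H "\<lambda>(v, w). a v w"
    unfolding universal_extension_def universal_extension_axioms_def
    using sf cstar_presentation_axioms m[unfolded magic_unitary_iff_vanish[OF sf]] by blast
  show thesis
  proof (rule that)
    show "e.ext \<in> unital_star_hom (A_aut G) (End H)" unfolding A_aut_def by (rule e.ext_star_hom)
    show "e.ext (aut_gen v w) = a v w" if "v \<in> pverts G" "w \<in> pverts G" for v w
      unfolding aut_gen_def using e.ext_gen[of "(v, w)"] that by simp
  qed
qed

lemma quantum_iso_qiso_of_rep:
  assumes H: "fd_hilbert H" and \<rho>: "\<rho> \<in> unital_star_hom (A_aut G) (End H)"
  shows "quantum_iso G H (of_entries (pverts G) H (\<lambda>v w. \<rho> (aut_gen v w)))"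
    and "v \<in> pverts G \<Longrightarrow> w \<in> pverts G \<Longrightarrow>
      entry (pverts G) H (of_entries (pverts G) H (\<lambda>v w. \<rho> (aut_gen v w))) v w = \<rho> (aut_gen v w)"
proof -
  let ?P = "of_entries (pverts G) H (\<lambda>v w. \<rho> (aut_gen v w))"
  note l = rep_aut_lin[OF H \<rho>]
  show e: "entry (pverts G) H ?P v w = \<rho> (aut_gen v w)" if "v \<in> pverts G" "w \<in> pverts G" for v w
    by (rule entry_of_entries[OF V H l that])
  have "magic_unitary G H (entry (pverts G) H ?P)"
    by (rule magic_unitary_cong[OF H rep_aut_magic[OF H \<rho>]]) (simp add: e)
  moreover have "?P \<in> lin (H \<otimes>\<^sub>H fun_space (pverts G)) (fun_space (pverts G) \<otimes>\<^sub>H H)"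
    by (rule of_entries_lin[OF V H l])
  ultimately show "quantum_iso G H ?P"
    unfolding quantum_iso_iff_magic_unitary[OF V] using H by blast
qed

lemma bij_betw_qiso_of_rep: "bij_betw qiso_of_rep (Obj (fd_Rep (A_aut G))) (Obj (QIso G))"
  unfolding bij_betw_def
proof (intro conjI subset_antisym subsetI inj_onI)
  fix x y :: "'h hilb \<times> ((nat \<Rightarrow> ('v \<times> 'v) free_elem) set \<Rightarrow> ('h, 'h) arr)"
  assume x: "x \<in> Obj (fd_Rep (A_aut G))" and y: "y \<in> Obj (fd_Rep (A_aut G))" and eq: "qiso_of_rep x = qiso_of_rep y"
  obtain H \<rho> K \<sigma> where e: "x = (H, \<rho>)" "y = (K, \<sigma>)" by (cases x, cases y) auto
  have H: "fd_hilbert H" and \<rho>: "\<rho> \<in> unital_star_hom (A_aut G) (End H)"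
    and \<sigma>: "\<sigma> \<in> unital_star_hom (A_aut G) (End H)" and HK: "H = K"
    and P: "of_entries (pverts G) H (\<lambda>v w. \<rho> (aut_gen v w)) = of_entries (pverts G) H (\<lambda>v w. \<sigma> (aut_gen v w))"
    using x y eq by (auto simp: e fd_Rep_def qiso_of_rep_def)
  have "\<rho> = \<sigma>"
    \<comment> \<open>The generators of both representations are recovered as the entries of the
      common map.\<close>
    by (rule rep_aut_eqI[OF H \<rho> \<sigma>]) (metis P quantum_iso_qiso_of_rep(2) H \<rho> \<sigma>)
  then show "x = y" by (simp add: e HK)
next
  fix z :: "'h hilb \<times> ('v, 'h) qmap"
  assume "z \<in> qiso_of_rep ` Obj (fd_Rep (A_aut G))"
  then show "z \<in> Obj (QIso G)"
    using quantum_iso_qiso_of_rep(1) by (auto simp: fd_Rep_def QIso_def qiso_of_rep_def)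
next
  fix z :: "'h hilb \<times> ('v, 'h) qmap"
  assume "z \<in> Obj (QIso G)"
  then obtain H P where z: "z = (H, P)" "quantum_iso G H P" by (auto simp: QIso_def)
  then have H: "fd_hilbert H" and P: "P \<in> lin (H \<otimes>\<^sub>H fun_space (pverts G)) (fun_space (pverts G) \<otimes>\<^sub>H H)"
    and m: "magic_unitary G H (entry (pverts G) H P)"
    unfolding quantum_iso_iff_magic_unitary[OF V] by blast+
  obtain \<rho> where \<rho>: "\<rho> \<in> unital_star_hom (A_aut G) (End H)"
    and g: "\<And>v w. v \<in> pverts G \<Longrightarrow> w \<in> pverts G \<Longrightarrow> \<rho> (aut_gen v w) = entry (pverts G) H P v w"
    by (rule rep_of_magic_unitary[OF H m]) (rule that)
  have "of_entries (pverts G) H (\<lambda>v w. \<rho> (aut_gen v w)) = P"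
    by (rule eq_of_entries[OF V H of_entries_lin[OF V H rep_aut_lin[OF H \<rho>]] P])
      (simp_all add: quantum_iso_qiso_of_rep(2)[OF H \<rho>] g)
  then have "z = qiso_of_rep (H, \<rho>)" by (simp add: z qiso_of_rep_def)
  moreover have "(H, \<rho>) \<in> Obj (fd_Rep (A_aut G))" using H \<rho> by (simp add: fd_Rep_def)
  ultimately show "z \<in> qiso_of_rep ` Obj (fd_Rep (A_aut G))" by blast
qed

text \<open>Both intertwining conditions are equivalent to the same condition on generators: the
  tensor condition through its components, the algebraic one through density of the free algebra and
  automatic continuity.\<close>

lemma Hom_qiso_of_rep:
  assumes x: "x \<in> Obj (fd_Rep (A_aut G))" and y: "y \<in> Obj (fd_Rep (A_aut G))"
  shows "Hom (QIso G) (qiso_of_rep x) (qiso_of_rep y) = Hom (fd_Rep (A_aut G)) x y"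
proof -
  obtain H \<rho> K \<sigma> where e: "x = (H, \<rho>)" "y = (K, \<sigma>)" by (cases x, cases y) auto
  have H: "fd_hilbert H" and \<rho>: "\<rho> \<in> unital_star_hom (A_aut G) (End H)"
    and K: "fd_hilbert K" and \<sigma>: "\<sigma> \<in> unital_star_hom (A_aut G) (End K)"
    using x y by (auto simp: e fd_Rep_def)
  let ?P = "of_entries (pverts G) H (\<lambda>v w. \<rho> (aut_gen v w))"
  let ?Q = "of_entries (pverts G) K (\<lambda>v w. \<sigma> (aut_gen v w))"
  have P: "?P \<in> lin (H \<otimes>\<^sub>H fun_space (pverts G)) (fun_space (pverts G) \<otimes>\<^sub>H H)"
    by (rule of_entries_lin[OF V H rep_aut_lin[OF H \<rho>]])
  have Q: "?Q \<in> lin (K \<otimes>\<^sub>H fun_space (pverts G)) (fun_space (pverts G) \<otimes>\<^sub>H K)"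
    by (rule of_entries_lin[OF V K rep_aut_lin[OF K \<sigma>]])
  have "(idm (fun_space (pverts G)) \<otimes>\<^sub>M f) \<circ>\<^sub>M ?P = ?Q \<circ>\<^sub>M (f \<otimes>\<^sub>M idm (fun_space (pverts G))) \<longleftrightarrow>
      (\<forall>S\<in>carrier (A_aut G). f \<circ>\<^sub>M \<rho> S = \<sigma> S \<circ>\<^sub>M f)" if f: "f \<in> lin H K" for f
  proof -
    have "(idm (fun_space (pverts G)) \<otimes>\<^sub>M f) \<circ>\<^sub>M ?P = ?Q \<circ>\<^sub>M (f \<otimes>\<^sub>M idm (fun_space (pverts G))) \<longleftrightarrow>
        (\<forall>v\<in>pverts G. \<forall>w\<in>pverts G. f \<circ>\<^sub>M \<rho> (aut_gen v w) = \<sigma> (aut_gen v w) \<circ>\<^sub>M f)"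
      unfolding intertwiner_iff[OF V H K P Q f]
      by (simp add: quantum_iso_qiso_of_rep(2)[OF H \<rho>] quantum_iso_qiso_of_rep(2)[OF K \<sigma>] cong: ball_cong)
    also have "\<dots> \<longleftrightarrow> (\<forall>S\<in>carrier (A_aut G). f \<circ>\<^sub>M \<rho> S = \<sigma> S \<circ>\<^sub>M f)"
      using intertwiner_of_generators[OF H K \<rho> \<sigma> f] aut_gen_closed by blast
    finally show ?thesis .
  qed
  then show ?thesis by (auto simp: e qiso_of_rep_def QIso_def fd_Rep_def)
qed

lemma equivalent_QIso_fd_Rep:
  "equivalent_categories (QIso G :: ('h hilb \<times> ('v, 'h) qmap, ('h, 'h) arr) cat)
    (fd_Rep (A_aut G) ::
      ('h hilb \<times> ((nat \<Rightarrow> ('v \<times> 'v) free_elem) set \<Rightarrow> ('h, 'h) arr), ('h, 'h) arr) cat)"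
  by (rule equivalent_categoriesI[OF category_fd_Rep bij_betw_qiso_of_rep Hom_qiso_of_rep])
    (auto simp: qiso_of_rep_def QIso_def fd_Rep_def)

end

theorem proposition5p19:
  fixes G :: "'v pair_pre_digraph"
  assumes "pair_pseudo_graph G"
  shows "equivalent_categories
    (QIso G :: ('h hilb \<times> ('v, 'h) qmap, ('h, 'h) arr) cat)
    (fd_Rep (A_aut G) ::
      ('h hilb \<times> ((nat \<Rightarrow> ('v \<times> 'v) free_elem) set \<Rightarrow> ('h, 'h) arr), ('h, 'h) arr) cat)"
proof -
  interpret pair_pseudo_graph G by (rule assms)
  show ?thesis by (rule equivalent_QIso_fd_Rep) (rule pair_finite_verts)
qed

end
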